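(* For the optimization version of $W$-weight Packing, a $3$-approximation can be computed in time $\mathcal{O}({k^*}^2|V|\,|E|)$, where $k^*$ denotes the optimum value; that is, given a vertex-weighted graph $G=(V,E,w)$ and $W\in\mathbb{N}$, one can compute in that time a $W$-packing of $G$ of size at least $\lceil k^*/3\rceil$.
   Context: Vertex weights $w\colon V\to\mathbb{N}$, $w(S)=\sum_{v\in S}w(v)$. A $W$-packing of $G$ is a family of pairwise disjoint sets $T_1,\dots,T_\ell\subseteq V$ such that each $G[T_i]$ is connected and $w(T_i)\ge W$; the optimization problem asks for a $W$-packing of maximum size, and $k^*$ is this maximum size.
   Formalization: The time bound proved is O(k*²|V||E| + |V| + |E| + 1), because the stated bound is 0 when k* = 0 or there are no edges; for k*, |V|, |E| ≥ 1 the two agree up to a constant. Vertices are natural numbers, and sets of a packing are nonempty. *)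

theory Defs
  imports Complex_Main "Graph_Theory.Graph_Theory"
begin

section \<open>Packings\<close>

text \<open>A finite simple undirected graph is a \<^locale>\<open>pair_graph\<close>: finite, loop-free, without
  parallel arcs, and symmetric. Every undirected edge therefore occurs as two arcs.\<close>

definition edges :: "'a pair_pre_digraph \<Rightarrow> 'a set set" where
  "edges G = (\<lambda>(u, v). {u, v}) ` parcs G"

text \<open>The notion \<open>Digraph_Component.connected\<close> requires a nonempty vertex set. In particular
  no member of a packing is empty, also when \<^term>\<open>W = 0\<close>.\<close>

definition is_packing :: "'a pair_pre_digraph \<Rightarrow> ('a \<Rightarrow> nat) \<Rightarrow> nat \<Rightarrow> 'a set list \<Rightarrow> bool" where
  "is_packing G w W Ts \<longleftrightarrow>
     (\<forall>T \<in> set Ts. T \<subseteq> pverts G \<and> Digraph_Component.connected (with_proj G \<restriction> T) \<and> sum w T \<ge> W) \<and>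
     (\<forall>i < length Ts. \<forall>j < length Ts. i \<noteq> j \<longrightarrow> Ts ! i \<inter> Ts ! j = {})"

definition opt_packing :: "'a pair_pre_digraph \<Rightarrow> ('a \<Rightarrow> nat) \<Rightarrow> nat \<Rightarrow> nat" where
  "opt_packing G w W = Max (length ` {Ts. is_packing G w W Ts})"

lemma is_packing_Nil: "is_packing G w W []"
  by (simp add: is_packing_def)

lemma is_packing_length:
  assumes "finite (pverts G)" and p: "is_packing G w W Ts"
  shows "length Ts \<le> card (pverts G)"
proof -
  have ne: "Ts ! i \<noteq> {}" "Ts ! i \<subseteq> pverts G" if "i < length Ts" for i
    using p that nth_mem[OF that]
    by (auto simp: is_packing_def Digraph_Component.connected_def strongly_connected_def)
  then have pick: "(SOME x. x \<in> Ts ! i) \<in> Ts ! i" if "i < length Ts" for i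
    using that some_in_eq by blast
  have "inj_on (\<lambda>i. SOME x. x \<in> Ts ! i) {..<length Ts}"
  proof (rule inj_onI)
    fix i j assume "i \<in> {..<length Ts}" "j \<in> {..<length Ts}"
      and eq: "(SOME x. x \<in> Ts ! i) = (SOME x. x \<in> Ts ! j)"
    then have "Ts ! i \<inter> Ts ! j \<noteq> {}"
      using pick[of i] pick[of j] by auto
    with p \<open>i \<in> _\<close> \<open>j \<in> _\<close> show "i = j" unfolding is_packing_def by blast
  qed
  moreover have "(\<lambda>i. SOME x. x \<in> Ts ! i) ` {..<length Ts} \<subseteq> pverts G"
    using pick ne(2) by blast
  ultimately show ?thesis
    using card_inj_on_le[OF _ _ assms(1)] by fastforce
qed

text \<open>The maximum in \<^const>\<open>opt_packing\<close> is taken over a finite nonempty set.\<close>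

lemma opt_packing_attained:
  assumes "finite (pverts G)"
  shows "\<exists>Ts. is_packing G w W Ts \<and> length Ts = opt_packing G w W"
    and "is_packing G w W Ts \<Longrightarrow> length Ts \<le> opt_packing G w W"
proof -
  let ?L = "length ` {Ts. is_packing G w W Ts}"
  have fin: "finite ?L"
    by (rule finite_subset[of _ "{..card (pverts G)}"]) (auto dest: is_packing_length[OF assms])
  have "?L \<noteq> {}" using is_packing_Nil by blast
  from Max_in[OF fin this] show "\<exists>Ts. is_packing G w W Ts \<and> length Ts = opt_packing G w W"
    by (auto simp: opt_packing_def)
  show "is_packing G w W Ts \<Longrightarrow> length Ts \<le> opt_packing G w W"
    unfolding opt_packing_def by (rule Max_ge[OF fin]) auto
qed


section \<open>Machine model\<close>

text \<open>A structured form of the unit-cost random access machine of Cook and Reckhow: finitely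
  many registers and zero-initialised arrays holding natural numbers, indirect addressing,
  comparison, addition and truncated subtraction. Multiplication, division and bit operations
  are deliberately absent, since at unit cost on unbounded numbers they would make running
  times unrealistic.\<close>

datatype aexp =
    Const nat
  | Reg string
  | Cell string aexp
  | Plus aexp aexp
  | Minus aexp aexp

datatype bexp =
    Less aexp aexp
  | Equal aexp aexp
  | Neg bexp
  | Conj bexp bexp

datatype com =
    Skip
  | Assign string aexp
  | Store string aexp aexp
  | Seq com com
  | Cond bexp com com
  | While bexp com

record store =
  reg :: "string \<Rightarrow> nat"
  arr :: "string \<Rightarrow> nat \<Rightarrow> nat"

primrec aval :: "aexp \<Rightarrow> store \<Rightarrow> nat" where
  "aval (Const k) s = k"
| "aval (Reg x) s = reg s x"
| "aval (Cell a e) s = arr s a (aval e s)"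
| "aval (Plus e f) s = aval e s + aval f s"
| "aval (Minus e f) s = aval e s - aval f s"

primrec bval :: "bexp \<Rightarrow> store \<Rightarrow> bool" where
  "bval (Less e f) s \<longleftrightarrow> aval e s < aval f s"
| "bval (Equal e f) s \<longleftrightarrow> aval e s = aval f s"
| "bval (Neg b) s \<longleftrightarrow> \<not> bval b s"
| "bval (Conj b c) s \<longleftrightarrow> bval b s \<and> bval c s"

text \<open>Evaluating an expression costs one step per operation or access in it.\<close>

primrec acost :: "aexp \<Rightarrow> nat" where
  "acost (Const k) = 1"
| "acost (Reg x) = 1"
| "acost (Cell a e) = acost e + 1"
| "acost (Plus e f) = acost e + acost f + 1"
| "acost (Minus e f) = acost e + acost f + 1"

primrec bcost :: "bexp \<Rightarrow> nat" where
  "bcost (Less e f) = acost e + acost f + 1"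
| "bcost (Equal e f) = acost e + acost f + 1"
| "bcost (Neg b) = bcost b + 1"
| "bcost (Conj b c) = bcost b + bcost c + 1"

text \<open>\<open>exec c s t s'\<close>: started in \<open>s\<close>, the program \<open>c\<close> terminates in \<open>s'\<close> after exactly
  \<open>t\<close> steps.\<close>

inductive exec :: "com \<Rightarrow> store \<Rightarrow> nat \<Rightarrow> store \<Rightarrow> bool" where
  Skip: "exec Skip s 1 s"
| Assign: "exec (Assign x e) s (acost e + 1) (s\<lparr>reg := (reg s)(x := aval e s)\<rparr>)"
| Store: "exec (Store a e f) s (acost e + acost f + 1)
    (s\<lparr>arr := (arr s)(a := (arr s a)(aval e s := aval f s))\<rparr>)"
| Seq: "exec c s t s' \<Longrightarrow> exec d s' u s'' \<Longrightarrow> exec (Seq c d) s (t + u) s''"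
| CondTrue: "bval b s \<Longrightarrow> exec c s t s' \<Longrightarrow> exec (Cond b c d) s (bcost b + 1 + t) s'"
| CondFalse: "\<not> bval b s \<Longrightarrow> exec d s t s' \<Longrightarrow> exec (Cond b c d) s (bcost b + 1 + t) s'"
| WhileFalse: "\<not> bval b s \<Longrightarrow> exec (While b c) s (bcost b + 1) s"
| WhileTrue: "bval b s \<Longrightarrow> exec c s t s' \<Longrightarrow> exec (While b c) s' u s'' \<Longrightarrow>
    exec (While b c) s (bcost b + 1 + t + u) s''"

inductive_cases exec_SkipE: "exec Skip s t s'"
inductive_cases exec_AssignE: "exec (Assign x e) s t s'"
inductive_cases exec_StoreE: "exec (Store a e f) s t s'"
inductive_cases exec_SeqE: "exec (Seq c d) s t s'"
inductive_cases exec_CondE: "exec (Cond b c d) s t s'"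
inductive_cases exec_WhileE: "exec (While b c) s t s'"

lemma exec_deterministic:
  "exec c s t s' \<Longrightarrow> exec c s u s'' \<Longrightarrow> u = t \<and> s'' = s'"
proof (induction arbitrary: u s'' rule: exec.induct)
  case (Seq c s t s' d v r)
  from Seq.prems obtain t1 s1 u1 where "exec c s t1 s1" "exec d s1 u1 s''" "u = t1 + u1"
    by (rule exec_SeqE)
  with Seq.IH show ?case by metis
next
  case (CondTrue b s c t s' d)
  from CondTrue.prems obtain t1 where "exec c s t1 s''" and u: "u = Suc (bcost b + t1)"
    by (rule exec_CondE) (use CondTrue.hyps(1) in metis)+
  with CondTrue.IH have "t1 = t \<and> s'' = s'" by blast
  with u show ?case by simp
next
  case (CondFalse b s d t s' c)
  from CondFalse.prems obtain t1 where "exec d s t1 s''" and u: "u = Suc (bcost b + t1)"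
    by (rule exec_CondE) (use CondFalse.hyps(1) in metis)+
  with CondFalse.IH have "t1 = t \<and> s'' = s'" by blast
  with u show ?case by simp
next
  case (WhileFalse b s c)
  from WhileFalse.prems show ?case
    by (rule exec_WhileE) (use WhileFalse.hyps(1) in simp_all)
next
  case (WhileTrue b s c t s' v r)
  from WhileTrue.prems obtain t1 s1 u1
    where "exec c s t1 s1" "exec (While b c) s1 u1 s''" and u: "u = Suc (bcost b + t1 + u1)"
    by (rule exec_WhileE) (use WhileTrue.hyps(1) in metis)+
  with WhileTrue.IH have "t1 = t \<and> u1 = v \<and> s'' = r" by metis
  with u show ?case by simp
next
  case (Skip s)
  then show ?case by (rule exec_SkipE) simp
next
  case (Assign x e s)
  then show ?case by (rule exec_AssignE) simp
next
  case (Store a e f s)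
  then show ?case by (rule exec_StoreE) simp
qed


section \<open>Input and output\<close>

text \<open>The vertices are numbered by their position in \<open>vs\<close>. The list \<open>es\<close> contains every
  undirected edge exactly once, as a pair of vertex numbers in arbitrary orientation and
  in arbitrary order.\<close>

definition represents ::
  "'a list \<Rightarrow> (nat \<times> nat) list \<Rightarrow> 'a pair_pre_digraph \<Rightarrow> bool" where
  "represents vs es G \<longleftrightarrow>
     distinct vs \<and> set vs = pverts G \<and>
     (\<forall>(i, j) \<in> set es. i < length vs \<and> j < length vs) \<and>
     distinct (map (\<lambda>(i, j). {vs ! i, vs ! j}) es) \<and>
     set (map (\<lambda>(i, j). {vs ! i, vs ! j}) es) = edges G"

definition input_store ::
  "'a list \<Rightarrow> (nat \<times> nat) list \<Rightarrow> ('a \<Rightarrow> nat) \<Rightarrow> nat \<Rightarrow> store" where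
  "input_store vs es w W =
     \<lparr> reg = (\<lambda>_. 0)(''n'' := length vs, ''m'' := length es, ''W'' := W),
       arr = (\<lambda>_ _. 0)
         (''weight'' := (\<lambda>i. if i < length vs then w (vs ! i) else 0),
          ''fst'' := (\<lambda>i. if i < length es then fst (es ! i) else 0),
          ''snd'' := (\<lambda>i. if i < length es then snd (es ! i) else 0)) \<rparr>"

text \<open>The result is a family of \<open>size\<close> sets. Vertex number \<open>j\<close> belongs to the \<open>i\<close>-th set,
  counted from 1, if its entry in the array \<open>part\<close> is \<open>i\<close>. Entries 0 mark unused vertices.\<close>

definition output_sets :: "'a list \<Rightarrow> store \<Rightarrow> 'a set list" where
  "output_sets vs s =
     map (\<lambda>i. {vs ! j | j. j < length vs \<and> arr s ''part'' j = i}) [1..<Suc (reg s ''size'')]"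

end

theory Submission
  imports Defs
begin

text \<open>Vertices of weight at least \<open>W\<close> form sets of their own. Among the remaining vertices the algorithm keeps
  \<^emph>\<open>cores\<close>: light cores, which are connected sets of weight in \<open>[W, 3 W)\<close>, and heads, which are single vertices.
  The other vertices are partitioned into \<^emph>\<open>units\<close>, connected sets of weight below \<open>W\<close>. The invariant is a Hall condition:
  every set \<open>Z\<close> of heads together with the units adjacent to \<open>Z\<close> weighs at least \<open>2 W |Z|\<close>.

  A push-relabel procedure assigns units to adjacent cores so that heads reach a threshold and the rest flows to light
  cores. If a light core \<open>j\<close> would have to exceed \<open>3 W\<close>, then a spanning tree of \<open>j\<close> with its units attached either splits
  into two sets of weight at least \<open>W\<close>, which gives one more set, or it has a center \<open>z\<close> all of whose branches weigh less than
  \<open>W\<close>; then \<open>z\<close> becomes a head and the branches become units. Otherwise all light cores are blocked, and the blocked cores \<open>F\<close>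
  with their adjacent units weigh at most \<open>3 W |F|\<close>. If every edge between different units joins two units adjacent to \<open>F\<close>,
  a packing has at most \<open>3 |F|\<close> sets inside this region, and every further set contains a head outside \<open>F\<close> or a heavy vertex,
  which certifies the factor 3. Otherwise two adjacent units are tentatively joined to a new light core, which gives one more
  set or enlarges \<open>F\<close>.\<close>

section \<open>Total correctness with running times\<close>

text \<open>The two labelling thresholds carry the argument. A run at threshold \<open>W\<close>
  turns heads into cores. If it fails, all blocked heads have load below \<open>2 * W\<close> and
  one has load below \<open>W\<close>, so a set of heads misses more than \<open>W\<close> of its
  Hall weight of \<open>2 * W\<close> per head. The factor 2 in the Hall condition is thus slack for
  the loss of one unit, which weighs less than \<open>W\<close>: after a split the run cannot fail,
  and after joining two units it fails only for a set of heads not contained in \<open>F\<close>.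
  The run at threshold \<open>2 * W\<close> serves the light cores: saturated heads hold their Hall
  share without the full core \<open>j\<close>, so \<open>j\<close> and its units may be split or
  released, and blocked heads obey \<open>2 * W + W\<close>, the capacity of light cores.

  Labels without gaps are at most the number of cores, and every core uses up a vertex and an arc,
  so one run costs O(|V||E|). Let K be the optimum. At most K heads arise for each packing size and
  at most about K probes for each new core, which leaves O(K^2) runs. The bound is linear for K = 0;
  hence a linear-time scan of components precedes all work of order |V||E|.\<close>

definition wp :: "com \<Rightarrow> (nat \<Rightarrow> store \<Rightarrow> bool) \<Rightarrow> store \<Rightarrow> bool" where
  "wp c Q s \<longleftrightarrow> (\<exists>t s'. exec c s t s' \<and> Q t s')"

lemma wp_mono: "wp c Q s ==> (\<And>t s'. Q t s' ==> R t s') ==> wp c R s"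
  unfolding wp_def by blast

lemma wp_Skip [simp]: "wp Skip Q s \<longleftrightarrow> Q 1 s"
  unfolding wp_def by (metis One_nat_def exec.Skip exec_SkipE)

lemma wp_Assign [simp]:
  "wp (Assign x e) Q s \<longleftrightarrow> Q (acost e + 1) (s\<lparr>reg := (reg s)(x := aval e s)\<rparr>)"
  unfolding wp_def using exec.Assign exec_deterministic by metis

lemma wp_Store [simp]:
  "wp (Store a e f) Q s \<longleftrightarrow>
    Q (acost e + acost f + 1) (s\<lparr>arr := (arr s)(a := (arr s a)(aval e s := aval f s))\<rparr>)"
  unfolding wp_def using exec.Store exec_deterministic by metis

lemma wp_Seq [simp]: "wp (Seq c d) Q s \<longleftrightarrow> wp c (\<lambda>t s'. wp d (\<lambda>u. Q (t + u)) s') s"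
  unfolding wp_def by (blast intro: exec.Seq elim: exec_SeqE)

lemma wp_Cond [simp]:
  "wp (Cond b c d) Q s \<longleftrightarrow>
    (if bval b s then wp c (\<lambda>t. Q (bcost b + 1 + t)) s else wp d (\<lambda>t. Q (bcost b + 1 + t)) s)"
proof (cases "bval b s")
  case True
  then show ?thesis unfolding wp_def
    by (auto elim!: exec_CondE) (use exec.CondTrue[OF True] in \<open>fastforce\<close>)
next
  case False
  then show ?thesis unfolding wp_def
    by (auto elim!: exec_CondE) (use exec.CondFalse[OF False] in \<open>fastforce\<close>)
qed

text \<open>The potential \<open>p\<close> is termination measure and clock at once: an iteration
  pays for its body and its guard out of a drop in \<open>p\<close>, so only the final failing
  guard, \<open>bcost b + 1\<close>, is left to be paid.\<close>

lemma wp_while: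
  assumes "I s"
    and step: "\<And>s. I s ==> bval b s ==> wp c (\<lambda>t s'. I s' \<and> t + bcost b + 1 + p s' \<le> p s) s"
    and post: "\<And>s' t. I s' ==> \<not> bval b s' ==> t + p s' \<le> p s + bcost b + 1 ==> Q t s'"
  shows "wp (While b c) Q s"
proof -
  have "\<exists>t s'. exec (While b c) s t s' \<and> I s' \<and> \<not> bval b s' \<and> t + p s' \<le> p s + bcost b + 1"
    if "I s" for s
    using that
  proof (induction "p s" arbitrary: s rule: less_induct)
    case less
    show ?case
    proof (cases "bval b s")
      case False
      then show ?thesis using exec.WhileFalse[OF False] less.prems by fastforce
    next
      case True
      from step[OF less.prems True] obtain t1 s1 where
        1: "exec c s t1 s1" "I s1" "t1 + bcost b + 1 + p s1 \<le> p s"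
        unfolding wp_def by blast
      \<comment> \<open>The 1 charged for entering the body makes the drop strict.\<close>
      then have "p s1 < p s" by simp
      from less.hyps[OF this 1(2)] obtain t2 s2 where
        2: "exec (While b c) s1 t2 s2" "I s2" "\<not> bval b s2" "t2 + p s2 \<le> p s1 + bcost b + 1"
        by blast
      from exec.WhileTrue[OF True 1(1) 2(1)] 2 1(3) show ?thesis by fastforce
    qed
  qed
  with \<open>I s\<close> post show ?thesis unfolding wp_def by blast
qed

definition For :: "string \<Rightarrow> aexp \<Rightarrow> aexp \<Rightarrow> com \<Rightarrow> com" where
  "For x lo hi c = Seq (Assign x lo)
     (While (Less (Reg x) hi) (Seq c (Assign x (Plus (Reg x) (Const 1)))))"

text \<open>Amortised counted loop: a round may also spend from an external potential
  \<open>p\<close>, which must not look at the loop register (\<open>px\<close>), so that the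
  increment leaves it fixed. The overhead of a round is \<open>acost hi + 3\<close> for the guard
  and 4 for the increment.\<close>

lemma wp_For_pot:
  fixes p :: "store \<Rightarrow> nat"
  assumes lo: "aval lo s = l" and lh: "l \<le> h"
    and init: "I l (s\<lparr>reg := (reg s)(x := l)\<rparr>)"
    and hi: "\<And>i s. I i s ==> reg s x = i ==> aval hi s = h"
    and px: "\<And>s i. p (s\<lparr>reg := (reg s)(x := i)\<rparr>) = p s"
    and step: "\<And>i s. I i s ==> reg s x = i ==> l \<le> i ==> i < h ==>
      wp c (\<lambda>t s'. reg s' x = i \<and> I (Suc i) (s'\<lparr>reg := (reg s')(x := Suc i)\<rparr>) \<and> t + p s' \<le> p s + K) s"
    and post: "\<And>s' t. I h s' ==> reg s' x = h ==>
      t + p s' \<le> p s + (h - l) * (K + acost hi + 7) + acost lo + acost hi + 5 ==> Q t s'"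
  shows "wp (For x lo hi c) Q s"
proof -
  let ?p = "\<lambda>s. (h - reg s x) * (K + acost hi + 7) + p s"
  let ?J = "\<lambda>s. I (reg s x) s \<and> l \<le> reg s x \<and> reg s x \<le> h"
  have "wp (While (Less (Reg x) hi) (Seq c (Assign x (Plus (Reg x) (Const 1)))))
    (\<lambda>t. Q (acost lo + 1 + t)) (s\<lparr>reg := (reg s)(x := l)\<rparr>)"
  proof (rule wp_while[where I = ?J and p = ?p], goal_cases)
    case 1
    then show ?case using init lh by simp
  next
    case (2 s)
    then have i: "reg s x < h" using hi[of "reg s x" s] by simp
    have eq: "h - reg s x = Suc (h - Suc (reg s x))" using i by simp
    have ih: "I (reg s x) s" "l \<le> reg s x" using 2 by auto
    show ?case
      unfolding wp_Seq wp_Assign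
      by (rule wp_mono[OF step[OF ih(1) refl ih(2) i]]) (use ih(2) i in \<open>simp add: eq px\<close>)
  next
    case (3 s' t)
    then have "reg s' x = h" using hi[of "reg s' x" s'] by simp
    with 3 show ?case by (intro post) (simp_all add: px)
  qed
  then show ?thesis using lo by (simp add: For_def)
qed

lemma wp_For:
  assumes lo: "aval lo s = l" and lh: "l \<le> h"
    and init: "I l (s\<lparr>reg := (reg s)(x := l)\<rparr>)"
    and hi: "\<And>i s. I i s ==> reg s x = i ==> aval hi s = h"
    and step: "\<And>i s. I i s ==> reg s x = i ==> l \<le> i ==> i < h ==>
      wp c (\<lambda>t s'. reg s' x = i \<and> I (Suc i) (s'\<lparr>reg := (reg s')(x := Suc i)\<rparr>) \<and> t \<le> K) s"
    and post: "\<And>s' t. I h s' ==> reg s' x = h ==>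
      t \<le> (h - l) * (K + acost hi + 7) + acost lo + acost hi + 5 ==> Q t s'"
  shows "wp (For x lo hi c) Q s"
  by (rule wp_For_pot[where p = "\<lambda>_. 0" and I = I and l = l and h = h and K = K]) (use assms in simp_all)

section \<open>Registers and arrays that a program can modify\<close>

primrec rmods :: "com \<Rightarrow> string set" where
  "rmods Skip = {}"
| "rmods (Assign x e) = {x}"
| "rmods (Store a e f) = {}"
| "rmods (Seq c d) = rmods c \<union> rmods d"
| "rmods (Cond b c d) = rmods c \<union> rmods d"
| "rmods (While b c) = rmods c"

primrec amods :: "com \<Rightarrow> string set" where
  "amods Skip = {}"
| "amods (Assign x e) = {}"
| "amods (Store a e f) = {a}"
| "amods (Seq c d) = amods c \<union> amods d"
| "amods (Cond b c d) = amods c \<union> amods d"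
| "amods (While b c) = amods c"

lemma exec_frame:
  "exec c s t s' ==> (\<forall>x. x \<notin> rmods c --> reg s' x = reg s x) \<and> (\<forall>a. a \<notin> amods c --> arr s' a = arr s a)"
  by (induction rule: exec.induct) auto

lemma rmods_For [simp]: "rmods (For x lo hi c) = insert x (rmods c)"
  and amods_For [simp]: "amods (For x lo hi c) = amods c"
  by (auto simp: For_def)

definition frame :: "com \<Rightarrow> store \<Rightarrow> store \<Rightarrow> bool" where
  "frame c s s' \<longleftrightarrow> (\<forall>x. x \<notin> rmods c --> reg s' x = reg s x) \<and> (\<forall>a. a \<notin> amods c --> arr s' a = arr s a)"

text \<open>Keeps the specifications of subprograms short: what a program leaves untouched is read
  off its text and added only where it is used.\<close>

lemma wp_frame:
  "wp c Q s ==> (\<And>t s'. Q t s' ==> frame c s s' ==> R t s') ==> wp c R s"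
  unfolding wp_def frame_def using exec_frame by metis

lemma frame_reg: "frame c s s' ==> x \<notin> rmods c ==> reg s' x = reg s x"
  and frame_arr: "frame c s s' ==> a \<notin> amods c ==> arr s' a = arr s a"
  unfolding frame_def by auto

section \<open>Labellings\<close>

text \<open>Push-relabel with the roles reversed: cores pull units. Arc \<open>a\<close> belongs to
  core \<open>key a\<close> and, if \<open>va a\<close>, leads to unit \<open>un a\<close>.
  \<open>fi\<close> and \<open>nxt\<close> chain the arcs of a core in decreasing order with end
  mark 0; the clauses excluding arcs in between make the chains exhaustive. \<open>B\<close> lies
  above every label that an unblocked core can take, also right after a relabelling.\<close>

locale labelling =
  fixes K :: "nat set" and head :: "nat \<Rightarrow> bool"
    and key :: "nat \<Rightarrow> nat" and M :: nat and va :: "nat \<Rightarrow> bool" and un :: "nat \<Rightarrow> nat"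
    and U :: "nat set" and wU base :: "nat \<Rightarrow> nat" and W th B :: nat
    and nxt fi :: "nat \<Rightarrow> nat"
  assumes finK: "finite K" and finU: "finite U" and K0: "0 \<notin> K"
    and va_U: "1 \<le> a ==> a \<le> M ==> va a ==> un a \<in> U"
    and wU: "u \<in> U ==> wU u < W"
    and base: "i \<in> K ==> \<not> head i ==> base i < 3 * W"
    and B: "card K + 2 \<le> B"
    and nxt: "1 \<le> a ==> a \<le> M ==> key a \<in> K ==>
      nxt a < a \<and> (nxt a \<noteq> 0 --> key (nxt a) = key a) \<and> (\<forall>b. nxt a < b \<and> b < a --> key b \<noteq> key a)"
    and fi: "i \<in> K ==> fi i \<le> M \<and> (fi i \<noteq> 0 --> key (fi i) = i) \<and> (\<forall>b. fi i < b \<and> b \<le> M --> key b \<noteq> i)"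
begin

definition nbr :: "nat \<Rightarrow> nat \<Rightarrow> bool" where
  "nbr i u \<longleftrightarrow> (\<exists>a. 1 \<le> a \<and> a \<le> M \<and> key a = i \<and> va a \<and> un a = u)"

text \<open>A head takes a unit only while its load is below \<open>th\<close>, and units are
  lighter than \<open>W\<close>.\<close>

definition ub :: "nat \<Rightarrow> nat" where
  "ub i = (if head i then th + W else 3 * W)"

definition cntok :: "(nat \<Rightarrow> nat) \<Rightarrow> (nat \<Rightarrow> nat) \<Rightarrow> bool" where
  "cntok lab cnt \<longleftrightarrow> (\<forall>s. 1 \<le> s \<and> s < B --> cnt s = card {i \<in> K. lab i = s})"

definition own_ok :: "(nat \<Rightarrow> nat) \<Rightarrow> (nat \<Rightarrow> nat) \<Rightarrow> bool" where
  "own_ok own load \<longleftrightarrow>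
     (\<forall>u \<in> U. own u \<noteq> 0 --> own u \<in> K \<and> nbr (own u) u) \<and>
     (\<forall>i \<in> K. load i = base i + (\<Sum>u \<in> {u \<in> U. own u = i}. wU u))"

text \<open>Label \<open>B\<close> marks blocked cores. The dummy core 0 owns the free units and has label 0.\<close>

definition lab_ok :: "(nat \<Rightarrow> nat) \<Rightarrow> (nat \<Rightarrow> nat) \<Rightarrow> bool" where
  "lab_ok own lab \<longleftrightarrow> lab 0 = 0 \<and> (\<forall>i \<in> K. 1 \<le> lab i) \<and>
     (\<forall>i \<in> K. \<forall>u. nbr i u -->
        (if lab i = B then lab (own u) = B else lab i \<le> lab (own u) + 1))"

text \<open>The labels in use below an unblocked core have no gaps. This bounds labels by the number
  of cores instead of the number of vertices, and with it the time of a run.\<close>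

definition cont :: "(nat \<Rightarrow> nat) \<Rightarrow> bool" where
  "cont lab \<longleftrightarrow> (\<forall>i \<in> K. lab i \<noteq> B --> (\<forall>s. 1 \<le> s \<and> s < lab i --> (\<exists>i' \<in> K. lab i' = s)))"

text \<open>A head above label 1 has been relabelled, hence was below \<open>th\<close> at that
  moment. Exempt are only heads still at label 1 whose base weight already reaches
  \<open>th\<close>.\<close>

definition load_ok :: "(nat \<Rightarrow> nat) \<Rightarrow> (nat \<Rightarrow> nat) \<Rightarrow> bool" where
  "load_ok load lab \<longleftrightarrow> (\<forall>i \<in> K. (2 \<le> lab i \<or> \<not> head i \<or> base i < th --> load i < ub i))"

text \<open>Current-arc rule: chains run downwards, so the arcs of \<open>i\<close> above
  \<open>cur i\<close> have been scanned at the present label, and none of them can be used for a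
  pull now.\<close>

definition cur_ok :: "(nat \<Rightarrow> nat) \<Rightarrow> (nat \<Rightarrow> nat) \<Rightarrow> (nat \<Rightarrow> nat) \<Rightarrow> bool" where
  "cur_ok own lab cur \<longleftrightarrow> (\<forall>i \<in> K. cur i \<le> M \<and> (cur i \<noteq> 0 --> key (cur i) = i) \<and>
     (lab i \<noteq> B --> (\<forall>a. cur i < a \<and> a \<le> M \<and> key a = i \<and> va a --> lab i \<le> lab (own (un a)))))"

definition LI :: "(nat \<Rightarrow> nat) \<Rightarrow> (nat \<Rightarrow> nat) \<Rightarrow> (nat \<Rightarrow> nat) \<Rightarrow> (nat \<Rightarrow> nat) \<Rightarrow> bool" where
  "LI own load lab cur \<longleftrightarrow> own_ok own load \<and> lab_ok own lab \<and> cont lab \<and> load_ok load lab \<and> cur_ok own lab cur"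

lemma nbr_U: "nbr i u ==> u \<in> U"
  using va_U by (auto simp: nbr_def)

text \<open>Without gaps, each of the values 1 to \<open>lab i\<close> is the label of some
  core.\<close>

lemma cont_le: assumes "cont lab" "i \<in> K" "lab i \<noteq> B" shows "lab i \<le> card K"
proof -
  have "{1..lab i} \<subseteq> lab ` K"
  proof
    fix s assume s: "s \<in> {1..lab i}"
    show "s \<in> lab ` K"
    proof (cases "s = lab i")
      case False
      then obtain i' where "i' \<in> K" "lab i' = s"
        using assms s unfolding cont_def by (metis atLeastAtMost_iff le_neq_implies_less)
      then show ?thesis by blast
    qed (use assms in auto)
  qed
  then have "card {1..lab i} \<le> card (lab ` K)" by (intro card_mono) (auto simp: finK)
  also have "\<dots> \<le> card K" by (rule card_image_le[OF finK])
  finally show ?thesis by simp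
qed

lemma LI_lab: "LI own load lab cur ==> i \<in> K ==> lab i \<noteq> B ==> 1 \<le> lab i \<and> lab i \<le> card K"
  using cont_le unfolding LI_def lab_ok_def by blast

text \<open>Free units belong to the dummy core, whose label 0 differs from \<open>B\<close>; so a
  blocked core sees no free unit.\<close>

lemma flagged_closed:
  assumes "LI own load lab cur" "i \<in> K" "lab i = B" "nbr i u"
  shows "own u \<in> K \<and> lab (own u) = B"
proof -
  have "lab (own u) = B" "lab 0 = 0" using assms unfolding LI_def lab_ok_def by fastforce+
  moreover have "B \<noteq> 0" using B by simp
  ultimately have "own u \<noteq> 0" by metis
  with assms \<open>lab (own u) = B\<close> nbr_U[OF assms(4)] show ?thesis
    unfolding LI_def own_ok_def by blast
qed

lemma sum_own_upd:
  assumes "u \<in> U" "own u = o1" "o1 \<noteq> x"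
  shows "(\<Sum>v \<in> {v \<in> U. (own(u := x)) v = x}. wU v) = (\<Sum>v \<in> {v \<in> U. own v = x}. wU v) + wU u"
    and "(\<Sum>v \<in> {v \<in> U. (own(u := x)) v = o1}. wU v) + wU u = (\<Sum>v \<in> {v \<in> U. own v = o1}. wU v)"
    and "i \<noteq> x ==> i \<noteq> o1 ==> (\<Sum>v \<in> {v \<in> U. (own(u := x)) v = i}. wU v) = (\<Sum>v \<in> {v \<in> U. own v = i}. wU v)"
proof -
  have "{v \<in> U. (own(u := x)) v = x} = insert u {v \<in> U. own v = x}" using assms by auto
  then show "(\<Sum>v \<in> {v \<in> U. (own(u := x)) v = x}. wU v) = (\<Sum>v \<in> {v \<in> U. own v = x}. wU v) + wU u"
    using assms finU by simp
  have "{v \<in> U. own v = o1} = insert u {v \<in> U. (own(u := x)) v = o1}" "u \<notin> {v \<in> U. (own(u := x)) v = o1}"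
    using assms by auto
  then show "(\<Sum>v \<in> {v \<in> U. (own(u := x)) v = o1}. wU v) + wU u = (\<Sum>v \<in> {v \<in> U. own v = o1}. wU v)"
    using assms finU by simp
  show "(\<Sum>v \<in> {v \<in> U. (own(u := x)) v = i}. wU v) = (\<Sum>v \<in> {v \<in> U. own v = i}. wU v)"
    if "i \<noteq> x" "i \<noteq> o1"
    using assms that by (intro sum.cong) auto
qed

text \<open>A pull only raises the label of the owner of \<open>u\<close>, and for unblocked cores
  all label conditions bound owners' labels from below. Blocked cores are not affected, since the
  old owner of \<open>u\<close> is unblocked and so \<open>u\<close> is not adjacent to any of them.
  The loads are where \<open>hungry\<close> and \<open>fits\<close> enter.\<close>

lemma LI_pull:
  assumes L: "LI own load lab cur" and x: "x \<in> K" "lab x \<noteq> B"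
    and a: "1 \<le> a" "a \<le> M" "key a = x" "va a" "un a = u"
    and lt: "lab (own u) < lab x"
    and hungry: "head x ==> load x < th" and fits: "\<not> head x ==> load x + wU u < 3 * W"
  shows "LI (own(u := x)) (load(x := load x + wU u, own u := load (own u) - wU u)) lab cur"
proof -
  have u: "u \<in> U" and nb: "nbr x u" using a va_U nbr_def by auto
  have ne: "own u \<noteq> x" using lt by auto
  have xB: "lab x < B" using LI_lab[OF L x] B by simp
  have own: "own_ok own load" "lab_ok own lab" "cont lab" "load_ok load lab" "cur_ok own lab cur"
    using L unfolding LI_def by auto
  have ld: "load i = base i + (\<Sum>v \<in> {v \<in> U. own v = i}. wU v)" if "i \<in> K" for i
    using own(1) that unfolding own_ok_def by blast
  have "own_ok (own(u := x)) (load(x := load x + wU u, own u := load (own u) - wU u))"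
    unfolding own_ok_def
  proof (intro conjI ballI)
    fix v assume "v \<in> U"
    then show "(own(u := x)) v \<noteq> 0 --> (own(u := x)) v \<in> K \<and> nbr ((own(u := x)) v) v"
      using own(1) x nb unfolding own_ok_def by auto
  next
    fix i assume i: "i \<in> K"
    show "(load(x := load x + wU u, own u := load (own u) - wU u)) i =
      base i + (\<Sum>v \<in> {v \<in> U. (own(u := x)) v = i}. wU v)"
      using sum_own_upd[of u own "own u" x, OF u refl ne] ld[OF i] ne
      by (cases "i = x"; cases "i = own u") auto
  qed
  moreover have "lab_ok (own(u := x)) lab"
    using own(2) lt xB unfolding lab_ok_def by (fastforce split: if_splits)
  moreover have "load_ok (load(x := load x + wU u, own u := load (own u) - wU u)) lab"
    unfolding load_ok_def
  proof (intro ballI impI)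
    fix i assume i: "i \<in> K" "2 \<le> lab i \<or> \<not> head i \<or> base i < th"
    then have "load i < ub i" using own(4) unfolding load_ok_def by blast
    then show "(load(x := load x + wU u, own u := load (own u) - wU u)) i < ub i"
      using hungry fits wU[OF u] ne by (cases "i = x"; cases "i = own u") (auto simp: ub_def)
  qed
  moreover have "cur_ok (own(u := x)) lab cur"
    unfolding cur_ok_def
  proof (intro ballI conjI impI allI)
    fix i b assume "i \<in> K" "lab i \<noteq> B" "cur i < b \<and> b \<le> M \<and> key b = i \<and> va b"
    then have "lab i \<le> lab (own (un b))" using own(5) unfolding cur_ok_def by blast
    then show "lab i \<le> lab ((own(u := x)) (un b))" using lt by auto
  qed (use own(5) in \<open>auto simp: cur_ok_def\<close>)
  ultimately show ?thesis using own(3) unfolding LI_def by blast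
qed

text \<open>The arcs between \<open>nxt (cur x)\<close> and \<open>cur x\<close> belong to other
  cores, and \<open>no\<close> says that \<open>cur x\<close> itself cannot be used.\<close>

lemma LI_advance:
  assumes L: "LI own load lab cur" and x: "x \<in> K" and c: "cur x \<noteq> 0"
    and no: "\<not> (va (cur x) \<and> lab (own (un (cur x))) < lab x)"
  shows "LI own load lab (cur(x := nxt (cur x)))"
proof -
  have co: "cur_ok own lab cur" using L unfolding LI_def by blast
  then have cx: "cur x \<le> M" "key (cur x) = x" using x c unfolding cur_ok_def by auto
  have n: "nxt (cur x) < cur x" "nxt (cur x) \<noteq> 0 --> key (nxt (cur x)) = x"
    "\<forall>b. nxt (cur x) < b \<and> b < cur x --> key b \<noteq> x"
    using nxt[of "cur x"] c cx x by auto
  have "cur_ok own lab (cur(x := nxt (cur x)))"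
    unfolding cur_ok_def
  proof (intro ballI conjI impI allI)
    fix i a assume i: "i \<in> K" "lab i \<noteq> B" and a: "(cur(x := nxt (cur x))) i < a \<and> a \<le> M \<and> key a = i \<and> va a"
    consider "i \<noteq> x" | "i = x" "cur x < a" | "i = x" "a = cur x" | "i = x" "a < cur x" by linarith
    then show "lab i \<le> lab (own (un a))"
    proof cases
      case 4 then show ?thesis using n a by auto
    next
      case 3 then show ?thesis using no a by auto
    qed (use a i co in \<open>auto simp: cur_ok_def\<close>)
  next
    fix i assume "i \<in> K"
    then show "(cur(x := nxt (cur x))) i \<le> M" using co n cx by (auto simp: cur_ok_def)
  next
    fix i assume "i \<in> K" "(cur(x := nxt (cur x))) i \<noteq> 0"
    then show "key ((cur(x := nxt (cur x))) i) = i" using co n cx by (auto simp: cur_ok_def split: if_splits)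
  qed
  then show ?thesis using L unfolding LI_def by blast
qed

text \<open>When the chain of \<open>x\<close> is exhausted, every unit seen by \<open>x\<close> has
  an owner of label at least \<open>lab x\<close>; hence one more is still a valid label.
  Gap-freeness is the only part of the invariant that is not settled here.\<close>

lemma relabel_aux:
  assumes L: "LI own load lab cur" and x: "x \<in> K" "lab x \<noteq> B" and c: "cur x = 0"
    and hungry: "head x ==> load x < th" and W: "0 < W"
  shows "lab_ok own (lab(x := Suc (lab x)))" "load_ok load (lab(x := Suc (lab x)))"
    "cur_ok own (lab(x := Suc (lab x))) (cur(x := fi x))"
proof -
  have own: "own_ok own load" "lab_ok own lab" "cont lab" "load_ok load lab" "cur_ok own lab cur"
    using L unfolding LI_def by auto
  have xB: "Suc (lab x) < B" using LI_lab[OF L x] B by simp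
  have le: "lab x \<le> lab (own u)" if "nbr x u" for u
    using own(5) x c that unfolding cur_ok_def nbr_def by (metis less_eq_Suc_le One_nat_def)
  have x0: "x \<noteq> 0" using x K0 by metis
  show "lab_ok own (lab(x := Suc (lab x)))"
    unfolding lab_ok_def
  proof (intro conjI ballI allI impI)
    fix i u assume i: "i \<in> K" "nbr i u"
    then have *: "if lab i = B then lab (own u) = B else lab i \<le> lab (own u) + 1"
      using own(2) unfolding lab_ok_def by blast
    show "if (lab(x := Suc (lab x))) i = B then (lab(x := Suc (lab x))) (own u) = B
      else (lab(x := Suc (lab x))) i \<le> (lab(x := Suc (lab x))) (own u) + 1"
      using * le[of u] i xB x(2) by (auto split: if_splits)
  qed (use own(2) x0 in \<open>auto simp: lab_ok_def\<close>)
  show "load_ok load (lab(x := Suc (lab x)))"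
    unfolding load_ok_def
  proof (intro ballI impI)
    fix i assume i: "i \<in> K" "2 \<le> (lab(x := Suc (lab x))) i \<or> \<not> head i \<or> base i < th"
    show "load i < ub i"
    proof (cases "i = x \<and> head x")
      case True then show ?thesis using hungry W by (auto simp: ub_def)
    next
      case False
      then have "2 \<le> lab i \<or> \<not> head i \<or> base i < th" using i by (auto split: if_splits)
      then show ?thesis using own(4) i unfolding load_ok_def by blast
    qed
  qed
  show "cur_ok own (lab(x := Suc (lab x))) (cur(x := fi x))"
    unfolding cur_ok_def
  proof (intro ballI conjI impI allI)
    fix i a assume i: "i \<in> K" "(lab(x := Suc (lab x))) i \<noteq> B"
      and a: "(cur(x := fi x)) i < a \<and> a \<le> M \<and> key a = i \<and> va a"
    show "(lab(x := Suc (lab x))) i \<le> (lab(x := Suc (lab x))) (own (un a))"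
    proof (cases "i = x")
      case True then show ?thesis using a fi[OF x(1)] by auto
    next
      case False
      then have "lab i \<le> lab (own (un a))" using own(5) i a unfolding cur_ok_def by auto
      then show ?thesis using False by auto
    qed
  next
    fix i assume "i \<in> K"
    then show "(cur(x := fi x)) i \<le> M" using own(5) fi by (auto simp: cur_ok_def)
  next
    fix i assume "i \<in> K" "(cur(x := fi x)) i \<noteq> 0"
    then show "key ((cur(x := fi x)) i) = i" using own(5) fi by (auto simp: cur_ok_def split: if_splits)
  qed
qed

text \<open>Raising \<open>x\<close> leaves no gap as long as another core keeps the old
  label.\<close>

lemma LI_relabel:
  assumes L: "LI own load lab cur" and x: "x \<in> K" "lab x \<noteq> B" and c: "cur x = 0"
    and hungry: "head x ==> load x < th" and W: "0 < W"
    and ex: "\<exists>i \<in> K. (lab(x := Suc (lab x))) i = lab x"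
  shows "LI own load (lab(x := Suc (lab x))) (cur(x := fi x))"
proof -
  have co: "cont lab" using L unfolding LI_def by blast
  have "cont (lab(x := Suc (lab x)))"
    unfolding cont_def
  proof (intro ballI impI allI)
    fix i s assume i: "i \<in> K" "(lab(x := Suc (lab x))) i \<noteq> B" "1 \<le> s \<and> s < (lab(x := Suc (lab x))) i"
    show "\<exists>i' \<in> K. (lab(x := Suc (lab x))) i' = s"
    proof (cases "s = lab x")
      case True then show ?thesis using ex by blast
    next
      case False
      then have "s < lab i \<and> lab i \<noteq> B" using i x by (auto split: if_splits)
      then obtain i' where "i' \<in> K" "lab i' = s" using co i unfolding cont_def by blast
      then show ?thesis using False by (intro bexI[of _ i']) auto
    qed
  qed
  then show ?thesis using relabel_aux[OF L x c hungry W] L unfolding LI_def by blast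
qed

text \<open>After \<open>x\<close> has left its level, that level is empty. A core above it sees
  only units owned at this level or higher, hence strictly higher, and in particular no free unit.
  So the cores above the gap are closed under adjacent units and can be blocked together.\<close>

lemma LI_gap:
  assumes L: "LI own load lab cur" and x: "x \<in> K" "lab x \<noteq> B" and c: "cur x = 0"
    and hungry: "head x ==> load x < th" and W: "0 < W"
    and ne: "\<not> (\<exists>i \<in> K. (lab(x := Suc (lab x))) i = lab x)"
    and lab': "lab' = (\<lambda>i. if i \<in> K \<and> lab x < (lab(x := Suc (lab x))) i then B else (lab(x := Suc (lab x))) i)"
  shows "LI own load lab' (cur(x := fi x))"
proof -
  let ?l = "lab(x := Suc (lab x))" and ?s = "lab x"
  note aux = relabel_aux[OF L x c hungry W]
  have own: "own_ok own load" "cont lab" using L unfolding LI_def by auto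
  have s: "1 \<le> ?s" "Suc ?s < B" using LI_lab[OF L x] B by auto
  have ge: "?l i \<le> lab' i" if "i \<in> K" for i
  proof (cases "lab i = B")
    case False
    then show ?thesis using LI_lab[OF L that False] B s that by (auto simp: lab')
  next
    case True
    then show ?thesis using x that s by (auto simp: lab')
  qed
  have l0: "lab' 0 = 0" "?l 0 = 0" using K0 aux(1) by (auto simp: lab' lab_ok_def)
  have ownK: "own u = 0 \<or> own u \<in> K" if "u \<in> U" for u using own(1) that unfolding own_ok_def by blast
  have ge': "?l (own u) \<le> lab' (own u)" if "u \<in> U" for u using ownK[OF that] ge l0 by fastforce
  have old: "?l i < ?s" if "i \<in> K" "lab' i \<noteq> B" for i
    using that ne by (auto simp: lab' split: if_splits)
  have same: "lab' i = ?l i" if "i \<in> K" "lab' i \<noteq> B" for i using that by (auto simp: lab' split: if_splits)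
  have lo: "lab_ok own lab'"
    unfolding lab_ok_def
  proof (intro conjI ballI allI impI)
    fix i u assume i: "i \<in> K" "nbr i u"
    then have *: "if ?l i = B then ?l (own u) = B else ?l i \<le> ?l (own u) + 1"
      using aux(1) unfolding lab_ok_def by blast
    have u: "u \<in> U" using i nbr_U by auto
    show "if lab' i = B then lab' (own u) = B else lab' i \<le> lab' (own u) + 1"
    proof (cases "lab' i = B")
      case True
      then have "?s < ?l i" using s(2) i by (auto simp: lab' split: if_splits)
      then have "?s \<le> ?l (own u)" using * s by (auto split: if_splits)
      then have "own u \<in> K" using ownK[OF u] l0 s by fastforce
      moreover have "?l (own u) \<noteq> ?s" using ne \<open>own u \<in> K\<close> by blast
      ultimately have "lab' (own u) = B" using \<open>?s \<le> ?l (own u)\<close> by (simp add: lab' split: if_splits)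
      then show ?thesis using True by simp
    next
      case False
      have "?l i \<noteq> B" using same[OF i(1) False] False by simp
      then have "lab' i \<le> ?l (own u) + 1" using * same[OF i(1) False] by simp
      then show ?thesis using False ge'[OF u] by simp
    qed
  next
    fix i assume "i \<in> K"
    then show "1 \<le> lab' i" using aux(1) ge[of i] unfolding lab_ok_def by fastforce
  qed (use l0 in simp)
  have "cont lab'"
    unfolding cont_def
  proof (intro ballI impI allI)
    fix i s' assume i: "i \<in> K" "lab' i \<noteq> B" "1 \<le> s' \<and> s' < lab' i"
    then have "s' < lab i" "lab i < ?s" "lab i \<noteq> B"
      using old[OF i(1,2)] same[OF i(1,2)] by (auto split: if_splits)
    then obtain i' where i': "i' \<in> K" "lab i' = s'" using own(2) i unfolding cont_def by blast
    then have "?l i' = s'" using \<open>s' < lab i\<close> \<open>lab i < ?s\<close> by auto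
    then show "\<exists>i' \<in> K. lab' i' = s'" using i' \<open>s' < lab i\<close> \<open>lab i < ?s\<close>
      by (intro bexI[of _ i']) (auto simp: lab')
  qed
  moreover have "load_ok load lab'"
    unfolding load_ok_def
  proof (intro ballI impI)
    fix i assume i: "i \<in> K" "2 \<le> lab' i \<or> \<not> head i \<or> base i < th"
    have "2 \<le> ?l i \<or> \<not> head i \<or> base i < th"
      using i s by (auto simp: lab' split: if_splits)
    then show "load i < ub i" using aux(2) i unfolding load_ok_def by blast
  qed
  moreover have "cur_ok own lab' (cur(x := fi x))"
    unfolding cur_ok_def
  proof (intro ballI conjI impI allI)
    fix i a assume i: "i \<in> K" "lab' i \<noteq> B" and a: "(cur(x := fi x)) i < a \<and> a \<le> M \<and> key a = i \<and> va a"
    have "?l i \<noteq> B" using same[OF i] i by simp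
    then have "?l i \<le> ?l (own (un a))" using aux(3) i a unfolding cur_ok_def by blast
    moreover have "un a \<in> U" using va_U a by (metis i(1) K0 One_nat_def Suc_leI gr_implies_not0 not_gr_zero)
    ultimately show "lab' i \<le> lab' (own (un a))" using same[OF i] ge' by fastforce
  qed (use aux(3) in \<open>auto simp: cur_ok_def\<close>)
  ultimately show ?thesis using own(1) lo unfolding LI_def by blast
qed

section \<open>Amortised running time of the labelling\<close>

definition rk :: "nat \<Rightarrow> nat \<Rightarrow> nat" where "rk i c = card {a. 1 \<le> a \<and> a \<le> c \<and> key a = i}"

text \<open>The first sum allows each core one scan of its chain for every label it can still take,
  \<open>rk\<close> being the rest of the current scan. In the second, a pull raises the label of a
  unit's owner; it yields 3 because the pull may also push a head on the stack. The last term pays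
  for the pass over all cores after a gap, which blocks at least one more core.\<close>

definition pot :: "(nat \<Rightarrow> nat) \<Rightarrow> (nat \<Rightarrow> nat) \<Rightarrow> (nat \<Rightarrow> nat) \<Rightarrow> nat" where
  "pot own lab cur = (\<Sum>i \<in> K. (card K + 2 - lab i) * (rk i M + 1) + rk i (cur i)) +
     3 * (\<Sum>u \<in> U. card K + 2 - lab (own u)) + (card K + 2) * card {i \<in> K. lab i \<noteq> B}"

lemma pot_pull:
  assumes L: "LI own load lab cur" and x: "x \<in> K" "lab x \<noteq> B" and u: "u \<in> U" and lt: "lab (own u) < lab x"
  shows "pot (own(u := x)) lab cur + 3 \<le> pot own lab cur"
proof -
  have "lab x \<le> card K" using LI_lab[OF L x] by simp
  then have "card K + 2 - lab ((own(u := x)) u) < card K + 2 - lab (own u)" using lt by simp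
  moreover have "card K + 2 - lab ((own(u := x)) v) \<le> card K + 2 - lab (own v)" for v
    using lt by auto
  ultimately have "(\<Sum>v \<in> U. card K + 2 - lab ((own(u := x)) v)) < (\<Sum>v \<in> U. card K + 2 - lab (own v))"
    using u finU by (intro sum_strict_mono_ex1) blast+
  then show ?thesis unfolding pot_def by simp
qed

lemma sum_upd1:
  fixes f g :: "nat \<Rightarrow> nat"
  assumes "x \<in> K" "\<And>i. i \<in> K ==> i \<noteq> x ==> f i = g i" "f x + d \<le> g x"
  shows "sum f K + d \<le> sum g K"
proof -
  have "sum f (K - {x}) = sum g (K - {x})" using assms by (intro sum.cong) auto
  then show ?thesis using assms finK by (simp add: sum.remove[of K x])
qed

lemma pot_advance:
  assumes L: "LI own load lab cur" and x: "x \<in> K" and c: "cur x \<noteq> 0"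
  shows "pot own lab (cur(x := nxt (cur x))) + 1 \<le> pot own lab cur"
proof -
  have cx: "cur x \<le> M" "key (cur x) = x" using L x c unfolding LI_def cur_ok_def by auto
  have n: "nxt (cur x) < cur x" "\<forall>b. nxt (cur x) < b \<and> b < cur x --> key b \<noteq> x"
    using nxt[of "cur x"] c cx x by auto
  have "{a. 1 \<le> a \<and> a \<le> cur x \<and> key a = x} = insert (cur x) {a. 1 \<le> a \<and> a \<le> nxt (cur x) \<and> key a = x}"
    using n cx c by (auto simp: not_less_eq_eq) (metis le_neq_implies_less not_le)
  then have "rk x (nxt (cur x)) + 1 = rk x (cur x)" using n unfolding rk_def by simp
  then have "(\<Sum>i \<in> K. (card K + 2 - lab i) * (rk i M + 1) + rk i ((cur(x := nxt (cur x))) i)) + 1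
    \<le> (\<Sum>i \<in> K. (card K + 2 - lab i) * (rk i M + 1) + rk i (cur i))"
    using x by (intro sum_upd1[of x]) auto
  then show ?thesis unfolding pot_def by simp
qed

text \<open>Losing one label level frees \<open>rk x M + 1\<close>: the new scan and the step
  itself. Blocking raises labels further and so only lowers the sums. In the gap case
  \<open>x\<close> leaves the unblocked cores, which frees \<open>card K + 2\<close> in
  addition.\<close>

lemma pot_relabel:
  assumes L: "LI own load lab cur" and x: "x \<in> K" "lab x \<noteq> B" and c: "cur x = 0"
    and lab1: "lab1 = lab(x := Suc (lab x))"
    and lab': "lab' = lab1 \<or> lab' = (\<lambda>i. if i \<in> K \<and> lab x < lab1 i then B else lab1 i)"
  shows "pot own lab' (cur(x := fi x)) + 1 + (if lab' = lab1 then 0 else card K + 2) \<le> pot own lab cur"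
proof -
  let ?g = "\<lambda>l c i. (card K + 2 - l i) * (rk i M + 1) + rk i (c i)"
  have s: "1 \<le> lab x" "lab x \<le> card K" using LI_lab[OF L x] by auto
  have fx: "rk x (fi x) \<le> rk x M"
    unfolding rk_def by (rule card_mono) (use fi[OF x(1)] in auto)
  have sb: "Suc (lab x) \<le> B" using s B by simp
  have own: "own u = 0 \<or> own u \<in> K" if "u \<in> U" for u
    using L that unfolding LI_def own_ok_def by blast
  have mono: "lab i \<le> lab' i" "lab1 i \<le> lab' i" if "i \<in> K" for i
  proof -
    have "lab i \<le> B" using LI_lab[OF L that] B by (cases "lab i = B") auto
    then show "lab i \<le> lab' i" "lab1 i \<le> lab' i" using lab' lab1 sb by (auto split: if_splits)
  qed
  have l0: "lab' 0 = lab 0" using lab' lab1 K0 x by (metis fun_upd_other)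
  have A: "(\<Sum>i \<in> K. ?g lab' (cur(x := fi x)) i) + 1 \<le> (\<Sum>i \<in> K. ?g lab cur i)"
  proof -
    have "(\<Sum>i \<in> K. ?g lab' (cur(x := fi x)) i) \<le> (\<Sum>i \<in> K. ?g lab1 (cur(x := fi x)) i)"
      by (intro sum_mono add_mono mult_le_mono diff_le_mono2 mono) auto
    moreover have "?g lab1 (cur(x := fi x)) x + 1 \<le> ?g lab cur x"
    proof -
      have "card K + 2 - lab x = Suc (card K + 2 - lab1 x)" using s lab1 by simp
      then show ?thesis using fx by simp
    qed
    then have "(\<Sum>i \<in> K. ?g lab1 (cur(x := fi x)) i) + 1 \<le> (\<Sum>i \<in> K. ?g lab cur i)"
      using x by (intro sum_upd1[of x]) (auto simp: lab1)
    ultimately show ?thesis by simp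
  qed
  have Bs: "(\<Sum>u \<in> U. card K + 2 - lab' (own u)) \<le> (\<Sum>u \<in> U. card K + 2 - lab (own u))"
  proof (intro sum_mono diff_le_mono2)
    fix u assume "u \<in> U"
    then show "lab (own u) \<le> lab' (own u)" using own[of u] mono l0 by auto
  qed
  have C: "(card K + 2) * card {i \<in> K. lab' i \<noteq> B} + (if lab' = lab1 then 0 else card K + 2) \<le> (card K + 2) * card {i \<in> K. lab i \<noteq> B}"
  proof (cases "lab' = lab1")
    case True
    have "card {i \<in> K. lab' i \<noteq> B} \<le> card {i \<in> K. lab i \<noteq> B}"
      using finK x by (intro card_mono) (auto simp: True lab1 split: if_splits)
    then have "(card K + 2) * card {i \<in> K. lab' i \<noteq> B} \<le> (card K + 2) * card {i \<in> K. lab i \<noteq> B}"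
      by (rule mult_le_mono2)
    then show ?thesis using True by simp
  next
    case False
    then have l': "lab' = (\<lambda>i. if i \<in> K \<and> lab x < lab1 i then B else lab1 i)" using lab' by blast
    have "{i \<in> K. lab' i \<noteq> B} \<subset> {i \<in> K. lab i \<noteq> B}"
      using x by (auto simp: l' lab1 split: if_splits)
    then have "Suc (card {i \<in> K. lab' i \<noteq> B}) \<le> card {i \<in> K. lab i \<noteq> B}"
      using psubset_card_mono[of "{i \<in> K. lab i \<noteq> B}"] finK by (simp add: Suc_leI)
    then have "(card K + 2) * Suc (card {i \<in> K. lab' i \<noteq> B}) \<le> (card K + 2) * card {i \<in> K. lab i \<noteq> B}"
      by (rule mult_le_mono2)
    then show ?thesis using False by simp
  qed
  show ?thesis using A Bs C unfolding pot_def by simp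
qed

end

section \<open>Label counters and the order in which cores act\<close>

context labelling
begin

lemma cntok_flag:
  assumes "cntok lab cnt" "j \<in> K" "1 \<le> lab j" "lab j < B"
  shows "cntok (lab(j := B)) (cnt(lab j := cnt (lab j) - 1))"
  unfolding cntok_def
proof (intro allI impI)
  fix s assume s: "1 \<le> s \<and> s < B"
  have c: "cnt s = card {i \<in> K. lab i = s}" using assms s unfolding cntok_def by blast
  show "(cnt(lab j := cnt (lab j) - 1)) s = card {i \<in> K. (lab(j := B)) i = s}"
  proof (cases "s = lab j")
    case True
    have "{i \<in> K. (lab(j := B)) i = s} = {i \<in> K. lab i = s} - {j}" using s by auto
    moreover have "j \<in> {i \<in> K. lab i = s}" using True assms by simp
    ultimately show ?thesis using c True finK by simp
  next
    case False
    have "{i \<in> K. (lab(j := B)) i = s} = {i \<in> K. lab i = s}" using s False by auto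
    then show ?thesis using c False by simp
  qed
qed

lemma cntok_relabel:
  assumes "cntok lab cnt" "x \<in> K" "1 \<le> lab x" "Suc (lab x) < B"
  shows "cntok (lab(x := Suc (lab x))) (cnt(lab x := cnt (lab x) - 1, Suc (lab x) := cnt (Suc (lab x)) + 1))"
  unfolding cntok_def
proof (intro allI impI)
  fix s assume s: "1 \<le> s \<and> s < B"
  let ?l = "lab(x := Suc (lab x))"
  have c: "cnt s = card {i \<in> K. lab i = s}" using assms s unfolding cntok_def by blast
  consider "s = lab x" | "s = Suc (lab x)" | "s \<noteq> lab x" "s \<noteq> Suc (lab x)" by blast
  then show "(cnt(lab x := cnt (lab x) - 1, Suc (lab x) := cnt (Suc (lab x)) + 1)) s = card {i \<in> K. ?l i = s}"
  proof cases
    case 1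
    have "{i \<in> K. ?l i = s} = {i \<in> K. lab i = s} - {x}" using 1 by auto
    moreover have "x \<in> {i \<in> K. lab i = s}" using 1 assms by simp
    ultimately show ?thesis using c 1 finK by simp
  next
    case 2
    have "{i \<in> K. ?l i = s} = insert x {i \<in> K. lab i = s}" using 2 assms by auto
    moreover have "x \<notin> {i \<in> K. lab i = s}" using 2 by simp
    ultimately show ?thesis using c 2 finK by simp
  next
    case 3
    have "{i \<in> K. ?l i = s} = {i \<in> K. lab i = s}" using 3 by auto
    then show ?thesis using c 3 by simp
  qed
qed

definition gap :: "(nat \<Rightarrow> nat) \<Rightarrow> nat \<Rightarrow> nat \<Rightarrow> nat" where
  "gap lab s = (\<lambda>i. if i \<in> K \<and> s < lab i then B else lab i)"

end

text \<open>Light cores before \<open>jl0\<close> sit out: with \<open>jl0 = c + 1\<close> all light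
  cores ask for units, with \<open>jl0 = k + 1\<close> only the heads do.\<close>

locale labrun = labelling +
  fixes c k jl0 :: nat
  assumes K: "K = {c<..k}" and jl0: "c < jl0" "jl0 \<le> Suc k" and W0: "0 < W"
begin

lemma inK: "i \<in> K \<longleftrightarrow> c < i \<and> i \<le> k" by (simp add: K)

text \<open>The stack may hold stale and repeated entries, which are popped when met; what matters
  is that no unblocked hungry head is missing. Light cores that sit out keep label 1 and own
  nothing.\<close>

definition JS :: "(nat \<Rightarrow> nat) \<Rightarrow> (nat \<Rightarrow> nat) \<Rightarrow> (nat \<Rightarrow> nat) \<Rightarrow> (nat \<Rightarrow> nat) \<Rightarrow> nat \<Rightarrow> nat \<Rightarrow> bool" where
  "JS own load lab stk sp jl \<longleftrightarrow>
    (\<forall>i \<in> K. head i \<and> lab i \<noteq> B \<and> load i < th --> (\<exists>p < sp. stk p = i)) \<and>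
    (\<forall>p < sp. stk p \<in> K \<and> head (stk p)) \<and>
    (\<forall>i \<in> K. \<not> head i \<and> jl0 \<le> i \<and> i < jl --> lab i = B) \<and>
    (\<forall>i \<in> K. \<not> head i \<and> i < jl0 --> lab i = 1 \<and> (\<forall>u \<in> U. own u \<noteq> i)) \<and>
    jl0 \<le> jl \<and> jl \<le> Suc k"

text \<open>Running, finished with all participating light cores passed, or stopped at a light core
  without room for an adjacent unit. Since \<open>ev\<close> is a unit plus 1, the value 0 can stand
  for no event.\<close>

definition JE :: "(nat \<Rightarrow> nat) \<Rightarrow> (nat \<Rightarrow> nat) \<Rightarrow> (nat \<Rightarrow> nat) \<Rightarrow> nat \<Rightarrow> nat \<Rightarrow> nat \<Rightarrow> nat \<Rightarrow> bool" where
  "JE own load lab sp jl go ev \<longleftrightarrow>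
    (go = 1 \<and> ev = 0) \<or>
    (go = (0::nat) \<and> sp = (0::nat) \<and> ev = 0 \<and> k < jl) \<or>
    (go = 0 \<and> sp = 0 \<and> jl \<in> K \<and> \<not> head jl \<and> lab jl \<noteq> B \<and>
      (\<exists>u. ev = Suc u \<and> nbr jl u \<and> lab (own u) < lab jl \<and> 3 * W \<le> load jl + wU u))"

text \<open>Blocking is always triggered by a core that still wants a unit, and blocked cores
  neither gain nor lose units afterwards. The surviving witness of unmet demand later makes the Hall
  deficit strict.\<close>

definition JF :: "(nat \<Rightarrow> nat) \<Rightarrow> (nat \<Rightarrow> nat) \<Rightarrow> bool" where
  "JF load lab \<longleftrightarrow> ((\<exists>i \<in> K. lab i = B) --> (\<exists>i \<in> K. lab i = B \<and> (head i --> load i < th)))"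

definition JJ :: "(nat \<Rightarrow> nat) \<Rightarrow> (nat \<Rightarrow> nat) \<Rightarrow> (nat \<Rightarrow> nat) \<Rightarrow> (nat \<Rightarrow> nat) \<Rightarrow> (nat \<Rightarrow> nat) \<Rightarrow> (nat \<Rightarrow> nat) \<Rightarrow> nat \<Rightarrow> nat \<Rightarrow> nat \<Rightarrow> nat \<Rightarrow> bool" where
  "JJ own load lab cur cnt stk sp jl go ev \<longleftrightarrow> LI own load lab cur \<and> cntok lab cnt \<and>
     JS own load lab stk sp jl \<and> JE own load lab sp jl go ev \<and> JF load lab"

definition PP :: "(nat \<Rightarrow> nat) \<Rightarrow> (nat \<Rightarrow> nat) \<Rightarrow> (nat \<Rightarrow> nat) \<Rightarrow> nat \<Rightarrow> nat \<Rightarrow> nat \<Rightarrow> nat" where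
  "PP own lab cur sp jl go = pot own lab cur + sp + (Suc k - jl) + go"

lemma JJ_pop:
  assumes "JJ own load lab cur cnt stk sp jl 1 ev" "0 < sp" "stk (sp - 1) = x" "\<not> (lab x < B \<and> load x < th)"
  shows "JJ own load lab cur cnt stk (sp - 1) jl 1 ev" "PP own lab cur (sp - 1) jl 1 + 1 \<le> PP own lab cur sp jl 1"
proof -
  have L: "LI own load lab cur" and J: "JS own load lab stk sp jl" using assms unfolding JJ_def by auto
  have "JS own load lab stk (sp - 1) jl"
    unfolding JS_def
  proof (intro conjI ballI impI)
    fix i assume i: "i \<in> K" "head i \<and> lab i \<noteq> B \<and> load i < th"
    then obtain p where p: "p < sp" "stk p = i" using J unfolding JS_def by blast
    have "lab i < B" using LI_lab[OF L] i B by fastforce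
    then have "p \<noteq> sp - 1" using assms p i by auto
    then show "\<exists>p < sp - 1. stk p = i" using p by (intro exI[of _ p]) auto
  qed (use J in \<open>auto simp: JS_def\<close>)
  then show "JJ own load lab cur cnt stk (sp - 1) jl 1 ev"
    using assms unfolding JJ_def JE_def by auto
  show "PP own lab cur (sp - 1) jl 1 + 1 \<le> PP own lab cur sp jl 1" using assms by (simp add: PP_def)
qed

lemma JJ_done:
  assumes "JJ own load lab cur cnt stk 0 jl 1 ev" "k < jl"
  shows "JJ own load lab cur cnt stk 0 jl 0 ev" "PP own lab cur 0 jl 0 + 1 \<le> PP own lab cur 0 jl 1"
  using assms unfolding JJ_def JE_def PP_def by auto

lemma JJ_skip:
  assumes "JJ own load lab cur cnt stk 0 jl 1 ev" "\<not> k < jl" "\<not> (lab jl < B \<and> \<not> head jl)"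
  shows "JJ own load lab cur cnt stk 0 (Suc jl) 1 ev" "PP own lab cur 0 (Suc jl) 1 + 1 \<le> PP own lab cur 0 jl 1"
proof -
  have L: "LI own load lab cur" and J: "JS own load lab stk 0 jl" using assms unfolding JJ_def by auto
  have jl: "jl \<in> K" using J assms jl0 by (auto simp: JS_def inK)
  have "lab jl = B \<or> head jl" using LI_lab[OF L jl] B assms by fastforce
  then have "JS own load lab stk 0 (Suc jl)" using J assms unfolding JS_def by (auto simp: less_Suc_eq)
  then show "JJ own load lab cur cnt stk 0 (Suc jl) 1 ev" using assms unfolding JJ_def JE_def by auto
  show "PP own lab cur 0 (Suc jl) 1 + 1 \<le> PP own lab cur 0 jl 1" using assms by (simp add: PP_def)
qed

text \<open>The core \<open>x\<close> that is allowed to make a step: the top of the stack, or the current light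
  core if no head is hungry.\<close>

definition act :: "(nat \<Rightarrow> nat) \<Rightarrow> (nat \<Rightarrow> nat) \<Rightarrow> (nat \<Rightarrow> nat) \<Rightarrow> nat \<Rightarrow> nat \<Rightarrow> nat \<Rightarrow> bool" where
  "act load lab stk sp jl x \<longleftrightarrow> (0 < sp \<and> x = stk (sp - 1) \<and> lab x < B \<and> load x < th) \<or>
     (sp = 0 \<and> x = jl \<and> jl \<le> k \<and> lab x < B \<and> \<not> head x)"

lemma actD:
  assumes "JS own load lab stk sp jl" "act load lab stk sp jl x"
  shows "x \<in> K" "lab x \<noteq> B" "head x ==> load x < th" "\<not> head x ==> jl0 \<le> x \<and> x = jl \<and> sp = 0"
proof -
  have "x \<in> K \<and> lab x \<noteq> B \<and> (head x --> load x < th) \<and> (\<not> head x --> jl0 \<le> x \<and> x = jl \<and> sp = 0)"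
    using assms(2) unfolding act_def
  proof (elim disjE conjE)
    assume "0 < sp" "x = stk (sp - 1)" "lab x < B" "load x < th"
    moreover from this have "sp - 1 < sp" by simp
    then have "x \<in> K" "head x" using assms(1) \<open>x = _\<close> unfolding JS_def by metis+
    ultimately show ?thesis by auto
  next
    assume "sp = 0" "x = jl" "jl \<le> k" "lab x < B" "\<not> head x"
    moreover from this have "x \<in> K" using assms(1) jl0 by (auto simp: JS_def inK)
    ultimately show ?thesis using assms(1) by (auto simp: JS_def)
  qed
  then show "x \<in> K" "lab x \<noteq> B" "head x ==> load x < th" "\<not> head x ==> jl0 \<le> x \<and> x = jl \<and> sp = 0"
    by auto
qed

lemma JJ_event:
  assumes J: "JJ own load lab cur cnt stk sp jl 1 ev" and x: "act load lab stk sp jl x"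
    and a: "cur x = a" "a \<noteq> 0" "va a" "un a = u" "lab (own u) < lab x" and "\<not> head x" "\<not> load x + wU u < 3 * W"
  shows "JJ own load lab cur cnt stk sp jl 0 (Suc u)" "PP own lab cur sp jl 0 + 1 \<le> PP own lab cur sp jl 1"
proof -
  have L: "LI own load lab cur" and JS: "JS own load lab stk sp jl" using J unfolding JJ_def by auto
  note d = actD[OF JS x]
  have "nbr x u" using L d(1) a unfolding LI_def cur_ok_def nbr_def by (intro exI[of _ a]) (auto simp: Suc_le_eq)
  then have "JE own load lab sp jl 0 (Suc u)" using d assms unfolding JE_def by auto
  then show "JJ own load lab cur cnt stk sp jl 0 (Suc u)" using J unfolding JJ_def by auto
  show "PP own lab cur sp jl 0 + 1 \<le> PP own lab cur sp jl 1" by (simp add: PP_def)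
qed

text \<open>The former owner may have become hungry and is pushed whenever it is a head; the
  potential drops by 3, which covers the push and the step.\<close>

lemma JJ_pull:
  assumes J: "JJ own load lab cur cnt stk sp jl 1 ev" and x: "act load lab stk sp jl x"
    and a: "cur x = a" "a \<noteq> 0" "va a" "un a = u" "lab (own u) < lab x" and fits: "\<not> head x ==> load x + wU u < 3 * W"
    and head0: "\<not> head 0"
    and st: "if head (own u) then stk' = stk(sp := own u) \<and> sp' = Suc sp else stk' = stk \<and> sp' = sp"
  shows "JJ (own(u := x)) (load(x := load x + wU u, own u := load (own u) - wU u)) lab cur cnt stk' sp' jl 1 ev"
    and "PP (own(u := x)) lab cur sp' jl 1 + 1 \<le> PP own lab cur sp jl 1" and "own u \<noteq> x"
proof -
  have L: "LI own load lab cur" and JS: "JS own load lab stk sp jl" using J unfolding JJ_def by auto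
  note d = actD[OF JS x]
  have aa: "1 \<le> a" "a \<le> M" "key a = x" using L d(1) a unfolding LI_def cur_ok_def by (auto simp: Suc_le_eq)
  have u: "u \<in> U" using aa a va_U by auto
  have ownu: "own u = 0 \<or> own u \<in> K" using L u unfolding LI_def own_ok_def by blast
  show ne: "own u \<noteq> x" using a by auto
  let ?load = "load(x := load x + wU u, own u := load (own u) - wU u)"
  have L': "LI (own(u := x)) ?load lab cur"
    by (rule LI_pull[OF L d(1,2) aa a(3,4,5) d(3) fits])
  have "JS (own(u := x)) ?load lab stk' sp' jl"
    unfolding JS_def
  proof (intro conjI ballI impI allI)
    fix i assume i: "i \<in> K" "head i \<and> lab i \<noteq> B \<and> ?load i < th"
    show "\<exists>p < sp'. stk' p = i"
    proof (cases "i = own u")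
      case True
      then show ?thesis using st i by (intro exI[of _ sp]) auto
    next
      case False
      then have "load i < th" using i by (auto split: if_splits)
      then obtain p where "p < sp" "stk p = i" using JS i unfolding JS_def by blast
      then show ?thesis using st by (intro exI[of _ p]) (auto split: if_splits)
    qed
  next
    fix p assume "p < sp'"
    then show "stk' p \<in> K" "head (stk' p)"
      using st JS ownu head0 unfolding JS_def by (auto simp: less_Suc_eq split: if_splits)
  next
    fix i v assume i: "i \<in> K" "\<not> head i \<and> i < jl0" and v: "v \<in> U"
    show "(own(u := x)) v \<noteq> i" using i d JS v unfolding JS_def by auto
  qed (use JS in \<open>auto simp: JS_def\<close>)
  moreover have "JF ?load lab"
    unfolding JF_def
  proof
    assume "\<exists>i \<in> K. lab i = B"
    then obtain i where i: "i \<in> K" "lab i = B" "head i --> load i < th" using J unfolding JJ_def JF_def by blast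
    moreover have "lab x < B" using LI_lab[OF L d(1,2)] B by simp
    \<comment> \<open>The witness is blocked, while the core that takes and the core that gives are
      not.\<close>
    ultimately have "i \<noteq> x" "i \<noteq> own u" using a by auto
    then show "\<exists>i \<in> K. lab i = B \<and> (head i --> ?load i < th)" using i by (intro bexI[of _ i]) auto
  qed
  ultimately show "JJ (own(u := x)) ?load lab cur cnt stk' sp' jl 1 ev"
    using L' J unfolding JJ_def JE_def by auto
  show "PP (own(u := x)) lab cur sp' jl 1 + 1 \<le> PP own lab cur sp jl 1"
    using pot_pull[OF L d(1,2) u a(5)] st unfolding PP_def by (auto split: if_splits)
qed

lemma JJ_advance:
  assumes J: "JJ own load lab cur cnt stk sp jl 1 ev" and x: "act load lab stk sp jl x"
    and a: "cur x = a" "a \<noteq> 0" "\<not> (va a \<and> lab (own (un a)) < lab x)"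
  shows "JJ own load lab (cur(x := nxt a)) cnt stk sp jl 1 ev"
    and "PP own lab (cur(x := nxt a)) sp jl 1 + 1 \<le> PP own lab cur sp jl 1"
proof -
  have L: "LI own load lab cur" and JS: "JS own load lab stk sp jl" using J unfolding JJ_def by auto
  note d = actD[OF JS x]
  show "JJ own load lab (cur(x := nxt a)) cnt stk sp jl 1 ev"
    using LI_advance[OF L d(1)] a J unfolding JJ_def JE_def by auto
  show "PP own lab (cur(x := nxt a)) sp jl 1 + 1 \<le> PP own lab cur sp jl 1"
    using pot_advance[OF L d(1)] a unfolding PP_def by auto
qed

text \<open>Covers the relabelling with and without a gap. \<open>lab'\<close> and
  \<open>cnt''\<close> describe the state after the optional pass that blocks everything above level
  \<open>s\<close>; the additional \<open>card K + 2\<close> is the budget of that pass.\<close>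

lemma JJ_relabel:
  assumes J: "JJ own load lab cur cnt stk sp jl 1 ev" and x: "act load lab stk sp jl x"
    and c0: "cur x = 0" and s: "lab x = s"
    and cnt': "cnt' = cnt(s := cnt s - 1, Suc s := cnt (Suc s) + 1)" and lab1: "lab1 = lab(x := Suc s)"
    and g: "if cnt' s = 0 then lab' = gap lab1 s \<and> cntok lab' cnt'' else lab' = lab1 \<and> cnt'' = cnt'"
  shows "JJ own load lab' (cur(x := fi x)) cnt'' stk sp jl 1 ev"
    and "PP own lab' (cur(x := fi x)) sp jl 1 + 1 + (if cnt' s = 0 then card K + 2 else 0) \<le> PP own lab cur sp jl 1"
    and "cntok lab1 cnt'" and "1 \<le> s" and "Suc s < B"
proof -
  have L: "LI own load lab cur" and JS: "JS own load lab stk sp jl" and C: "cntok lab cnt"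
    using J unfolding JJ_def by auto
  note d = actD[OF JS x]
  show s1: "1 \<le> s" and s2: "Suc s < B" using LI_lab[OF L d(1,2)] s B by auto
  show C1: "cntok lab1 cnt'" using cntok_relabel[OF C d(1)] s s1 s2 lab1 cnt' by auto
  have "cnt' s = card {i \<in> K. lab1 i = s}" using C1 s1 s2 unfolding cntok_def by auto
  then have ex: "cnt' s = 0 \<longleftrightarrow> \<not> (\<exists>i \<in> K. lab1 i = s)" using finK by auto
  have W: "0 < W" by (rule W0)
  have cntok': "cntok lab' cnt''" using g C1 by (auto split: if_splits)
  have L': "LI own load lab' (cur(x := fi x))"
  proof (cases "cnt' s = 0")
    case True
    then show ?thesis
      using LI_gap[OF L d(1,2) c0 d(3) W, of lab'] ex g unfolding gap_def lab1 s by auto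
  next
    case False
    then show ?thesis using LI_relabel[OF L d(1,2) c0 d(3) W] ex g lab1 s by auto
  qed
  have l1: "lab i = B ==> lab' i = B" if "i \<in> K" for i
    using that g lab1 s1 s2 s d(2) by (auto simp: gap_def split: if_splits)
  have l2: "lab i = B" if "i \<in> K" "lab' i \<noteq> B" "i \<noteq> x" "lab i \<noteq> lab' i" for i
    using that g lab1 by (auto simp: gap_def split: if_splits)
  have JS': "JS own load lab' stk sp jl"
    unfolding JS_def
  proof (intro conjI ballI impI allI)
    fix i assume "i \<in> K" "head i \<and> lab' i \<noteq> B \<and> load i < th"
    then show "\<exists>p < sp. stk p = i" using JS l1 unfolding JS_def by blast
  next
    fix i assume i: "i \<in> K" "\<not> head i \<and> i < jl0"
    then have "lab i = 1" "i \<noteq> x" using JS d unfolding JS_def by auto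
    then show "lab' i = 1" using g lab1 s1 by (auto simp: gap_def split: if_splits)
  qed (use JS l1 in \<open>auto simp: JS_def\<close>)
  moreover have "JF load lab'"
    unfolding JF_def
  proof
    assume "\<exists>i \<in> K. lab' i = B"
    show "\<exists>i \<in> K. lab' i = B \<and> (head i --> load i < th)"
    proof (cases "cnt' s = 0")
      case True
      then have "lab' x = B" using g d(1) lab1 by (simp add: gap_def)
      then show ?thesis using d by blast
    next
      case False
      then have "lab' = lab1" using g by simp
      then have "\<exists>i \<in> K. lab i = B" using \<open>\<exists>i \<in> K. lab' i = B\<close> lab1 s2 by (auto split: if_splits)
      then show ?thesis using J l1 unfolding JJ_def JF_def by blast
    qed
  qed
  ultimately show "JJ own load lab' (cur(x := fi x)) cnt'' stk sp jl 1 ev"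
    using L' cntok' J unfolding JJ_def JE_def by auto
  have ne: "gap lab1 s \<noteq> lab1"
  proof
    assume "gap lab1 s = lab1"
    then have "gap lab1 s x = lab1 x" by simp
    then show False using d(1) lab1 s2 by (simp add: gap_def)
  qed
  have "pot own lab' (cur(x := fi x)) + 1 + (if lab' = lab1 then 0 else card K + 2) \<le> pot own lab cur"
    by (rule pot_relabel[OF L d(1,2) c0]) (use g lab1 s in \<open>auto simp: gap_def split: if_splits\<close>)
  then show "PP own lab' (cur(x := fi x)) sp jl 1 + 1 + (if cnt' s = 0 then card K + 2 else 0) \<le> PP own lab cur sp jl 1"
    using g ne unfolding PP_def by (auto split: if_splits)
qed

text \<open>The chains of different cores are disjoint, so their lengths sum to at most
  \<open>M\<close>. Each of the other quantities is counted at most \<open>card K + 2\<close> times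
  as well.\<close>

lemma pot_init:
  assumes "card U \<le> n" "\<forall>i \<in> K. lab i = 1" "lab 0 = 0" "\<forall>u \<in> U. own u = 0" "\<forall>i \<in> K. cur i \<le> M"
  shows "pot own lab cur \<le> (card K + 2) * (2 * M + 2 * card K + 3 * n)"
proof -
  let ?q = "card K"
  have rk: "(\<Sum>i \<in> K. rk i M) \<le> M"
  proof -
    have "(\<Sum>i \<in> K. rk i M) = card (\<Union>i \<in> K. {a. 1 \<le> a \<and> a \<le> M \<and> key a = i})"
      unfolding rk_def by (rule card_UN_disjoint[symmetric]) (auto simp: finK)
    also have "\<dots> \<le> card {1..M}" by (rule card_mono) auto
    finally show ?thesis by simp
  qed
  have "(\<Sum>i \<in> K. (?q + 2 - lab i) * (rk i M + 1) + rk i (cur i)) \<le> (\<Sum>i \<in> K. (?q + 1) * (rk i M + 1) + rk i M)"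
  proof (rule sum_mono)
    fix i assume i: "i \<in> K"
    have "rk i (cur i) \<le> rk i M" unfolding rk_def using assms(5) i
      by (intro card_mono) (auto intro: le_trans)
    then show "(?q + 2 - lab i) * (rk i M + 1) + rk i (cur i) \<le> (?q + 1) * (rk i M + 1) + rk i M"
      using assms(2) i by simp
  qed
  also have "\<dots> = (?q + 2) * (\<Sum>i \<in> K. rk i M) + (?q + 1) * ?q"
  proof -
    have "(\<Sum>i \<in> K. (?q + 1) * (rk i M + 1) + rk i M) = (\<Sum>i \<in> K. (?q + 2) * rk i M + (?q + 1))"
      by (intro sum.cong) auto
    then show ?thesis by (simp only: sum.distrib sum_distrib_left sum_constant) simp
  qed
  also have "\<dots> \<le> (?q + 2) * M + (?q + 1) * ?q" using rk by (intro add_mono mult_le_mono) auto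
  finally have 1: "(\<Sum>i \<in> K. (?q + 2 - lab i) * (rk i M + 1) + rk i (cur i)) \<le> (?q + 2) * M + (?q + 1) * ?q" .
  have "(\<Sum>u \<in> U. ?q + 2 - lab (own u)) = card U * (?q + 2)" using assms by simp
  also have "\<dots> \<le> n * (?q + 2)" using assms(1) by (rule mult_le_mono1)
  finally have 2: "(\<Sum>u \<in> U. ?q + 2 - lab (own u)) \<le> n * (?q + 2)" .
  have 3: "card {i \<in> K. lab i \<noteq> B} \<le> ?q" by (rule card_mono) (auto simp: finK)
  have "pot own lab cur \<le> (?q + 2) * M + (?q + 1) * ?q + 3 * (n * (?q + 2)) + (?q + 2) * ?q"
    unfolding pot_def by (intro add_mono mult_le_mono 1 2 3) auto
  also have "\<dots> \<le> (?q + 2) * (2 * M + 2 * ?q + 3 * n)" by (simp add: algebra_simps)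
  finally show ?thesis .
qed

end

section \<open>The labelling program\<close>

abbreviation "N \<equiv> Const"
abbreviation "R \<equiv> Reg"
abbreviation seq (infixr ";;" 60) where "c ;; d \<equiv> Seq c d"
abbreviation asg (infix "::=" 65) where "x ::= e \<equiv> Assign x e"
abbreviation inc :: "string \<Rightarrow> com" where "inc x \<equiv> Assign x (Plus (Reg x) (Const 1))"

text \<open>Prepending arcs in increasing order yields the decreasing chains ended by 0. All
  \<open>size - c\<close> cores start at label 1, and all heads start on the stack.\<close>

definition label_init :: com where "label_init =
  For ''i'' (N 0) (R ''big'')
    (Store ''lab'' (R ''i'') (N 1) ;; Store ''load'' (R ''i'') (N 0) ;;
     Store ''fi'' (R ''i'') (N 0) ;; Store ''cnt'' (R ''i'') (N 0)) ;;
  Store ''cnt'' (N 1) (Minus (R ''size'') (R ''c'')) ;;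
  Store ''lab'' (N 0) (N 0) ;;
  For ''v'' (N 0) (R ''n'')
    (Store ''own'' (R ''v'') (N 0) ;;
     Store ''load'' (Cell ''part'' (R ''v''))
       (Plus (Cell ''load'' (Cell ''part'' (R ''v''))) (Cell ''weight'' (R ''v'')))) ;;
  For ''a'' (N 1) (Plus (R ''M'') (N 1))
    (Store ''nxt'' (R ''a'') (Cell ''fi'' (Cell ''part'' (Cell ''src'' (R ''a'')))) ;;
     Store ''fi'' (Cell ''part'' (Cell ''src'' (R ''a''))) (R ''a'')) ;;
  ''sp'' ::= N 0 ;;
  For ''i'' (Plus (R ''c'') (N 1)) (Plus (R ''size'') (N 1))
    (Store ''cur'' (R ''i'') (Cell ''fi'' (R ''i'')) ;;
     Cond (Equal (Cell ''kind'' (R ''i'')) (N 1))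
       (Store ''stk'' (R ''sp'') (R ''i'') ;; inc ''sp'') Skip) ;;
  ''ev'' ::= N 0 ;; ''go'' ::= N 1"

definition label_gap :: com where "label_gap =
  For ''i'' (Plus (R ''c'') (N 1)) (Plus (R ''size'') (N 1))
    (Cond (Conj (Less (R ''s'') (Cell ''lab'' (R ''i''))) (Less (Cell ''lab'' (R ''i'')) (R ''big'')))
      (Store ''cnt'' (Cell ''lab'' (R ''i'')) (Minus (Cell ''cnt'' (Cell ''lab'' (R ''i''))) (N 1)) ;;
       Store ''lab'' (R ''i'') (R ''big''))
      Skip)"

definition label_up :: com where "label_up =
  ''s'' ::= Cell ''lab'' (R ''x'') ;;
  Store ''cnt'' (R ''s'') (Minus (Cell ''cnt'' (R ''s'')) (N 1)) ;;
  Store ''lab'' (R ''x'') (Plus (R ''s'') (N 1)) ;;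
  Store ''cnt'' (Plus (R ''s'') (N 1)) (Plus (Cell ''cnt'' (Plus (R ''s'') (N 1))) (N 1)) ;;
  Store ''cur'' (R ''x'') (Cell ''fi'' (R ''x'')) ;;
  Cond (Equal (Cell ''cnt'' (R ''s'')) (N 0)) label_gap Skip"

definition label_pull :: com where "label_pull =
  Store ''own'' (R ''u'') (R ''x'') ;;
  Store ''load'' (R ''x'') (Plus (Cell ''load'' (R ''x'')) (Cell ''wU'' (R ''u''))) ;;
  Store ''load'' (R ''o'') (Minus (Cell ''load'' (R ''o'')) (Cell ''wU'' (R ''u''))) ;;
  Cond (Equal (Cell ''kind'' (R ''o'')) (N 1))
    (Store ''stk'' (R ''sp'') (R ''o'') ;; inc ''sp'') Skip"

definition label_step :: com where "label_step =
  ''a'' ::= Cell ''cur'' (R ''x'') ;;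
  Cond (Equal (R ''a'') (N 0)) label_up
    (''u'' ::= Cell ''unit'' (Cell ''tgt'' (R ''a'')) ;;
     ''o'' ::= Cell ''own'' (R ''u'') ;;
     Cond (Conj (Equal (Cell ''part'' (Cell ''tgt'' (R ''a''))) (N 0)) (Less (Cell ''lab'' (R ''o'')) (Cell ''lab'' (R ''x''))))
       (Cond (Conj (Equal (Cell ''kind'' (R ''x'')) (N 0))
                (Neg (Less (Plus (Cell ''load'' (R ''x'')) (Cell ''wU'' (R ''u''))) (R ''W3''))))
          (''ev'' ::= Plus (R ''u'') (N 1) ;; ''go'' ::= N 0)
          label_pull)
       (Store ''cur'' (R ''x'') (Cell ''nxt'' (R ''a''))))"

definition label_body :: com where "label_body =
  Cond (Less (N 0) (R ''sp''))
    (''x'' ::= Cell ''stk'' (Minus (R ''sp'') (N 1)) ;;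
     Cond (Conj (Less (Cell ''lab'' (R ''x'')) (R ''big'')) (Less (Cell ''load'' (R ''x'')) (R ''th'')))
       label_step (''sp'' ::= Minus (R ''sp'') (N 1)))
    (Cond (Less (R ''size'') (R ''jl'')) (''go'' ::= N 0)
       (Cond (Conj (Less (Cell ''lab'' (R ''jl'')) (R ''big'')) (Equal (Cell ''kind'' (R ''jl'')) (N 0)))
          (''x'' ::= R ''jl'' ;; label_step) (inc ''jl'')))"

definition label_loop :: com where
  "label_loop = While (Less (N 0) (R ''go'')) label_body"

definition label :: com where "label = label_init ;; label_loop"

lemma wp_eq: "wp c Q s1 ==> s1 = s2 ==> (\<And>t s'. Q t s' ==> Q' t s') ==> wp c Q' s2"
  using wp_mono by blast

section \<open>Correctness and time of the labelling program\<close>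

locale labprog =
  fixes n M c k jl0 W th B :: nat and sr tg P Ut kd wU wt :: "nat \<Rightarrow> nat"
  assumes sr: "1 \<le> a ==> a \<le> M ==> sr a < n" and tg: "1 \<le> a ==> a \<le> M ==> tg a < n"
    and P: "v < n ==> P v \<le> k"
    and Ut: "v < n ==> P v = 0 ==> Ut v < n"
    and wU: "v < n ==> P v = 0 ==> wU (Ut v) < W"
    and kd: "kd i \<le> 1" "kd 0 = 0"
    and jl0: "c < jl0" "jl0 \<le> Suc k" and ck: "c \<le> k"
    and B: "k + 2 \<le> B" and W0: "0 < W"
    and light: "c < i ==> i \<le> k ==> kd i = 0 ==> (\<Sum>v | v < n \<and> P v = i. wt v) < 3 * W"
begin

definition U :: "nat set" where "U = {Ut v | v. v < n \<and> P v = 0}"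
definition hd :: "nat \<Rightarrow> bool" where "hd i \<longleftrightarrow> kd i = 1"
definition key :: "nat \<Rightarrow> nat" where "key a = P (sr a)"
definition va :: "nat \<Rightarrow> bool" where "va a \<longleftrightarrow> P (tg a) = 0"
definition un :: "nat \<Rightarrow> nat" where "un a = Ut (tg a)"
definition base :: "nat \<Rightarrow> nat" where "base i = (\<Sum>v | v < n \<and> P v = i. wt v)"

text \<open>The chains after insertion of the arcs below \<open>m\<close>; at \<open>Suc M\<close>
  this is what \<open>labelling\<close> asks for.\<close>

definition lists :: "nat \<Rightarrow> (nat \<Rightarrow> nat) \<Rightarrow> (nat \<Rightarrow> nat) \<Rightarrow> bool" where
  "lists m nx fi \<longleftrightarrow>
    (\<forall>a. 1 \<le> a \<and> a < m --> nx a < a \<and> (nx a \<noteq> 0 --> key (nx a) = key a) \<and> (\<forall>b. nx a < b \<and> b < a --> key b \<noteq> key a)) \<and>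
    (\<forall>i \<le> k. fi i < m \<and> (fi i \<noteq> 0 --> key (fi i) = i) \<and> (\<forall>b. fi i < b \<and> b < m --> key b \<noteq> i))"

lemma labrun: "lists (Suc M) nx fi ==> labrun {c<..k} hd key M va un U wU base W B nx fi c k jl0"
proof unfold_locales
  show "finite U" unfolding U_def by simp
  show "u \<in> U ==> wU u < W" for u unfolding U_def using wU by auto
  show "1 \<le> a ==> a \<le> M ==> va a ==> un a \<in> U" for a unfolding U_def va_def un_def using tg by auto
  show "card {c<..k} + 2 \<le> B" using B by simp
  show "i \<in> {c<..k} ==> \<not> hd i ==> base i < 3 * W" for i
    using light[of i] kd(1)[of i] by (simp add: hd_def base_def le_Suc_eq)
qed (use jl0 ck W0 in \<open>auto simp: lists_def less_Suc_eq_le\<close>)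

definition ctx :: "store \<Rightarrow> bool" where
  "ctx s \<longleftrightarrow> reg s ''n'' = n \<and> reg s ''M'' = M \<and> reg s ''c'' = c \<and> reg s ''size'' = k \<and>
    reg s ''W3'' = 3 * W \<and> reg s ''th'' = th \<and> reg s ''big'' = B \<and>
    arr s ''src'' = sr \<and> arr s ''tgt'' = tg \<and> arr s ''part'' = P \<and> arr s ''unit'' = Ut \<and>
    arr s ''kind'' = kd \<and> arr s ''wU'' = wU \<and> arr s ''weight'' = wt"

end

locale labprog2 = labprog +
  fixes nx fi :: "nat \<Rightarrow> nat"
  assumes lists: "lists (Suc M) nx fi"

sublocale labprog2 \<subseteq> labrun "{c<..k}" hd key M va un U wU base W th B nx fi c k jl0
  by (rule labrun[OF lists])

context labprog2
begin

definition LJ :: "store \<Rightarrow> bool" where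
  "LJ s \<longleftrightarrow> ctx s \<and> arr s ''nxt'' = nx \<and> arr s ''fi'' = fi \<and>
     JJ (arr s ''own'') (arr s ''load'') (arr s ''lab'') (arr s ''cur'') (arr s ''cnt'') (arr s ''stk'')
       (reg s ''sp'') (reg s ''jl'') (reg s ''go'') (reg s ''ev'')"

text \<open>The factor 200 bounds the instructions charged to one unit of potential, including the
  share of one core in a gap pass.\<close>

definition LP :: "store \<Rightarrow> nat" where
  "LP s = 200 * PP (arr s ''own'') (arr s ''lab'') (arr s ''cur'') (reg s ''sp'') (reg s ''jl'') (reg s ''go'')"

definition LA :: "store \<Rightarrow> bool" where
  "LA s \<longleftrightarrow> act (arr s ''load'') (arr s ''lab'') (arr s ''stk'') (reg s ''sp'') (reg s ''jl'') (reg s ''x'')"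

lemma label_gap:
  assumes c0: "ctx s" and s0: "reg s ''s'' = s0" "1 \<le> s0" and cn: "cntok (arr s ''lab'') (arr s ''cnt'')"
    and le: "\<And>j. j \<in> {c<..k} ==> arr s ''lab'' j \<le> B"
  shows "wp label_gap (\<lambda>t s'. ctx s' \<and> arr s' ''lab'' = gap (arr s ''lab'') s0 \<and> cntok (arr s' ''lab'') (arr s' ''cnt'')
     \<and> t \<le> 40 * (k - c) + 20) s"
proof -
  \<comment> \<open>\<open>pg i\<close> is the label array after the gap pass has treated the cores
    below \<open>i\<close>.\<close>
  define pg where "pg i = (\<lambda>j. if j \<in> {c<..k} \<and> j < i \<and> s0 < arr s ''lab'' j then B else arr s ''lab'' j)" for i
  have pg0: "pg (Suc c) = arr s ''lab''" and pg1: "pg (Suc k) = gap (arr s ''lab'') s0"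
    by (auto simp: pg_def gap_def fun_eq_iff)
  have pgi: "pg i i = arr s ''lab'' i" for i by (simp add: pg_def)
  show ?thesis
    unfolding label_gap_def
  proof (rule wp_For[where I = "\<lambda>i s'. ctx s' \<and> reg s' ''s'' = s0 \<and> arr s' ''lab'' = pg i
      \<and> cntok (arr s' ''lab'') (arr s' ''cnt'')" and l = "Suc c" and h = "Suc k" and K = 29], goal_cases)
    case (5 i s')
    let ?L = "arr s ''lab'' i"
    have i: "i \<in> {c<..k}" using 5 by auto
    have l: "arr s' ''lab'' = pg i" using 5 by blast
    then have cnk: "cntok (pg i) (arr s' ''cnt'')" using 5 by metis
    show ?case
    proof (cases "s0 < ?L \<and> ?L < B")
      case True
      have "cntok ((pg i)(i := B)) ((arr s' ''cnt'')(pg i i := arr s' ''cnt'' (pg i i) - 1))"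
        by (rule cntok_flag) (use 5 i True s0 in \<open>auto simp: pgi\<close>)
      moreover have "(pg i)(i := B) = pg (Suc i)" using i True by (auto simp: pg_def fun_eq_iff less_Suc_eq)
      ultimately show ?thesis using 5 True by (simp add: ctx_def pgi)
    next
      case False
      then have "pg (Suc i) = pg i" using le[OF i] by (auto simp: pg_def fun_eq_iff less_Suc_eq)
      then show ?thesis using 5 False cnk by (cases "s0 < ?L") (simp_all add: ctx_def pgi)
    qed
  next
    case (6 s' t)
    then show ?case by (auto simp: pg1)
  qed (use c0 s0 cn ck pg0 in \<open>simp_all add: ctx_def\<close>)
qed

lemma lab_le_B: "LI own load lab cur ==> i \<in> {c<..k} ==> lab i \<le> B"
  using LI_lab[of own load lab cur i] B by (cases "lab i = B") auto

lemma label_up: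
  assumes J: "LJ s" and A: "LA s" and g: "reg s ''go'' = 1" and c0: "arr s ''cur'' (reg s ''x'') = 0"
  shows "wp label_up (\<lambda>t s'. LJ s' \<and> t + 90 + LP s' \<le> LP s) s"
proof -
  let ?x = "reg s ''x''" and ?lab = "arr s ''lab''" and ?cnt = "arr s ''cnt''" and ?cur = "arr s ''cur''"
  define s0 where "s0 = ?lab ?x"
  define cnt' where "cnt' = ?cnt(s0 := ?cnt s0 - 1, Suc s0 := ?cnt (Suc s0) + 1)"
  define lab1 where "lab1 = ?lab(?x := Suc s0)"
  have c: "ctx s" and nx: "arr s ''nxt'' = nx" "arr s ''fi'' = fi" using J unfolding LJ_def by auto
  have JJ: "JJ (arr s ''own'') (arr s ''load'') ?lab ?cur ?cnt (arr s ''stk'') (reg s ''sp'') (reg s ''jl'') 1 (reg s ''ev'')"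
    using J g unfolding LJ_def by simp
  note R = JJ_relabel[OF JJ A[unfolded LA_def] c0 s0_def[symmetric] cnt'_def lab1_def]
  show ?thesis
  proof (cases "cnt' s0 = 0")
    case False
    have "JJ (arr s ''own'') (arr s ''load'') lab1 (?cur(?x := fi ?x)) cnt' (arr s ''stk'') (reg s ''sp'') (reg s ''jl'') 1 (reg s ''ev'')"
      and "PP (arr s ''own'') lab1 (?cur(?x := fi ?x)) (reg s ''sp'') (reg s ''jl'') 1 + 1 \<le>
        PP (arr s ''own'') ?lab ?cur (reg s ''sp'') (reg s ''jl'') 1"
      using R(1,2)[of lab1 cnt'] False by auto
    then show ?thesis using False c nx g unfolding label_up_def
      by (simp add: LJ_def LP_def ctx_def cnt'_def lab1_def s0_def)
  next
    case True
    \<comment> \<open>The counters after the gap pass are not known yet. The exact counting function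
      stands in for them, only to read off the bounds on \<open>s0\<close> and the counters before
      the pass.\<close>
    note R3 = R(3,4,5)[of "gap lab1 s0" "\<lambda>s. card {i \<in> {c<..k}. gap lab1 s0 i = s}"]
    have tr: "cntok (gap lab1 s0) (\<lambda>s. card {i \<in> {c<..k}. gap lab1 s0 i = s})" by (simp add: cntok_def)
    have s0: "1 \<le> s0" "Suc s0 < B" and cn: "cntok lab1 cnt'" using R3 True tr by auto
    have LI: "LI (arr s ''own'') (arr s ''load'') ?lab ?cur" using JJ unfolding JJ_def by blast
    have le: "lab1 j \<le> B" if "j \<in> {c<..k}" for j
      using lab_le_B[OF LI that] s0 by (auto simp: lab1_def)
    define s1 where "s1 = s\<lparr>reg := (reg s)(''s'' := s0), arr := (arr s)(''lab'' := lab1, ''cnt'' := cnt', ''cur'' := ?cur(?x := fi ?x))\<rparr>"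
    have g1: "wp label_gap (\<lambda>t s'. ctx s' \<and> arr s' ''lab'' = gap (arr s1 ''lab'') s0 \<and> cntok (arr s' ''lab'') (arr s' ''cnt'')
     \<and> t \<le> 40 * (k - c) + 20) s1"
      by (rule label_gap) (use c s0 cn le in \<open>simp_all add: s1_def ctx_def\<close>)
    have mods: "rmods label_gap = {''i''}" "amods label_gap = {''cnt'', ''lab''}" by (auto simp: label_gap_def)
    have g2: "wp label_gap (\<lambda>t s'. LJ s' \<and> t + 150 + LP s' \<le> LP s) s1"
    proof (rule wp_frame[OF g1], elim conjE)
      fix t s' assume H: "ctx s'" "arr s' ''lab'' = gap (arr s1 ''lab'') s0" "cntok (arr s' ''lab'') (arr s' ''cnt'')"
        "t \<le> 40 * (k - c) + 20" and F: "frame label_gap s1 s'"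
      have fr: "reg s' x = reg s1 x" if "x \<noteq> ''i''" for x using F that by (auto simp: frame_def mods)
      have fa: "arr s' x = arr s1 x" if "x \<noteq> ''cnt''" "x \<noteq> ''lab''" for x using F that by (auto simp: frame_def mods)
      have l: "arr s' ''lab'' = gap lab1 s0" using H by (simp add: s1_def)
      have "JJ (arr s ''own'') (arr s ''load'') (gap lab1 s0) (?cur(?x := fi ?x)) (arr s' ''cnt'') (arr s ''stk'') (reg s ''sp'') (reg s ''jl'') 1 (reg s ''ev'')"
        and "PP (arr s ''own'') (gap lab1 s0) (?cur(?x := fi ?x)) (reg s ''sp'') (reg s ''jl'') 1 + 1 + (card {c<..k} + 2) \<le>
          PP (arr s ''own'') ?lab ?cur (reg s ''sp'') (reg s ''jl'') 1"
        using R(1,2)[of "gap lab1 s0" "arr s' ''cnt''"] True H(3) l by auto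
      then show "LJ s' \<and> t + 150 + LP s' \<le> LP s"
        using H(1,4) nx g by (simp add: LJ_def LP_def l fr fa s1_def)
    qed
    have g3: "wp (Cond (Equal (Cell ''cnt'' (R ''s'')) (N 0)) label_gap Skip) (\<lambda>t s'. LJ s' \<and> t + 130 + LP s' \<le> LP s) s1"
      using True by (simp add: s1_def[symmetric]) (simp add: s1_def, rule wp_mono[OF g2[unfolded s1_def]], simp)
    have s1: "s1 = s\<lparr>reg := (reg s)(''s'' := ?lab ?x), arr := (arr s)
        (''lab'' := ?lab(?x := Suc (?lab ?x)),
         ''cnt'' := ?cnt(?lab ?x := ?cnt (?lab ?x) - Suc 0, Suc (?lab ?x) := Suc (?cnt (Suc (?lab ?x)))),
         ''cur'' := ?cur(?x := fi ?x))\<rparr>"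
      by (simp add: s1_def s0_def cnt'_def lab1_def)
    show ?thesis
      unfolding label_up_def using c nx
      by (simp add: ctx_def s1[symmetric] del: wp_Cond) (rule wp_mono[OF g3], simp)
  qed
qed

lemma label_pull:
  assumes J: "LJ s" and A: "LA s" and g: "reg s ''go'' = 1" and a0: "arr s ''cur'' (reg s ''x'') = a" "a \<noteq> 0"
    and a: "va a" "reg s ''u'' = un a" "reg s ''o'' = arr s ''own'' (un a)"
      "arr s ''lab'' (arr s ''own'' (un a)) < arr s ''lab'' (reg s ''x'')"
    and fits: "\<not> hd (reg s ''x'') ==> arr s ''load'' (reg s ''x'') + wU (un a) < 3 * W"
  shows "wp label_pull (\<lambda>t s'. LJ s' \<and> t + 100 + LP s' \<le> LP s) s"
proof -
  let ?x = "reg s ''x''" and ?lab = "arr s ''lab''" and ?cnt = "arr s ''cnt''" and ?cur = "arr s ''cur''"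
    and ?own = "arr s ''own''" and ?load = "arr s ''load''" and ?u = "un a" and ?stk = "arr s ''stk''" and ?sp = "reg s ''sp''"
  have c: "ctx s" and nx: "arr s ''nxt'' = nx" "arr s ''fi'' = fi" using J unfolding LJ_def by auto
  have JJ: "JJ ?own ?load ?lab ?cur ?cnt ?stk ?sp (reg s ''jl'') 1 (reg s ''ev'')"
    using J g unfolding LJ_def by simp
  have hd0: "\<not> hd 0" using kd by (simp add: hd_def)
  note R = JJ_pull[OF JJ A[unfolded LA_def] a0 a(1) refl a(4) fits hd0]
  have ne: "?own ?u \<noteq> ?x" using a(4) by auto
  show ?thesis
  proof (cases "kd (?own ?u) = 1")
    case True
    then have "JJ (?own(?u := ?x)) (?load(?x := ?load ?x + wU ?u, ?own ?u := ?load (?own ?u) - wU ?u)) ?lab ?cur ?cnt (?stk(?sp := ?own ?u)) (Suc ?sp) (reg s ''jl'') 1 (reg s ''ev'')"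
      "PP (?own(?u := ?x)) ?lab ?cur (Suc ?sp) (reg s ''jl'') 1 + 1 \<le> PP ?own ?lab ?cur ?sp (reg s ''jl'') 1"
      using R(1,2)[of "?stk(?sp := ?own ?u)" "Suc ?sp"] by (auto simp: hd_def)
    then show ?thesis using True c nx g a ne unfolding label_pull_def
      by (simp add: LJ_def LP_def ctx_def)
  next
    case False
    then have "JJ (?own(?u := ?x)) (?load(?x := ?load ?x + wU ?u, ?own ?u := ?load (?own ?u) - wU ?u)) ?lab ?cur ?cnt ?stk ?sp (reg s ''jl'') 1 (reg s ''ev'')"
      "PP (?own(?u := ?x)) ?lab ?cur ?sp (reg s ''jl'') 1 + 1 \<le> PP ?own ?lab ?cur ?sp (reg s ''jl'') 1"
      using R(1,2)[of ?stk ?sp] by (auto simp: hd_def)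
    then show ?thesis using False c nx g a ne unfolding label_pull_def
      by (simp add: LJ_def LP_def ctx_def)
  qed
qed

lemma label_step:
  assumes J: "LJ s" and A: "LA s" and g: "reg s ''go'' = 1"
  shows "wp label_step (\<lambda>t s'. LJ s' \<and> t + 50 + LP s' \<le> LP s) s"
proof -
  let ?x = "reg s ''x''" and ?lab = "arr s ''lab''" and ?cnt = "arr s ''cnt''" and ?cur = "arr s ''cur''"
    and ?own = "arr s ''own''" and ?load = "arr s ''load''" and ?stk = "arr s ''stk''" and ?sp = "reg s ''sp''"
  define a where "a = ?cur ?x"
  have c: "ctx s" and nx: "arr s ''nxt'' = nx" "arr s ''fi'' = fi" using J unfolding LJ_def by auto
  have JJ: "JJ ?own ?load ?lab ?cur ?cnt ?stk ?sp (reg s ''jl'') 1 (reg s ''ev'')"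
    using J g unfolding LJ_def by simp
  define s1 where "s1 = s\<lparr>reg := (reg s)(''a'' := a)\<rparr>"
  define s2 where "s2 = s\<lparr>reg := (reg s)(''a'' := a, ''u'' := un a, ''o'' := ?own (un a))\<rparr>"
  have J1: "LJ s1" "LA s1" "LP s1 = LP s" and J2: "LJ s2" "LA s2" "LP s2 = LP s"
    using J A by (simp_all add: LJ_def LA_def LP_def ctx_def s1_def s2_def)
  show ?thesis
  proof (cases "a = 0")
    case True
    have "wp label_up (\<lambda>t s'. LJ s' \<and> t + 90 + LP s' \<le> LP s1) s1"
      by (rule label_up) (use J1 g True in \<open>simp_all add: s1_def a_def\<close>)
    note st = this
    show ?thesis
      unfolding label_step_def using True
      apply (simp add: a_def[symmetric]) apply(rule wp_eq[OF st]) using J1(3) apply (simp_all add: s1_def True) done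
  next
    case False
    have un: "un a = Ut (tg a)" "va a \<longleftrightarrow> P (tg a) = 0" by (simp_all add: un_def va_def)
    show ?thesis
    proof (cases "va a \<and> ?lab (?own (un a)) < ?lab ?x")
      case adv: False
      note R = JJ_advance[OF JJ A[unfolded LA_def] a_def[symmetric] False adv]
      then show ?thesis
        unfolding label_step_def using c nx g adv un False
        by (cases "va a") (simp_all add: LJ_def LP_def ctx_def a_def[symmetric])
    next
      case pull: True
      show ?thesis
      proof (cases "\<not> hd ?x \<and> \<not> ?load ?x + wU (un a) < 3 * W")
        case True
        note R = JJ_event[OF JJ A[unfolded LA_def] a_def[symmetric] False, of "un a"]
        have "JJ ?own ?load ?lab ?cur ?cnt ?stk ?sp (reg s ''jl'') 0 (Suc (un a))"
          "PP ?own ?lab ?cur ?sp (reg s ''jl'') 0 + 1 \<le> PP ?own ?lab ?cur ?sp (reg s ''jl'') 1"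
          using R pull True by auto
        moreover have "kd ?x = 0" using True kd(1)[of ?x] by (simp add: hd_def)
        ultimately show ?thesis
          unfolding label_step_def using c nx g pull un False True
          by (simp add: LJ_def LP_def ctx_def a_def[symmetric])
      next
        case fits: False
        have "wp label_pull (\<lambda>t s'. LJ s' \<and> t + 100 + LP s' \<le> LP s2) s2"
          by (rule label_pull[where a = a]) (use J2 g False pull fits in \<open>auto simp: s2_def a_def\<close>)
        note st = this
        have "kd ?x = 0 --> ?load ?x + wU (un a) < 3 * W" using fits by (auto simp: hd_def)
        then show ?thesis
          unfolding label_step_def using c False pull un
          by (cases "kd ?x = 0"; simp add: ctx_def a_def[symmetric]; intro impI wp_eq[OF st]; simp add: s2_def J2(3)[unfolded s2_def un_def] un)
      qed
    qed
  qed
qed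

lemma label_body:
  assumes J: "LJ s" and g: "0 < reg s ''go''"
  shows "wp label_body (\<lambda>t s'. LJ s' \<and> t + 20 + LP s' \<le> LP s) s"
proof -
  let ?lab = "arr s ''lab''" and ?cnt = "arr s ''cnt''" and ?cur = "arr s ''cur''" and ?jl = "reg s ''jl''"
    and ?own = "arr s ''own''" and ?load = "arr s ''load''" and ?stk = "arr s ''stk''" and ?sp = "reg s ''sp''"
  have c: "ctx s" and nx: "arr s ''nxt'' = nx" "arr s ''fi'' = fi" using J unfolding LJ_def by auto
  have g: "reg s ''go'' = 1" using J g unfolding LJ_def JJ_def JE_def by auto
  have JJ: "JJ ?own ?load ?lab ?cur ?cnt ?stk ?sp ?jl 1 (reg s ''ev'')"
    using J g unfolding LJ_def by simp
  show ?thesis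
  proof (cases "0 < ?sp")
    case True
    define x where "x = ?stk (?sp - Suc 0)"
    define s1 where "s1 = s\<lparr>reg := (reg s)(''x'' := x)\<rparr>"
    show ?thesis
    proof (cases "?lab x < B \<and> ?load x < th")
      case h: True
      have "wp label_step (\<lambda>t s'. LJ s' \<and> t + 50 + LP s' \<le> LP s1) s1"
        by (rule label_step) (use J g True h in \<open>simp_all add: LJ_def LA_def act_def ctx_def s1_def x_def\<close>)
      note st = this
      have LPe: "LP s1 = LP s" by (simp add: LP_def s1_def)
      show ?thesis
        unfolding label_body_def using True h c
        by (simp add: ctx_def x_def[symmetric], intro impI wp_eq[OF st]) (simp_all add: s1_def LPe[unfolded s1_def])
    next
      case False
      have "JJ ?own ?load ?lab ?cur ?cnt ?stk (?sp - Suc 0) ?jl 1 (reg s ''ev'')"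
        "PP ?own ?lab ?cur (?sp - Suc 0) ?jl 1 + 1 \<le> PP ?own ?lab ?cur ?sp ?jl 1"
        using JJ_pop[OF JJ True _ False] by (auto simp: x_def)
      then show ?thesis
        unfolding label_body_def using True False c nx g
        by (cases "?lab x < B") (simp_all add: ctx_def x_def[symmetric] LJ_def LP_def)
    qed
  next
    case False
    then have sp: "?sp = 0" by simp
    note JJ0 = JJ[unfolded sp]
    show ?thesis
    proof (cases "k < ?jl")
      case True
      note JJ_done[OF JJ0 True]
      then show ?thesis
        unfolding label_body_def using True sp c nx g
        by (simp add: ctx_def LJ_def LP_def)
    next
      case jl: False
      show ?thesis
      proof (cases "?lab ?jl < B \<and> \<not> hd ?jl")
        case h: True
        then have kd0: "kd ?jl = 0" using kd(1)[of ?jl] by (simp add: hd_def)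
        define s1 where "s1 = s\<lparr>reg := (reg s)(''x'' := ?jl)\<rparr>"
        have "wp label_step (\<lambda>t s'. LJ s' \<and> t + 50 + LP s' \<le> LP s1) s1"
          by (rule label_step) (use J g jl h sp in \<open>simp_all add: LJ_def LA_def act_def ctx_def s1_def\<close>)
        note st = this
        have LPe: "LP s1 = LP s" by (simp add: LP_def s1_def)
        show ?thesis
          unfolding label_body_def using sp jl h c kd0
          by (simp add: ctx_def, intro impI wp_eq[OF st]) (simp_all add: s1_def LPe[unfolded s1_def])
      next
        case h: False
        have h': "\<not> (?lab ?jl < B \<and> kd ?jl = 0)" using h by (auto simp: hd_def)
        note JJ_skip[OF JJ0 jl h]
        then show ?thesis
          unfolding label_body_def using sp jl h' c nx g
          by (cases "?lab ?jl < B") (simp_all add: ctx_def LJ_def LP_def)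
      qed
    qed
  qed
qed

lemma label_loop:
  assumes J: "LJ s"
  shows "wp label_loop (\<lambda>t s'. LJ s' \<and> reg s' ''go'' = 0 \<and> t \<le> LP s + 4) s"
  unfolding label_loop_def
  by (rule wp_while[where I = LJ and p = LP, OF J]) (auto intro!: wp_mono[OF label_body])

end

context labprog
begin

lemma lists_step:
  assumes l: "lists a nx fi" and a: "1 \<le> a" and key: "key a \<le> k"
  shows "lists (Suc a) (nx(a := fi (key a))) (fi(key a := a))"
  unfolding lists_def
proof (intro conjI allI impI)
  fix b assume b: "1 \<le> b \<and> b < Suc a"
  have f: "fi (key a) < a" "fi (key a) \<noteq> 0 --> key (fi (key a)) = key a"
    "\<And>b. fi (key a) < b \<and> b < a ==> key b \<noteq> key a" using l key unfolding lists_def by blast+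
  show "(nx(a := fi (key a))) b < b"
    "(nx(a := fi (key a))) b \<noteq> 0 ==> key ((nx(a := fi (key a))) b) = key b"
    "\<And>d. (nx(a := fi (key a))) b < d \<and> d < b ==> key d \<noteq> key b"
    using l f b unfolding lists_def by (cases "b = a"; simp add: less_Suc_eq)+
next
  fix i assume i: "i \<le> k"
  show "(fi(key a := a)) i < Suc a" using l i unfolding lists_def by (auto simp: less_Suc_eq)
  show "(fi(key a := a)) i \<noteq> 0 ==> key ((fi(key a := a)) i) = i"
    using l i unfolding lists_def by (auto split: if_splits)
  fix d assume "(fi(key a := a)) i < d \<and> d < Suc a"
  then show "key d \<noteq> i" using l i unfolding lists_def by (auto simp: less_Suc_eq split: if_splits)
qed

lemma lists_1: "(\<forall>i \<le> k. fi i = 0) ==> lists 1 nx fi"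
  unfolding lists_def by auto

definition ini :: "store \<Rightarrow> bool" where
  "ini s \<longleftrightarrow> ctx s \<and> reg s ''jl'' = jl0 \<and> (\<forall>j < B. arr s ''lab'' j = (if j = 0 then 0 else 1)) \<and>
     (\<forall>j < B. arr s ''cnt'' j = (if j = 1 then k - c else 0))"

lemma base_step: "v < n ==> (\<Sum>u | u < Suc v \<and> P u = j. wt u) = (\<Sum>u | u < v \<and> P u = j. wt u) + (if P v = j then wt v else 0)"
proof -
  have "{u. u < Suc v \<and> P u = j} = (if P v = j then insert v {u. u < v \<and> P u = j} else {u. u < v \<and> P u = j})"
    by (auto simp: less_Suc_eq)
  then show ?thesis by simp
qed

lemma label_init:
  assumes c0: "ctx s" and jl: "reg s ''jl'' = jl0"
  shows "wp label_init (\<lambda>t s'. ini s' \<and> (\<forall>v < n. arr s' ''own'' v = 0) \<and> (\<forall>j \<le> k. arr s' ''load'' j = base j) \<and>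
    lists (Suc M) (arr s' ''nxt'') (arr s' ''fi'') \<and> (\<forall>j. c < j \<and> j \<le> k --> arr s' ''cur'' j = arr s' ''fi'' j) \<and>
    (\<forall>j. c < j \<and> j \<le> k \<and> hd j --> (\<exists>p < reg s' ''sp''. arr s' ''stk'' p = j)) \<and>
    (\<forall>p < reg s' ''sp''. c < arr s' ''stk'' p \<and> arr s' ''stk'' p \<le> k \<and> hd (arr s' ''stk'' p)) \<and>
    reg s' ''sp'' \<le> k - c \<and> reg s' ''ev'' = 0 \<and> reg s' ''go'' = 1 \<and> t \<le> 60 * (B + n + M + (k - c) + 1)) s"
  unfolding label_init_def wp_Seq
proof (rule wp_For[where I = "\<lambda>i s. ctx s \<and> reg s ''jl'' = jl0 \<and> (\<forall>j < i. arr s ''lab'' j = 1 \<and> arr s ''load'' j = 0 \<and> arr s ''fi'' j = 0 \<and> arr s ''cnt'' j = 0)"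
     and l = 0 and h = B and K = 12], goal_cases)
  case (6 s1 t1)
  have b: "0 < B" "Suc 0 < B" using B by auto
  have k: "j < B" if "j \<le> k" for j using that B by simp
  show ?case unfolding wp_Store
  proof (rule wp_For[where I = "\<lambda>v s. ini s \<and> (\<forall>j < B. arr s ''fi'' j = 0) \<and> (\<forall>u < v. arr s ''own'' u = 0) \<and>
      (\<forall>j \<le> k. arr s ''load'' j = (\<Sum>u | u < v \<and> P u = j. wt u))" and l = 0 and h = n and K = 12], goal_cases)
    case 3
    show ?case using 6 b k by (simp add: ini_def ctx_def)
  next
    case (5 i s)
    then show ?case by (simp add: ini_def ctx_def base_step) (fastforce simp: less_Suc_eq)?
  next
    case (6 s2 t2)
    note s2 = 6
    show ?case
    proof (rule wp_For[where I = "\<lambda>a s. ini s \<and> (\<forall>u < n. arr s ''own'' u = 0) \<and>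
        (\<forall>j \<le> k. arr s ''load'' j = base j) \<and> lists a (arr s ''nxt'') (arr s ''fi'')" and l = 1 and h = "Suc M" and K = 13], goal_cases)
      case 3
      show ?case using s2 k lists_1[of "arr s2 ''fi''" "arr s2 ''nxt''"] by (simp add: ini_def ctx_def base_def)
    next
      case (5 a s)
      have "key a \<le> k" unfolding key_def using P sr 5 by simp
      then have "lists (Suc a) ((arr s ''nxt'')(a := arr s ''fi'' (key a))) ((arr s ''fi'')(key a := a))"
        using lists_step[of a "arr s ''nxt''" "arr s ''fi''"] 5 by blast
      then show ?case using 5 by (simp add: ini_def ctx_def key_def)
    next
      case (6 s3 t3)
      note s3 = 6
      show ?case unfolding wp_Assign
      proof (rule wp_For[where I = "\<lambda>i s. ini s \<and> (\<forall>u < n. arr s ''own'' u = 0) \<and>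
        (\<forall>j \<le> k. arr s ''load'' j = base j) \<and> lists (Suc M) (arr s ''nxt'') (arr s ''fi'') \<and>
        (\<forall>j. c < j \<and> j < i --> arr s ''cur'' j = arr s ''fi'' j) \<and>
        (\<forall>j. c < j \<and> j < i \<and> hd j --> (\<exists>p < reg s ''sp''. arr s ''stk'' p = j)) \<and>
        (\<forall>p < reg s ''sp''. c < arr s ''stk'' p \<and> arr s ''stk'' p \<le> k \<and> hd (arr s ''stk'' p)) \<and>
        reg s ''sp'' + c < i" and l = "Suc c" and h = "Suc k" and K = 20], goal_cases)
        case 3
        show ?case using s3 by (simp add: ini_def ctx_def)
      next
        case (5 i s)
        have i: "c < i" "i \<le> k" using 5 by auto
        have st: "\<exists>p < Suc (reg s ''sp''). ((arr s ''stk'')(reg s ''sp'' := i)) p = j"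
          if j: "c < j" "j < Suc i" "hd j" for j
        proof (cases "j = i")
          case False
          then have "j < i" using j by simp
          then have "\<exists>p < reg s ''sp''. arr s ''stk'' p = j" using 5 j by blast
          then obtain p where "p < reg s ''sp''" "arr s ''stk'' p = j" by blast
          then show ?thesis by (intro exI[of _ p]) auto
        qed auto
        define cur' stk' where "cur' = (arr s ''cur'')(i := arr s ''fi'' i)" and "stk' = (arr s ''stk'')(reg s ''sp'' := i)"
        have cu: "\<forall>j. c < j \<and> j < Suc i --> cur' j = arr s ''fi'' j"
          using 5 by (auto simp: less_Suc_eq cur'_def)
        show ?case
        proof (cases "kd i = 1")
          case True
          then have "hd i" by (simp add: hd_def)
          have "\<forall>p < Suc (reg s ''sp''). c < stk' p \<and> stk' p \<le> k \<and> hd (stk' p)"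
            using 5 i \<open>hd i\<close> by (auto simp: less_Suc_eq stk'_def)
          moreover have "\<forall>j. c < j \<and> j < Suc i \<and> hd j --> (\<exists>p < Suc (reg s ''sp''). stk' p = j)"
            using st unfolding stk'_def by blast
          ultimately show ?thesis using 5 i cu True
            by (simp add: ini_def ctx_def cur'_def[symmetric] stk'_def[symmetric])
        next
          case False
          then have "\<not> hd i" by (simp add: hd_def)
          then have "\<forall>j. c < j \<and> j < Suc i \<and> hd j --> (\<exists>p < reg s ''sp''. arr s ''stk'' p = j)"
            using 5 by (metis less_Suc_eq)
          then show ?thesis using 5 i cu False by (simp add: ini_def ctx_def cur'_def[symmetric])
        qed
      next
        case (6 s4 t4)
        have "reg s4 ''sp'' + c < Suc k" using 6 by blast
        then have "reg s4 ''sp'' \<le> k - c" by simp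
        moreover have "t1 + (t2 + (t3 + t4)) \<le> 46 + 60 * (B + n + M + k - c)"
          using 6(3) s3(3) s2(3) \<open>t1 \<le> _\<close> ck by (simp add: Nat.add_diff_assoc)
        ultimately show ?case unfolding wp_Assign using 6
          by (simp add: ini_def ctx_def less_Suc_eq_le)
      qed (use s3 ck in \<open>simp_all add: ini_def ctx_def\<close>)
    qed (use s2 in \<open>simp_all add: ini_def ctx_def\<close>)
  qed (use 6 in \<open>simp_all add: ini_def ctx_def\<close>)
qed (use c0 jl in \<open>auto simp: ctx_def less_Suc_eq\<close>)

definition nb :: "nat \<Rightarrow> nat \<Rightarrow> bool" where
  "nb i u \<longleftrightarrow> (\<exists>a. 1 \<le> a \<and> a \<le> M \<and> P (sr a) = i \<and> P (tg a) = 0 \<and> Ut (tg a) = u)"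

text \<open>Interface of a finished run: of the labels only the distinction between blocked and
  unblocked survives, and the scanning data are gone.\<close>

definition LR :: "(nat \<Rightarrow> nat) \<Rightarrow> (nat \<Rightarrow> nat) \<Rightarrow> (nat \<Rightarrow> nat) \<Rightarrow> nat \<Rightarrow> nat \<Rightarrow> bool" where
  "LR own load lab ev jl \<longleftrightarrow>
    (\<forall>u \<in> U. own u \<noteq> 0 --> own u \<in> {c<..k} \<and> nb (own u) u) \<and>
    (\<forall>i \<in> {c<..k}. load i = base i + (\<Sum>u \<in> {u \<in> U. own u = i}. wU u)) \<and>
    (\<forall>i \<in> {c<..k}. lab i = B --> (\<forall>u. nb i u --> own u \<in> {c<..k} \<and> lab (own u) = B)) \<and>
    (\<forall>i \<in> {c<..k}. lab i = B \<or> base i < th --> load i < (if hd i then th + W else 3 * W)) \<and>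
    ((\<exists>i \<in> {c<..k}. lab i = B) --> (\<exists>i \<in> {c<..k}. lab i = B \<and> (hd i --> load i < th))) \<and>
    (\<forall>i \<in> {c<..k}. hd i --> lab i = B \<or> th \<le> load i) \<and>
    (\<forall>i \<in> {c<..k}. \<not> hd i --> load i < 3 * W) \<and>
    (\<forall>i \<in> {c<..k}. \<not> hd i \<and> i < jl0 --> lab i \<noteq> B \<and> (\<forall>u \<in> U. own u \<noteq> i)) \<and>
    (\<forall>i \<in> {c<..k}. lab i \<le> B) \<and>
    (ev = 0 --> (\<forall>i \<in> {c<..k}. \<not> hd i \<and> jl0 \<le> i --> lab i = B)) \<and>
    (ev \<noteq> 0 --> jl \<in> {c<..k} \<and> jl0 \<le> jl \<and> \<not> hd jl \<and> lab jl \<noteq> B \<and> nb jl (ev - 1) \<and> own (ev - 1) \<noteq> jl \<and>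
       lab (own (ev - 1)) \<noteq> B \<and> 3 * W \<le> load jl + wU (ev - 1))"

lemma label:
  assumes c0: "ctx s" and jl: "reg s ''jl'' = jl0"
  shows "wp label (\<lambda>t s'. LR (arr s' ''own'') (arr s' ''load'') (arr s' ''lab'') (reg s' ''ev'') (reg s' ''jl'') \<and>
    t \<le> 60 * (B + n + M + (k - c) + 1) + 200 * ((k - c + 2) * (2 * M + 2 * (k - c) + 3 * n + 2) + 2) + 4) s"
  unfolding label_def wp_Seq
proof (rule wp_mono[OF label_init[OF assms]], elim conjE)
  fix t1 s1
  assume s1: "ini s1" "\<forall>v < n. arr s1 ''own'' v = 0" "\<forall>j \<le> k. arr s1 ''load'' j = base j"
    "lists (Suc M) (arr s1 ''nxt'') (arr s1 ''fi'')" "\<forall>j. c < j \<and> j \<le> k --> arr s1 ''cur'' j = arr s1 ''fi'' j"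
    "\<forall>j. c < j \<and> j \<le> k \<and> hd j --> (\<exists>p < reg s1 ''sp''. arr s1 ''stk'' p = j)"
    "\<forall>p < reg s1 ''sp''. c < arr s1 ''stk'' p \<and> arr s1 ''stk'' p \<le> k \<and> hd (arr s1 ''stk'' p)"
    "reg s1 ''sp'' \<le> k - c" "reg s1 ''ev'' = 0" "reg s1 ''go'' = 1"
    and t1: "t1 \<le> 60 * (B + n + M + (k - c) + 1)"
  define nx fi where "nx = arr s1 ''nxt''" and "fi = arr s1 ''fi''"
  have kB: "k + 2 \<le> B" by (rule B)
  interpret labprog2 n M c k jl0 W th B sr tg P Ut kd wU wt nx fi
    by unfold_locales (use s1 in \<open>simp add: nx_def fi_def\<close>)
  let ?K = "{c<..k}"
  have fi_ok: "fi i \<le> M \<and> (fi i \<noteq> 0 --> key (fi i) = i) \<and> (\<forall>b. fi i < b \<and> b \<le> M --> key b \<noteq> i)" if "i \<in> ?K" for i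
    using fi[OF that] .
  have Ul: "u < n" if "u \<in> U" for u using that Ut unfolding U_def by auto
  have own0: "arr s1 ''own'' u = 0" if "u \<in> U" for u using Ul[OF that] s1 by auto
  have lab1: "arr s1 ''lab'' i = 1" if "i \<in> ?K" for i using s1(1) that kB unfolding ini_def by auto
  have lab0: "arr s1 ''lab'' 0 = 0" using s1(1) kB unfolding ini_def by auto
  have cur: "arr s1 ''cur'' i = fi i" if "i \<in> ?K" for i using s1(5) that by (auto simp: fi_def)
  have B1: "1 < B" using kB by simp
  have e: "{u \<in> U. arr s1 ''own'' u = i} = {}" if "i \<in> ?K" for i using own0 that by auto
  have LI: "LI (arr s1 ''own'') (arr s1 ''load'') (arr s1 ''lab'') (arr s1 ''cur'')"
    unfolding LI_def
  proof (intro conjI)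
    show "own_ok (arr s1 ''own'') (arr s1 ''load'')"
      unfolding own_ok_def
    proof (intro conjI ballI)
      fix i assume i: "i \<in> ?K"
      then show "arr s1 ''load'' i = base i + (\<Sum>u \<in> {u \<in> U. arr s1 ''own'' u = i}. wU u)"
        unfolding e[OF i] using s1(3) by simp
    qed (use own0 in simp)
    show "lab_ok (arr s1 ''own'') (arr s1 ''lab'')" using lab1 lab0 B1 by (simp add: lab_ok_def)
    show "cont (arr s1 ''lab'')" using lab1 by (simp add: cont_def)
    show "load_ok (arr s1 ''load'') (arr s1 ''lab'')" using lab1 s1(3) base by (auto simp: load_ok_def ub_def)
    show "cur_ok (arr s1 ''own'') (arr s1 ''lab'') (arr s1 ''cur'')"
      unfolding cur_ok_def
    proof (intro ballI)
      fix i assume i: "i \<in> ?K"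
      then show "arr s1 ''cur'' i \<le> M \<and> (arr s1 ''cur'' i \<noteq> 0 --> key (arr s1 ''cur'' i) = i) \<and>
         (arr s1 ''lab'' i \<noteq> B --> (\<forall>a. arr s1 ''cur'' i < a \<and> a \<le> M \<and> key a = i \<and> va a -->
             arr s1 ''lab'' i \<le> arr s1 ''lab'' (arr s1 ''own'' (un a))))"
        using fi_ok[OF i] cur[OF i] by auto
    qed
  qed
  have "JJ (arr s1 ''own'') (arr s1 ''load'') (arr s1 ''lab'') (arr s1 ''cur'') (arr s1 ''cnt'') (arr s1 ''stk'')
       (reg s1 ''sp'') (reg s1 ''jl'') (reg s1 ''go'') (reg s1 ''ev'')"
    unfolding JJ_def
  proof (intro conjI LI)
    have "{i \<in> ?K. arr s1 ''lab'' i = s} = (if s = 1 then ?K else {})" for s using lab1 by auto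
    then show "cntok (arr s1 ''lab'') (arr s1 ''cnt'')"
      using s1(1) unfolding cntok_def ini_def by auto
    show "JS (arr s1 ''own'') (arr s1 ''load'') (arr s1 ''lab'') (arr s1 ''stk'') (reg s1 ''sp'') (reg s1 ''jl'')"
      using s1 lab1 own0 jl0 unfolding JS_def ini_def by auto
    show "JE (arr s1 ''own'') (arr s1 ''load'') (arr s1 ''lab'') (reg s1 ''sp'') (reg s1 ''jl'') (reg s1 ''go'') (reg s1 ''ev'')"
      using s1 by (simp add: JE_def)
    show "JF (arr s1 ''load'') (arr s1 ''lab'')" using lab1 B1 by (auto simp: JF_def)
  qed
  then have LJ: "LJ s1" using s1(1) unfolding LJ_def ini_def by (simp add: nx_def fi_def)
  have "U \<subseteq> {..<n}" using Ul by auto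
  then have "card U \<le> n" using subset_eq_atLeast0_lessThan_card[of U n] by (simp add: atLeast0LessThan)
  then have "pot (arr s1 ''own'') (arr s1 ''lab'') (arr s1 ''cur'') \<le> (card ?K + 2) * (2 * M + 2 * card ?K + 3 * n)"
    by (rule pot_init) (use lab1 lab0 own0 cur fi_ok in auto)
  then have P: "pot (arr s1 ''own'') (arr s1 ''lab'') (arr s1 ''cur'') \<le> (k - c + 2) * (2 * M + 2 * (k - c) + 3 * n)" by simp
  have "Suc k - reg s1 ''jl'' \<le> k - c" using s1(1) jl0 unfolding ini_def by auto
  then have "PP (arr s1 ''own'') (arr s1 ''lab'') (arr s1 ''cur'') (reg s1 ''sp'') (reg s1 ''jl'') (reg s1 ''go'')
    \<le> (k - c + 2) * (2 * M + 2 * (k - c) + 3 * n) + (k - c) + (k - c) + 1"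
    unfolding PP_def using P s1(8,10) by linarith
  also have "\<dots> \<le> (k - c + 2) * (2 * M + 2 * (k - c) + 3 * n + 2) + 2" by (simp add: algebra_simps)
  finally have LP: "LP s1 \<le> 200 * ((k - c + 2) * (2 * M + 2 * (k - c) + 3 * n + 2) + 2)"
    unfolding LP_def by (rule mult_le_mono2)
  have nbr: "nbr = nb" by (auto simp: fun_eq_iff nbr_def nb_def key_def va_def un_def)
  show "wp label_loop (\<lambda>u s'. LR (arr s' ''own'') (arr s' ''load'') (arr s' ''lab'') (reg s' ''ev'') (reg s' ''jl'') \<and>
     t1 + u \<le> 60 * (B + n + M + (k - c) + 1) + 200 * ((k - c + 2) * (2 * M + 2 * (k - c) + 3 * n + 2) + 2) + 4) s1"
  proof (rule wp_mono[OF label_loop[OF LJ]], elim conjE)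
    fix t s' assume s': "LJ s'" "reg s' ''go'' = 0" "t \<le> LP s1 + 4"
    let ?own = "arr s' ''own''" and ?load = "arr s' ''load''" and ?lab = "arr s' ''lab''" and ?jl = "reg s' ''jl''"
    have J: "LI ?own ?load ?lab (arr s' ''cur'')" "JS ?own ?load ?lab (arr s' ''stk'') (reg s' ''sp'') ?jl"
      "JE ?own ?load ?lab (reg s' ''sp'') ?jl 0 (reg s' ''ev'')" "JF ?load ?lab"
      using s' unfolding LJ_def JJ_def by auto
    \<comment> \<open>Both ways of stopping leave an empty stack, so every unblocked head has
      reached its threshold.\<close>
    have sp: "reg s' ''sp'' = 0" using J(3) unfolding JE_def by auto
    have "LR ?own ?load ?lab (reg s' ''ev'') ?jl"
      unfolding LR_def
    proof (intro conjI)
      show "\<forall>i \<in> ?K. ?lab i = B --> (\<forall>u. nb i u --> ?own u \<in> ?K \<and> ?lab (?own u) = B)"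
        using flagged_closed[OF J(1)] unfolding nbr by blast
      show "\<forall>i \<in> ?K. ?lab i = B \<or> base i < th --> ?load i < (if hd i then th + W else 3 * W)"
        using J(1) B unfolding LI_def load_ok_def ub_def by auto
      show "\<forall>i \<in> ?K. \<not> hd i --> ?load i < 3 * W"
        using J(1) unfolding LI_def load_ok_def ub_def by auto
      show "\<forall>i \<in> ?K. hd i --> ?lab i = B \<or> th \<le> ?load i" using J(2) sp unfolding JS_def by fastforce
      show "\<forall>i \<in> ?K. ?lab i \<le> B" using lab_le_B[OF J(1)] by blast
      show "reg s' ''ev'' = 0 --> (\<forall>i \<in> ?K. \<not> hd i \<and> jl0 \<le> i --> ?lab i = B)"
        using J(2,3) unfolding JS_def JE_def by auto
      show "reg s' ''ev'' \<noteq> 0 --> ?jl \<in> ?K \<and> jl0 \<le> ?jl \<and> \<not> hd ?jl \<and> ?lab ?jl \<noteq> B \<and> nb ?jl (reg s' ''ev'' - 1) \<and>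
        ?own (reg s' ''ev'' - 1) \<noteq> ?jl \<and> ?lab (?own (reg s' ''ev'' - 1)) \<noteq> B \<and>
        3 * W \<le> ?load ?jl + wU (reg s' ''ev'' - 1)"
      proof
        assume "reg s' ''ev'' \<noteq> 0"
        then obtain u where u: "reg s' ''ev'' = Suc u" "nbr ?jl u" "?lab (?own u) < ?lab ?jl" "3 * W \<le> ?load ?jl + wU u"
          and jl: "?jl \<in> ?K" "\<not> hd ?jl" "?lab ?jl \<noteq> B" using J(3) unfolding JE_def by auto
        have "?lab ?jl \<le> B" using lab_le_B[OF J(1) jl(1)] .
        moreover have "jl0 \<le> ?jl" using J(2) unfolding JS_def by blast
        ultimately show "?jl \<in> ?K \<and> jl0 \<le> ?jl \<and> \<not> hd ?jl \<and> ?lab ?jl \<noteq> B \<and> nb ?jl (reg s' ''ev'' - 1) \<and>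
          ?own (reg s' ''ev'' - 1) \<noteq> ?jl \<and> ?lab (?own (reg s' ''ev'' - 1)) \<noteq> B \<and>
          3 * W \<le> ?load ?jl + wU (reg s' ''ev'' - 1)"
          using u jl unfolding nbr by auto
      qed
      show "\<forall>i \<in> ?K. \<not> hd i \<and> i < jl0 --> ?lab i \<noteq> B \<and> (\<forall>u \<in> U. ?own u \<noteq> i)"
        using J(2) B1 unfolding JS_def by auto
      have ok: "own_ok ?own ?load" using J(1) unfolding LI_def by blast
      show "\<forall>u \<in> U. ?own u \<noteq> 0 --> ?own u \<in> ?K \<and> nb (?own u) u"
        using ok unfolding own_ok_def nbr by blast
      show "\<forall>i \<in> ?K. ?load i = base i + (\<Sum>u \<in> {u \<in> U. ?own u = i}. wU u)"
        using ok unfolding own_ok_def by blast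
      show "(\<exists>i \<in> ?K. ?lab i = B) --> (\<exists>i \<in> ?K. ?lab i = B \<and> (hd i --> ?load i < th))"
        using J(4) unfolding JF_def .
    qed
    then show "LR ?own ?load ?lab (reg s' ''ev'') ?jl \<and> t1 + t \<le> 60 * (B + n + M + (k - c) + 1) +
       200 * ((k - c + 2) * (2 * M + 2 * (k - c) + 3 * n + 2) + 2) + 4"
      using t1 LP s'(3) by simp
  qed
qed

end

section \<open>Connected sets and the counting arguments\<close>

locale inst =
  fixes n M :: nat and sr tg wt :: "nat \<Rightarrow> nat" and W :: nat
  assumes sr: "1 \<le> a ==> a \<le> M ==> sr a < n" and tg: "1 \<le> a ==> a \<le> M ==> tg a < n"
    and rev: "1 \<le> a ==> a \<le> M ==> \<exists>b. 1 \<le> b \<and> b \<le> M \<and> sr b = tg a \<and> tg b = sr a"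
begin

definition adj :: "nat \<Rightarrow> nat \<Rightarrow> bool" where
  "adj x y \<longleftrightarrow> (\<exists>a. 1 \<le> a \<and> a \<le> M \<and> sr a = x \<and> tg a = y)"

lemma adj_sym: "adj x y ==> adj y x"
  unfolding adj_def using rev by metis

lemma adj_less: "adj x y ==> x < n \<and> y < n"
  unfolding adj_def using sr tg by metis

text \<open>Connectivity by cuts. This form suits unions and containment arguments; it is matched
  with reachability only when the result is translated back to the graph.\<close>

definition conn :: "nat set \<Rightarrow> bool" where
  "conn T \<longleftrightarrow> T \<noteq> {} \<and> (\<forall>A. A \<subset> T \<and> A \<noteq> {} --> (\<exists>x \<in> A. \<exists>y \<in> T - A. adj x y))"

lemma conn_sing: "conn {x}"
  unfolding conn_def by auto

lemma connD: "conn T ==> A \<subseteq> T ==> A \<noteq> {} ==> T - A \<noteq> {} ==> \<exists>x \<in> A. \<exists>y \<in> T - A. adj x y"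
  unfolding conn_def by blast

lemma conn_Un:
  assumes S: "conn S" and T: "conn T" and xy: "x \<in> S" "y \<in> T" "adj x y"
  shows "conn (S \<union> T)"
  unfolding conn_def
proof (intro conjI allI impI)
  show "S \<union> T \<noteq> {}" using S unfolding conn_def by blast
  fix A assume A: "A \<subset> S \<union> T \<and> A \<noteq> {}"
  show "\<exists>x \<in> A. \<exists>y \<in> S \<union> T - A. adj x y"
  proof (cases "A \<inter> S \<noteq> {} \<and> S - A \<noteq> {}")
    case True
    then show ?thesis using connD[OF S, of "A \<inter> S"] by blast
  next
    case 1: False
    show ?thesis
    proof (cases "A \<inter> T \<noteq> {} \<and> T - A \<noteq> {}")
      case True
      then show ?thesis using connD[OF T, of "A \<inter> T"] by blast
    next
      case False
      then have "(S \<subseteq> A \<and> A \<inter> T = {}) \<or> (T \<subseteq> A \<and> A \<inter> S = {})" using 1 A by blast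
      then show ?thesis using xy adj_sym by blast
    qed
  qed
qed

lemma conn_subset:
  assumes "conn T" and x: "x \<in> T" "x \<in> S" and no: "\<And>u v. u \<in> T ==> v \<in> T ==> u \<in> S ==> v \<notin> S ==> \<not> adj u v"
  shows "T \<subseteq> S"
proof (rule ccontr)
  assume "\<not> T \<subseteq> S"
  then have "T - T \<inter> S \<noteq> {}" by blast
  then show False using connD[OF assms(1), of "T \<inter> S"] x no by blast
qed

text \<open>In a part that misses the root, the vertex of least index has its parent outside. A part
  containing the root is treated through its complement.\<close>

lemma conn_tree:
  fixes p q :: "nat \<Rightarrow> nat"
  assumes r: "r \<in> L" and p: "\<And>l. l \<in> L ==> l \<noteq> r ==> p l \<in> L \<and> p l < l \<and> adj (q (p l)) (q l)"
  shows "conn (q ` L)"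
  unfolding conn_def
proof (intro conjI allI impI)
  show "q ` L \<noteq> {}" using r by blast
  fix A assume A: "A \<subset> q ` L \<and> A \<noteq> {}"
  have key: "\<exists>x \<in> X. \<exists>y \<in> q ` L - X. adj y x" if X: "X \<subseteq> q ` L" "X \<noteq> {}" "q r \<notin> X" for X
  proof -
    obtain l0 where l0: "l0 \<in> L \<and> q l0 \<in> X" using X by blast
    define l where "l = (LEAST l. l \<in> L \<and> q l \<in> X)"
    have l: "l \<in> L" "q l \<in> X" using LeastI[of "\<lambda>l. l \<in> L \<and> q l \<in> X", OF l0] unfolding l_def by auto
    then have "l \<noteq> r" using X by auto
    then have pl: "p l \<in> L" "p l < l" "adj (q (p l)) (q l)" using p l by auto
    then have "q (p l) \<notin> X" using not_less_Least[of "p l" "\<lambda>l. l \<in> L \<and> q l \<in> X"] unfolding l_def by auto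
    then show ?thesis using l pl by blast
  qed
  show "\<exists>x \<in> A. \<exists>y \<in> q ` L - A. adj x y"
  proof (cases "q r \<in> A")
    case False
    then show ?thesis using key[of A] A adj_sym by blast
  next
    case True
    obtain x y where xy: "x \<in> q ` L - A" "y \<in> q ` L - (q ` L - A)" "adj y x"
      using key[of "q ` L - A"] A True by blast
    then show ?thesis using A by blast
  qed
qed

abbreviation w :: "nat set \<Rightarrow> nat" where "w S \<equiv> sum wt S"

definition cls :: "(nat \<Rightarrow> nat) \<Rightarrow> nat \<Rightarrow> nat set" where "cls P i = {v. v < n \<and> P v = i}"

definition uset :: "(nat \<Rightarrow> nat) \<Rightarrow> (nat \<Rightarrow> nat) \<Rightarrow> nat \<Rightarrow> nat set" where
  "uset P Ut u = {v. v < n \<and> P v = 0 \<and> Ut v = u}"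

definition units :: "(nat \<Rightarrow> nat) \<Rightarrow> (nat \<Rightarrow> nat) \<Rightarrow> nat set" where
  "units P Ut = {Ut v | v. v < n \<and> P v = 0}"

definition nbu :: "(nat \<Rightarrow> nat) \<Rightarrow> (nat \<Rightarrow> nat) \<Rightarrow> nat \<Rightarrow> nat \<Rightarrow> bool" where
  "nbu P Ut i u \<longleftrightarrow> (\<exists>x y. adj x y \<and> P x = i \<and> P y = 0 \<and> Ut y = u)"

definition NB :: "(nat \<Rightarrow> nat) \<Rightarrow> (nat \<Rightarrow> nat) \<Rightarrow> nat set \<Rightarrow> nat set" where
  "NB P Ut Z = {u. \<exists>i \<in> Z. nbu P Ut i u}"

text \<open>Total weight on which the cores \<open>Z\<close> can draw: their own vertices and all
  adjacent units, each counted once.\<close>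

definition acc :: "(nat \<Rightarrow> nat) \<Rightarrow> (nat \<Rightarrow> nat) \<Rightarrow> nat set \<Rightarrow> nat" where
  "acc P Ut Z = (\<Sum>i \<in> Z. w (cls P i)) + (\<Sum>u \<in> NB P Ut Z. w (uset P Ut u))"

definition heads :: "nat \<Rightarrow> nat \<Rightarrow> (nat \<Rightarrow> nat) \<Rightarrow> nat set" where
  "heads c k kd = {i. c < i \<and> i \<le> k \<and> kd i = 1}"

definition hall :: "nat \<Rightarrow> nat \<Rightarrow> (nat \<Rightarrow> nat) \<Rightarrow> (nat \<Rightarrow> nat) \<Rightarrow> (nat \<Rightarrow> nat) \<Rightarrow> bool" where
  "hall c k P Ut kd \<longleftrightarrow> (\<forall>Z \<subseteq> heads c k kd. 2 * W * card Z \<le> acc P Ut Z)"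

text \<open>Class 0 holds the free vertices, the classes up to \<open>c\<close> the heavy vertices,
  the others the cores. A head gets no lower bound on its weight: the Hall condition takes its
  place.\<close>

definition parts_ok :: "nat \<Rightarrow> nat \<Rightarrow> (nat \<Rightarrow> nat) \<Rightarrow> (nat \<Rightarrow> nat) \<Rightarrow> bool" where
  "parts_ok c k P kd \<longleftrightarrow> c \<le> k \<and> (\<forall>v < n. P v \<le> k) \<and> (\<forall>v < n. W \<le> wt v \<longleftrightarrow> 1 \<le> P v \<and> P v \<le> c) \<and>
     (\<forall>i. 1 \<le> i \<and> i \<le> c --> (\<exists>v. cls P i = {v})) \<and> (\<forall>i. kd i \<le> 1) \<and> kd 0 = 0 \<and>
     (\<forall>i. c < i \<and> i \<le> k --> (if kd i = 1 then \<exists>h. cls P i = {h} else conn (cls P i) \<and> W \<le> w (cls P i) \<and> w (cls P i) < 3 * W))"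

text \<open>A unit is named by one of its own vertices, hence the idempotence of
  \<open>Ut\<close>.\<close>

definition units_ok :: "(nat \<Rightarrow> nat) \<Rightarrow> (nat \<Rightarrow> nat) \<Rightarrow> bool" where
  "units_ok P Ut \<longleftrightarrow> (\<forall>v < n. P v = 0 --> Ut v < n \<and> P (Ut v) = 0 \<and> Ut (Ut v) = Ut v \<and>
     conn (uset P Ut (Ut v)) \<and> w (uset P Ut (Ut v)) < W)"

definition ipack :: "nat set set \<Rightarrow> bool" where
  "ipack G \<longleftrightarrow> finite G \<and> (\<forall>T \<in> G. T \<subseteq> {..<n} \<and> conn T \<and> W \<le> w T) \<and> (\<forall>S \<in> G. \<forall>T \<in> G. S \<noteq> T --> S \<inter> T = {})"

lemma fin_cls [simp]: "finite (cls P i)" and fin_uset [simp]: "finite (uset P Ut u)"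
  unfolding cls_def uset_def by auto

lemma NB_units: "NB P Ut Z \<subseteq> units P Ut"
  unfolding NB_def nbu_def units_def using adj_less by blast

lemma fin_units [simp]: "finite (units P Ut)"
  unfolding units_def by auto

lemma fin_NB [simp]: "finite (NB P Ut Z)"
  using NB_units finite_subset by (metis fin_units)

lemma disjoint_cls: "i \<noteq> j ==> cls P i \<inter> cls P j = {}"
  and disjoint_uset: "u \<noteq> u' ==> uset P Ut u \<inter> uset P Ut u' = {}"
  unfolding cls_def uset_def by auto

lemma sum_UN_uset: "finite A ==> (\<Sum>u \<in> A. w (uset P Ut u)) = w (\<Union>u \<in> A. uset P Ut u)"
  by (rule sum.UNION_disjoint[symmetric]) (use disjoint_uset in auto)

lemma sum_UN_cls: "finite A ==> (\<Sum>i \<in> A. w (cls P i)) = w (\<Union>i \<in> A. cls P i)"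
  by (rule sum.UNION_disjoint[symmetric]) (use disjoint_cls in auto)

text \<open>Disjoint sets are told apart by the points where they hit \<open>X\<close>.\<close>

lemma ipack_card_hit:
  assumes G: "ipack G" and X: "finite X" "\<And>T. T \<in> G ==> T \<inter> X \<noteq> {}"
  shows "card G \<le> card X"
proof -
  define f where "f T = (SOME x. x \<in> T \<inter> X)" for T
  have f: "f T \<in> T \<inter> X" if "T \<in> G" for T unfolding f_def using X(2)[OF that] some_in_eq by blast
  have "inj_on f G"
  proof (rule inj_onI, rule ccontr)
    fix S T assume "S \<in> G" "T \<in> G" "f S = f T" "S \<noteq> T"
    moreover from this have "S \<inter> T = {}" using G unfolding ipack_def by simp
    ultimately show False using f[of S] f[of T] by auto
  qed
  then show ?thesis by (rule card_inj_on_le) (use f X in auto)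
qed

lemma ipack_card_weight:
  assumes G: "ipack G" and Y: "finite Y" "\<And>T. T \<in> G ==> T \<subseteq> Y"
  shows "W * card G \<le> w Y"
proof -
  have fin: "\<forall>T \<in> G. finite T" using Y finite_subset by blast
  have dj: "\<forall>S \<in> G. \<forall>T \<in> G. S \<noteq> T --> S \<inter> T = {}" using G unfolding ipack_def by blast
  have "W * card G = (\<Sum>T \<in> G. W)" by simp
  also have "\<dots> \<le> (\<Sum>T \<in> G. w T)" using G unfolding ipack_def by (intro sum_mono) auto
  also have "\<dots> = w (\<Union>G)" using sum.Union_disjoint[OF fin dj, of wt] by simp
  also have "\<dots> \<le> w Y" by (rule sum_mono2) (use Y in auto)
  finally show ?thesis .
qed

lemma ipack_subset: "ipack G ==> G' \<subseteq> G ==> ipack G'"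
  unfolding ipack_def by (elim conjE, intro conjI) (metis finite_subset, metis subsetD, metis subsetD)

text \<open>With \<open>X\<close> made of the heavy vertices and the heads outside \<open>F\<close>,
  the count is \<open>c + (k - c - card F)\<close> for the sets that hit \<open>X\<close> plus
  \<open>3 * card F\<close> for those inside the region \<open>R\<close> of \<open>F\<close>,
  together at most \<open>3 * k\<close>.\<close>

lemma certificate:
  assumes P: "parts_ok c k P kd" and Ut: "units_ok P Ut" and W0: "0 < W"
    and F: "F \<subseteq> {c<..k}" and light: "\<And>i. c < i ==> i \<le> k ==> kd i \<noteq> 1 ==> i \<in> F"
    and small: "acc P Ut F \<le> 3 * W * card F"
    and conf: "\<And>x y. adj x y ==> P x = 0 ==> P y = 0 ==> Ut x \<noteq> Ut y ==> Ut x \<in> NB P Ut F \<and> Ut y \<in> NB P Ut F"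
    and G: "ipack G"
  shows "card G \<le> 3 * k"
proof -
  define I where "I = {1..c} \<union> ({c<..k} - F)"
  define X where "X = (\<Union>i \<in> I. cls P i)"
  define R where "R = (\<Union>i \<in> F. cls P i) \<union> (\<Union>u \<in> NB P Ut F. uset P Ut u)"
  have finF: "finite F" using F finite_subset by blast
  have ck: "c \<le> k" using P unfolding parts_ok_def by blast
  have "card (cls P i) \<le> 1" if "i \<in> I" for i
  proof -
    have "\<exists>h. cls P i = {h}"
    proof (cases "i \<le> c")
      case True then show ?thesis using P that unfolding parts_ok_def I_def by auto
    next
      case False
      then have "c < i" "i \<le> k" "i \<notin> F" using that unfolding I_def by auto
      then have "kd i = 1" using light by blast
      then show ?thesis using P \<open>c < i\<close> \<open>i \<le> k\<close> unfolding parts_ok_def by simp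
    qed
    then show ?thesis by auto
  qed
  then have "(\<Sum>i \<in> I. card (cls P i)) \<le> (\<Sum>i \<in> I. 1)" by (rule sum_mono)
  moreover have "finite I" unfolding I_def by simp
  then have "card X \<le> (\<Sum>i \<in> I. card (cls P i))" unfolding X_def by (rule card_UN_le)
  ultimately have "card X \<le> (\<Sum>i \<in> I. 1)" by (rule le_trans[rotated])
  also have "\<dots> = card I" by simp
  also have "\<dots> = card {1..c} + card ({c<..k} - F)" unfolding I_def by (rule card_Un_disjoint) auto
  also have "card ({c<..k} - F) = (k - c) - card F" using card_Diff_subset[OF finF F] by simp
  also have "card {1..c} = c" by simp
  finally have cX: "card X \<le> c + ((k - c) - card F)" .
  have cF: "card F \<le> k - c" using card_mono[OF _ F] by simp
  have finX: "finite X" unfolding X_def I_def by auto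
  have finR: "finite R" unfolding R_def using finF by auto
  have wR: "w R \<le> 3 * W * card F"
  proof -
    have "w R \<le> w (\<Union>i \<in> F. cls P i) + w (\<Union>u \<in> NB P Ut F. uset P Ut u)"
      unfolding R_def using finF sum.union_inter[of "\<Union>i \<in> F. cls P i" "\<Union>u \<in> NB P Ut F. uset P Ut u" wt] by simp
    also have "\<dots> = acc P Ut F" unfolding acc_def using finF by (simp add: sum_UN_uset sum_UN_cls)
    finally show ?thesis using small by simp
  qed
  define G1 where "G1 = {T \<in> G. T \<inter> X \<noteq> {}}"
  \<comment> \<open>A set that avoids \<open>X\<close> consists of vertices of \<open>R\<close> and
    of units not adjacent to \<open>F\<close>. The claim is that it cannot contain any of the
    latter.\<close>
  have inR: "T \<subseteq> R" if T: "T \<in> G - G1" for T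
  proof -
    have c: "conn T" and Tn: "T \<subseteq> {..<n}" and Tw: "W \<le> w T" and TX: "T \<inter> X = {}"
      using T G unfolding ipack_def G1_def by auto
    obtain x where x: "x \<in> T" using c unfolding conn_def by blast
    have cover: "v \<in> R \<or> (P v = 0 \<and> Ut v \<notin> NB P Ut F)" if "v \<in> T" for v
    proof -
      have v: "v < n" "P v \<le> k" "v \<notin> X" using that Tn TX P unfolding parts_ok_def by auto
      then have "P v \<notin> I" unfolding X_def cls_def by auto
      then have "P v = 0 \<or> P v \<in> F" using v F unfolding I_def by auto
      then show ?thesis using v unfolding R_def cls_def uset_def by auto
    qed
    \<comment> \<open>An arc leaving \<open>R\<close> starts either in a core of \<open>F\<close>,
      which makes the unit at its end adjacent to \<open>F\<close>, or in a unit adjacent to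
      \<open>F\<close>, where \<open>conf\<close> puts the other end in such a unit too.\<close>
    have noedge: False if uv: "u \<in> R" "u \<in> T" "v \<in> T" "v \<notin> R" "adj u v" for u v
    proof -
      have v: "P v = 0" "Ut v \<notin> NB P Ut F" using cover uv by blast+
      from uv(1) consider i where "i \<in> F" "P u = i" | "P u = 0" "Ut u \<in> NB P Ut F"
        unfolding R_def cls_def uset_def by auto
      then show False
      proof cases
        case 1
        then have "nbu P Ut i (Ut v)" using uv v unfolding nbu_def by blast
        then show False using 1 v unfolding NB_def by blast
      next
        case 2
        then show False using conf[of u v] uv v by (cases "Ut u = Ut v") auto
      qed
    qed
    show "T \<subseteq> R"
    proof (cases "x \<in> R")
      case True
      show ?thesis by (rule conn_subset[OF c x True]) (metis noedge)
    next
      case False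
      then have x0: "P x = 0" "Ut x \<notin> NB P Ut F" using cover x by auto
      \<comment> \<open>Starting outside \<open>R\<close>, the set cannot change units either:
        \<open>conf\<close> would place both units next to \<open>F\<close>. A single unit is too
        light for a member of a packing.\<close>
      have "T \<subseteq> uset P Ut (Ut x)"
      proof (rule conn_subset[OF c x])
        show "x \<in> uset P Ut (Ut x)" using x x0 Tn unfolding uset_def by auto
        fix u v assume uv: "u \<in> T" "v \<in> T" "u \<in> uset P Ut (Ut x)" "v \<notin> uset P Ut (Ut x)"
        show "\<not> adj u v"
        proof
          assume a: "adj u v"
          have u: "P u = 0" "Ut u = Ut x" using uv unfolding uset_def by auto
          have "u \<notin> R" using u x0 F unfolding R_def cls_def uset_def by auto
          then have "v \<notin> R" using noedge[of v u] uv a adj_sym by blast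
          then have "P v = 0" "Ut v \<notin> NB P Ut F" using cover uv by auto
          then show False using conf[OF a u(1)] u uv x0 Tn unfolding uset_def by auto
        qed
      qed
      then have "w T \<le> w (uset P Ut (Ut x))" by (intro sum_mono2) auto
      also have "\<dots> < W" using Ut x x0 Tn unfolding units_ok_def by auto
      finally show ?thesis using Tw by simp
    qed
  qed
  have cG1: "card G1 \<le> card X"
    by (rule ipack_card_hit[OF ipack_subset[OF G] finX]) (auto simp: G1_def)
  have "W * card (G - G1) \<le> w R"
    by (rule ipack_card_weight[OF ipack_subset[OF G] finR]) (use inR in auto)
  moreover have "3 * W * card F = W * (3 * card F)" by (simp add: algebra_simps)
  ultimately have "W * card (G - G1) \<le> W * (3 * card F)" using wR by linarith
  then have "card (G - G1) \<le> 3 * card F" using W0 by simp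
  moreover note cG1
  moreover have "card G = card G1 + card (G - G1)"
  proof -
    have G1: "G1 \<subseteq> G" "finite G" using G unfolding G1_def ipack_def by auto
    then have "card (G - G1) = card G - card G1" by (intro card_Diff_subset) (auto intro: finite_subset)
    then show ?thesis using card_mono[OF G1(2,1)] by simp
  qed
  ultimately show ?thesis using cX cF ck by linarith
qed

text \<open>The neighbourhood of a union is the union of the neighbourhoods, while that of an
  intersection is contained in their intersection; so \<open>acc\<close> is submodular.\<close>

lemma acc_submod:
  assumes "finite F" "finite Z"
  shows "acc P Ut (F \<union> Z) + acc P Ut (Z \<inter> F) \<le> acc P Ut F + acc P Ut Z"
proof -
  let ?u = "\<lambda>A. \<Sum>u \<in> A. w (uset P Ut u)" and ?c = "\<lambda>A. \<Sum>i \<in> A. w (cls P i)"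
  have "NB P Ut (F \<union> Z) = NB P Ut F \<union> NB P Ut Z" unfolding NB_def by blast
  then have 1: "?u (NB P Ut (F \<union> Z)) + ?u (NB P Ut F \<inter> NB P Ut Z) = ?u (NB P Ut F) + ?u (NB P Ut Z)"
    using sum.union_inter[of "NB P Ut F" "NB P Ut Z"] by simp
  have "?u (NB P Ut (Z \<inter> F)) \<le> ?u (NB P Ut F \<inter> NB P Ut Z)"
  proof (rule sum_mono2)
    show "NB P Ut (Z \<inter> F) \<subseteq> NB P Ut F \<inter> NB P Ut Z" by (auto simp: NB_def)
  qed simp_all
  moreover have "?c (F \<union> Z) + ?c (Z \<inter> F) = ?c F + ?c Z"
    using sum.union_inter[OF assms] by (simp add: Int_commute)
  ultimately show ?thesis using 1 unfolding acc_def by linarith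
qed

text \<open>Submodularity, with the Hall condition as lower bound for \<open>Z \<inter> F\<close>,
  limits the increase to less than \<open>2 * W * card (Z - F) + W\<close>. As \<open>Z - F\<close>
  is nonempty, the extra \<open>W\<close> is absorbed and each new head is charged at most
  \<open>3 * W\<close>.\<close>

lemma frozen_extend:
  assumes F: "finite F" "acc P Ut F \<le> 3 * W * card F" and H: "hall c k P Ut kd" and Z: "Z \<subseteq> heads c k kd"
    and small: "acc P Ut Z < 2 * W * card Z + W" and new: "\<not> Z \<subseteq> F"
  shows "acc P Ut (F \<union> Z) \<le> 3 * W * card (F \<union> Z)"
proof -
  have finZ: "finite Z" using Z unfolding heads_def by (auto intro: finite_subset[of _ "{..k}"])
  have "2 * W * card (Z \<inter> F) \<le> acc P Ut (Z \<inter> F)" using H Z unfolding hall_def by blast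
  moreover have cZ: "card Z = card (Z \<inter> F) + card (Z - F)" using finZ by (metis card_Int_Diff)
  then have "2 * W * card Z = 2 * W * card (Z \<inter> F) + 2 * W * card (Z - F)" by (simp add: distrib_left)
  moreover have "card (F \<union> Z) = card F + card (Z - F)"
    using F(1) finZ by (metis Un_Diff_cancel card_Un_disjoint Diff_disjoint finite_Diff)
  then have "3 * W * card (F \<union> Z) = 3 * W * card F + 3 * W * card (Z - F)" by (simp add: distrib_left)
  moreover have "1 \<le> card (Z - F)" using new finZ by (simp add: Suc_le_eq card_gt_0_iff)
  then have "W * 1 \<le> W * card (Z - F)" by (rule mult_le_mono2)
  ultimately show ?thesis using acc_submod[OF F(1) finZ, of P Ut] F(2) small by linarith
qed

end

section \<open>Labelling outcomes as statements on weights of regions\<close>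

locale labinst = labprog n M c k jl0 W th B sr tg P Ut kd wU wt + inst n M sr tg wt W
  for n M c k jl0 W th B :: nat and sr tg P Ut kd wU wt :: "nat \<Rightarrow> nat" +
  assumes wUeq: "v < n ==> P v = 0 ==> wU (Ut v) = w (uset P Ut (Ut v))"
begin

lemma U_units: "U = units P Ut"
  unfolding U_def units_def by auto

lemma nb_nbu: "nb = nbu P Ut"
  unfolding nb_def nbu_def adj_def by (auto simp: fun_eq_iff)

lemma base_cls: "base i = w (cls P i)"
  unfolding base_def cls_def by simp

lemma wU_uset: "u \<in> U ==> wU u = w (uset P Ut u)"
  unfolding U_def using wUeq by auto

lemma LRD:
  assumes "LR own load lab ev jl"
  shows LR_own: "\<And>u. u \<in> U ==> own u \<noteq> 0 ==> own u \<in> {c<..k} \<and> nb (own u) u"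
    and LR_load: "\<And>i. i \<in> {c<..k} ==> load i = base i + (\<Sum>u \<in> {u \<in> U. own u = i}. wU u)"
    and LR_closed: "\<And>i u. i \<in> {c<..k} ==> lab i = B ==> nb i u ==> own u \<in> {c<..k} \<and> lab (own u) = B"
    and LR_ub: "\<And>i. i \<in> {c<..k} ==> lab i = B \<or> base i < th ==> load i < (if hd i then th + W else 3 * W)"
    and LR_hungry: "\<And>i. i \<in> {c<..k} ==> lab i = B ==> \<exists>i \<in> {c<..k}. lab i = B \<and> (hd i --> load i < th)"
    and LR_head: "\<And>i. i \<in> {c<..k} ==> hd i ==> lab i \<noteq> B ==> th \<le> load i"
    and LR_light: "\<And>i. i \<in> {c<..k} ==> \<not> hd i ==> load i < 3 * W"
    and LR_idle: "\<And>i u. i \<in> {c<..k} ==> \<not> hd i ==> i < jl0 ==> lab i \<noteq> B \<and> (u \<in> U --> own u \<noteq> i)"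
    and LR_le: "\<And>i. i \<in> {c<..k} ==> lab i \<le> B"
    and LR_noev: "\<And>i. ev = 0 ==> i \<in> {c<..k} ==> \<not> hd i ==> jl0 \<le> i ==> lab i = B"
    and LR_ev: "ev \<noteq> 0 ==> jl \<in> {c<..k} \<and> jl0 \<le> jl \<and> \<not> hd jl \<and> lab jl \<noteq> B \<and> nb jl (ev - 1) \<and> own (ev - 1) \<noteq> jl \<and>
       lab (own (ev - 1)) \<noteq> B \<and> 3 * W \<le> load jl + wU (ev - 1)"
  using assms unfolding LR_def by (elim conjE, metis)+

lemma LR_sum:
  assumes R: "LR own load lab ev jl" and Z: "Z \<subseteq> {c<..k}"
  shows "(\<Sum>i \<in> Z. load i) = (\<Sum>i \<in> Z. w (cls P i)) + (\<Sum>u \<in> {u \<in> U. own u \<in> Z}. w (uset P Ut u))"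
proof -
  have finZ: "finite Z" and finU: "finite U" using Z finite_subset unfolding U_units by auto
  have "(\<Sum>i \<in> Z. load i) = (\<Sum>i \<in> Z. w (cls P i) + (\<Sum>u \<in> {u \<in> U. own u = i}. wU u))"
    using LR_load[OF R] Z by (intro sum.cong) (auto simp: base_cls)
  also have "\<dots> = (\<Sum>i \<in> Z. w (cls P i)) + (\<Sum>i \<in> Z. \<Sum>u \<in> {u \<in> U. own u = i}. wU u)" by (rule sum.distrib)
  also have "(\<Sum>i \<in> Z. \<Sum>u \<in> {u \<in> U. own u = i}. wU u) = (\<Sum>u \<in> (\<Union>i \<in> Z. {u \<in> U. own u = i}). wU u)"
    by (rule sum.UNION_disjoint[symmetric]) (use finZ finU in auto)
  also have "(\<Union>i \<in> Z. {u \<in> U. own u = i}) = {u \<in> U. own u \<in> Z}" by auto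
  also have "(\<Sum>u \<in> {u \<in> U. own u \<in> Z}. wU u) = (\<Sum>u \<in> {u \<in> U. own u \<in> Z}. w (uset P Ut u))"
    using wU_uset by (intro sum.cong) auto
  finally show ?thesis .
qed

definition flagged :: "(nat \<Rightarrow> nat) \<Rightarrow> nat set" where "flagged lab = {i \<in> {c<..k}. lab i = B}"

lemma NB_flagged:
  assumes R: "LR own load lab ev jl" and Z: "Z \<subseteq> flagged lab"
  shows "NB P Ut Z \<subseteq> {u \<in> U. own u \<in> flagged lab}"
proof
  fix u assume "u \<in> NB P Ut Z"
  then obtain i where i: "i \<in> Z" "nb i u" unfolding NB_def nb_nbu by blast
  have "u \<in> U" using \<open>u \<in> NB P Ut Z\<close> NB_units unfolding U_units by blast
  moreover have "i \<in> {c<..k}" "lab i = B" using i Z unfolding flagged_def by auto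
  then have "own u \<in> {c<..k} \<and> lab (own u) = B" using LR_closed[OF R] i by blast
  ultimately show "u \<in> {u \<in> U. own u \<in> flagged lab}" unfolding flagged_def by blast
qed

text \<open>All units adjacent to blocked cores are owned by blocked cores, so their weight is part
  of these loads.\<close>

lemma acc_flagged:
  assumes R: "LR own load lab ev jl"
  shows "acc P Ut (flagged lab) \<le> (\<Sum>i \<in> flagged lab. load i)"
proof -
  have K: "flagged lab \<subseteq> {c<..k}" unfolding flagged_def by auto
  have "finite U" unfolding U_units by simp
  then have "(\<Sum>u \<in> NB P Ut (flagged lab). w (uset P Ut u)) \<le> (\<Sum>u \<in> {u \<in> U. own u \<in> flagged lab}. w (uset P Ut u))"
    using NB_flagged[OF R subset_refl] by (intro sum_mono2) auto
  then show ?thesis unfolding acc_def LR_sum[OF R K] by simp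
qed

text \<open>For \<open>th\<close> up to \<open>2 * W\<close> the load bound \<open>th + W\<close> of
  blocked heads does not exceed the bound \<open>3 * W\<close> of light cores, so both kinds are
  charged alike.\<close>

lemma acc_flagged_le:
  assumes R: "LR own load lab ev jl" and th: "th \<le> 2 * W"
  shows "acc P Ut (flagged lab) \<le> 3 * W * card (flagged lab)"
proof -
  have "(\<Sum>i \<in> flagged lab. load i) \<le> (\<Sum>i \<in> flagged lab. 3 * W)"
  proof (rule sum_mono)
    fix i assume "i \<in> flagged lab"
    then have "load i < (if hd i then th + W else 3 * W)" using LR_ub[OF R] unfolding flagged_def by blast
    then show "load i \<le> 3 * W" using th by (auto split: if_splits)
  qed
  then show ?thesis using acc_flagged[OF R] by (simp add: mult.commute mult.left_commute)
qed

text \<open>With \<open>jl0 = Suc k\<close> only heads can be blocked. Their loads are below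
  \<open>2 * W\<close>, and the unmet demand leaves one below \<open>W\<close>; so their region
  misses more than \<open>W\<close> of the Hall weight.\<close>

lemma flagged_small:
  assumes R: "LR own load lab ev jl" and th: "th = W" and jl: "jl0 = Suc k" and ne: "flagged lab \<noteq> {}"
  shows "flagged lab \<subseteq> heads c k kd" and "acc P Ut (flagged lab) + W < 2 * W * card (flagged lab)"
proof -
  let ?F = "flagged lab"
  have hdF: "hd i" if "i \<in> ?F" for i
  proof (rule ccontr)
    assume "\<not> hd i"
    moreover have "i < jl0" using that jl unfolding flagged_def by auto
    ultimately show False using LR_idle[OF R] that unfolding flagged_def by blast
  qed
  then show "?F \<subseteq> heads c k kd" unfolding heads_def flagged_def hd_def by auto
  have fin: "finite ?F" unfolding flagged_def by simp
  have "\<exists>i \<in> {c<..k}. lab i = B \<and> (hd i --> load i < th)" using LR_hungry[OF R] ne unfolding flagged_def by blast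
  then obtain x where x: "x \<in> ?F" "load x < W"
    using th hdF unfolding flagged_def by blast
  have le: "load i + 1 \<le> 2 * W" if "i \<in> ?F" for i
  proof -
    have "load i < (if hd i then th + W else 3 * W)" using LR_ub[OF R] that unfolding flagged_def by blast
    then show ?thesis using hdF[OF that] th by simp
  qed
  have "(\<Sum>i \<in> ?F. load i) = load x + (\<Sum>i \<in> ?F - {x}. load i)" using x fin by (simp add: sum.remove)
  also have "(\<Sum>i \<in> ?F - {x}. load i) \<le> (\<Sum>i \<in> ?F - {x}. 2 * W)" by (rule sum_mono) (use le in force)
  also have "\<dots> = card (?F - {x}) * (2 * W)" by simp
  finally have 1: "(\<Sum>i \<in> ?F. load i) \<le> load x + card (?F - {x}) * (2 * W)" by simp
  have "card ?F = Suc (card (?F - {x}))" using x fin by (metis card.remove)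
  then have "2 * W * card ?F = 2 * W + card (?F - {x}) * (2 * W)" by (simp add: algebra_simps)
  then show "acc P Ut ?F + W < 2 * W * card ?F" using 1 x(2) acc_flagged[OF R] by linarith
qed

text \<open>When a run stops at the light core \<open>jl\<close>, the Hall condition survives
  without the units owned by \<open>jl\<close>. Unblocked heads of \<open>Z\<close> own
  \<open>2 * W\<close> each; for the blocked ones the old condition is used, and its units have
  blocked owners, so none is owned by \<open>jl\<close>. This is what permits rearranging
  \<open>jl\<close> together with its units.\<close>

lemma hall_event:
  assumes R: "LR own load lab ev jl" and th: "th = 2 * W" and H: "hall c k P Ut kd" and ev: "ev \<noteq> 0"
    and Z: "Z \<subseteq> heads c k kd"
  shows "2 * W * card Z \<le> (\<Sum>i \<in> Z. w (cls P i)) + (\<Sum>u \<in> {u \<in> NB P Ut Z. own u \<noteq> jl}. w (uset P Ut u))"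
proof -
  define Zf Za where "Zf = Z \<inter> flagged lab" and "Za = Z - flagged lab"
  have ZK: "Z \<subseteq> {c<..k}" using Z unfolding heads_def by auto
  then have finZ: "finite Z" using finite_subset by blast
  have ZK': "Zf \<subseteq> {c<..k}" "Za \<subseteq> {c<..k}" using ZK unfolding Zf_def Za_def by auto
  have finU: "finite U" unfolding U_units by simp
  have jl: "jl \<in> {c<..k}" "\<not> hd jl" "lab jl \<noteq> B" using LR_ev[OF R ev] by auto
  have jlZ: "jl \<notin> Z" using jl Z unfolding heads_def hd_def by auto
  let ?u = "\<lambda>A. \<Sum>u \<in> A. w (uset P Ut u)" and ?c = "\<lambda>A. \<Sum>i \<in> A. w (cls P i)"
  have 1: "2 * W * card Zf \<le> ?c Zf + ?u (NB P Ut Zf)"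
    using H Z unfolding hall_def acc_def Zf_def by blast
  have "(\<Sum>i \<in> Za. 2 * W) \<le> (\<Sum>i \<in> Za. load i)"
  proof (rule sum_mono)
    fix i assume "i \<in> Za"
    then have "i \<in> {c<..k}" "hd i" "lab i \<noteq> B" using Z ZK unfolding Za_def heads_def hd_def flagged_def by auto
    then have "th \<le> load i" by (rule LR_head[OF R])
    then show "2 * W \<le> load i" using th by simp
  qed
  then have 2: "2 * W * card Za \<le> ?c Za + ?u {u \<in> U. own u \<in> Za}"
    unfolding LR_sum[OF R ZK'(2)] by (simp add: mult.commute mult.left_commute)
  have a: "NB P Ut Zf \<subseteq> {u \<in> U. own u \<in> flagged lab}" using NB_flagged[OF R, of Zf] unfolding Zf_def by blast
  have b: "{u \<in> U. own u \<in> Za} \<subseteq> NB P Ut Z"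
  proof
    fix u assume u: "u \<in> {u \<in> U. own u \<in> Za}"
    then have "own u \<noteq> 0" using ZK'(2) by auto
    then have "nb (own u) u" using LR_own[OF R] u by blast
    then show "u \<in> NB P Ut Z" using u unfolding NB_def nb_nbu Za_def by blast
  qed
  \<comment> \<open>Units next to blocked heads have blocked owners, so none of them is counted
    again for an unblocked head.\<close>
  have "NB P Ut Zf \<inter> {u \<in> U. own u \<in> Za} = {}" using a unfolding Za_def by blast
  then have "?u (NB P Ut Zf) + ?u {u \<in> U. own u \<in> Za} = ?u (NB P Ut Zf \<union> {u \<in> U. own u \<in> Za})"
    using finU by (subst sum.union_disjoint) auto
  also have "\<dots> \<le> ?u {u \<in> NB P Ut Z. own u \<noteq> jl}"
  proof (rule sum_mono2)
    show "NB P Ut Zf \<union> {u \<in> U. own u \<in> Za} \<subseteq> {u \<in> NB P Ut Z. own u \<noteq> jl}"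
      using a b jl jlZ unfolding Zf_def Za_def flagged_def NB_def by auto
  qed simp_all
  finally have 3: "?u (NB P Ut Zf) + ?u {u \<in> U. own u \<in> Za} \<le> ?u {u \<in> NB P Ut Z. own u \<noteq> jl}" .
  have 4: "?c Z = ?c Zf + ?c Za" unfolding Zf_def Za_def using finZ by (rule sum.Int_Diff)
  have "card Z = card Zf + card Za" unfolding Zf_def Za_def using finZ by (metis card_Int_Diff)
  then have "2 * W * card Z = 2 * W * card Zf + 2 * W * card Za" by (simp add: distrib_left)
  then show ?thesis using 1 2 3 4 by linarith
qed

definition ext :: "(nat \<Rightarrow> nat) \<Rightarrow> nat \<Rightarrow> nat set" where
  "ext own i = cls P i \<union> (\<Union>u \<in> {u \<in> U. own u = i}. uset P Ut u)"

lemma w_ext: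
  assumes R: "LR own load lab ev jl" and i: "i \<in> {c<..k}"
  shows "w (ext own i) = load i"
proof -
  have "w (ext own i) = w (cls P i) + w (\<Union>u \<in> {u \<in> U. own u = i}. uset P Ut u)"
    unfolding ext_def using i by (intro sum.union_disjoint) (auto simp: U_units cls_def uset_def)
  also have "\<dots> = (\<Sum>i \<in> {i}. w (cls P i)) + (\<Sum>u \<in> {u \<in> U. own u \<in> {i}}. w (uset P Ut u))"
    by (simp add: sum_UN_uset U_units)
  also have "\<dots> = load i" using LR_sum[OF R, of "{i}"] i by simp
  finally show ?thesis .
qed

lemma conn_ext:
  assumes R: "LR own load lab ev jl" and i: "i \<in> {c<..k}" and c: "conn (cls P i)" and Ut: "units_ok P Ut"
    and A: "A \<subseteq> {u \<in> U. nb i u}"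
  shows "conn (cls P i \<union> (\<Union>u \<in> A. uset P Ut u))"
proof -
  have "finite A" using A finite_subset[of A U] by (auto simp: U_units)
  then show ?thesis using A
  proof (induction A rule: finite_induct)
    case (insert u A)
    then obtain x y where xy: "adj x y" "P x = i" "P y = 0" "Ut y = u" unfolding nb_nbu nbu_def by blast
    then have cu: "conn (uset P Ut u)" using Ut adj_less unfolding units_ok_def by blast
    have "x \<in> cls P i" "y \<in> uset P Ut u" using xy adj_less unfolding cls_def uset_def by blast+
    moreover have "conn (cls P i \<union> (\<Union>u \<in> A. uset P Ut u))" using insert by auto
    ultimately have "conn ((cls P i \<union> (\<Union>u \<in> A. uset P Ut u)) \<union> uset P Ut u)"
      using conn_Un[OF _ cu _ _ xy(1)] by blast
    then show ?case by (simp add: Un_ac)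
  qed (use c in simp)
qed

end

section \<open>Loops that fill an array\<close>

text \<open>For loops whose state is an explicit function of the counter: the invariant becomes an
  equation and a round can be checked by rewriting.\<close>

lemma wp_For_seq:
  assumes lo: "aval lo s = l" and lh: "l \<le> h" and x: "\<And>i. reg (S i) x = i"
    and init: "S l = s\<lparr>reg := (reg s)(x := l)\<rparr>"
    and hi: "\<And>i. l \<le> i ==> i \<le> h ==> aval hi (S i) = h"
    and step: "\<And>i. l \<le> i ==> i < h ==>
      wp c (\<lambda>t s'. reg s' x = i \<and> s'\<lparr>reg := (reg s')(x := Suc i)\<rparr> = S (Suc i) \<and> t \<le> K) (S i)"
    and post: "\<And>t. t \<le> (h - l) * (K + acost hi + 7) + acost lo + acost hi + 5 ==> Q t (S h)"
  shows "wp (For x lo hi c) Q s"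
proof (rule wp_For[where I = "\<lambda>i s'. s' = S i \<and> l \<le> i \<and> i \<le> h" and l = l and h = h and K = K], goal_cases)
  case (5 i s')
  then have i: "s' = S i" "l \<le> i" "i < h" by simp_all
  show ?case unfolding i(1) by (rule wp_mono[OF step[OF i(2,3)]]) (use i in simp)
qed (use lo lh init hi post in auto)

text \<open>Below the counter the array \<open>g\<close> already has its new values, from the
  counter on the old ones. A round may thus read earlier results, as in recursions along parent
  pointers.\<close>

lemma wp_For_map:
  assumes lo: "aval lo s = l" and lh: "l \<le> h"
    and hi: "\<And>i g. l \<le> i ==> i \<le> h ==> aval hi (s\<lparr>reg := (reg s)(x := i), arr := (arr s)(a := g)\<rparr>) = h"
    and step: "\<And>i g. l \<le> i ==> i < h ==> g i = arr s a i ==> (\<And>v. l \<le> v ==> v < i ==> g v = vl v) ==>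
      (\<And>v. i \<le> v ==> g v = arr s a v) ==>
      wp c (\<lambda>t s'. s' = s\<lparr>reg := (reg s)(x := i), arr := (arr s)(a := g(i := vl i))\<rparr> \<and> t \<le> K)
        (s\<lparr>reg := (reg s)(x := i), arr := (arr s)(a := g)\<rparr>)"
    and post: "\<And>t. t \<le> (h - l) * (K + acost hi + 7) + acost lo + acost hi + 5 ==>
      Q t (s\<lparr>reg := (reg s)(x := h), arr := (arr s)(a := \<lambda>v. if l \<le> v \<and> v < h then vl v else arr s a v)\<rparr>)"
  shows "wp (For x lo hi c) Q s"
proof (rule wp_For_seq[where l = l and h = h and K = K and
    S = "\<lambda>i. s\<lparr>reg := (reg s)(x := i), arr := (arr s)(a := \<lambda>v. if l \<le> v \<and> v < i then vl v else arr s a v)\<rparr>"], goal_cases)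
  case 4
  have "(\<lambda>v. if l \<le> v \<and> v < l then vl v else arr s a v) = arr s a" by auto
  then show ?case by simp
next
  case (6 i)
  have e: "(\<lambda>v. if l \<le> v \<and> v < i then vl v else arr s a v)(i := vl i) = (\<lambda>v. if l \<le> v \<and> v < Suc i then vl v else arr s a v)"
    using 6 by (auto simp: less_Suc_eq fun_eq_iff)
  show ?case
    by (rule wp_mono[OF step[OF 6, of "\<lambda>v. if l \<le> v \<and> v < i then vl v else arr s a v"]]) (simp_all add: e)
qed (use lo lh hi post in auto)

text \<open>A search without early exit. The conclusion leaves open which of several hits is
  stored.\<close>

lemma wp_For_find:
  assumes lo: "aval lo s = l" and lh: "l \<le> h" and xy: "x \<noteq> y"
    and hi: "\<And>i z. aval hi (s\<lparr>reg := (reg s)(x := i, y := z)\<rparr>) = h"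
    and b: "\<And>i z. l \<le> i ==> i < h ==> bval b (s\<lparr>reg := (reg s)(x := i, y := z)\<rparr>) = cn i"
    and e: "\<And>i z. l \<le> i ==> i < h ==> cn i ==> aval e (s\<lparr>reg := (reg s)(x := i, y := z)\<rparr>) = vl i"
    and post: "\<And>t z. t \<le> (h - l) * (bcost b + acost e + acost hi + 10) + acost lo + acost hi + 5 ==>
      (z = reg s y \<and> (\<forall>i. l \<le> i \<and> i < h --> \<not> cn i)) \<or> (\<exists>i. l \<le> i \<and> i < h \<and> cn i \<and> z = vl i) ==>
      Q t (s\<lparr>reg := (reg s)(x := h, y := z)\<rparr>)"
  shows "wp (For x lo hi (Cond b (Assign y e) Skip)) Q s"
proof (rule wp_For[where I = "\<lambda>i s'. \<exists>z. s' = s\<lparr>reg := (reg s)(x := i, y := z)\<rparr> \<and>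
    ((z = reg s y \<and> (\<forall>j. l \<le> j \<and> j < i --> \<not> cn j)) \<or> (\<exists>j. l \<le> j \<and> j < i \<and> cn j \<and> z = vl j))"
    and l = l and h = h and K = "bcost b + acost e + 3"], goal_cases)
  case 3
  show ?case using xy by (intro exI[of _ "reg s y"]) (simp add: fun_upd_twist fun_upd_idem, auto)
next
  case (4 i s')
  then show ?case using hi by metis
next
  case (5 i s')
  then obtain z where z: "s' = s\<lparr>reg := (reg s)(x := i, y := z)\<rparr>"
    "(z = reg s y \<and> (\<forall>j. l \<le> j \<and> j < i --> \<not> cn j)) \<or> (\<exists>j. l \<le> j \<and> j < i \<and> cn j \<and> z = vl j)" by blast
  show ?case
  proof (cases "cn i")
    case True
    then show ?thesis
      using 5 xy by (simp add: z(1) b e) (intro exI[of _ "vl i"], auto simp: fun_upd_twist)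
  next
    case False
    then have "(z = reg s y \<and> (\<forall>j. l \<le> j \<and> j < Suc i --> \<not> cn j)) \<or> (\<exists>j. l \<le> j \<and> j < Suc i \<and> cn j \<and> z = vl j)"
      using z(2) less_Suc_eq by metis
    then show ?thesis using False 5 xy by (simp add: z(1) b e) (intro exI[of _ z], auto simp: fun_upd_twist)
  qed
next
  case (6 s' t)
  then obtain z where "s' = s\<lparr>reg := (reg s)(x := h, y := z)\<rparr>"
    "(z = reg s y \<and> (\<forall>j. l \<le> j \<and> j < h --> \<not> cn j)) \<or> (\<exists>j. l \<le> j \<and> j < h \<and> cn j \<and> z = vl j)" by blast
  moreover have "bcost b + acost e + 3 + acost hi + 7 = bcost b + acost e + acost hi + 10" by simp
  then have "t \<le> (h - l) * (bcost b + acost e + acost hi + 10) + acost lo + acost hi + 5" using 6(3) by (simp add: add_ac)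
  ultimately show ?case using post[of t z] by simp
qed (use lo lh hi in auto)

section \<open>The program\<close>

abbreviation "either b1 b2 \<equiv> Neg (Conj (Neg b1) (Neg b2))"
abbreviation "C \<equiv> Cell"
abbreviation "neq a b \<equiv> Neg (Equal a b)"

text \<open>Arcs are numbered from 1, so that 0 ends an arc list. The sets \<open>1..c\<close> are heavy vertices and \<open>c + 1..size\<close> are cores,
  of kind 1 for heads and 0 for light cores. The array \<open>seen\<close> holds queue positions plus 1, and \<open>ev\<close> a unit plus 1.\<close>

definition merge_units :: com where "merge_units =
  For ''a'' (N 1) (Plus (R ''M'') (N 1))
   (''p'' ::= C ''unit'' (C ''src'' (R ''a'')) ;;
    ''q'' ::= C ''unit'' (C ''tgt'' (R ''a'')) ;;
    Cond (Conj (Conj (Equal (C ''part'' (C ''src'' (R ''a''))) (N 0)) (Equal (C ''part'' (C ''tgt'' (R ''a''))) (N 0)))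
       (Conj (neq (R ''p'') (R ''q'')) (Less (Plus (C ''wU'' (R ''p'')) (C ''wU'' (R ''q''))) (R ''W''))))
     (Store ''wU'' (R ''p'') (Plus (C ''wU'' (R ''p'')) (C ''wU'' (R ''q''))) ;;
      For ''v'' (N 0) (R ''n'')
        (Cond (Equal (C ''unit'' (R ''v'')) (R ''q'')) (Store ''unit'' (R ''v'') (R ''p'')) Skip))
     Skip)"

definition single_units :: com where "single_units =
  For ''v'' (N 0) (R ''n'') (Store ''unit'' (R ''v'') (R ''v'')) ;;
  For ''v'' (N 0) (R ''n'') (Store ''wU'' (R ''v'') (C ''weight'' (R ''v'')))"

definition take_parts :: com where "take_parts =
  For ''v'' (N 0) (R ''n'')
    (Cond (Equal (C ''part'' (R ''v'')) (N 0)) (Store ''part'' (R ''v'') (C ''own'' (C ''unit'' (R ''v'')))) Skip) ;;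
  For ''i'' (N 0) (Plus (R ''size'') (N 1)) (Store ''kind'' (R ''i'') (N 0))"

text \<open>The search does not reset the queue but starts at the current \<open>qt\<close>.
  Searches from several roots share \<open>q\<close>, \<open>par\<close> and \<open>seen\<close>, so
  that their costs add up to a linear bound.\<close>

definition bfs :: com where "bfs =
  Store ''q'' (R ''qt'') (R ''r'') ;; Store ''seen'' (R ''r'') (Plus (R ''qt'') (N 1)) ;;
  ''qh'' ::= R ''qt'' ;; inc ''qt'' ;; ''ptr'' ::= C ''vfi'' (R ''r'') ;; ''ac'' ::= C ''weight'' (R ''r'') ;;
  While (Less (R ''qh'') (R ''qt''))
   (Cond (Equal (R ''ptr'') (N 0))
     (inc ''qh'' ;; ''ptr'' ::= C ''vfi'' (C ''q'' (R ''qh'')))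
     (''y'' ::= C ''tgt'' (R ''ptr'') ;;
      Cond (Conj (Equal (C ''part'' (R ''y'')) (R ''cl'')) (Equal (C ''seen'' (R ''y'')) (N 0)))
       (Store ''q'' (R ''qt'') (R ''y'') ;; Store ''par'' (R ''qt'') (R ''qh'') ;; inc ''qt'' ;;
        Store ''seen'' (R ''y'') (R ''qt'') ;;
        ''ac'' ::= Plus (R ''ac'') (C ''weight'' (R ''y''))) Skip ;;
      ''ptr'' ::= C ''vnx'' (R ''ptr'')))"

definition attached :: bexp where "attached =
  Conj (Equal (C ''part'' (R ''v'')) (N 0))
    (either (Equal (C ''own'' (C ''unit'' (R ''v''))) (R ''jl'')) (Equal (C ''unit'' (R ''v'')) (R ''Y'')))"

abbreviation "anchor \<equiv> C ''att'' (C ''unit'' (R ''v''))"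
abbreviation "posn e \<equiv> Minus (C ''seen'' e) (N 1)"

definition core_tree :: com where "core_tree =
  For ''v'' (N 0) (R ''n'') (Store ''seen'' (R ''v'') (N 0)) ;;
  For ''v'' (N 0) (R ''n'') (Cond (Equal (C ''part'' (R ''v'')) (R ''jl'')) (''r'' ::= R ''v'') Skip) ;;
  ''qt'' ::= N 0 ;; ''cl'' ::= R ''jl'' ;; bfs"

definition attach :: com where "attach =
  For ''a'' (N 1) (Plus (R ''M'') (N 1))
    (Cond (Conj (Equal (C ''part'' (C ''src'' (R ''a''))) (R ''jl'')) (Equal (C ''part'' (C ''tgt'' (R ''a''))) (N 0)))
      (Store ''att'' (C ''unit'' (C ''tgt'' (R ''a''))) (C ''src'' (R ''a''))) Skip) ;;
  For ''v'' (N 0) (R ''n'') (Store ''aug'' (R ''v'') (C ''weight'' (R ''v''))) ;;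
  For ''v'' (N 0) (R ''n'')
    (Cond attached (Store ''aug'' anchor (Plus (C ''aug'' anchor) (C ''weight'' (R ''v'')))) Skip)"

text \<open>Parents precede their children in the queue, so a single pass in increasing order
  decides membership in the subtree at position \<open>i\<close>.\<close>

definition mark_subtree :: com where "mark_subtree =
  For ''l'' (N 0) (R ''qt'')
    (Cond (Equal (R ''l'') (R ''i'')) (Store ''ins'' (R ''l'') (N 1))
      (Cond (Equal (R ''l'') (N 0)) (Store ''ins'' (R ''l'') (N 0))
        (Store ''ins'' (R ''l'') (C ''ins'' (C ''par'' (R ''l'')))))) ;;
  ''s'' ::= N 0 ;; ''tot'' ::= N 0 ;;
  For ''l'' (N 0) (R ''qt'')
    (''tot'' ::= Plus (R ''tot'') (C ''aug'' (C ''q'' (R ''l''))) ;;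
     Cond (Equal (C ''ins'' (R ''l'')) (N 1)) (''s'' ::= Plus (R ''s'') (C ''aug'' (C ''q'' (R ''l'')))) Skip)"

text \<open>Positions are tried from the end of the queue, so the first hit is the last position
  with a subtree of weight at least \<open>W\<close>.\<close>

definition find_subtree :: com where "find_subtree =
  ''fnd'' ::= N 0 ;;
  For ''ii'' (N 0) (R ''qt'')
    (Cond (Equal (R ''fnd'') (N 0))
      (''i'' ::= Minus (R ''qt'') (Plus (R ''ii'') (N 1)) ;; mark_subtree ;;
       Cond (Less (R ''s'') (R ''W'')) Skip (''fnd'' ::= N 1)) Skip)"

definition split_core :: com where "split_core =
  inc ''size'' ;;
  For ''v'' (N 0) (R ''n'')
    (Cond (Conj (Equal (C ''part'' (R ''v'')) (R ''jl'')) (Equal (C ''ins'' (posn (R ''v''))) (N 1)))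
      (Store ''part'' (R ''v'') (R ''size'')) Skip) ;;
  For ''v'' (N 0) (R ''n'')
    (Cond attached
      (Cond (Equal (C ''ins'' (posn anchor)) (N 1)) (Store ''part'' (R ''v'') (R ''size''))
        (Store ''part'' (R ''v'') (R ''jl''))) Skip) ;;
  Store ''kind'' (R ''size'') (N 0)"

definition sum_units :: com where "sum_units =
  For ''v'' (N 0) (R ''n'') (Store ''wU'' (R ''v'') (N 0)) ;;
  For ''v'' (N 0) (R ''n'')
    (Cond (Equal (C ''part'' (R ''v'')) (N 0))
      (Store ''wU'' (C ''unit'' (R ''v'')) (Plus (C ''wU'' (C ''unit'' (R ''v''))) (C ''weight'' (R ''v'')))) Skip)"

text \<open>The vertices leave the core only in the last loop, because the earlier loops still
  recognise them by \<open>part\<close>.\<close>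

definition make_head :: com where "make_head =
  For ''l'' (N 0) (R ''qt'')
    (Cond (either (Equal (R ''l'') (N 0)) (Equal (C ''par'' (R ''l'')) (R ''i'')))
      (Store ''br'' (R ''l'') (R ''l''))
      (Store ''br'' (R ''l'') (C ''br'' (C ''par'' (R ''l''))))) ;;
  ''z'' ::= C ''q'' (R ''i'') ;;
  For ''v'' (N 0) (R ''n'')
    (Cond (Conj attached (neq anchor (R ''z'')))
      (Store ''unit'' (R ''v'') (C ''q'' (C ''br'' (posn anchor)))) Skip) ;;
  For ''v'' (N 0) (R ''n'')
    (Cond (Conj (Equal (C ''part'' (R ''v'')) (R ''jl'')) (neq (R ''v'') (R ''z'')))
      (Store ''unit'' (R ''v'') (C ''q'' (C ''br'' (posn (R ''v''))))) Skip) ;;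
  For ''v'' (N 0) (R ''n'')
    (Cond (Conj (Equal (C ''part'' (R ''v'')) (R ''jl'')) (neq (R ''v'') (R ''z'')))
      (Store ''part'' (R ''v'') (N 0)) Skip) ;;
  Store ''kind'' (R ''jl'') (N 1) ;;
  sum_units"

text \<open>Placing \<open>jl\<close> behind the last core makes all light cores sit out.\<close>

definition label_W :: com where "label_W =
  ''th'' ::= R ''W'' ;; ''jl'' ::= Plus (R ''size'') (N 1) ;; label"

definition light_event :: com where "light_event =
  ''Y'' ::= Minus (R ''ev'') (N 1) ;; core_tree ;; attach ;; find_subtree ;;
  Cond (Less (Minus (R ''tot'') (R ''s'')) (R ''W'')) make_head (split_core ;; label_W ;; take_parts ;; single_units)"

definition find_conflict :: com where "find_conflict =
  For ''v'' (N 0) (R ''n'') (Store ''nf'' (R ''v'') (N 0)) ;;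
  For ''a'' (N 1) (Plus (R ''M'') (N 1))
    (Cond (Conj (Conj (Less (R ''c'') (C ''part'' (C ''src'' (R ''a'')))) (Equal (C ''part'' (C ''tgt'' (R ''a''))) (N 0)))
         (Equal (C ''fl'' (C ''part'' (C ''src'' (R ''a'')))) (N 1)))
      (Store ''nf'' (C ''unit'' (C ''tgt'' (R ''a''))) (N 1)) Skip) ;;
  ''fnd'' ::= N 0 ;;
  For ''a'' (N 1) (Plus (R ''M'') (N 1))
    (Cond (Conj (Conj (Equal (C ''part'' (C ''src'' (R ''a''))) (N 0)) (Equal (C ''part'' (C ''tgt'' (R ''a''))) (N 0)))
       (Conj (neq (C ''unit'' (C ''src'' (R ''a''))) (C ''unit'' (C ''tgt'' (R ''a''))))
         (Neg (Conj (Equal (C ''nf'' (C ''unit'' (C ''src'' (R ''a'')))) (N 1)) (Equal (C ''nf'' (C ''unit'' (C ''tgt'' (R ''a'')))) (N 1))))))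
      (''fnd'' ::= R ''a'') Skip)"

definition probe :: com where "probe =
  ''p'' ::= C ''unit'' (C ''src'' (R ''fnd'')) ;; ''q'' ::= C ''unit'' (C ''tgt'' (R ''fnd'')) ;;
  inc ''size'' ;; Store ''kind'' (R ''size'') (N 0) ;;
  For ''v'' (N 0) (R ''n'')
    (Cond (Conj (Equal (C ''part'' (R ''v'')) (N 0)) (either (Equal (C ''unit'' (R ''v'')) (R ''p'')) (Equal (C ''unit'' (R ''v'')) (R ''q''))))
      (Store ''part'' (R ''v'') (R ''size'')) Skip) ;;
  label_W ;;
  ''bad'' ::= N 0 ;;
  For ''i'' (Plus (R ''c'') (N 1)) (Plus (R ''size'') (N 1))
    (Cond (Equal (C ''lab'' (R ''i'')) (R ''big'')) (''bad'' ::= N 1) Skip)"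

definition undo_probe :: com where "undo_probe =
  For ''v'' (N 0) (R ''n'')
    (Cond (Equal (C ''part'' (R ''v'')) (R ''size'')) (Store ''part'' (R ''v'') (N 0)) Skip) ;;
  ''size'' ::= Minus (R ''size'') (N 1) ;;
  For ''i'' (Plus (R ''c'') (N 1)) (Plus (R ''size'') (N 1))
    (Cond (Equal (C ''lab'' (R ''i'')) (R ''big'')) (Store ''fl'' (R ''i'') (N 1)) Skip)"

definition probe_loop :: com where "probe_loop =
  ''lp'' ::= N 1 ;;
  While (Less (N 0) (R ''lp''))
    (find_conflict ;;
     Cond (Equal (R ''fnd'') (N 0)) (''lp'' ::= N 0)
       (probe ;; Cond (Equal (R ''bad'') (N 0)) (''lp'' ::= N 0) undo_probe))"

definition no_event :: com where "no_event =
  For ''i'' (Plus (R ''c'') (N 1)) (Plus (R ''size'') (N 1))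
    (Cond (Equal (C ''lab'' (R ''i'')) (R ''big'')) (Store ''fl'' (R ''i'') (N 1)) (Store ''fl'' (R ''i'') (N 0))) ;;
  probe_loop ;;
  Cond (Equal (R ''fnd'') (N 0)) (label_W ;; ''fin'' ::= N 1) Skip ;;
  take_parts ;; single_units"

definition grow :: com where "grow =
  single_units ;; ''fin'' ::= N 0 ;;
  While (Equal (R ''fin'') (N 0))
   (merge_units ;; ''th'' ::= Plus (R ''W'') (R ''W'') ;; ''jl'' ::= Plus (R ''c'') (N 1) ;; label ;;
    Cond (Equal (R ''ev'') (N 0)) no_event light_event)"

definition read_input :: com where "read_input =
  ''M'' ::= Plus (R ''m'') (R ''m'') ;; ''W3'' ::= Plus (Plus (R ''W'') (R ''W'')) (R ''W'') ;;
  ''big'' ::= Plus (R ''n'') (N 5) ;;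
  For ''a'' (N 1) (Plus (R ''m'') (N 1)) (Store ''src'' (R ''a'') (C ''fst'' (Minus (R ''a'') (N 1)))) ;;
  For ''a'' (Plus (R ''m'') (N 1)) (Plus (R ''M'') (N 1)) (Store ''src'' (R ''a'') (C ''snd'' (Minus (R ''a'') (Plus (R ''m'') (N 1))))) ;;
  For ''a'' (N 1) (Plus (R ''m'') (N 1)) (Store ''tgt'' (R ''a'') (C ''snd'' (Minus (R ''a'') (N 1)))) ;;
  For ''a'' (Plus (R ''m'') (N 1)) (Plus (R ''M'') (N 1)) (Store ''tgt'' (R ''a'') (C ''fst'' (Minus (R ''a'') (Plus (R ''m'') (N 1))))) ;;
  For ''a'' (N 1) (Plus (R ''M'') (N 1))
    (Store ''vnx'' (R ''a'') (C ''vfi'' (C ''src'' (R ''a''))) ;;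
     Store ''vfi'' (C ''src'' (R ''a'')) (R ''a'')) ;;
  For ''v'' (N 0) (R ''n'')
    (Cond (Less (C ''weight'' (R ''v'')) (R ''W'')) Skip
      (inc ''size'' ;; Store ''part'' (R ''v'') (R ''size''))) ;;
  ''c'' ::= R ''size''"

text \<open>Linear-time test whether some component of the free vertices weighs at least
  \<open>W\<close>. It keeps work of order |V||E| away from graphs with optimum 0 or without edges,
  for which the time bound is only linear.\<close>

definition screen :: com where "screen =
  ''any'' ::= N 0 ;;
  For ''v'' (N 0) (R ''n'')
    (Cond (Conj (Equal (C ''part'' (R ''v'')) (N 0)) (Equal (C ''seen'' (R ''v'')) (N 0)))
      (''r'' ::= R ''v'' ;; bfs ;; Cond (Less (R ''ac'') (R ''W'')) Skip (''any'' ::= N 1)) Skip)"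

definition pack :: com where "pack =
  read_input ;; screen ;; Cond (Equal (R ''any'') (N 0)) Skip grow"

text \<open>Gives stores one normal form, so that states reached on different ways can be compared
  by rewriting.\<close>

lemma store_swap [simp]: "(s :: store)\<lparr>arr := f, reg := g\<rparr> = s\<lparr>reg := g, arr := f\<rparr>"
  by (cases s) simp

section \<open>Regions, and coarsening the partition into units\<close>

context inst
begin

definition region :: "(nat \<Rightarrow> nat) \<Rightarrow> (nat \<Rightarrow> nat) \<Rightarrow> nat set \<Rightarrow> nat set" where
  "region P Ut Z = {v. v < n \<and> (P v \<in> Z \<or> P v = 0 \<and> Ut v \<in> NB P Ut Z)}"

lemma finite_region [simp]: "finite (region P Ut Z)"
  unfolding region_def by simp

lemma acc_region:
  assumes "finite Z" "0 \<notin> Z"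
  shows "acc P Ut Z = w (region P Ut Z)"
proof -
  have "acc P Ut Z = w (\<Union>i \<in> Z. cls P i) + w (\<Union>u \<in> NB P Ut Z. uset P Ut u)"
    unfolding acc_def using assms by (simp add: sum_UN_uset sum_UN_cls)
  also have "\<dots> = w ((\<Union>i \<in> Z. cls P i) \<union> (\<Union>u \<in> NB P Ut Z. uset P Ut u))"
    by (rule sum.union_disjoint[symmetric]) (use assms in \<open>auto simp: cls_def uset_def\<close>)
  also have "(\<Union>i \<in> Z. cls P i) \<union> (\<Union>u \<in> NB P Ut Z. uset P Ut u) = region P Ut Z"
    unfolding region_def cls_def uset_def by auto
  finally show ?thesis .
qed

definition coarser :: "(nat \<Rightarrow> nat) \<Rightarrow> (nat \<Rightarrow> nat) \<Rightarrow> (nat \<Rightarrow> nat) \<Rightarrow> bool" where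
  "coarser P Ut Ut' \<longleftrightarrow> (\<forall>x < n. \<forall>y < n. P x = 0 --> P y = 0 --> Ut x = Ut y --> Ut' x = Ut' y)"

lemma coarser_trans: "coarser P U1 U2 ==> coarser P U2 U3 ==> coarser P U1 U3"
  unfolding coarser_def by blast

text \<open>Coarser units can only enlarge the region reached from a set of heads.\<close>

lemma hall_coarser:
  assumes H: "hall c k P Ut kd" and co: "coarser P Ut Ut'"
  shows "hall c k P Ut' kd"
  unfolding hall_def
proof (intro allI impI)
  fix Z assume Z: "Z \<subseteq> heads c k kd"
  have fin: "finite Z" "0 \<notin> Z" using Z unfolding heads_def by (auto intro: finite_subset[of _ "{..k}"])
  have "region P Ut Z \<subseteq> region P Ut' Z"
  proof
    fix v assume v: "v \<in> region P Ut Z"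
    show "v \<in> region P Ut' Z"
    proof (cases "P v \<in> Z")
      case True
      then show ?thesis using v unfolding region_def by blast
    next
      case False
      then obtain i x y where xy: "v < n" "P v = 0" "i \<in> Z" "adj x y" "P x = i" "P y = 0" "Ut y = Ut v"
        using v unfolding region_def NB_def nbu_def by blast
      then have "Ut' y = Ut' v" using co adj_less unfolding coarser_def by blast
      then show ?thesis using xy unfolding region_def NB_def nbu_def by blast
    qed
  qed
  then have "w (region P Ut Z) \<le> w (region P Ut' Z)" by (intro sum_mono2) simp_all
  moreover have "2 * W * card Z \<le> acc P Ut Z" using H Z unfolding hall_def by blast
  ultimately show "2 * W * card Z \<le> acc P Ut' Z"
    using acc_region[OF fin, of P Ut] acc_region[OF fin, of P Ut'] by linarith
qed

lemma conn_attach: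
  assumes "finite A" and S: "conn S" and A: "\<And>u. u \<in> A ==> conn (V u) \<and> (\<exists>x \<in> S. \<exists>y \<in> V u. adj x y)"
  shows "conn (S \<union> (\<Union>u \<in> A. V u))"
  using assms(1) A
proof (induction A rule: finite_induct)
  case (insert u A)
  then obtain x y where xy: "conn (V u)" "x \<in> S" "y \<in> V u" "adj x y" by blast
  have "conn ((S \<union> (\<Union>u \<in> A. V u)) \<union> V u)"
    by (rule conn_Un[OF _ xy(1) _ xy(3,4)]) (use insert xy in auto)
  then show ?case by (simp add: Un_ac)
qed (use S in simp)

definition wu_ok :: "(nat \<Rightarrow> nat) \<Rightarrow> (nat \<Rightarrow> nat) \<Rightarrow> (nat \<Rightarrow> nat) \<Rightarrow> bool" where
  "wu_ok P Ut wU \<longleftrightarrow> (\<forall>v < n. P v = 0 --> wU (Ut v) = w (uset P Ut (Ut v)))"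

lemma units_okD:
  assumes "units_ok P Ut" "v < n" "P v = 0"
  shows "Ut v < n" "P (Ut v) = 0" "Ut (Ut v) = Ut v" "conn (uset P Ut (Ut v))" "w (uset P Ut (Ut v)) < W"
  using assms unfolding units_ok_def by blast+

text \<open>Besides the correctness of one merge it records that the unit of a vertex never loses
  weight; this keeps the tests on earlier arcs valid.\<close>

lemma merge_step:
  assumes ok: "units_ok P Ut" and wu: "wu_ok P Ut wU" and xy: "adj x y" "P x = 0" "P y = 0" "Ut x \<noteq> Ut y"
    and small: "w (uset P Ut (Ut x)) + w (uset P Ut (Ut y)) < W"
    and Ut': "\<And>v. v < n ==> Ut' v = (if Ut v = Ut y then Ut x else Ut v)"
  shows "units_ok P Ut'" and "wu_ok P Ut' (wU(Ut x := w (uset P Ut (Ut x)) + w (uset P Ut (Ut y))))"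
    and "coarser P Ut Ut'" and "\<And>v. v < n ==> P v = 0 ==> w (uset P Ut (Ut v)) \<le> w (uset P Ut' (Ut' v))"
    and "Ut' x = Ut' y"
proof -
  have n: "x < n" "y < n" using adj_less xy by auto
  have ux: "uset P Ut' (Ut x) = uset P Ut (Ut x) \<union> uset P Ut (Ut y)"
    unfolding uset_def using Ut' by auto
  have uo: "uset P Ut' u = uset P Ut u" if "u \<noteq> Ut x" "u \<noteq> Ut y" for u
    unfolding uset_def using Ut' that by auto
  have dis: "uset P Ut (Ut x) \<inter> uset P Ut (Ut y) = {}" using disjoint_uset xy by simp
  have wx: "w (uset P Ut' (Ut x)) = w (uset P Ut (Ut x)) + w (uset P Ut (Ut y))"
    unfolding ux by (rule sum.union_disjoint) (use dis in auto)
  have mem: "x \<in> uset P Ut (Ut x)" "y \<in> uset P Ut (Ut y)" using n xy unfolding uset_def by auto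
  have cx: "conn (uset P Ut' (Ut x))"
    unfolding ux by (rule conn_Un[OF units_okD(4)[OF ok] units_okD(4)[OF ok] mem xy(1)]) (use n xy in auto)
  have rx: "Ut x < n" "P (Ut x) = 0" "Ut (Ut x) = Ut x" using units_okD[OF ok] n xy by auto
  show "units_ok P Ut'"
    unfolding units_ok_def
  proof (intro allI impI)
    fix v assume v: "v < n" "P v = 0"
    note o = units_okD[OF ok v]
    show "Ut' v < n \<and> P (Ut' v) = 0 \<and> Ut' (Ut' v) = Ut' v \<and> conn (uset P Ut' (Ut' v)) \<and> w (uset P Ut' (Ut' v)) < W"
    proof (cases "Ut v = Ut y \<or> Ut v = Ut x")
      case True
      then have "Ut' v = Ut x" using Ut'[OF v(1)] by auto
      moreover have "Ut' (Ut x) = Ut x" using Ut'[OF rx(1)] rx(3) xy(4) by simp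
      ultimately show ?thesis using rx cx wx small by simp
    next
      case False
      then have "Ut' v = Ut v" using Ut'[OF v(1)] by auto
      moreover have "Ut' (Ut v) = Ut v" using Ut'[OF o(1)] o(3) False by simp
      ultimately show ?thesis using o uo False by simp
    qed
  qed
  show "wu_ok P Ut' (wU(Ut x := w (uset P Ut (Ut x)) + w (uset P Ut (Ut y))))"
    unfolding wu_ok_def
  proof (intro allI impI)
    fix v assume v: "v < n" "P v = 0"
    show "(wU(Ut x := w (uset P Ut (Ut x)) + w (uset P Ut (Ut y)))) (Ut' v) = w (uset P Ut' (Ut' v))"
      using Ut'[OF v(1)] wx uo wu v unfolding wu_ok_def by (cases "Ut v = Ut y \<or> Ut v = Ut x") auto
  qed
  show "coarser P Ut Ut'" unfolding coarser_def using Ut' by auto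
  show "w (uset P Ut (Ut v)) \<le> w (uset P Ut' (Ut' v))" if v: "v < n" "P v = 0" for v
    using Ut'[OF v(1)] wx uo by (cases "Ut v = Ut y \<or> Ut v = Ut x") auto
  show "Ut' x = Ut' y" using Ut' n xy by simp
qed

definition separated :: "(nat \<Rightarrow> nat) \<Rightarrow> (nat \<Rightarrow> nat) \<Rightarrow> bool" where
  "separated P Ut \<longleftrightarrow> (\<forall>x y. adj x y \<and> P x = 0 \<and> P y = 0 \<and> Ut x \<noteq> Ut y -->
     W \<le> w (uset P Ut (Ut x)) + w (uset P Ut (Ut y)))"

lemma single_units_ok:
  assumes "\<And>v. v < n ==> P v = 0 ==> wt v < W" and Ut: "\<And>v. v < n ==> Ut v = v"
  shows "units_ok P Ut" and "\<And>v. v < n ==> wU v = wt v ==> P v = 0 ==> wU (Ut v) = w (uset P Ut (Ut v))"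
proof -
  have u: "uset P Ut (Ut v) = {v}" if "v < n" "P v = 0" for v
    unfolding uset_def using Ut that by auto
  then show "units_ok P Ut" unfolding units_ok_def using Ut assms(1) conn_sing by auto
  show "\<And>v. v < n ==> wU v = wt v ==> P v = 0 ==> wU (Ut v) = w (uset P Ut (Ut v))"
    using u Ut by auto
qed

lemma parts_okD:
  assumes "parts_ok c k P kd"
  shows "c \<le> k" and "\<And>v. v < n ==> P v \<le> k" and "\<And>v. v < n ==> W \<le> wt v \<longleftrightarrow> 1 \<le> P v \<and> P v \<le> c"
    and "\<And>i. 1 \<le> i ==> i \<le> c ==> \<exists>v. cls P i = {v}" and "\<And>i. kd i \<le> 1" and "kd 0 = 0"
    and "\<And>i. c < i ==> i \<le> k ==> kd i = 1 ==> \<exists>h. cls P i = {h}"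
    and "\<And>i. c < i ==> i \<le> k ==> kd i \<noteq> 1 ==> conn (cls P i) \<and> W \<le> w (cls P i) \<and> w (cls P i) < 3 * W"
  using assms unfolding parts_ok_def by (elim conjE, metis)+

lemma parts_ok_ipack:
  assumes P: "parts_ok c k P kd" and kd: "\<And>i. c < i ==> i \<le> k ==> kd i = 0"
  shows "ipack (cls P ` {1..k})" and "card (cls P ` {1..k}) = k"
proof -
  have 1: "conn (cls P i) \<and> W \<le> w (cls P i)" if i: "1 \<le> i" "i \<le> k" for i
  proof (cases "i \<le> c")
    case True
    then obtain v where v: "cls P i = {v}" using parts_okD(4)[OF P] i by blast
    then have "v < n" "P v = i" unfolding cls_def by auto
    then show ?thesis using parts_okD(3)[OF P, of v] v i True conn_sing by simp
  next
    case False
    then show ?thesis using parts_okD(8)[OF P, of i] i kd[of i] by simp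
  qed
  have dj: "cls P i \<noteq> cls P j" if "i \<in> {1..k}" "i \<noteq> j" for i j
    using 1[of i] that disjoint_cls[of i j P] unfolding conn_def by auto
  then have "inj_on (cls P) {1..k}" by (meson inj_onI)
  then show "card (cls P ` {1..k}) = k" by (simp add: card_image)
  show "ipack (cls P ` {1..k})"
    unfolding ipack_def using 1 disjoint_cls by (auto simp: cls_def)
qed

text \<open>A core weighs at least \<open>W\<close> although its vertices are lighter, so it has two
  vertices and an arc starting in it; different cores get different arcs. The number of cores is
  thus bounded by arcs as well as by vertices, which brings a labelling run down to |V||E|.\<close>

lemma parts_ok_arcs:
  assumes P: "parts_ok c k P kd" and kd: "\<And>i. c < i ==> i \<le> k ==> kd i = 0"
  shows "k - c \<le> M"
proof -
  have ex: "\<exists>a. 1 \<le> a \<and> a \<le> M \<and> P (sr a) = i" if i: "c < i" "i \<le> k" for i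
  proof -
    have i': "conn (cls P i)" "W \<le> w (cls P i)" using parts_okD(8)[OF P, of i] i kd[of i] by auto
    then obtain v where v: "v \<in> cls P i" unfolding conn_def by blast
    then have "wt v < W" using parts_okD(3)[OF P, of v] i unfolding cls_def by auto
    then have "cls P i \<noteq> {v}" using i' by auto
    then have "\<exists>x\<in>{v}. \<exists>y\<in>cls P i - {v}. adj x y" using v by (intro connD[OF i'(1)]) auto
    then show ?thesis using v unfolding adj_def cls_def by auto
  qed
  define f where "f i = (SOME a. 1 \<le> a \<and> a \<le> M \<and> P (sr a) = i)" for i
  have f: "1 \<le> f i \<and> f i \<le> M \<and> P (sr (f i)) = i" if "i \<in> {c<..k}" for i
    unfolding f_def using someI_ex[OF ex] that by auto
  have "inj_on f {c<..k}" by (rule inj_onI) (metis f)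
  then have "card {c<..k} \<le> card {1..M}" by (rule card_inj_on_le) (use f in auto)
  then show ?thesis by simp
qed

end

text \<open>\<open>kst\<close> enters as an upper bound for all packings and becomes the optimum at
  the end. \<open>W\<close> is positive here because the counting cancels it; \<open>W = 0\<close>
  is treated apart.\<close>

locale packing = inst n M sr tg wt W for n M :: nat and sr tg wt :: "nat \<Rightarrow> nat" and W :: nat +
  fixes c kst :: nat and vfi vnx :: "nat \<Rightarrow> nat"
  assumes W0: "0 < W" and kst: "ipack G ==> card G \<le> kst" and kst_n: "kst \<le> n"
    and vnx: "1 \<le> a ==> a \<le> M ==> vnx a < a \<and> (vnx a \<noteq> 0 --> sr (vnx a) = sr a) \<and> (\<forall>b. vnx a < b \<and> b < a --> sr b \<noteq> sr a)"
    and vfi: "v < n ==> vfi v \<le> M \<and> (vfi v \<noteq> 0 --> sr (vfi v) = v) \<and> (\<forall>b. vfi v < b \<and> b \<le> M --> sr b \<noteq> v)"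
begin

definition gctx :: "store \<Rightarrow> bool" where
  "gctx s \<longleftrightarrow> reg s ''n'' = n \<and> reg s ''M'' = M \<and> reg s ''c'' = c \<and> reg s ''W'' = W \<and> reg s ''W3'' = 3 * W \<and>
    reg s ''big'' = n + 5 \<and> arr s ''src'' = sr \<and> arr s ''tgt'' = tg \<and> arr s ''weight'' = wt \<and>
    arr s ''vfi'' = vfi \<and> arr s ''vnx'' = vnx"

text \<open>Unit of account for the time of one round. The added ones let it dominate
  \<open>n\<close>, \<open>M\<close> and constants.\<close>

definition D :: nat where "D = (n + 1) * (M + 1)"

lemma D_bounds: "n \<le> D" "M \<le> D" "1 \<le> D" "n * M \<le> D" "n + M \<le> D"
  unfolding D_def by simp_all

text \<open>One pass over the arcs suffices. Units only gain weight, so two units that were too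
  heavy together at an earlier arc remain so, unless they have become one unit. Each arc causes at
  most one renaming pass over the vertices, which is within \<open>D\<close>.\<close>

lemma merge_units:
  assumes g: "gctx s" and P: "arr s ''part'' = P" and ok: "units_ok P (arr s ''unit'')" and wu: "wu_ok P (arr s ''unit'') (arr s ''wU'')"
  shows "wp merge_units (\<lambda>t s'. gctx s' \<and> arr s' ''part'' = P \<and> units_ok P (arr s' ''unit'') \<and>
     wu_ok P (arr s' ''unit'') (arr s' ''wU'') \<and> coarser P (arr s ''unit'') (arr s' ''unit'') \<and>
     separated P (arr s' ''unit'') \<and> t \<le> 200 * D) s"
proof -
  define sep where "sep i Ut \<longleftrightarrow> (\<forall>a. 1 \<le> a \<and> a < i \<and> P (sr a) = 0 \<and> P (tg a) = 0 \<and> Ut (sr a) \<noteq> Ut (tg a) -->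
     W \<le> w (uset P Ut (Ut (sr a))) + w (uset P Ut (Ut (tg a))))" for i and Ut :: "nat \<Rightarrow> nat"
  define I where "I i s' \<longleftrightarrow> gctx s' \<and> arr s' ''part'' = P \<and> units_ok P (arr s' ''unit'') \<and>
     wu_ok P (arr s' ''unit'') (arr s' ''wU'') \<and> coarser P (arr s ''unit'') (arr s' ''unit'') \<and> sep i (arr s' ''unit'')" for i s'
  show ?thesis
    unfolding merge_units_def
  proof (rule wp_For[where I = I and l = 1 and h = "Suc M" and K = "n * 17 + 60"], goal_cases)
    case 3
    then show ?case using g P ok wu by (simp add: I_def gctx_def sep_def coarser_def)
  next
    case (4 i s')
    then show ?case by (simp add: I_def gctx_def)
  next
    case (5 i s')
    let ?U = "arr s' ''unit''"
    define x y where "x = sr i" and "y = tg i"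
    have J: "gctx s'" "arr s' ''part'' = P" "units_ok P ?U" "wu_ok P ?U (arr s' ''wU'')"
      "coarser P (arr s ''unit'') ?U" "sep i ?U" using 5 unfolding I_def by auto
    have xy: "adj x y" "x < n" "y < n" using 5 sr tg unfolding adj_def x_def y_def by auto
    have wx: "P v = 0 ==> v < n ==> arr s' ''wU'' (?U v) = w (uset P ?U (?U v))" for v
      using J(4) unfolding wu_ok_def by blast
    show ?case
    proof (cases "P x = 0 \<and> P y = 0 \<and> ?U x \<noteq> ?U y \<and> w (uset P ?U (?U x)) + w (uset P ?U (?U y)) < W")
      case False
      have "sep (Suc i) ?U"
        using J(6) False unfolding sep_def x_def y_def by (metis less_Suc_eq not_less)
      then have II: "I (Suc i) (s'\<lparr>reg := (reg s')(''p'' := ?U x, ''q'' := ?U y, ''a'' := Suc i)\<rparr>)"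
        using J by (simp add: I_def gctx_def)
      have nc: "\<not> (P x = 0 \<and> P y = 0 \<and> ?U x \<noteq> ?U y \<and> arr s' ''wU'' (?U x) + arr s' ''wU'' (?U y) < W)"
        using False wx xy by auto
      show ?thesis
        using J(1,2) nc 5(2) II
        by (simp add: gctx_def x_def[symmetric] y_def[symmetric], intro impI, elim conjE disjE; simp)
    next
      case True
      define p q where "p = ?U x" and "q = ?U y"
      define U1 where "U1 = (\<lambda>v. if 0 \<le> v \<and> v < n then (if ?U v = q then p else ?U v) else ?U v)"
      define s1 where "s1 = s'\<lparr>reg := (reg s')(''p'' := p, ''q'' := q), arr := (arr s')(''wU'' := (arr s' ''wU'')(p := arr s' ''wU'' p + arr s' ''wU'' q))\<rparr>"
      have "U1 v = (if ?U v = ?U y then ?U x else ?U v)" if "v < n" for v using that by (simp add: U1_def p_def q_def)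
      note m = merge_step[OF J(3,4) xy(1) _ _ _ _ this]
      have wpq: "arr s' ''wU'' p = w (uset P ?U (?U x))" "arr s' ''wU'' q = w (uset P ?U (?U y))"
        using wx xy True unfolding p_def q_def by auto
      have sep: "sep (Suc i) U1"
        unfolding sep_def
      proof (intro allI impI, elim conjE)
        fix a assume a: "1 \<le> a" "a < Suc i" "P (sr a) = 0" "P (tg a) = 0" "U1 (sr a) \<noteq> U1 (tg a)"
        have an: "sr a < n" "tg a < n" using a 5 sr tg by auto
        have "?U (sr a) \<noteq> ?U (tg a)" using m(3) True a(3-5) an unfolding coarser_def by metis
        moreover have "a \<noteq> i" using a(5) m(5) True unfolding x_def y_def by auto
        ultimately have "W \<le> w (uset P ?U (?U (sr a))) + w (uset P ?U (?U (tg a)))" using J(6) a unfolding sep_def by auto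
        also have "\<dots> \<le> w (uset P U1 (U1 (sr a))) + w (uset P U1 (U1 (tg a)))"
          by (rule add_mono) (use m(4) True a an in blast)+
        finally show "W \<le> w (uset P U1 (U1 (sr a))) + w (uset P U1 (U1 (tg a)))" .
      qed
      have st: "wp (For ''v'' (N 0) (R ''n'')
        (Cond (Equal (C ''unit'' (R ''v'')) (R ''q'')) (Store ''unit'' (R ''v'') (R ''p'')) Skip))
        (\<lambda>t s2. s2 = s1\<lparr>reg := (reg s1)(''v'' := n), arr := (arr s1)(''unit'' := U1)\<rparr> \<and> t \<le> n * 17 + 10) s1"
        by (rule wp_For_map[where a = "''unit''" and l = 0 and h = n and vl = "\<lambda>v. if ?U v = q then p else ?U v" and K = 9])
           (use J(1) in \<open>simp_all add: gctx_def s1_def U1_def fun_upd_idem cong: if_cong\<close>)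
      have m2: "wu_ok P U1 ((arr s' ''wU'')(p := arr s' ''wU'' p + arr s' ''wU'' q))"
        using m(2) True unfolding wpq by (simp add: p_def q_def)
      have U1: "units_ok P U1" by (rule m(1)) (use True in auto)
      have U2: "coarser P (arr s ''unit'') U1" by (rule coarser_trans[OF J(5) m(3)]) (use True in auto)
      have fin: "I (Suc i) (s1\<lparr>reg := (reg s1)(''v'' := n, ''a'' := Suc i), arr := (arr s1)(''unit'' := U1)\<rparr>)"
        unfolding I_def using J(1,2) U1 U2 m2 sep by (simp add: s1_def gctx_def)
      have st': "wp (For ''v'' (N 0) (R ''n'')
        (Cond (Equal (C ''unit'' (R ''v'')) (R ''q'')) (Store ''unit'' (R ''v'') (R ''p'')) Skip))
        (\<lambda>t s2. reg s2 ''a'' = i \<and> I (Suc i) (s2\<lparr>reg := (reg s2)(''a'' := Suc i)\<rparr>) \<and> t \<le> n * 17 + 10) s1"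
      proof (rule wp_mono[OF st], elim conjE)
        fix t s2 assume "s2 = s1\<lparr>reg := (reg s1)(''v'' := n), arr := (arr s1)(''unit'' := U1)\<rparr>" "t \<le> n * 17 + 10"
        then show "reg s2 ''a'' = i \<and> I (Suc i) (s2\<lparr>reg := (reg s2)(''a'' := Suc i)\<rparr>) \<and> t \<le> n * 17 + 10"
          using fin 5(2) by (simp add: s1_def)
      qed
      have s1: "s1 = s'\<lparr>reg := (reg s')(''p'' := p, ''q'' := q), arr := (arr s')(''wU'' := (arr s' ''wU'')
          (p := w (uset P ?U p) + w (uset P ?U q)))\<rparr>"
        by (simp add: s1_def wpq) (simp add: p_def q_def)
      show ?thesis
        using J(1,2) True 5(2)
        apply (simp add: gctx_def x_def[symmetric] y_def[symmetric] p_def[symmetric] q_def[symmetric] wpq s1[symmetric])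
        apply (rule wp_mono[OF st'])
        apply simp
        done
    qed
  next
    case (6 s' t)
    have "separated P (arr s' ''unit'')"
      using 6 unfolding I_def sep_def separated_def adj_def by (metis less_Suc_eq_le)
    moreover have "t \<le> 200 * D" using 6(3) unfolding D_def by (simp add: algebra_simps)
    ultimately show ?case using 6 unfolding I_def by blast
  qed simp_all
qed

end

section \<open>Breadth-first search\<close>

context packing
begin

text \<open>A search that began at queue position \<open>t0\<close> with marks \<open>seen0\<close>.
  Completeness is the clause on arcs: those of finished vertices, and those of the current vertex
  above \<open>ptr\<close>, lead to marked vertices of the class.\<close>

definition BI :: "(nat \<Rightarrow> nat) \<Rightarrow> nat \<Rightarrow> nat \<Rightarrow> nat \<Rightarrow> (nat \<Rightarrow> nat) \<Rightarrow> nat \<Rightarrow> nat \<Rightarrow> nat \<Rightarrow>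
    (nat \<Rightarrow> nat) \<Rightarrow> (nat \<Rightarrow> nat) \<Rightarrow> (nat \<Rightarrow> nat) \<Rightarrow> nat \<Rightarrow> bool" where
  "BI P cl r t0 seen0 qh qt ptr q par seen ac \<longleftrightarrow>
     t0 \<le> qh \<and> qh \<le> qt \<and> t0 < qt \<and> q t0 = r \<and> (qh < qt --> ptr \<le> M \<and> (ptr \<noteq> 0 --> sr ptr = q qh)) \<and>
     (\<forall>l. t0 \<le> l \<and> l < qt --> q l < n \<and> P (q l) = cl \<and> seen (q l) = Suc l \<and> seen0 (q l) = 0) \<and>
     (\<forall>l. t0 < l \<and> l < qt --> t0 \<le> par l \<and> par l < l \<and> adj (q (par l)) (q l)) \<and>
     (\<forall>v. v \<notin> q ` {t0..<qt} --> seen v = seen0 v) \<and>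
     (\<forall>a. 1 \<le> a \<and> a \<le> M \<and> P (tg a) = cl \<and> (sr a \<in> q ` {t0..<qh} \<or> (qh < qt \<and> sr a = q qh \<and> ptr < a)) -->
        seen (tg a) \<noteq> 0) \<and>
     ac = (\<Sum>l = t0..<qt. wt (q l))"

definition unseen :: "(nat \<Rightarrow> nat) \<Rightarrow> nat" where "unseen seen = card {v. v < n \<and> seen v = 0}"

text \<open>Arcs still to be scanned, in this search or in a later one.\<close>

definition pend :: "nat \<Rightarrow> nat \<Rightarrow> nat \<Rightarrow> (nat \<Rightarrow> nat) \<Rightarrow> (nat \<Rightarrow> nat) \<Rightarrow> nat set" where
  "pend qh qt ptr q seen = {a. 1 \<le> a \<and> a \<le> M \<and>
     (seen (sr a) = 0 \<or> sr a \<in> q ` {Suc qh..<qt} \<or> (qh < qt \<and> sr a = q qh \<and> a \<le> ptr))}"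

text \<open>Budget between two searches: unmarked vertices and arcs with an unmarked source. A
  search pays for itself, up to a constant, by what it marks, so any sequence of searches is linear
  in total.\<close>

definition bpot :: "(nat \<Rightarrow> nat) \<Rightarrow> nat" where
  "bpot seen = 50 * (card {a. 1 \<le> a \<and> a \<le> M \<and> seen (sr a) = 0} + 2 * unseen seen)"

definition lpot :: "nat \<Rightarrow> nat \<Rightarrow> nat \<Rightarrow> (nat \<Rightarrow> nat) \<Rightarrow> (nat \<Rightarrow> nat) \<Rightarrow> nat" where
  "lpot qh qt ptr q seen = 50 * (card (pend qh qt ptr q seen) + 2 * unseen seen + (qt - qh))"

lemma fin_pend: "finite (pend qh qt ptr q seen)"
  unfolding pend_def by (rule finite_subset[of _ "{..M}"]) auto

lemma unseen_upd: "v < n ==> seen v = 0 ==> unseen seen = Suc (unseen (seen(v := Suc x)))"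
proof -
  assume v: "v < n" "seen v = 0"
  have "{u. u < n \<and> (seen(v := Suc x)) u = 0} = {u. u < n \<and> seen u = 0} - {v}" by auto
  moreover have "card {u. u < n \<and> seen u = 0} = Suc (card ({u. u < n \<and> seen u = 0} - {v}))"
    by (rule card.remove) (use v in auto)
  ultimately show ?thesis unfolding unseen_def by presburger
qed

lemma BI_next:
  assumes B: "BI P cl r t0 seen0 qh qt 0 q par seen ac" and h: "qh < qt"
  shows "BI P cl r t0 seen0 (Suc qh) qt (vfi (q (Suc qh))) q par seen ac"
    and "lpot (Suc qh) qt (vfi (q (Suc qh))) q seen + 50 \<le> lpot qh qt 0 q seen"
proof -
  have q: "q l < n" if "t0 \<le> l" "l < qt" for l using B that unfolding BI_def by blast
  have t: "t0 \<le> qh" using B unfolding BI_def by blast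
  have v: "vfi (q (Suc qh)) \<le> M \<and> (vfi (q (Suc qh)) \<noteq> 0 --> sr (vfi (q (Suc qh))) = q (Suc qh)) \<and>
      (\<forall>b. vfi (q (Suc qh)) < b \<and> b \<le> M --> sr b \<noteq> q (Suc qh))" if "Suc qh < qt"
    using vfi[OF q] that t by auto
  have im: "q ` {t0..<Suc qh} = insert (q qh) (q ` {t0..<qh})"
    using t by (simp add: atLeastLessThanSuc)
  show "BI P cl r t0 seen0 (Suc qh) qt (vfi (q (Suc qh))) q par seen ac"
    using B h v unfolding BI_def im by (simp add: Suc_le_eq) (metis not_less)
  have "pend (Suc qh) qt (vfi (q (Suc qh))) q seen \<subseteq> pend qh qt 0 q seen"
    unfolding pend_def by auto
  then have "card (pend (Suc qh) qt (vfi (q (Suc qh))) q seen) \<le> card (pend qh qt 0 q seen)"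
    by (rule card_mono[OF fin_pend])
  then show "lpot (Suc qh) qt (vfi (q (Suc qh))) q seen + 50 \<le> lpot qh qt 0 q seen"
    using h unfolding lpot_def by simp
qed

lemma BI_skip:
  assumes B: "BI P cl r t0 seen0 qh qt ptr q par seen ac" and h: "qh < qt" "ptr \<noteq> 0"
    and no: "\<not> (P (tg ptr) = cl \<and> seen (tg ptr) = 0)"
  shows "BI P cl r t0 seen0 qh qt (vnx ptr) q par seen ac"
    and "lpot qh qt (vnx ptr) q seen + 50 \<le> lpot qh qt ptr q seen"
proof -
  have p: "1 \<le> ptr" "ptr \<le> M" "sr ptr = q qh" "t0 \<le> qh" using B h unfolding BI_def by auto
  have v: "vnx ptr < ptr" "vnx ptr \<noteq> 0 --> sr (vnx ptr) = sr ptr" "\<And>b. vnx ptr < b ==> b < ptr ==> sr b \<noteq> sr ptr"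
    using vnx[OF p(1,2)] by auto
  have "seen (tg a) \<noteq> 0" if a: "1 \<le> a" "a \<le> M" "P (tg a) = cl" "sr a = q qh" "vnx ptr < a" for a
  proof -
    consider "a < ptr" | "a = ptr" | "ptr < a" by linarith
    then show ?thesis
    proof cases
      case 1 then show ?thesis using v(3)[OF a(5)] a p by simp
    next
      case 2 then show ?thesis using no a by simp
    next
      case 3 then show ?thesis using B a h unfolding BI_def by blast
    qed
  qed
  then have "\<forall>a. 1 \<le> a \<and> a \<le> M \<and> P (tg a) = cl \<and> (sr a \<in> q ` {t0..<qh} \<or> (qh < qt \<and> sr a = q qh \<and> vnx ptr < a)) -->
        seen (tg a) \<noteq> 0"
    using B unfolding BI_def by blast
  moreover have "qh < qt --> vnx ptr \<le> M \<and> (vnx ptr \<noteq> 0 --> sr (vnx ptr) = q qh)" using v(1,2) p by simp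
  ultimately show "BI P cl r t0 seen0 qh qt (vnx ptr) q par seen ac"
    using B unfolding BI_def by (elim conjE, intro conjI) assumption+
  \<comment> \<open>Marks record queue positions, so the current vertex is not queued a second time
    and its scanned arc really leaves \<open>pend\<close>.\<close>
  have inj: "q l \<noteq> q qh" if "qh < l" "l < qt" for l
  proof -
    have "seen (q l) = Suc l" "seen (q qh) = Suc qh" using B that p unfolding BI_def by auto
    then show ?thesis using that by auto
  qed
  have sq: "seen (q qh) = Suc qh" using B h p unfolding BI_def by auto
  have "pend qh qt (vnx ptr) q seen \<subseteq> pend qh qt ptr q seen - {ptr}"
    using v(1) p inj sq unfolding pend_def by (auto simp: Suc_le_eq)
  then have "card (pend qh qt (vnx ptr) q seen) \<le> card (pend qh qt ptr q seen - {ptr})"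
    by (rule card_mono[rotated]) (simp add: fin_pend)
  moreover have "ptr \<in> pend qh qt ptr q seen" using p h unfolding pend_def by auto
  then have "card (pend qh qt ptr q seen) = Suc (card (pend qh qt ptr q seen - {ptr}))"
    using fin_pend by (metis card.remove)
  ultimately show "lpot qh qt (vnx ptr) q seen + 50 \<le> lpot qh qt ptr q seen"
    unfolding lpot_def by simp
qed

text \<open>The arcs of the new vertex move from the unmarked to the queued part of
  \<open>pend\<close>, which therefore does not grow. The factor 2 on \<open>unseen\<close> pays for
  the longer queue and for the step.\<close>

lemma BI_add:
  assumes B: "BI P cl r t0 seen0 qh qt ptr q par seen ac" and h: "qh < qt" "ptr \<noteq> 0"
    and y: "P (tg ptr) = cl" "seen (tg ptr) = 0"
  shows "BI P cl r t0 seen0 qh (Suc qt) ptr (q(qt := tg ptr)) (par(qt := qh)) (seen(tg ptr := Suc qt)) (ac + wt (tg ptr))"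
    and "lpot qh (Suc qt) ptr (q(qt := tg ptr)) (seen(tg ptr := Suc qt)) + 50 \<le> lpot qh qt ptr q seen"
proof -
  let ?y = "tg ptr" and ?q = "q(qt := tg ptr)" and ?s = "seen(tg ptr := Suc qt)"
  have p: "1 \<le> ptr" "ptr \<le> M" "sr ptr = q qh" "t0 \<le> qh" using B h unfolding BI_def by auto
  have yn: "?y < n" using tg p by simp
  have a: "adj (q qh) ?y" using p unfolding adj_def by auto
  have ny: "q l \<noteq> ?y" if "t0 \<le> l" "l < qt" for l
  proof -
    have "seen (q l) = Suc l" using B that unfolding BI_def by blast
    then show ?thesis using y by auto
  qed
  have B1: "t0 \<le> qh" "qh \<le> qt" "t0 < qt" "q t0 = r" "qh < qt --> ptr \<le> M \<and> (ptr \<noteq> 0 --> sr ptr = q qh)"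
    and B2: "\<And>l. t0 \<le> l ==> l < qt ==> q l < n \<and> P (q l) = cl \<and> seen (q l) = Suc l \<and> seen0 (q l) = 0"
    and B3: "\<And>l. t0 < l ==> l < qt ==> t0 \<le> par l \<and> par l < l \<and> adj (q (par l)) (q l)"
    and B4: "\<And>v. v \<notin> q ` {t0..<qt} ==> seen v = seen0 v"
    and B5: "\<And>a. 1 \<le> a \<and> a \<le> M \<and> P (tg a) = cl \<and> (sr a \<in> q ` {t0..<qh} \<or> (qh < qt \<and> sr a = q qh \<and> ptr < a)) ==>
        seen (tg a) \<noteq> 0"
    and B6: "ac = (\<Sum>l = t0..<qt. wt (q l))"
    using B unfolding BI_def by (elim conjE, blast)+
  have nyq: "?y \<notin> q ` {t0..<qt}" using ny by fastforce
  have s0: "seen0 ?y = 0" using B4[OF nyq] y by simp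
  have im: "?q ` {t0..<Suc qt} = insert ?y (q ` {t0..<qt})"
    using p h by (auto simp: image_iff less_Suc_eq)
  have im2: "?q ` {t0..<qh} = q ` {t0..<qh}" using h by (auto simp: image_iff)
  have "(\<Sum>l = t0..<Suc qt. wt (?q l)) = (\<Sum>l = t0..<qt. wt (?q l)) + wt ?y" using p h by simp
  also have "(\<Sum>l = t0..<qt. wt (?q l)) = (\<Sum>l = t0..<qt. wt (q l))" by (intro sum.cong) auto
  finally have sm: "(\<Sum>l = t0..<Suc qt. wt (?q l)) = (\<Sum>l = t0..<qt. wt (q l)) + wt ?y" .
  have c2: "?q l < n \<and> P (?q l) = cl \<and> ?s (?q l) = Suc l \<and> seen0 (?q l) = 0" if l: "t0 \<le> l" "l < Suc qt" for l
  proof (cases "l = qt")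
    case True then show ?thesis using yn y s0 by simp
  next
    case False then show ?thesis using B2[of l] ny[of l] l by simp
  qed
  have c3: "t0 \<le> (par(qt := qh)) l \<and> (par(qt := qh)) l < l \<and> adj (?q ((par(qt := qh)) l)) (?q l)"
    if l: "t0 < l" "l < Suc qt" for l
  proof (cases "l = qt")
    case True then show ?thesis using a h B1 by simp
  next
    case False then show ?thesis using B3[of l] l by simp
  qed
  have c4: "?s v = seen0 v" if "v \<notin> insert ?y (q ` {t0..<qt})" for v using B4 that by simp
  have c5: "?s (tg a) \<noteq> 0" if "1 \<le> a \<and> a \<le> M \<and> P (tg a) = cl \<and>
     (sr a \<in> q ` {t0..<qh} \<or> (qh < Suc qt \<and> sr a = ?q qh \<and> ptr < a))" for a
    using B5[of a] that h by simp
  show "BI P cl r t0 seen0 qh (Suc qt) ptr ?q (par(qt := qh)) ?s (ac + wt ?y)"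
    unfolding BI_def im im2 sm B6
    by (intro conjI allI impI) (use B1 h p c2 c3 c4 c5 in \<open>simp_all del: fun_upd_apply\<close>, simp_all)
  have "pend qh (Suc qt) ptr ?q ?s \<subseteq> pend qh qt ptr q seen"
  proof
    fix a assume a: "a \<in> pend qh (Suc qt) ptr ?q ?s"
    have "?q ` {Suc qh..<Suc qt} \<subseteq> insert ?y (q ` {Suc qh..<qt})" by (auto simp: less_Suc_eq)
    then have "sr a = ?y \<or> seen (sr a) = 0 \<or> sr a \<in> q ` {Suc qh..<qt} \<or> (sr a = q qh \<and> a \<le> ptr)"
      using a h unfolding pend_def by (cases "sr a = ?y") auto
    then show "a \<in> pend qh qt ptr q seen" using a h y unfolding pend_def by auto
  qed
  then have "card (pend qh (Suc qt) ptr ?q ?s) \<le> card (pend qh qt ptr q seen)"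
    by (rule card_mono[OF fin_pend])
  then show "lpot qh (Suc qt) ptr ?q ?s + 50 \<le> lpot qh qt ptr q seen"
    using unseen_upd[of ?y seen qt] yn y(2) h unfolding lpot_def by simp
qed

lemma BI_start:
  assumes r: "r < n" "P r = cl" "seen0 r = 0"
  shows "BI P cl r t0 seen0 t0 (Suc t0) (vfi r) (q(t0 := r)) par (seen0(r := Suc t0)) (wt r)"
    and "lpot t0 (Suc t0) (vfi r) (q(t0 := r)) (seen0(r := Suc t0)) + 50 \<le> bpot seen0"
proof -
  have im: "{t0..<Suc t0} = {t0}" by auto
  show "BI P cl r t0 seen0 t0 (Suc t0) (vfi r) (q(t0 := r)) par (seen0(r := Suc t0)) (wt r)"
    unfolding BI_def im using r vfi[OF r(1)] by auto
  have "pend t0 (Suc t0) (vfi r) (q(t0 := r)) (seen0(r := Suc t0)) \<subseteq> {a. 1 \<le> a \<and> a \<le> M \<and> seen0 (sr a) = 0}"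
    unfolding pend_def using r by (auto split: if_splits)
  then have "card (pend t0 (Suc t0) (vfi r) (q(t0 := r)) (seen0(r := Suc t0))) \<le> card {a. 1 \<le> a \<and> a \<le> M \<and> seen0 (sr a) = 0}"
    by (rule card_mono[rotated]) (auto intro: finite_subset[of _ "{..M}"])
  then show "lpot t0 (Suc t0) (vfi r) (q(t0 := r)) (seen0(r := Suc t0)) + 50 \<le> bpot seen0"
    using unseen_upd[of r seen0 t0] r unfolding lpot_def bpot_def by simp
qed

lemma bpot_le_lpot: "bpot seen \<le> lpot qh qt ptr q seen"
proof -
  have "card {a. 1 \<le> a \<and> a \<le> M \<and> seen (sr a) = 0} \<le> card (pend qh qt ptr q seen)"
    by (rule card_mono[OF fin_pend]) (auto simp: pend_def)
  then show ?thesis unfolding bpot_def lpot_def by simp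
qed

lemma bfs:
  assumes g: "gctx s" and P: "arr s ''part'' = P" and cl: "reg s ''cl'' = cl" and r: "reg s ''r'' = r" "r < n" "P r = cl"
    and seen: "arr s ''seen'' = seen0" "seen0 r = 0" and t0: "reg s ''qt'' = t0"
  shows "wp bfs (\<lambda>t s'. BI P cl r t0 seen0 (reg s' ''qt'') (reg s' ''qt'') 0 (arr s' ''q'') (arr s' ''par'') (arr s' ''seen'') (reg s' ''ac'') \<and>
     gctx s' \<and> t + bpot (arr s' ''seen'') \<le> bpot seen0 + 50) s"
proof -
  define I where "I s' \<longleftrightarrow> gctx s' \<and> arr s' ''part'' = P \<and> reg s' ''cl'' = cl \<and>
    BI P cl r t0 seen0 (reg s' ''qh'') (reg s' ''qt'') (reg s' ''ptr'') (arr s' ''q'') (arr s' ''par'') (arr s' ''seen'') (reg s' ''ac'')" for s' :: store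
  define p where "p s' = lpot (reg s' ''qh'') (reg s' ''qt'') (reg s' ''ptr'') (arr s' ''q'') (arr s' ''seen'')" for s' :: store
  define body where "body = Cond (Equal (R ''ptr'') (N 0))
     (inc ''qh'' ;; ''ptr'' ::= C ''vfi'' (C ''q'' (R ''qh'')))
     (''y'' ::= C ''tgt'' (R ''ptr'') ;;
      Cond (Conj (Equal (C ''part'' (R ''y'')) (R ''cl'')) (Equal (C ''seen'' (R ''y'')) (N 0)))
       (Store ''q'' (R ''qt'') (R ''y'') ;; Store ''par'' (R ''qt'') (R ''qh'') ;; inc ''qt'' ;;
        Store ''seen'' (R ''y'') (R ''qt'') ;;
        ''ac'' ::= Plus (R ''ac'') (C ''weight'' (R ''y''))) Skip ;;
      ''ptr'' ::= C ''vnx'' (R ''ptr''))"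
  have loop: "wp (While (Less (R ''qh'') (R ''qt'')) body)
    (\<lambda>t s'. I s' \<and> reg s' ''qh'' = reg s' ''qt'' \<and> t + p s' \<le> p s1 + 4) s1" if "I s1" for s1
  proof (rule wp_while[where I = I and p = p], goal_cases)
    case (2 s2)
    then have B: "BI P cl r t0 seen0 (reg s2 ''qh'') (reg s2 ''qt'') (reg s2 ''ptr'') (arr s2 ''q'') (arr s2 ''par'') (arr s2 ''seen'') (reg s2 ''ac'')"
      and G: "gctx s2" "arr s2 ''part'' = P" "reg s2 ''cl'' = cl" and h: "reg s2 ''qh'' < reg s2 ''qt''" unfolding I_def by auto
    show ?case
    proof (cases "reg s2 ''ptr'' = 0")
      case True
      show ?thesis using BI_next[OF B[unfolded True] h] G True
        by (simp add: body_def I_def p_def gctx_def)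
    next
      case ptr: False
      let ?y = "tg (reg s2 ''ptr'')"
      show ?thesis
      proof (cases "P ?y = cl \<and> arr s2 ''seen'' ?y = 0")
        case False
        then show ?thesis using BI_skip[OF B h ptr False] G ptr
          by (cases "P ?y = cl") (simp_all add: body_def I_def p_def gctx_def)
      next
        case True
        note A = BI_add[OF B h ptr conjunct1[OF True] conjunct2[OF True]]
        have h': "reg s2 ''qh'' < Suc (reg s2 ''qt'')" using h by simp
        let ?q = "(arr s2 ''q'')(reg s2 ''qt'' := ?y)" and ?s = "(arr s2 ''seen'')(?y := Suc (reg s2 ''qt''))"
        have S: "BI P cl r t0 seen0 (reg s2 ''qh'') (Suc (reg s2 ''qt'')) (vnx (reg s2 ''ptr'')) ?q
            ((arr s2 ''par'')(reg s2 ''qt'' := reg s2 ''qh'')) ?s (reg s2 ''ac'' + wt ?y)"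
          by (rule BI_skip(1)[OF A(1) h' ptr]) simp
        have S2: "lpot (reg s2 ''qh'') (Suc (reg s2 ''qt'')) (vnx (reg s2 ''ptr'')) ?q ?s + 50 \<le>
            lpot (reg s2 ''qh'') (Suc (reg s2 ''qt'')) (reg s2 ''ptr'') ?q ?s"
          by (rule BI_skip(2)[OF A(1) h' ptr]) simp
        show ?thesis using S S2 A(2) G ptr True h
          by (simp add: body_def I_def p_def gctx_def)
      qed
    qed
  next
    case (3 s2 t)
    then have "reg s2 ''qh'' = reg s2 ''qt''" unfolding I_def BI_def by simp
    then show ?case using 3 by simp
  qed (use that in simp)
  define s1 where "s1 = s\<lparr>reg := (reg s)(''qh'' := t0, ''qt'' := Suc t0, ''ptr'' := vfi r, ''ac'' := wt r),
     arr := (arr s)(''q'' := (arr s ''q'')(t0 := r), ''seen'' := seen0(r := Suc t0))\<rparr>"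
  have I1: "I s1" and p1: "p s1 + 50 \<le> bpot seen0"
    using BI_start(1)[of r P cl seen0 t0 "arr s ''q''" "arr s ''par''"] BI_start(2)[of r P cl seen0 t0 "arr s ''q''"] r seen g P cl by (simp_all add: I_def p_def s1_def gctx_def)
  have fin: "BI P cl r t0 seen0 (reg s' ''qt'') (reg s' ''qt'') 0 (arr s' ''q'') (arr s' ''par'') (arr s' ''seen'') (reg s' ''ac'') \<and>
     gctx s' \<and> t + bpot (arr s' ''seen'') + 46 \<le> bpot seen0" if "I s' \<and> reg s' ''qh'' = reg s' ''qt'' \<and> t + p s' \<le> p s1 + 4" for t s'
  proof -
    have "BI P cl r t0 seen0 (reg s' ''qt'') (reg s' ''qt'') 0 (arr s' ''q'') (arr s' ''par'') (arr s' ''seen'') (reg s' ''ac'')"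
      using that unfolding I_def BI_def by simp
    moreover have "bpot (arr s' ''seen'') \<le> p s'" unfolding p_def by (rule bpot_le_lpot)
    ultimately show ?thesis using that p1 unfolding I_def by simp
  qed
  show ?thesis
    unfolding bfs_def body_def[symmetric] using g r seen t0
    apply (simp add: gctx_def)
    apply (rule wp_eq[OF loop[OF I1]])
     apply (simp add: s1_def)
    apply (drule fin)
    apply (simp add: gctx_def)
    done
qed

end

lemma wp_For_add:
  assumes lo: "aval lo s = 0"
    and hi: "\<And>i g. aval hi (s\<lparr>reg := (reg s)(x := i), arr := (arr s)(a := g)\<rparr>) = h"
    and b: "\<And>i g. i < h ==> bval b (s\<lparr>reg := (reg s)(x := i), arr := (arr s)(a := g)\<rparr>) = cn i"
    and f: "\<And>i g. i < h ==> cn i ==> aval f (s\<lparr>reg := (reg s)(x := i), arr := (arr s)(a := g)\<rparr>) = ix i"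
    and e: "\<And>i g. i < h ==> cn i ==> aval e (s\<lparr>reg := (reg s)(x := i), arr := (arr s)(a := g)\<rparr>) = vl i"
    and post: "\<And>t. t \<le> h * (bcost b + 2 * acost f + acost e + acost hi + 15) + acost lo + acost hi + 5 ==>
      Q t (s\<lparr>reg := (reg s)(x := h), arr := (arr s)(a := \<lambda>y. arr s a y + (\<Sum>v | v < h \<and> cn v \<and> ix v = y. vl v))\<rparr>)"
  shows "wp (For x lo hi (Cond b (Store a f (Plus (Cell a f) e)) Skip)) Q s"
proof (rule wp_For_seq[where l = 0 and h = h and K = "bcost b + 2 * acost f + acost e + 8" and
    S = "\<lambda>i. s\<lparr>reg := (reg s)(x := i), arr := (arr s)(a := \<lambda>y. arr s a y + (\<Sum>v | v < i \<and> cn v \<and> ix v = y. vl v))\<rparr>"], goal_cases)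
  case (6 i)
  let ?g = "\<lambda>i y. arr s a y + (\<Sum>v | v < i \<and> cn v \<and> ix v = y. vl v)"
  show ?case
  proof (cases "cn i")
    case True
    have "?g (Suc i) y = ((?g i)(ix i := ?g i (ix i) + vl i)) y" for y
    proof (cases "y = ix i")
      case y: True
      have "{v. v < Suc i \<and> cn v \<and> ix v = y} = insert i {v. v < i \<and> cn v \<and> ix v = y}" using True y by auto
      then show ?thesis using y by simp
    next
      case y: False
      then have "{v. v < Suc i \<and> cn v \<and> ix v = y} = {v. v < i \<and> cn v \<and> ix v = y}" by (auto simp: less_Suc_eq)
      then show ?thesis using y by simp
    qed
    then have "(?g i)(ix i := ?g i (ix i) + vl i) = ?g (Suc i)" by (intro ext) metis
    then show ?thesis using 6 True by (simp add: b f e)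
  next
    case False
    have "{v. v < Suc i \<and> cn v \<and> ix v = y} = {v. v < i \<and> cn v \<and> ix v = y}" for y using False by (auto simp: less_Suc_eq)
    then show ?thesis using 6 False by (simp add: b)
  qed
next
  case (7 t)
  then show ?case by (intro post) (simp add: add_ac)
qed (use lo hi in auto)

section \<open>Spanning trees of cores\<close>

text \<open>The test \<open>p l < l\<close> makes the recursion terminate for arbitrary
  \<open>p\<close>; on tree positions it always succeeds.\<close>

fun anc :: "(nat \<Rightarrow> nat) \<Rightarrow> nat \<Rightarrow> nat \<Rightarrow> bool" where
  "anc p i l = (if l = i then True else if 0 < l \<and> p l < l then anc p i (p l) else False)"

declare anc.simps [simp del]

lemma anc_refl: "anc p i i" by (subst anc.simps) simp

lemma anc_step: "l \<noteq> i ==> p l < l ==> anc p i l = anc p i (p l)"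
  by (subst anc.simps) simp

lemma anc_0: "anc p i 0 \<longleftrightarrow> i = 0"
  by (subst anc.simps) auto

lemma anc_le: "anc p i l ==> i \<le> l"
proof (induction l rule: less_induct)
  case (less l)
  show ?case
  proof (cases "l = i")
    case False
    then have "p l < l" "anc p i (p l)" using less.prems by (subst (asm) anc.simps, simp split: if_splits)+
    then show ?thesis using less.IH[of "p l"] by simp
  qed simp
qed

context packing
begin

definition tree :: "(nat \<Rightarrow> nat) \<Rightarrow> nat \<Rightarrow> (nat \<Rightarrow> nat) \<Rightarrow> (nat \<Rightarrow> nat) \<Rightarrow> (nat \<Rightarrow> nat) \<Rightarrow> nat \<Rightarrow> bool" where
  "tree P j q par pos qt \<longleftrightarrow> 0 < qt \<and> (\<forall>l < qt. q l < n \<and> P (q l) = j \<and> pos (q l) = Suc l) \<and>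
     (\<forall>l. 0 < l \<and> l < qt --> par l < l \<and> adj (q (par l)) (q l)) \<and> (\<forall>v < n. P v = j --> (\<exists>l < qt. q l = v))"

lemma treeD:
  assumes "tree P j q par pos qt"
  shows "0 < qt" "\<And>l. l < qt ==> q l < n \<and> P (q l) = j \<and> pos (q l) = Suc l"
    "\<And>l. 0 < l ==> l < qt ==> par l < l \<and> adj (q (par l)) (q l)" "\<And>v. v < n ==> P v = j ==> \<exists>l < qt. q l = v"
  using assms unfolding tree_def by blast+

text \<open>Both size bounds serve to bound \<open>m * m\<close> by \<open>D\<close> for a tree of
  size \<open>m\<close>: \<open>q\<close> embeds positions into vertices, and each position other
  than the root has an arc of its own, coming from its parent.\<close>

lemma tree_size:
  assumes T: "tree P j q par pos qt"
  shows "inj_on q {..<qt}" and "qt \<le> n" and "qt \<le> M + 1" and "q ` {..<qt} = cls P j"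
proof -
  show inj: "inj_on q {..<qt}"
    by (rule inj_onI) (metis lessThan_iff nat.inject treeD(2)[OF T])
  show "q ` {..<qt} = cls P j" unfolding cls_def using treeD(2,4)[OF T] by (auto simp: image_iff)
  have "card {..<qt} \<le> card {..<n}"
    by (rule card_inj_on_le[OF inj]) (use treeD(2)[OF T] in auto)
  then show "qt \<le> n" by simp
  define f where "f l = (SOME a. 1 \<le> a \<and> a \<le> M \<and> tg a = q l)" for l
  have f: "1 \<le> f l \<and> f l \<le> M \<and> tg (f l) = q l" if "l \<in> {1..<qt}" for l
  proof -
    have "\<exists>a. 1 \<le> a \<and> a \<le> M \<and> tg a = q l" using treeD(3)[OF T, of l] that unfolding adj_def by auto
    then show ?thesis unfolding f_def by (rule someI_ex)
  qed
  have "inj_on f {1..<qt}"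
  proof (rule inj_onI)
    fix x y assume xy: "x \<in> {1..<qt}" "y \<in> {1..<qt}" "f x = f y"
    then have "q x = q y" using f by metis
    then show "x = y" using inj_onD[OF inj] xy by simp
  qed
  then have "card {1..<qt} \<le> card {1..M}" by (rule card_inj_on_le) (use f in auto)
  then show "qt \<le> M + 1" by simp
qed

lemma core_tree:
  assumes g: "gctx s" and P: "arr s ''part'' = P" and j: "reg s ''jl'' = j" and cj: "conn (cls P j)"
  shows "wp core_tree (\<lambda>t s'. gctx s' \<and> tree P j (arr s' ''q'') (arr s' ''par'') (arr s' ''seen'') (reg s' ''qt'') \<and> t \<le> 500 * D) s"
proof -
  define seen0 where "seen0 = (\<lambda>v. if 0 \<le> v \<and> v < n then 0 else arr s ''seen'' v)"
  have s0: "v < n ==> seen0 v = 0" for v unfolding seen0_def by simp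
  have bp: "bpot seen0 \<le> 150 * D"
  proof -
    have "card {a. 1 \<le> a \<and> a \<le> M \<and> seen0 (sr a) = 0} \<le> card {1..M}" by (rule card_mono) auto
    moreover have "card {v. v < n \<and> seen0 v = 0} \<le> card {..<n}" by (rule card_mono) auto
    ultimately show ?thesis using D_bounds unfolding bpot_def unseen_def by simp
  qed
  obtain v0 where v0: "v0 < n" "P v0 = j" using cj unfolding conn_def cls_def by auto
  have "wp bfs (\<lambda>t s'. gctx s' \<and> tree P j (arr s' ''q'') (arr s' ''par'') (arr s' ''seen'') (reg s' ''qt'') \<and> t \<le> 150 * D + 50) s2"
    if s2: "s2 = s\<lparr>reg := (reg s)(''v'' := n, ''r'' := z, ''qt'' := 0, ''cl'' := j), arr := (arr s)(''seen'' := seen0)\<rparr>"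
      and z: "z < n" "P z = j" for s2 z
  proof (rule wp_mono[OF bfs[of s2 P j z seen0 0]])
    fix t s' assume "BI P j z 0 seen0 (reg s' ''qt'') (reg s' ''qt'') 0 (arr s' ''q'') (arr s' ''par'') (arr s' ''seen'') (reg s' ''ac'') \<and>
      gctx s' \<and> t + bpot (arr s' ''seen'') \<le> bpot seen0 + 50"
    then have B: "BI P j z 0 seen0 (reg s' ''qt'') (reg s' ''qt'') 0 (arr s' ''q'') (arr s' ''par'') (arr s' ''seen'') (reg s' ''ac'')"
      and G: "gctx s'" "t + bpot (arr s' ''seen'') \<le> bpot seen0 + 50" by auto
    let ?S = "arr s' ''q'' ` {0..<reg s' ''qt''}"
    \<comment> \<open>An arc from a marked to an unmarked vertex of the class would have been
      followed; connectivity does the rest.\<close>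
    have "cls P j \<subseteq> ?S"
    proof (rule conn_subset[OF cj])
      show "z \<in> cls P j" using z unfolding cls_def by simp
      show "z \<in> ?S" using B unfolding BI_def by (metis atLeastLessThan_iff image_eqI le0)
      fix u v assume uv: "u \<in> cls P j" "v \<in> cls P j" "u \<in> ?S" "v \<notin> ?S"
      show "\<not> adj u v"
      proof
        assume "adj u v"
        then obtain a where a: "1 \<le> a" "a \<le> M" "sr a = u" "tg a = v" unfolding adj_def by blast
        then have "arr s' ''seen'' v \<noteq> 0" using B uv unfolding BI_def cls_def by blast
        moreover have "arr s' ''seen'' v = seen0 v" using B uv(4) unfolding BI_def by blast
        ultimately show False using s0 uv(2) unfolding cls_def by auto
      qed
    qed
    then have "\<exists>l < reg s' ''qt''. arr s' ''q'' l = v" if "v < n" "P v = j" for v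
    proof -
      have "v \<in> ?S" using \<open>cls P j \<subseteq> ?S\<close> that unfolding cls_def by blast
      then show ?thesis by auto
    qed
    then have "tree P j (arr s' ''q'') (arr s' ''par'') (arr s' ''seen'') (reg s' ''qt'')"
      using B unfolding BI_def tree_def by simp
    then show "gctx s' \<and> tree P j (arr s' ''q'') (arr s' ''par'') (arr s' ''seen'') (reg s' ''qt'') \<and> t \<le> 150 * D + 50"
      using G bp by simp
  qed (use g P j z s0 in \<open>simp_all add: s2 gctx_def\<close>)
  note st = this[OF refl]
  show ?thesis
    unfolding core_tree_def wp_Seq
  proof (rule wp_For_map[where a = "''seen''" and l = 0 and h = n and vl = "\<lambda>_. 0" and K = 6], goal_cases)
    case (5 t1)
    show ?case
      unfolding seen0_def[symmetric]
    proof (rule wp_For_find[where l = 0 and h = n and cn = "\<lambda>v. P v = j" and vl = id], goal_cases)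
      case (7 t z)
      then have z: "z < n" "P z = j" using v0 by auto
      show ?case
        using 5 7 j D_bounds
        by (simp, intro wp_eq[OF st[OF z]]) simp_all
    qed (use g P j in \<open>simp_all add: gctx_def\<close>)
  qed (use g in \<open>simp_all add: gctx_def\<close>)
qed

definition anch :: "(nat \<Rightarrow> nat) \<Rightarrow> (nat \<Rightarrow> nat) \<Rightarrow> nat \<Rightarrow> nat \<Rightarrow> nat \<Rightarrow> bool" where
  "anch P Ut j u x \<longleftrightarrow> x < n \<and> P x = j \<and> (\<exists>y. adj x y \<and> P y = 0 \<and> Ut y = u)"

definition attd :: "(nat \<Rightarrow> nat) \<Rightarrow> (nat \<Rightarrow> nat) \<Rightarrow> (nat \<Rightarrow> nat) \<Rightarrow> nat \<Rightarrow> nat \<Rightarrow> nat \<Rightarrow> bool" where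
  "attd P Ut own j Y v \<longleftrightarrow> P v = 0 \<and> (own (Ut v) = j \<or> Ut v = Y)"

text \<open>A core vertex together with all vertices of the attached units that hang on it through
  \<open>att\<close>.\<close>

definition bag :: "(nat \<Rightarrow> nat) \<Rightarrow> (nat \<Rightarrow> nat) \<Rightarrow> (nat \<Rightarrow> nat) \<Rightarrow> nat \<Rightarrow> nat \<Rightarrow> (nat \<Rightarrow> nat) \<Rightarrow> nat \<Rightarrow> nat set" where
  "bag P Ut own j Y att x = insert x {v. v < n \<and> attd P Ut own j Y v \<and> att (Ut v) = x}"

lemma attach:
  assumes g: "gctx s" and c: "arr s ''part'' = P" "arr s ''unit'' = Ut" "arr s ''own'' = own" "reg s ''jl'' = j" "reg s ''Y'' = Y" "j \<noteq> 0"
  shows "wp attach (\<lambda>t s'. gctx s' \<and> (\<forall>u. nbu P Ut j u --> anch P Ut j u (arr s' ''att'' u)) \<and>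
     (\<forall>x < n. P x = j --> arr s' ''aug'' x = w (bag P Ut own j Y (arr s' ''att'') x)) \<and> t \<le> 500 * D) s"
proof -
  define I where "I i s' \<longleftrightarrow> gctx s' \<and> arr s' ''part'' = P \<and> arr s' ''unit'' = Ut \<and> arr s' ''own'' = own \<and> reg s' ''jl'' = j \<and> reg s' ''Y'' = Y \<and>
    (\<forall>a. 1 \<le> a \<and> a < i \<and> P (sr a) = j \<and> P (tg a) = 0 --> anch P Ut j (Ut (tg a)) (arr s' ''att'' (Ut (tg a))))" for i and s' :: store
  have rest: "wp (For ''v'' (N 0) (R ''n'') (Store ''aug'' (R ''v'') (C ''weight'' (R ''v''))) ;;
     For ''v'' (N 0) (R ''n'')
    (Cond attached (Store ''aug'' anchor (Plus (C ''aug'' anchor) (C ''weight'' (R ''v'')))) Skip))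
    (\<lambda>t s'. gctx s' \<and> (\<forall>u. nbu P Ut j u --> anch P Ut j u (arr s' ''att'' u)) \<and>
     (\<forall>x < n. P x = j --> arr s' ''aug'' x = w (bag P Ut own j Y (arr s' ''att'') x)) \<and> t \<le> n * 100 + 30) s1"
    if I: "I (Suc M) s1" for s1
  proof -
    define att where "att = arr s1 ''att''"
    have g1: "gctx s1" "arr s1 ''part'' = P" "arr s1 ''unit'' = Ut" "arr s1 ''own'' = own" "reg s1 ''jl'' = j" "reg s1 ''Y'' = Y"
      using I unfolding I_def by auto
    have a1: "\<forall>u. nbu P Ut j u --> anch P Ut j u (att u)"
      using I unfolding I_def nbu_def adj_def att_def by auto
    have au: "wt x + (\<Sum>v | v < n \<and> attd P Ut own j Y v \<and> att (Ut v) = x. wt v) = w (bag P Ut own j Y att x)" if "P x = j" for x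
      unfolding bag_def using that c(6) by (subst sum.insert) (auto simp: attd_def)
    show ?thesis
      unfolding wp_Seq
    proof (rule wp_For_map[where a = "''aug''" and l = 0 and h = n and vl = wt and K = 6], goal_cases)
      case (5 t1)
      show ?case
        unfolding attached_def
      proof (rule wp_For_add[where h = n and cn = "attd P Ut own j Y" and ix = "\<lambda>v. att (Ut v)" and vl = wt], goal_cases)
        case (6 t)
        then show ?case using 5 g1 a1 by (simp add: gctx_def att_def[symmetric] au)
      qed (use g1 in \<open>simp_all add: gctx_def attd_def att_def\<close>)
    qed (use g1 in \<open>simp_all add: gctx_def\<close>)
  qed
  show ?thesis
    unfolding attach_def
  proof (subst wp_Seq, rule wp_For[where I = I and l = 1 and h = "Suc M" and K = 30], goal_cases)
    case 3
    then show ?case using g c by (simp add: I_def gctx_def)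
  next
    case (4 i s')
    then show ?case by (simp add: I_def gctx_def)
  next
    case (5 i s')
    have J: "gctx s'" "arr s' ''part'' = P" "arr s' ''unit'' = Ut" "arr s' ''own'' = own" "reg s' ''jl'' = j" "reg s' ''Y'' = Y"
      and A: "\<And>a. 1 \<le> a ==> a < i ==> P (sr a) = j ==> P (tg a) = 0 ==> anch P Ut j (Ut (tg a)) (arr s' ''att'' (Ut (tg a)))"
      using 5 unfolding I_def by auto
    show ?case
    proof (cases "P (sr i) = j \<and> P (tg i) = 0")
      case True
      have i: "1 \<le> i" "i \<le> M" using 5 by auto
      then have "adj (sr i) (tg i)" unfolding adj_def by blast
      then have "anch P Ut j (Ut (tg i)) (sr i)" unfolding anch_def using True sr[OF i] by blast
      then have "anch P Ut j (Ut (tg a)) (((arr s' ''att'')(Ut (tg i) := sr i)) (Ut (tg a)))"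
        if "1 \<le> a \<and> a < Suc i \<and> P (sr a) = j \<and> P (tg a) = 0" for a
        using A[of a] that by (cases "a = i") auto
      then show ?thesis using J True 5(2) by (simp add: I_def gctx_def)
    next
      case False
      have "anch P Ut j (Ut (tg a)) (arr s' ''att'' (Ut (tg a)))"
        if "1 \<le> a \<and> a < Suc i \<and> P (sr a) = j \<and> P (tg a) = 0" for a
        using A[of a] that False by (cases "a = i") auto
      then show ?thesis using J False 5(2) by (cases "P (sr i) = j") (simp_all add: I_def gctx_def)
    qed
  next
    case (6 s' t)
    show ?case
      by (rule wp_mono[OF rest[OF 6(1)]]) (use 6(3) D_bounds in simp)
  qed simp_all
qed

end

definition sub :: "(nat \<Rightarrow> nat) \<Rightarrow> nat \<Rightarrow> (nat \<Rightarrow> nat) \<Rightarrow> nat \<Rightarrow> nat" where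
  "sub p m f i = (\<Sum>l | l < m \<and> anc p i l. f l)"

lemma sub_0:
  assumes "\<And>l. 0 < l ==> l < m ==> p l < l"
  shows "sub p m f 0 = (\<Sum>l < m. f l)"
proof -
  have "anc p 0 l" if "l < m" for l
    using that
  proof (induction l rule: less_induct)
    case (less l)
    then show ?case using assms[of l] anc_refl[of p 0] anc_step[of l 0 p] by (cases "l = 0") auto
  qed
  then have "{l. l < m \<and> anc p 0 l} = {..<m}" by auto
  then show ?thesis unfolding sub_def by simp
qed

lemma mark_subtree:
  assumes r: "reg s ''qt'' = m" "reg s ''i'' = i0" "arr s ''q'' = q" "arr s ''par'' = par" "arr s ''aug'' = au"
    and p: "\<And>l. 0 < l ==> l < m ==> par l < l"
  shows "wp mark_subtree (\<lambda>t s'. (\<forall>l < m. arr s' ''ins'' l = (if anc par i0 l then 1 else 0)) \<and>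
    reg s' ''s'' = sub par m (\<lambda>l. au (q l)) i0 \<and> reg s' ''tot'' = (\<Sum>l < m. au (q l)) \<and> t \<le> 60 * m + 40) s"
proof -
  define I where "I ins i s' \<longleftrightarrow> reg s' ''qt'' = m \<and> arr s' ''q'' = q \<and> arr s' ''aug'' = au \<and> arr s' ''ins'' = ins \<and>
    reg s' ''s'' = sub par i (\<lambda>l. au (q l)) i0 \<and> reg s' ''tot'' = (\<Sum>l < i. au (q l))" for ins i and s' :: store
  have Ss: "sub par (Suc i) f i0 = sub par i f i0 + (if anc par i0 i then f i else 0)" for f i
  proof -
    have "{l. l < Suc i \<and> anc par i0 l} = (if anc par i0 i then insert i {l. l < i \<and> anc par i0 l} else {l. l < i \<and> anc par i0 l})"
      by (auto simp: less_Suc_eq)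
    then show ?thesis unfolding sub_def by simp
  qed
  have st: "wp (For ''l'' (N 0) (R ''qt'')
    (''tot'' ::= Plus (R ''tot'') (C ''aug'' (C ''q'' (R ''l''))) ;;
     Cond (Equal (C ''ins'' (R ''l'')) (N 1)) (''s'' ::= Plus (R ''s'') (C ''aug'' (C ''q'' (R ''l'')))) Skip))
     (\<lambda>t s'. I ins m s' \<and> t \<le> 28 * m + 10) s1"
    if I: "I ins 0 s1" and ins: "\<And>l. l < m ==> ins l = (if anc par i0 l then 1 else 0)" for ins s1
  proof (rule wp_For[where I = "I ins" and l = 0 and h = m and K = 20], goal_cases)
    case 3 then show ?case using I by (simp add: I_def)
  next
    case (4 i s') then show ?case by (simp add: I_def)
  next
    case (5 i s')
    then show ?case using ins[of i] by (cases "anc par i0 i") (simp_all add: I_def Ss)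
  next
    case (6 s' t)
    then show ?case by simp
  qed simp_all
  show ?thesis
    unfolding mark_subtree_def
  proof (subst wp_Seq, rule wp_For_map[where a = "''ins''" and l = 0 and h = m and vl = "\<lambda>l. if anc par i0 l then 1 else 0" and K = 20], goal_cases)
    case (4 i g)
    show ?case
    proof (cases "i = i0")
      case True
      then show ?thesis using r 4 by (simp add: anc_refl)
    next
      case False
      show ?thesis
      proof (cases "i = 0")
        case True
        then show ?thesis using r 4 False by (simp add: anc_0)
      next
        case i: False
        then have "par i < i" using p 4 by simp
        \<comment> \<open>The parent has a smaller position, so its mark is already final.\<close>
        then have "g (par i) = (if anc par i0 i then 1 else 0)" using 4(4)[of "par i"] False anc_step[of i i0 par] by simp
        then show ?thesis using r 4 False i by simp
      qed
    qed
  next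
    case (5 t1)
    define ins where "ins = (\<lambda>v. if 0 \<le> v \<and> v < m then if anc par i0 v then 1 else 0 else arr s ''ins'' v)"
    have ins: "\<And>l. l < m ==> ins l = (if anc par i0 l then 1 else 0)" unfolding ins_def by simp
    show ?case
      unfolding ins_def[symmetric]
      apply (simp del: One_nat_def)
      apply (rule wp_mono[OF st[of ins]])
      subgoal using r by (simp add: I_def sub_def)
      subgoal using ins .
      subgoal using 5 ins by (simp add: I_def)
      done
  qed (use r in simp_all)
qed

context packing
begin

definition found :: "(nat \<Rightarrow> nat) \<Rightarrow> (nat \<Rightarrow> nat) \<Rightarrow> nat \<Rightarrow> store \<Rightarrow> bool" where
  "found par f m s \<longleftrightarrow> reg s ''i'' < m \<and> W \<le> sub par m f (reg s ''i'') \<and>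
    (\<forall>i. reg s ''i'' < i \<and> i < m --> sub par m f i < W) \<and>
    (\<forall>l < m. arr s ''ins'' l = (if anc par (reg s ''i'') l then 1 else 0)) \<and>
    reg s ''s'' = sub par m f (reg s ''i'') \<and> reg s ''tot'' = (\<Sum>l < m. f l)"

text \<open>The subtree at position 0 is the whole tree and weighs at least \<open>W\<close>, so the
  search succeeds. A marking pass for each position costs \<open>m * m\<close> up to constants,
  which is within \<open>D\<close> by the two bounds on \<open>m\<close>.\<close>

lemma find_subtree:
  assumes g: "gctx s" and r: "reg s ''qt'' = m" "arr s ''q'' = q" "arr s ''par'' = par" "arr s ''aug'' = au"
    and p: "\<And>l. 0 < l ==> l < m ==> par l < l" and tot: "W \<le> (\<Sum>l < m. au (q l))" and m: "m \<le> n" "m \<le> M + 1"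
  shows "wp find_subtree (\<lambda>t s'. gctx s' \<and> found par (\<lambda>l. au (q l)) m s' \<and> t \<le> 500 * D) s"
proof -
  let ?sub = "sub par m (\<lambda>l. au (q l))"
  define I where "I ii s' \<longleftrightarrow> gctx s' \<and> reg s' ''qt'' = m \<and> arr s' ''q'' = q \<and> arr s' ''par'' = par \<and> arr s' ''aug'' = au \<and>
    (reg s' ''fnd'' = 0 \<and> (\<forall>i. m - ii \<le> i \<and> i < m --> ?sub i < W) \<or> reg s' ''fnd'' = 1 \<and> found par (\<lambda>l. au (q l)) m s')"
    for ii and s' :: store
  have mods: "rmods mark_subtree = {''l'', ''s'', ''tot''}" "amods mark_subtree = {''ins''}"
    by (auto simp: mark_subtree_def)
  have m0: "0 < m" using tot W0 by (cases m) auto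
  show ?thesis
    unfolding find_subtree_def
  proof (simp, rule wp_For[where I = I and l = 0 and h = m and K = "60 * m + 80"], goal_cases)
    case 3 then show ?case using g r by (simp add: I_def gctx_def)
  next
    case (4 i s') then show ?case by (simp add: I_def)
  next
    case (5 ii s')
    have J: "gctx s'" "reg s' ''qt'' = m" "arr s' ''q'' = q" "arr s' ''par'' = par" "arr s' ''aug'' = au" using 5 unfolding I_def by auto
    show ?case
    proof (cases "reg s' ''fnd'' = 0")
      case False
      then have "found par (\<lambda>l. au (q l)) m s'" "reg s' ''fnd'' = 1" using 5 unfolding I_def by auto
      then show ?thesis using J 5(2) by (simp add: I_def found_def gctx_def)
    next
      case True
      then have small: "\<forall>i. m - ii \<le> i \<and> i < m --> ?sub i < W" using 5 unfolding I_def by simp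
      define i0 where "i0 = m - Suc ii"
      have i0: "i0 < m" "Suc i0 = m - ii" using 5 m0 unfolding i0_def by auto
      have big: "\<forall>i. i0 < i \<and> i < m --> ?sub i < W" using small i0 by (metis Suc_leI)
      define s1 where "s1 = s'\<lparr>reg := (reg s')(''i'' := i0)\<rparr>"
      have "wp mark_subtree (\<lambda>t s2. (\<forall>l < m. arr s2 ''ins'' l = (if anc par i0 l then 1 else 0)) \<and>
        reg s2 ''s'' = ?sub i0 \<and> reg s2 ''tot'' = (\<Sum>l < m. au (q l)) \<and> t \<le> 60 * m + 40) s1"
        by (rule mark_subtree) (use J p in \<open>simp_all add: s1_def\<close>)
      then have st: "wp mark_subtree (\<lambda>t s2. wp (Cond (Less (R ''s'') (R ''W'')) Skip (''fnd'' ::= N (Suc 0)))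
        (\<lambda>u s3. reg s3 ''ii'' = ii \<and> I (Suc ii) (s3\<lparr>reg := (reg s3)(''ii'' := Suc ii)\<rparr>) \<and> t + u \<le> 60 * m + 60) s2) s1"
      proof (rule wp_frame, elim conjE, goal_cases)
        case (1 t s2)
        have fr: "reg s2 x = reg s1 x" if "x \<noteq> ''l''" "x \<noteq> ''s''" "x \<noteq> ''tot''" for x using 1(1) that by (auto simp: frame_def mods)
        have fa: "arr s2 x = arr s1 x" if "x \<noteq> ''ins''" for x using 1(1) that by (auto simp: frame_def mods)
        have G: "gctx s2" using J unfolding gctx_def by (simp add: fr fa s1_def)
        have F: "found par (\<lambda>l. au (q l)) m (s2\<lparr>reg := r\<rparr>)" if "r ''i'' = reg s2 ''i''" "r ''s'' = reg s2 ''s''" "r ''tot'' = reg s2 ''tot''" "W \<le> ?sub i0" for r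
          using 1 i0 big that by (simp add: found_def fr s1_def)
        show ?case
        proof (cases "?sub i0 < W")
          case lt: True
          have "?sub i < W" if "m - Suc ii \<le> i" "i < m" for i using lt big that i0 unfolding i0_def by (cases "i = m - Suc ii") auto
          then show ?thesis using lt 1 G J True 5(2) by (simp add: gctx_def I_def fr fa s1_def)
        next
          case False
          then show ?thesis using F 1 G J True 5(2) by (simp add: gctx_def I_def fr fa s1_def)
        qed
      qed
      show ?thesis
        using True J 5(2)
        apply (subst wp_Cond)
        apply (simp del: wp_Cond One_nat_def)
        apply (rule wp_eq[OF st])
         apply (simp add: s1_def i0_def)
        apply (erule wp_mono)
        apply simp
        done
    qed
  next
    case (6 s' t)
    have "\<not> (\<forall>i. m - m \<le> i \<and> i < m --> ?sub i < W)" using sub_0[of m par "\<lambda>l. au (q l)"] p tot m0 by auto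
    then have "gctx s'" "found par (\<lambda>l. au (q l)) m s'" using 6(1) unfolding I_def by auto
    moreover have "m * m \<le> D" using mult_le_mono[OF m] unfolding D_def by simp
    then have "t + 2 \<le> 500 * D" using 6(3) m D_bounds by (simp add: algebra_simps)
    ultimately show ?case by simp
  qed simp_all
qed

end

section \<open>Splitting a full core, and branches at a center\<close>

fun rt :: "(nat \<Rightarrow> nat) \<Rightarrow> nat \<Rightarrow> nat \<Rightarrow> nat" where
  "rt p i l = (if l = 0 \<or> p l = i \<or> \<not> p l < l then l else rt p i (p l))"

declare rt.simps [simp del]

lemma rt_root: "l = 0 \<or> p l = i ==> rt p i l = l"
  by (subst rt.simps) auto

lemma rt_step: "l \<noteq> 0 ==> p l \<noteq> i ==> p l < l ==> rt p i l = rt p i (p l)"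
  by (subst rt.simps) simp

context packing
begin

definition cover :: "(nat \<Rightarrow> nat) \<Rightarrow> (nat \<Rightarrow> nat) \<Rightarrow> (nat \<Rightarrow> nat) \<Rightarrow> nat \<Rightarrow> nat \<Rightarrow> (nat \<Rightarrow> nat) \<Rightarrow> (nat \<Rightarrow> nat) \<Rightarrow> nat set \<Rightarrow> nat set" where
  "cover P Ut own j Y att q S = (\<Union>l \<in> S. bag P Ut own j Y att (q l))"

end

text \<open>The situation when no light core can take the unit \<open>Y\<close> that the light core \<open>j\<close> asks for.\<close>

locale event0 = packing n M sr tg wt W c kst vfi vnx for n M :: nat and sr tg wt :: "nat \<Rightarrow> nat" and W c kst :: nat and vfi vnx :: "nat \<Rightarrow> nat" +
  fixes k :: nat and P Ut kd wU own :: "nat \<Rightarrow> nat" and j Y :: nat and q par pos :: "nat \<Rightarrow> nat" and m :: nat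
    and att :: "nat \<Rightarrow> nat"
  assumes parts: "parts_ok c k P kd" and uok: "units_ok P Ut" and j: "c < j" "j \<le> k" "kd j = 0"
    and T: "tree P j q par pos m"
    and att: "\<And>v. v < n ==> attd P Ut own j Y v ==> anch P Ut j (Ut v) (att (Ut v))"
    and tot: "3 * W \<le> w {v. v < n \<and> (P v = j \<or> attd P Ut own j Y v)}"
    and load: "w {v. v < n \<and> (P v = j \<or> P v = 0 \<and> own (Ut v) = j)} < 3 * W"
    and Y: "Y \<in> units P Ut" "own Y \<noteq> j"
    and region: "\<And>Z. Z \<subseteq> heads c k kd ==>
      2 * W * card Z \<le> (\<Sum>i \<in> Z. w (cls P i)) + (\<Sum>u \<in> {u \<in> NB P Ut Z. own u \<noteq> j}. w (uset P Ut u))"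
begin

abbreviation "atd \<equiv> attd P Ut own j Y"
abbreviation "bg \<equiv> bag P Ut own j Y att"
abbreviation "f \<equiv> (\<lambda>l. w (bg (q l)))"
abbreviation "hl \<equiv> cover P Ut own j Y att q"

text \<open>The core vertex on which \<open>v\<close> hangs; a core vertex is its own home.\<close>

definition home :: "nat \<Rightarrow> nat" where "home v = (if P v = j then v else att (Ut v))"

lemma j0: "j \<noteq> 0" using j by simp

lemma fin_bag [simp]: "finite (bg x)" unfolding bag_def by simp

lemma at_home: "v < n ==> atd v ==> home v < n \<and> P (home v) = j"
  using att[of v] j0 unfolding home_def anch_def attd_def by auto

lemma home_pos: "v < n ==> P v = j \<or> atd v ==> pos (home v) - 1 < m \<and> q (pos (home v) - 1) = home v"
proof -
  assume v: "v < n" "P v = j \<or> atd v"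
  then have "home v < n" "P (home v) = j" using at_home[of v] by (cases "P v = j"; simp add: home_def)+
  then obtain l where "l < m" "q l = home v" using treeD(4)[OF T] by blast
  then show ?thesis using treeD(2)[OF T, of l] by simp
qed

lemma q_inj: "l < m ==> l' < m ==> q l = q l' ==> l = l'"
  using tree_size(1)[OF T] by (auto dest: inj_onD)

lemma mem_hull:
  assumes S: "S \<subseteq> {..<m}"
  shows "v \<in> hl S \<longleftrightarrow> v < n \<and> (P v = j \<or> atd v) \<and> pos (home v) - 1 \<in> S"
proof
  assume "v \<in> hl S"
  then obtain l where l: "l \<in> S" "v \<in> bg (q l)" unfolding cover_def by blast
  then have ql: "l < m" "q l < n" "P (q l) = j" "pos (q l) = Suc l" using treeD(2)[OF T, of l] S by auto
  then have "home v = q l \<and> v < n \<and> (P v = j \<or> atd v)"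
    using l j0 unfolding bag_def home_def attd_def by auto
  then show "v < n \<and> (P v = j \<or> atd v) \<and> pos (home v) - 1 \<in> S" using ql l by simp
next
  assume v: "v < n \<and> (P v = j \<or> atd v) \<and> pos (home v) - 1 \<in> S"
  then have "q (pos (home v) - 1) = home v" using home_pos by blast
  then have "v \<in> bg (q (pos (home v) - 1))" using v j0 unfolding bag_def home_def attd_def by auto
  then show "v \<in> hl S" using v unfolding cover_def by blast
qed

lemma w_hull:
  assumes S: "S \<subseteq> {..<m}"
  shows "w (hl S) = (\<Sum>l \<in> S. f l)"
  unfolding cover_def
proof (rule sum.UNION_disjoint)
  show "finite S" using S finite_subset by blast
  show "\<forall>l \<in> S. \<forall>l' \<in> S. l \<noteq> l' --> bg (q l) \<inter> bg (q l') = {}"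
  proof (intro ballI impI)
    fix l l' assume l: "l \<in> S" "l' \<in> S" "l \<noteq> l'"
    then have "l < m" "l' < m" using S by auto
    then have "q l \<noteq> q l'" "P (q l) = j" "P (q l') = j" using q_inj l treeD(2)[OF T] by blast+
    then show "bg (q l) \<inter> bg (q l') = {}" using j0 unfolding bag_def attd_def by auto
  qed
qed simp

text \<open>Each attached unit is connected and adjacent to its anchor, so it may be added to any
  connected set containing the anchor.\<close>

lemma conn_hull:
  assumes S: "S \<subseteq> {..<m}" and c: "conn (q ` S)"
  shows "conn (hl S)"
proof -
  define A where "A = {Ut v | v. v < n \<and> atd v \<and> att (Ut v) \<in> q ` S}"
  have "conn (q ` S \<union> (\<Union>u \<in> A. uset P Ut u))"
  proof (rule conn_attach[OF _ c])
    show "finite A" unfolding A_def by simp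
    fix u assume "u \<in> A"
    then obtain v where v: "v < n" "atd v" "att (Ut v) \<in> q ` S" "u = Ut v" unfolding A_def by blast
    then have P0: "P v = 0" unfolding attd_def by blast
    obtain y where y: "adj (att u) y" "P y = 0" "Ut y = u" using att[OF v(1,2)] v(4) unfolding anch_def by blast
    then have "y \<in> uset P Ut u" using adj_less unfolding uset_def by blast
    then show "conn (uset P Ut u) \<and> (\<exists>x \<in> q ` S. \<exists>y \<in> uset P Ut u. adj x y)"
      using units_okD(4)[OF uok v(1) P0] v y by blast
  qed
  moreover have "q ` S \<union> (\<Union>u \<in> A. uset P Ut u) = hl S"
  proof (intro equalityI subsetI)
    fix v assume "v \<in> q ` S \<union> (\<Union>u \<in> A. uset P Ut u)"
    then consider "v \<in> q ` S" | v' where "v' < n" "atd v'" "att (Ut v') \<in> q ` S" "v < n" "P v = 0" "Ut v = Ut v'"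
      unfolding A_def uset_def by auto
    then show "v \<in> hl S"
    proof cases
      case 1 then show ?thesis unfolding cover_def bag_def by auto
    next
      case 2
      then have "atd v" unfolding attd_def by simp
      then show ?thesis using 2 unfolding cover_def bag_def by auto
    qed
  next
    fix v assume "v \<in> hl S"
    then obtain l where l: "l \<in> S" "v \<in> bg (q l)" unfolding cover_def by blast
    then consider "v = q l" | "v < n" "atd v" "att (Ut v) = q l" unfolding bag_def by auto
    then show "v \<in> q ` S \<union> (\<Union>u \<in> A. uset P Ut u)"
    proof cases
      case 1 then show ?thesis using l by blast
    next
      case 2
      then have "v \<in> uset P Ut (Ut v)" "Ut v \<in> A" using l unfolding uset_def A_def attd_def by auto
      then show ?thesis by blast
    qed
  qed
  ultimately show ?thesis by simp
qed

lemma hull_all: "hl {..<m} = {v. v < n \<and> (P v = j \<or> atd v)}"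
proof -
  have "pos (home v) - 1 \<in> {..<m}" if "v < n" "P v = j \<or> atd v" for v using home_pos[OF that] by simp
  then show ?thesis using mem_hull[OF subset_refl] by blast
qed

text \<open>The unit \<open>Y\<close> weighs less than \<open>W\<close>. Hence the core with the
  units it owns exceeds \<open>2 * W\<close>, the share that a new head has to contribute to the
  Hall condition, and the total stays below \<open>4 * W\<close>, which lets two halves of weight at
  least \<open>W\<close> remain below \<open>3 * W\<close>.\<close>

lemma total: "3 * W \<le> (\<Sum>l < m. f l)" "(\<Sum>l < m. f l) < 4 * W"
    "2 * W < w {v. v < n \<and> (P v = j \<or> P v = 0 \<and> own (Ut v) = j)}"
proof -
  have t: "(\<Sum>l < m. f l) = w {v. v < n \<and> (P v = j \<or> atd v)}" using w_hull[of "{..<m}"] hull_all by simp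
  let ?X = "{v. v < n \<and> (P v = j \<or> P v = 0 \<and> own (Ut v) = j)}"
  have "{v. v < n \<and> (P v = j \<or> atd v)} = ?X \<union> uset P Ut Y" unfolding attd_def uset_def by auto
  moreover have "?X \<inter> uset P Ut Y = {}" using Y j0 unfolding uset_def by auto
  then have "w (?X \<union> uset P Ut Y) = w ?X + w (uset P Ut Y)" by (intro sum.union_disjoint) auto
  ultimately have e: "(\<Sum>l < m. f l) = w ?X + w (uset P Ut Y)" using t by simp
  have "w (uset P Ut Y) < W" using Y units_okD(5)[OF uok] unfolding units_def by blast
  then show "3 * W \<le> (\<Sum>l < m. f l)" "(\<Sum>l < m. f l) < 4 * W" "2 * W < w ?X" using e load tot t by auto
qed

lemma wY: "w (uset P Ut Y) < W"
  using Y units_okD(5)[OF uok] unfolding units_def by blast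

end

text \<open>Children have larger positions than their parents. Since \<open>i\<close> is the last
  position with a subtree of weight at least \<open>W\<close>, all subtrees at children of
  \<open>i\<close> are lighter.\<close>

locale event = event0 n M sr tg wt W c kst vfi vnx k P Ut kd wU own j Y q par pos m att
  for n M :: nat and sr tg wt :: "nat \<Rightarrow> nat" and W c kst :: nat and vfi vnx :: "nat \<Rightarrow> nat"
    and k :: nat and P Ut kd wU own :: "nat \<Rightarrow> nat" and j Y :: nat and q par pos :: "nat \<Rightarrow> nat" and m :: nat
    and att :: "nat \<Rightarrow> nat" +
  fixes i :: nat
  assumes i: "i < m" "W \<le> sub par m (\<lambda>l. w (bag P Ut own j Y att (q l))) i"
    and last: "\<And>i'. i < i' ==> i' < m ==> sub par m (\<lambda>l. w (bag P Ut own j Y att (q l))) i' < W"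
begin

definition S1 :: "nat set" where "S1 = {l. l < m \<and> anc par i l}"
definition S2 :: "nat set" where "S2 = {l. l < m \<and> \<not> anc par i l}"

lemma par: "0 < l ==> l < m ==> par l < l \<and> adj (q (par l)) (q l)"
  using treeD(3)[OF T] by blast

lemma conn_S1: "conn (q ` S1)"
proof (rule conn_tree)
  show "i \<in> S1" using i anc_refl unfolding S1_def by simp
  fix l assume l: "l \<in> S1" "l \<noteq> i"
  then have "i \<le> l" using anc_le unfolding S1_def by auto
  then have "0 < l" using l by simp
  then show "par l \<in> S1 \<and> par l < l \<and> adj (q (par l)) (q l)"
    using par[of l] l anc_step[of l i par] unfolding S1_def by auto
qed

lemma conn_S2: "i \<noteq> 0 ==> conn (q ` S2)"
proof (rule conn_tree)
  assume "i \<noteq> 0"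
  then show "0 \<in> S2" using treeD(1)[OF T] anc_0 unfolding S2_def by simp
  fix l assume l: "l \<in> S2" "l \<noteq> 0"
  moreover have "l \<noteq> i" using l anc_refl unfolding S2_def by auto
  ultimately show "par l \<in> S2 \<and> par l < l \<and> adj (q (par l)) (q l)"
    using par[of l] anc_step[of l i par] unfolding S2_def by auto
qed

lemma w_S: "w (hl S1) = sub par m f i" "w (hl S2) = (\<Sum>l < m. f l) - sub par m f i"
proof -
  have S: "S1 \<subseteq> {..<m}" "S2 \<subseteq> {..<m}" unfolding S1_def S2_def by auto
  show 1: "w (hl S1) = sub par m f i" using w_hull[OF S(1)] unfolding S1_def sub_def by simp
  have "S1 \<union> S2 = {..<m}" "S1 \<inter> S2 = {}" "finite S1" "finite S2" unfolding S1_def S2_def by auto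
  then have "(\<Sum>l < m. f l) = (\<Sum>l \<in> S1. f l) + (\<Sum>l \<in> S2. f l)" by (metis sum.union_disjoint)
  then show "w (hl S2) = (\<Sum>l < m. f l) - sub par m f i" using 1 w_hull[OF S(1)] w_hull[OF S(2)] by simp
qed

definition P1 :: "nat \<Rightarrow> nat" where
  "P1 v = (if v \<in> hl S1 then Suc k else if v \<in> hl S2 then j else P v)"

lemma hull_S:
  "v \<in> hl S1 \<longleftrightarrow> v < n \<and> (P v = j \<or> atd v) \<and> anc par i (pos (home v) - 1)"
  "v \<in> hl S2 \<longleftrightarrow> v < n \<and> (P v = j \<or> atd v) \<and> \<not> anc par i (pos (home v) - 1)"
proof -
  have S: "S1 \<subseteq> {..<m}" "S2 \<subseteq> {..<m}" unfolding S1_def S2_def by auto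
  show "v \<in> hl S1 \<longleftrightarrow> v < n \<and> (P v = j \<or> atd v) \<and> anc par i (pos (home v) - 1)"
    "v \<in> hl S2 \<longleftrightarrow> v < n \<and> (P v = j \<or> atd v) \<and> \<not> anc par i (pos (home v) - 1)"
    using mem_hull[OF S(1), of v] mem_hull[OF S(2), of v] home_pos[of v] unfolding S1_def S2_def by auto
qed

lemma P1_cases: "v < n ==> (P1 v = Suc k \<longleftrightarrow> v \<in> hl S1) \<and> (P1 v = j \<longleftrightarrow> v \<in> hl S2) \<and>
    (x \<noteq> j --> x \<noteq> Suc k --> (P1 v = x \<longleftrightarrow> P v = x \<and> \<not> atd v))"
  using hull_S[of v] j parts_okD(2)[OF parts, of v] unfolding P1_def by auto

text \<open>The subtree at \<open>i\<close> and the rest both weigh at least \<open>W\<close>, so by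
  the total below \<open>4 * W\<close> neither reaches \<open>3 * W\<close>. Whole units are moved,
  so the remaining ones are unchanged.\<close>

lemma split_parts:
  assumes s: "W \<le> (\<Sum>l < m. f l) - sub par m f i"
  shows "parts_ok c (Suc k) P1 (kd(Suc k := 0))" and "units_ok P1 Ut" and "\<And>v. v < n ==> P1 v = 0 ==> uset P1 Ut (Ut v) = uset P Ut (Ut v)"
    and "\<And>v. v < n ==> P1 v = 0 ==> P v = 0"
proof -
  note p = parts_okD[OF parts]
  have c1: "cls P1 (Suc k) = hl S1" "cls P1 j = hl S2"
    using P1_cases hull_S unfolding cls_def by auto
  have co: "cls P1 x = cls P x" if "x \<noteq> 0" "x \<noteq> j" "x \<noteq> Suc k" for x
    using P1_cases[of _ x] that unfolding cls_def attd_def by auto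
  \<comment> \<open>The subtree at the root is everything and would leave a rest of weight
    0.\<close>
  have "i \<noteq> 0"
  proof
    assume "i = 0"
    then have "sub par m f i = (\<Sum>l < m. f l)" using sub_0[of m par f] par by simp
    then show False using s W0 by simp
  qed
  then have S: "conn (hl S1)" "conn (hl S2)" "W \<le> w (hl S1)" "w (hl S1) < 3 * W" "W \<le> w (hl S2)" "w (hl S2) < 3 * W"
    using conn_hull[OF _ conn_S1] conn_hull[OF _ conn_S2] w_S i(2) s total unfolding S1_def S2_def by auto
  show "parts_ok c (Suc k) P1 (kd(Suc k := 0))"
    unfolding parts_ok_def
  proof (intro conjI allI impI)
    fix v assume v: "v < n"
    show "P1 v \<le> Suc k" using p(2)[OF v] j unfolding P1_def by auto
    have "\<not> W \<le> wt v" if "v \<in> hl S1 \<or> v \<in> hl S2" using that hull_S[of v] p(3)[OF v] j unfolding attd_def by auto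
    moreover have "c < Suc k" using p(1) by simp
    ultimately show "(W \<le> wt v) = (1 \<le> P1 v \<and> P1 v \<le> c)" using p(3)[OF v] j unfolding P1_def by auto
  next
    fix x assume x: "1 \<le> x \<and> x \<le> c"
    then have "cls P1 x = cls P x" using co j p(1) by auto
    then show "\<exists>v. cls P1 x = {v}" using p(4) x by auto
  next
    fix x assume x: "c < x \<and> x \<le> Suc k"
    show "if (kd(Suc k := 0)) x = 1 then \<exists>h. cls P1 x = {h}
         else conn (cls P1 x) \<and> W \<le> w (cls P1 x) \<and> w (cls P1 x) < 3 * W"
    proof (cases "x = Suc k \<or> x = j")
      case True
      then show ?thesis using c1 S j by auto
    next
      case False
      then have "cls P1 x = cls P x" "x \<noteq> Suc k" "x \<le> k" using co x by auto
      then show ?thesis using p(7,8)[of x] x by auto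
    qed
  qed (use p in auto)
  show z: "P v = 0" if "v < n" "P1 v = 0" for v using P1_cases[of v 0] that j0 by auto
  show us: "uset P1 Ut (Ut v) = uset P Ut (Ut v)" if v: "v < n" "P1 v = 0" for v
  proof -
    have "\<not> atd v" "P v = 0" using P1_cases[of v 0] v j0 by auto
    then have "\<not> atd x" if "Ut x = Ut v" "P x = 0" for x using that unfolding attd_def by auto
    then show ?thesis unfolding uset_def using P1_cases[of _ 0] j0 by auto
  qed
  show "units_ok P1 Ut"
    unfolding units_ok_def
  proof (intro allI impI)
    fix v assume v: "v < n" "P1 v = 0"
    note u = units_okD[OF uok v(1) z[OF v]]
    have "\<not> atd v" using P1_cases[of v 0] v j0 by auto
    then have "\<not> atd (Ut v)" using u(3) z[OF v] unfolding attd_def by auto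
    then have "P1 (Ut v) = 0" using P1_cases[of "Ut v" 0] u(1,2) j0 by auto
    then show "Ut v < n \<and> P1 (Ut v) = 0 \<and> Ut (Ut v) = Ut v \<and> conn (uset P1 Ut (Ut v)) \<and> w (uset P1 Ut (Ut v)) < W"
      using u us[OF v] by simp
  qed
qed

text \<open>The units that disappear are those owned by \<open>j\<close>, which
  \<open>region\<close> does not count, and \<open>Y\<close>. So the Hall condition loses at most
  one unit, lighter than \<open>W\<close>, whereas a failing run at threshold \<open>W\<close> would
  exhibit a deficit above \<open>W\<close>.\<close>

lemma split_hall:
  assumes Z: "Z \<subseteq> heads c k kd"
  shows "2 * W * card Z \<le> acc P1 Ut Z + w (uset P Ut Y)"
proof -
  have Zx: "x \<noteq> 0 \<and> x \<noteq> j \<and> x \<noteq> Suc k" if "x \<in> Z" for x using that Z j unfolding heads_def by auto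
  have cl: "cls P1 x = cls P x" if "x \<in> Z" for x
    using P1_cases[of _ x] Zx[OF that] unfolding cls_def attd_def by auto
  have us: "uset P1 Ut u = uset P Ut u" if "own u \<noteq> j" "u \<noteq> Y" for u
    unfolding uset_def using P1_cases[of _ 0] j0 that by (auto simp: attd_def)
  have sub: "{u \<in> NB P Ut Z. own u \<noteq> j} - {Y} \<subseteq> NB P1 Ut Z"
  proof
    fix u assume u: "u \<in> {u \<in> NB P Ut Z. own u \<noteq> j} - {Y}"
    then obtain x y where xy: "adj x y" "P x \<in> Z" "P y = 0" "Ut y = u" unfolding NB_def nbu_def by auto
    have "P1 x = P x" using P1_cases[of x "P x"] Zx[OF xy(2)] adj_less[OF xy(1)] unfolding attd_def by auto
    moreover have "P1 y = 0" using P1_cases[of y 0] xy u j0 adj_less[OF xy(1)] unfolding attd_def by auto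
    ultimately show "u \<in> NB P1 Ut Z" using xy unfolding NB_def nbu_def by blast
  qed
  let ?N = "{u \<in> NB P Ut Z. own u \<noteq> j}"
  have "(\<Sum>u \<in> ?N. w (uset P Ut u)) \<le> (\<Sum>u \<in> insert Y (?N - {Y}). w (uset P Ut u))" by (rule sum_mono2) auto
  also have "\<dots> = w (uset P Ut Y) + (\<Sum>u \<in> ?N - {Y}. w (uset P Ut u))" by (subst sum.insert) auto
  also have "(\<Sum>u \<in> ?N - {Y}. w (uset P Ut u)) = (\<Sum>u \<in> ?N - {Y}. w (uset P1 Ut u))" using us by (intro sum.cong) auto
  also have "\<dots> \<le> (\<Sum>u \<in> NB P1 Ut Z. w (uset P1 Ut u))" by (rule sum_mono2) (use sub in auto)
  finally show ?thesis using region[OF Z] cl unfolding acc_def by simp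
qed

end

section \<open>Turning the center of a core into a head\<close>

context event
begin

definition z :: nat where "z = q i"
definition moved :: "nat \<Rightarrow> bool" where "moved v \<longleftrightarrow> (P v = j \<or> atd v) \<and> home v \<noteq> z"
definition P2 :: "nat \<Rightarrow> nat" where "P2 v = (if P v = j \<and> v \<noteq> z then 0 else P v)"
definition U2 :: "nat \<Rightarrow> nat" where "U2 v = (if moved v then q (rt par i (pos (home v) - 1)) else Ut v)"
definition branch :: "nat \<Rightarrow> nat set" where "branch r = {l. l < m \<and> l \<noteq> i \<and> rt par i l = r}"

lemma z: "z < n" "P z = j" "pos z = Suc i"
  using treeD(2)[OF T i(1)] unfolding z_def by auto

text \<open>Walking up from a position other than \<open>i\<close> ends at a child of
  \<open>i\<close> or at the root. The branches at \<open>i\<close> are the subtrees of its children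
  and, if \<open>i\<close> is not the root, the remainder that contains position 0.\<close>

lemma rt_props:
  assumes "l < m" "l \<noteq> i"
  shows "rt par i l \<le> l \<and> rt par i l \<noteq> i \<and> (rt par i l = 0 \<or> par (rt par i l) = i) \<and> rt par i (rt par i l) = rt par i l \<and>
    anc par (rt par i l) l \<and> (rt par i l = 0 --> \<not> anc par i l)"
  using assms
proof (induction l rule: less_induct)
  case (less l)
  show ?case
  proof (cases "l = 0 \<or> par l = i")
    case True
    then have r: "rt par i l = l" by (rule rt_root)
    show ?thesis unfolding r using less.prems True anc_refl anc_0[of par i] r by auto
  next
    case False
    then have p: "par l < l" using par less.prems by auto
    then have p: "par l < l" "par l < m" using less.prems by auto
    then have r: "rt par i l = rt par i (par l)" using rt_step[of l par i] False by simp
    note IH = less.IH[OF p] False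
    have "l \<noteq> rt par i (par l)" using IH p by auto
    then show ?thesis using IH p anc_step[of l _ par] less.prems unfolding r by auto
  qed
qed

lemma conn_branch:
  assumes "l < m" "l \<noteq> i"
  shows "conn (q ` branch (rt par i l))"
proof (rule conn_tree)
  let ?r = "rt par i l"
  show "?r \<in> branch ?r" using rt_props[OF assms] assms unfolding branch_def by auto
  fix l' assume l': "l' \<in> branch ?r" "l' \<noteq> ?r"
  then have l: "l' < m" "l' \<noteq> i" "rt par i l' = ?r" unfolding branch_def by auto
  have n: "l' \<noteq> 0" "par l' \<noteq> i" using l l'(2) rt_root[of l' par i] by metis+
  then have p: "par l' < l'" "adj (q (par l')) (q l')" using par[of l'] l by auto
  then have "par l' \<in> branch ?r" using rt_step[of l' par i] p l n unfolding branch_def by auto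
  then show "par l' \<in> branch ?r \<and> par l' < l' \<and> adj (q (par l')) (q l')" using p by simp
qed

text \<open>The remainder is light because the split is impossible (\<open>s\<close>); the subtree
  at a child of \<open>i\<close> is light because \<open>i\<close> is the last position with a heavy
  one.\<close>

lemma branch_small:
  assumes s: "(\<Sum>l < m. f l) - sub par m f i < W" and l: "l < m" "l \<noteq> i"
  shows "w (hl (branch (rt par i l))) < W"
proof -
  let ?r = "rt par i l"
  note rp = rt_props[OF l]
  have B: "branch ?r \<subseteq> {..<m}" unfolding branch_def by auto
  show ?thesis
  proof (cases "?r = 0")
    case True
    have "branch ?r \<subseteq> S2" using rt_props True unfolding branch_def S2_def by auto
    then have "hl (branch ?r) \<subseteq> hl S2" unfolding cover_def by blast
    then have "w (hl (branch ?r)) \<le> w (hl S2)" by (intro sum_mono2) (auto simp: cover_def S2_def)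
    then show ?thesis using w_S s by simp
  next
    case False
    then have "par ?r = i" "?r < m" using rp l by auto
    then have "i < ?r" using par[of ?r] False by auto
    then have "sub par m f ?r < W" using last \<open>?r < m\<close> by blast
    moreover have "branch ?r \<subseteq> {l. l < m \<and> anc par ?r l}"
    proof
      fix x assume "x \<in> branch ?r"
      then have x: "x < m" "x \<noteq> i" "rt par i x = ?r" unfolding branch_def by auto
      then show "x \<in> {l. l < m \<and> anc par ?r l}" using rt_props[OF x(1,2)] by simp
    qed
    then have "(\<Sum>l \<in> branch ?r. f l) \<le> sub par m f ?r" unfolding sub_def by (intro sum_mono2) auto
    ultimately show ?thesis using w_hull[OF B] by simp
  qed
qed

lemma home_pos_ne: "v < n ==> moved v ==> pos (home v) - 1 < m \<and> pos (home v) - 1 \<noteq> i \<and> q (pos (home v) - 1) = home v"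
  using home_pos[of v] unfolding moved_def z_def by auto

lemma moved_unit: "P x = 0 ==> P y = 0 ==> Ut x = Ut y ==> moved x = moved y \<and> U2 x = U2 y"
  using j0 unfolding moved_def U2_def home_def attd_def by auto

lemma P2_0: "P2 v = 0 \<longleftrightarrow> P v = 0 \<or> P v = j \<and> v \<noteq> z"
  using j0 unfolding P2_def by auto

lemma P2_0_moved: "P2 v = 0 ==> \<not> moved v ==> P v = 0"
  using P2_0[of v] unfolding moved_def home_def by auto

lemma moved_P2: "moved v ==> P2 v = 0"
  using P2_0[of v] unfolding moved_def home_def attd_def by (auto split: if_splits)

text \<open>A new unit is named by the core vertex at the root of its branch. Names of old units are
  free vertices, so old and new names do not collide.\<close>

lemma U2_moved:
  assumes "v < n" "moved v"
  shows "U2 v < n" "P (U2 v) = j" "U2 v \<noteq> z" "U2 (U2 v) = U2 v" "P2 (U2 v) = 0"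
    "uset P2 U2 (U2 v) = hl (branch (rt par i (pos (home v) - 1)))"
proof -
  define l where "l = pos (home v) - 1"
  have l: "l < m" "l \<noteq> i" using home_pos_ne[OF assms] unfolding l_def by auto
  let ?r = "rt par i l"
  have u: "U2 v = q ?r" using assms unfolding U2_def l_def by simp
  have r: "?r < m" "?r \<noteq> i" "rt par i ?r = ?r" using rt_props[OF l] l by auto
  have qr: "q ?r < n" "P (q ?r) = j" "pos (q ?r) = Suc ?r" using treeD(2)[OF T r(1)] by auto
  have ne: "q ?r \<noteq> z" using q_inj[OF r(1) i(1)] r(2) unfolding z_def by auto
  have mv: "moved (q ?r)" "home (q ?r) = q ?r" using qr ne unfolding moved_def home_def by auto
  show "U2 v < n" "P (U2 v) = j" "U2 v \<noteq> z" using u qr ne by auto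
  show "U2 (U2 v) = U2 v" unfolding u using mv qr r unfolding U2_def by simp
  show "P2 (U2 v) = 0" unfolding u using moved_P2[OF mv(1)] .
  have B: "branch ?r \<subseteq> {..<m}" unfolding branch_def by auto
  have "x \<in> uset P2 U2 (q ?r) \<longleftrightarrow> x \<in> hl (branch ?r)" for x
  proof
    assume "x \<in> uset P2 U2 (q ?r)"
    then have x: "x < n" "P2 x = 0" "U2 x = q ?r" unfolding uset_def by auto
    have mx: "moved x"
    proof (rule ccontr)
      assume nm: "\<not> moved x"
      then have "P x = 0" "U2 x = Ut x" using P2_0_moved x unfolding U2_def by auto
      then show False using units_okD(2)[OF uok x(1)] x(3) qr j0 by simp
    qed
    note hx = home_pos_ne[OF x(1) mx]
    have "rt par i (pos (home x) - 1) < m" using rt_props[of "pos (home x) - 1"] hx by auto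
    then have "rt par i (pos (home x) - 1) = ?r" using q_inj r(1) x(3) mx unfolding U2_def by simp
    then show "x \<in> hl (branch ?r)" unfolding mem_hull[OF B] using x hx mx unfolding branch_def moved_def by simp
  next
    assume "x \<in> hl (branch ?r)"
    then have x: "x < n" "P x = j \<or> atd x" "pos (home x) - 1 < m" "pos (home x) - 1 \<noteq> i" "rt par i (pos (home x) - 1) = ?r"
      using mem_hull[OF B, of x] unfolding branch_def by auto
    have "home x \<noteq> z" using x z by auto
    then have "moved x" using x unfolding moved_def by simp
    then show "x \<in> uset P2 U2 (q ?r)" using x moved_P2 unfolding uset_def U2_def by simp
  qed
  then show "uset P2 U2 (U2 v) = hl (branch (rt par i (pos (home v) - 1)))" unfolding u l_def[symmetric] by blast
qed

text \<open>Units that hang directly on the center, like those not attached at all, remain units of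
  their own.\<close>

lemma U2_fixed:
  assumes v: "v < n" "P2 v = 0" "\<not> moved v"
  shows "U2 v = Ut v" "P v = 0" "uset P2 U2 (Ut v) = uset P Ut (Ut v)"
proof -
  show u: "U2 v = Ut v" using v unfolding U2_def by simp
  show P0: "P v = 0" using P2_0_moved v by blast
  have Pu: "P (Ut v) = 0" using units_okD(2)[OF uok v(1) P0] .
  have "x \<in> uset P2 U2 (Ut v) \<longleftrightarrow> x \<in> uset P Ut (Ut v)" for x
  proof
    assume "x \<in> uset P2 U2 (Ut v)"
    then have x: "x < n" "P2 x = 0" "U2 x = Ut v" unfolding uset_def by auto
    have "\<not> moved x" using U2_moved(2)[OF x(1)] x(3) Pu j0 by auto
    then show "x \<in> uset P Ut (Ut v)" using x P2_0_moved unfolding uset_def U2_def by auto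
  next
    assume "x \<in> uset P Ut (Ut v)"
    then have x: "x < n" "P x = 0" "Ut x = Ut v" unfolding uset_def by auto
    then show "x \<in> uset P2 U2 (Ut v)" using moved_unit[OF x(2) P0 x(3)] u P2_0[of x] unfolding uset_def by auto
  qed
  then show "uset P2 U2 (Ut v) = uset P Ut (Ut v)" by blast
qed

lemma head_heads: "heads c k (kd(j := 1)) = insert j (heads c k kd)" "j \<notin> heads c k kd"
  using j unfolding heads_def by auto

lemma head_parts: "parts_ok c k P2 (kd(j := 1))"
  unfolding parts_ok_def
proof (intro conjI allI impI)
  note p = parts_okD[OF parts]
  have co: "cls P2 x = cls P x" if "x \<noteq> 0" "x \<noteq> j" for x
    using that z unfolding cls_def P2_def by auto
  fix v assume v: "v < n"
  show "P2 v \<le> k" using p(2)[OF v] unfolding P2_def by auto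
  show "(W \<le> wt v) = (1 \<le> P2 v \<and> P2 v \<le> c)" using p(3)[OF v] j unfolding P2_def by auto
next
  note p = parts_okD[OF parts]
  have co: "cls P2 x = cls P x" if "x \<noteq> 0" "x \<noteq> j" for x
    using that z unfolding cls_def P2_def by auto
  fix x assume "1 \<le> x \<and> x \<le> c"
  then show "\<exists>v. cls P2 x = {v}" using co[of x] p(4)[of x] j by auto
next
  note p = parts_okD[OF parts]
  have co: "cls P2 x = cls P x" if "x \<noteq> 0" "x \<noteq> j" for x
    using that z unfolding cls_def P2_def by auto
  have cj: "cls P2 j = {z}" using z j0 unfolding cls_def P2_def by auto
  fix x assume x: "c < x \<and> x \<le> k"
  then show "if (kd(j := 1)) x = 1 then \<exists>h. cls P2 x = {h}
       else conn (cls P2 x) \<and> W \<le> w (cls P2 x) \<and> w (cls P2 x) < 3 * W"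
    using co[of x] cj p(7)[of x] p(8)[of x] by (cases "x = j") auto
qed (use parts_okD[OF parts] j in auto)

lemma head_units:
  assumes s: "(\<Sum>l < m. f l) - sub par m f i < W"
  shows "units_ok P2 U2"
  unfolding units_ok_def
proof (intro allI impI)
  fix v assume v: "v < n" "P2 v = 0"
  show "U2 v < n \<and> P2 (U2 v) = 0 \<and> U2 (U2 v) = U2 v \<and> conn (uset P2 U2 (U2 v)) \<and> w (uset P2 U2 (U2 v)) < W"
  proof (cases "moved v")
    case True
    note h = home_pos_ne[OF v(1) True]
    let ?r = "rt par i (pos (home v) - 1)"
    have "conn (hl (branch ?r))"
      by (rule conn_hull[OF _ conn_branch]) (use h in \<open>auto simp: branch_def\<close>)
    moreover have "w (hl (branch ?r)) < W" by (rule branch_small[OF s]) (use h in auto)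
    ultimately show ?thesis using U2_moved[OF v(1) True] by simp
  next
    case False
    note U = U2_fixed[OF v False]
    note u = units_okD[OF uok v(1) U(2)]
    have "moved (Ut v) = moved v \<and> U2 (Ut v) = U2 v" using moved_unit[OF u(2) U(2)] u(3) by simp
    moreover have "P2 (Ut v) = 0" using u(2) P2_0 by simp
    ultimately show ?thesis using u U by simp
  qed
qed

text \<open>Old regions can only grow, which settles sets without \<open>j\<close>. A set with
  \<open>j\<close> reaches all of \<open>X0\<close>, the former core with the units it owned,
  heavier than \<open>2 * W\<close>. The other heads are measured by \<open>region\<close>, which
  leaves out the units owned by \<open>j\<close>, so nothing is counted twice.\<close>

lemma head_hall:
  assumes H: "hall c k P Ut kd"
  shows "hall c k P2 U2 (kd(j := 1))"
  unfolding hall_def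
proof (intro allI impI)
  fix Z' assume Z': "Z' \<subseteq> heads c k (kd(j := 1))"
  define Z where "Z = Z' - {j}"
  have Z: "Z \<subseteq> heads c k kd" using Z' head_heads unfolding Z_def by auto
  have fin: "finite Z'" "0 \<notin> Z'" "finite Z" "0 \<notin> Z" "j \<notin> Z"
    using Z' j0 unfolding Z_def heads_def by (auto intro: finite_subset[of _ "{..k}"])
  have mono: "v \<in> region P2 U2 Z'" if v: "v \<in> region P Ut Z" for v
  proof (cases "P v \<in> Z")
    case True
    then have "P2 v = P v" "v < n" "P v \<in> Z'" using v fin unfolding P2_def region_def Z_def by auto
    then show ?thesis unfolding region_def by auto
  next
    case False
    then obtain x y where xy: "v < n" "P v = 0" "adj x y" "P x \<in> Z" "P y = 0" "Ut y = Ut v"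
      using v unfolding region_def NB_def nbu_def by blast
    have "P2 x = P x" "P2 y = 0" "P2 v = 0" using xy fin P2_0 unfolding P2_def by auto
    moreover have "U2 y = U2 v" using moved_unit xy by blast
    ultimately show ?thesis using xy unfolding region_def NB_def nbu_def Z_def by auto
  qed
  show "2 * W * card Z' \<le> acc P2 U2 Z'"
  proof (cases "j \<in> Z'")
    case False
    then have e: "Z = Z'" unfolding Z_def by auto
    have "w (region P Ut Z) \<le> w (region P2 U2 Z')" by (rule sum_mono2) (use mono in auto)
    moreover have "2 * W * card Z \<le> acc P Ut Z" using H Z unfolding hall_def by blast
    ultimately show ?thesis using acc_region[OF fin(3,4)] acc_region[OF fin(1,2)] e by simp
  next
    case True
    define R0 where "R0 = {v. v < n \<and> (P v \<in> Z \<or> P v = 0 \<and> Ut v \<in> NB P Ut Z \<and> own (Ut v) \<noteq> j)}"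
    define X0 where "X0 = {v. v < n \<and> (P v = j \<or> P v = 0 \<and> own (Ut v) = j)}"
    have R: "R0 \<subseteq> region P2 U2 Z'"
    proof
      fix v assume "v \<in> R0"
      then have "v \<in> region P Ut Z" unfolding R0_def region_def by auto
      then show "v \<in> region P2 U2 Z'" by (rule mono)
    qed
    have X: "X0 \<subseteq> region P2 U2 Z'"
    proof
      fix v assume "v \<in> X0"
      then have v: "v < n" "P v = j \<or> atd v" unfolding X0_def attd_def by auto
      show "v \<in> region P2 U2 Z'"
      proof (cases "moved v")
        case mv: True
        note h = home_pos_ne[OF v(1) mv]
        define l where "l = pos (home v) - 1"
        have l: "l < m" "l \<noteq> i" using h unfolding l_def by auto
        let ?r = "rt par i l"
        have u: "U2 v = q ?r" using mv unfolding U2_def l_def by simp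
        note rp = rt_props[OF l]
        \<comment> \<open>Every branch touches \<open>z\<close>: the branch of a child at its root,
          the remainder at the parent of \<open>i\<close>.\<close>
        have "\<exists>l' < m. l' \<noteq> i \<and> rt par i l' = ?r \<and> adj z (q l')"
        proof (cases "?r = 0")
          case False
          then have "adj (q (par ?r)) (q ?r)" "par ?r = i" using par[of ?r] rp l by auto
          then show ?thesis using rp l unfolding z_def by (intro exI[of _ ?r]) auto
        next
          case True
          then have i0: "0 < i" using rp by auto
          have p: "par i < i" "adj (q (par i)) z" using par[OF i0 i(1)] unfolding z_def by auto
          have p': "par i < m" "par i \<noteq> i" using p i by auto
          note rp' = rt_props[OF p']
          have "rt par i (par i) = 0"
          proof (rule ccontr)
            let ?s = "rt par i (par i)"
            assume "?s \<noteq> 0"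
            then have "par ?s = i" "0 < ?s" "?s < m" using rp' p' by auto
            then have "i < ?s" using par[of ?s] by auto
            then show False using rp' p by auto
          qed
          then show ?thesis using True p p' adj_sym by (intro exI[of _ "par i"]) auto
        qed
        then obtain l' where l': "l' < m" "l' \<noteq> i" "rt par i l' = ?r" "adj z (q l')" by blast
        have ql: "P (q l') = j" "pos (q l') = Suc l'" "q l' \<noteq> z" using treeD(2)[OF T l'(1)] q_inj[OF l'(1) i(1)] l' unfolding z_def by auto
        then have ml: "moved (q l')" "home (q l') = q l'" unfolding moved_def home_def by auto
        then have "U2 (q l') = q ?r" using ql l' unfolding U2_def by simp
        moreover have "P2 z = j" using z unfolding P2_def by simp
        ultimately have "nbu P2 U2 j (U2 v)" using l' u moved_P2[OF ml(1)] unfolding nbu_def by metis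
        then show ?thesis using v moved_P2[OF mv] True unfolding region_def NB_def by blast
      next
        case nm: False
        show ?thesis
        proof (cases "P v = j")
          case Pj: True
          then have "v = z" using nm unfolding moved_def home_def by simp
          then have "P2 v = j" using z unfolding P2_def by simp
          then show ?thesis using v True unfolding region_def by simp
        next
          case False
          then have a: "atd v" "P v = 0" using v unfolding attd_def by auto
          then have az: "att (Ut v) = z" using nm False unfolding moved_def home_def by auto
          obtain y where y: "adj z y" "P y = 0" "Ut y = Ut v" using att[OF v(1) a(1)] az unfolding anch_def by auto
          have "U2 y = U2 v" using moved_unit[OF y(2) a(2) y(3)] by simp
          moreover have "P2 z = j" "P2 y = 0" "P2 v = 0" using z y a P2_0 unfolding P2_def by auto
          ultimately show ?thesis using v y True unfolding region_def NB_def nbu_def by blast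
        qed
      qed
    qed
    have wR: "w R0 = (\<Sum>i \<in> Z. w (cls P i)) + (\<Sum>u \<in> {u \<in> NB P Ut Z. own u \<noteq> j}. w (uset P Ut u))"
    proof -
      have "R0 = (\<Union>i \<in> Z. cls P i) \<union> (\<Union>u \<in> {u \<in> NB P Ut Z. own u \<noteq> j}. uset P Ut u)"
        unfolding R0_def cls_def uset_def by auto
      moreover have "(\<Union>i \<in> Z. cls P i) \<inter> (\<Union>u \<in> {u \<in> NB P Ut Z. own u \<noteq> j}. uset P Ut u) = {}"
        using fin unfolding cls_def uset_def by auto
      ultimately have "w R0 = w (\<Union>i \<in> Z. cls P i) + w (\<Union>u \<in> {u \<in> NB P Ut Z. own u \<noteq> j}. uset P Ut u)"
        using sum.union_disjoint[of "\<Union>i \<in> Z. cls P i" "\<Union>u \<in> {u \<in> NB P Ut Z. own u \<noteq> j}. uset P Ut u" wt] fin by simp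
      then show ?thesis using fin by (simp add: sum_UN_uset sum_UN_cls)
    qed
    have "R0 \<inter> X0 = {}" using fin j0 unfolding R0_def X0_def by auto
    moreover have "finite R0" "finite X0" unfolding R0_def X0_def by auto
    ultimately have "w R0 + w X0 = w (R0 \<union> X0)" by (simp add: sum.union_disjoint)
    also have "\<dots> \<le> w (region P2 U2 Z')" by (rule sum_mono2) (use R X in auto)
    finally have "w R0 + w X0 \<le> acc P2 U2 Z'" using acc_region[OF fin(1,2)] by simp
    moreover have "2 * W < w X0" using total(3) unfolding X0_def .
    moreover have "card Z' = Suc (card Z)" using True fin unfolding Z_def by (metis card.remove)
    then have "2 * W * card Z' = 2 * W * card Z + 2 * W" by simp
    ultimately show ?thesis using region[OF Z] wR by linarith
  qed
qed

end

section \<open>Steps of the main loop\<close>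

context packing
begin

lemma gctx_frame:
  assumes "frame p s s'" "gctx s" "{''n'', ''M'', ''c'', ''W'', ''W3'', ''big''} \<inter> rmods p = {}"
    "{''src'', ''tgt'', ''weight'', ''vfi'', ''vnx''} \<inter> amods p = {}"
  shows "gctx s'"
  using assms unfolding gctx_def frame_def by (simp add: disjoint_iff)

lemma label_mods:
  "rmods label = {''i'', ''v'', ''a'', ''sp'', ''ev'', ''go'', ''s'', ''x'', ''u'', ''o'', ''jl''}"
  "amods label = {''lab'', ''load'', ''fi'', ''cnt'', ''own'', ''nxt'', ''cur'', ''stk''}"
  unfolding label_def label_init_def label_loop_def label_body_def label_step_def label_up_def label_pull_def label_gap_def
  by auto

definition state :: "store \<Rightarrow> (nat \<Rightarrow> nat) \<Rightarrow> (nat \<Rightarrow> nat) \<Rightarrow> (nat \<Rightarrow> nat) \<Rightarrow> (nat \<Rightarrow> nat) \<Rightarrow> nat \<Rightarrow> bool" where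
  "state s P Ut kd wU k \<longleftrightarrow> gctx s \<and> arr s ''part'' = P \<and> arr s ''unit'' = Ut \<and> arr s ''kind'' = kd \<and> arr s ''wU'' = wU \<and>
     reg s ''size'' = k"

text \<open>The bounds \<open>n + 1\<close> and \<open>M + 1\<close> leave room for one core added
  before it is known to belong to a packing.\<close>

definition ready :: "(nat \<Rightarrow> nat) \<Rightarrow> (nat \<Rightarrow> nat) \<Rightarrow> (nat \<Rightarrow> nat) \<Rightarrow> (nat \<Rightarrow> nat) \<Rightarrow> nat \<Rightarrow> bool" where
  "ready P Ut kd wU k \<longleftrightarrow> parts_ok c k P kd \<and> units_ok P Ut \<and> wu_ok P Ut wU \<and> k \<le> n + 1 \<and> k - c \<le> M + 1"

lemma label_frame:
  assumes "frame label s s'" "state s P Ut kd wU k"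
  shows "state s' P Ut kd wU k" and "x \<notin> rmods label ==> reg s' x = reg s x" and "x \<notin> amods label ==> arr s' x = arr s x"
  using assms gctx_frame[OF assms(1)] unfolding state_def frame_def by (auto simp: label_mods)

lemma ready_labinst:
  assumes r: "ready P Ut kd wU k" and jl0: "c < jl0" "jl0 \<le> Suc k"
  shows "labinst n M c k jl0 W (n + 5) sr tg P Ut kd wU wt"
proof
  have p: "parts_ok c k P kd" and u: "units_ok P Ut" and wu: "wu_ok P Ut wU" and k: "k \<le> n + 1" using r unfolding ready_def by auto
  note p = parts_okD[OF p]
  show "P v \<le> k" if "v < n" for v using p(2) that .
  show "Ut v < n" if "v < n" "P v = 0" for v using units_okD(1)[OF u that] .
  show wu': "wU (Ut v) = w (uset P Ut (Ut v))" if "v < n" "P v = 0" for v using wu that unfolding wu_ok_def by blast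
  show "wU (Ut v) < W" if "v < n" "P v = 0" for v using wu'[OF that] units_okD(5)[OF u that] by simp
  show "(\<Sum>v | v < n \<and> P v = i. wt v) < 3 * W" if "c < i" "i \<le> k" "kd i = 0" for i
    using p(8)[OF that(1,2)] that(3) unfolding cls_def by simp
  show "k + 2 \<le> n + 5" using k by simp
  show "kd i \<le> 1" "kd 0 = 0" for i using p(5,6) by auto
qed (use jl0 W0 sr tg r in \<open>auto simp: ready_def parts_ok_def\<close>)

text \<open>\<open>d\<close> is the number of cores. Being bounded by \<open>n + 1\<close> and by
  \<open>M + 1\<close>, it makes each of \<open>d * n\<close>, \<open>d * M\<close> and
  \<open>d * d\<close> at most \<open>D\<close>.\<close>

lemma label_time:
  assumes "d \<le> n + 1" "d \<le> M + 1"
  shows "60 * (n + 5 + n + M + d + 1) + 200 * ((d + 2) * (2 * M + 2 * d + 3 * n + 2) + 2) + 4 \<le> 9000 * D"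
proof -
  have "d * (M + 1) \<le> D" unfolding D_def using assms(1) by (intro mult_le_mono) auto
  moreover have "(n + 1) * d \<le> D" unfolding D_def using assms(2) by (intro mult_le_mono) auto
  moreover have "d * d \<le> D" unfolding D_def using assms by (intro mult_le_mono) auto
  moreover have "n + M \<le> D" "1 \<le> D" using D_bounds by auto
  ultimately show ?thesis by (simp add: algebra_simps)
qed

text \<open>With \<open>jl\<close> at \<open>Suc c\<close> all light cores take part. The two
  outcomes are prepared for their use: the region bound for the certificate, and the data of the
  full core \<open>j\<close> with the Hall condition that does without its units.\<close>

lemma label_2W:
  assumes st: "state s P Ut kd wU k" and r: "ready P Ut kd wU k" and H: "hall c k P Ut kd"
    and th: "reg s ''th'' = 2 * W" and jl: "reg s ''jl'' = Suc c"
  shows "wp label (\<lambda>t s'. state s' P Ut kd wU k \<and> t \<le> 9000 * D \<and>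
    (let F = {i \<in> {c<..k}. arr s' ''lab'' i = n + 5}; own = arr s' ''own''; j = reg s' ''jl''; Y = reg s' ''ev'' - 1 in
     (reg s' ''ev'' = 0 --> (\<forall>i. c < i \<and> i \<le> k \<and> kd i \<noteq> 1 --> i \<in> F) \<and> acc P Ut F \<le> 3 * W * card F) \<and>
     (reg s' ''ev'' \<noteq> 0 --> c < j \<and> j \<le> k \<and> kd j = 0 \<and> Y \<in> units P Ut \<and> own Y \<noteq> j \<and>
       (\<forall>v < n. attd P Ut own j Y v --> nbu P Ut j (Ut v)) \<and>
       3 * W \<le> w {v. v < n \<and> (P v = j \<or> attd P Ut own j Y v)} \<and>
       w {v. v < n \<and> (P v = j \<or> P v = 0 \<and> own (Ut v) = j)} < 3 * W \<and>
       (\<forall>Z \<subseteq> heads c k kd. 2 * W * card Z \<le> (\<Sum>i \<in> Z. w (cls P i)) +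
         (\<Sum>u \<in> {u \<in> NB P Ut Z. own u \<noteq> j}. w (uset P Ut u)))))) s"
proof -
  have p: "parts_ok c k P kd" and d: "k - c \<le> n + 1" "k - c \<le> M + 1" using r unfolding ready_def by auto
  note po = parts_okD[OF p]
  interpret L: labinst n M c k "Suc c" W "2 * W" "n + 5" sr tg P Ut kd wU wt
    by (rule ready_labinst[OF r]) (use po in auto)
  have cx: "L.ctx s" using st th unfolding L.ctx_def state_def gctx_def by simp
  show ?thesis
  proof (rule wp_frame[OF L.label[OF cx jl]], elim conjE, goal_cases)
    case (1 t s')
    let ?F = "{i \<in> {c<..k}. arr s' ''lab'' i = n + 5}" and ?own = "arr s' ''own''" and ?j = "reg s' ''jl''" and ?Y = "reg s' ''ev'' - 1"
    note LR = 1(2)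
    have fl: "L.flagged (arr s' ''lab'') = ?F" unfolding L.flagged_def by simp
    have A: "(\<forall>i. c < i \<and> i \<le> k \<and> kd i \<noteq> 1 --> i \<in> ?F) \<and> acc P Ut ?F \<le> 3 * W * card ?F" if "reg s' ''ev'' = 0"
      using L.LR_noev[OF LR that] L.acc_flagged_le[OF LR] unfolding fl L.hd_def by auto
    have E: "c < ?j \<and> ?j \<le> k \<and> kd ?j = 0 \<and> ?Y \<in> units P Ut \<and> ?own ?Y \<noteq> ?j \<and>
       (\<forall>v < n. attd P Ut ?own ?j ?Y v --> nbu P Ut ?j (Ut v)) \<and>
       3 * W \<le> w {v. v < n \<and> (P v = ?j \<or> attd P Ut ?own ?j ?Y v)} \<and>
       w {v. v < n \<and> (P v = ?j \<or> P v = 0 \<and> ?own (Ut v) = ?j)} < 3 * W \<and>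
       (\<forall>Z \<subseteq> heads c k kd. 2 * W * card Z \<le> (\<Sum>i \<in> Z. w (cls P i)) +
         (\<Sum>u \<in> {u \<in> NB P Ut Z. ?own u \<noteq> ?j}. w (uset P Ut u)))" if ev: "reg s' ''ev'' \<noteq> 0"
    proof -
      note e = L.LR_ev[OF LR ev]
      have j: "?j \<in> {c<..k}" "\<not> L.hd ?j" and nY: "nbu P Ut ?j ?Y" and oY: "?own ?Y \<noteq> ?j"
        and big: "3 * W \<le> arr s' ''load'' ?j + wU ?Y" using e unfolding L.nb_nbu by auto
      have kj: "kd ?j = 0" using j(2) po(5)[of ?j] unfolding L.hd_def by simp
      have j0: "?j \<noteq> 0" using j by auto
      have Yu: "?Y \<in> units P Ut"
      proof -
        obtain x y where "adj x y" "P y = 0" "Ut y = ?Y" using nY unfolding nbu_def by blast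
        then show ?thesis unfolding units_def using adj_less[of x y] by force
      qed
      have own: "nbu P Ut ?j (Ut v)" if "v < n" "attd P Ut ?own ?j ?Y v" for v
      proof (cases "Ut v = ?Y")
        case False
        then have "?own (Ut v) = ?j" "P v = 0" using that unfolding attd_def by auto
        moreover have "Ut v \<in> L.U" using that unfolding L.U_def attd_def by auto
        ultimately show ?thesis using L.LR_own[OF LR, of "Ut v"] j0 unfolding L.nb_nbu by auto
      qed (use nY in simp)
      let ?X = "{v. v < n \<and> (P v = ?j \<or> P v = 0 \<and> ?own (Ut v) = ?j)}"
      have X: "?X = L.ext ?own ?j" unfolding L.ext_def cls_def uset_def L.U_def by auto
      then have wX: "w ?X = arr s' ''load'' ?j" using L.w_ext[OF LR j(1)] by simp
      have "{v. v < n \<and> (P v = ?j \<or> attd P Ut ?own ?j ?Y v)} = ?X \<union> uset P Ut ?Y" unfolding attd_def uset_def by auto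
      moreover have "?X \<inter> uset P Ut ?Y = {}" using oY j0 unfolding uset_def by auto
      then have "w (?X \<union> uset P Ut ?Y) = w ?X + w (uset P Ut ?Y)" by (intro sum.union_disjoint) auto
      moreover have "wU ?Y = w (uset P Ut ?Y)" using L.wU_uset Yu unfolding L.U_units by simp
      ultimately have "3 * W \<le> w {v. v < n \<and> (P v = ?j \<or> attd P Ut ?own ?j ?Y v)}" using big wX by simp
      moreover have "w ?X < 3 * W" unfolding wX using L.LR_light[OF LR j] .
      ultimately show ?thesis using j kj Yu oY own L.hall_event[OF LR refl H ev] by simp
    qed
    have "t \<le> 9000 * D" using 1(3) label_time[OF d] by linarith
    then show ?case using label_frame(1)[OF 1(1) st] A E unfolding Let_def by blast
  qed
qed

text \<open>Free units have owner 0, so their vertices stay free.\<close>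

definition taken :: "(nat \<Rightarrow> nat) \<Rightarrow> (nat \<Rightarrow> nat) \<Rightarrow> (nat \<Rightarrow> nat) \<Rightarrow> nat \<Rightarrow> nat" where
  "taken P Ut own v = (if v < n \<and> P v = 0 then own (Ut v) else P v)"

text \<open>If no head is blocked, each one has load at least \<open>W\<close>, and below
  \<open>2 * W\<close> because its own vertex is light; absorbing the owned units makes it an
  ordinary core. Otherwise the blocked heads show a Hall deficit above \<open>W\<close>. The result
  speaks of an arbitrary \<open>kd'\<close> because the array of kinds is rewritten only
  later.\<close>

lemma label_W:
  assumes st: "state s P Ut kd wU k" and r: "ready P Ut kd wU k"
  shows "wp label_W (\<lambda>t s'. state s' P Ut kd wU k \<and> t \<le> 9010 * D \<and>
    (let Z = {i \<in> {c<..k}. arr s' ''lab'' i = n + 5} in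
     (Z \<noteq> {} --> Z \<subseteq> heads c k kd \<and> acc P Ut Z + W < 2 * W * card Z) \<and>
     (Z = {} --> (\<forall>kd'. (\<forall>i \<le> k. kd' i = 0) \<and> (\<forall>i. kd' i \<le> 1) --> parts_ok c k (taken P Ut (arr s' ''own'')) kd')))) s"
proof -
  have p: "parts_ok c k P kd" and uo: "units_ok P Ut" and d: "k - c \<le> n + 1" "k - c \<le> M + 1" using r unfolding ready_def by auto
  note po = parts_okD[OF p]
  interpret L: labinst n M c k "Suc k" W W "n + 5" sr tg P Ut kd wU wt
    by (rule ready_labinst[OF r]) (use po in auto)
  define s1 where "s1 = s\<lparr>reg := (reg s)(''th'' := W, ''jl'' := Suc k)\<rparr>"
  have st1: "state s1 P Ut kd wU k" using st unfolding state_def gctx_def s1_def by simp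
  have cx: "L.ctx s1" using st unfolding L.ctx_def state_def gctx_def s1_def by simp
  have jl: "reg s1 ''jl'' = Suc k" unfolding s1_def by simp
  have main: "wp label (\<lambda>t s'. state s' P Ut kd wU k \<and> t \<le> 9000 * D \<and>
    (let Z = {i \<in> {c<..k}. arr s' ''lab'' i = n + 5} in
     (Z \<noteq> {} --> Z \<subseteq> heads c k kd \<and> acc P Ut Z + W < 2 * W * card Z) \<and>
     (Z = {} --> (\<forall>kd'. (\<forall>i \<le> k. kd' i = 0) \<and> (\<forall>i. kd' i \<le> 1) --> parts_ok c k (taken P Ut (arr s' ''own'')) kd')))) s1"
  proof (rule wp_frame[OF L.label[OF cx jl]], elim conjE, goal_cases)
    case (1 t s')
    let ?F = "{i \<in> {c<..k}. arr s' ''lab'' i = n + 5}" and ?own = "arr s' ''own''"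
    let ?P = "taken P Ut ?own"
    note LR = 1(2)
    have fl: "L.flagged (arr s' ''lab'') = ?F" unfolding L.flagged_def by simp
    have A: "?F \<subseteq> heads c k kd \<and> acc P Ut ?F + W < 2 * W * card ?F" if "?F \<noteq> {}"
      using L.flagged_small[OF LR refl refl] that unfolding fl by blast
    have E: "parts_ok c k ?P kd'" if F: "?F = {}" and kd': "\<forall>i \<le> k. kd' i = 0" "\<forall>i. kd' i \<le> 1" for kd'
    proof -
      have own: "?own (Ut v) = 0 \<or> ?own (Ut v) \<in> {c<..k} \<and> nbu P Ut (?own (Ut v)) (Ut v)" if "v < n" "P v = 0" for v
        using L.LR_own[OF LR, of "Ut v"] that unfolding L.U_def L.nb_nbu by auto
      have cl: "cls ?P i = cls P i" if "1 \<le> i" "i \<le> c" for i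
        using own that unfolding cls_def taken_def by (auto; fastforce)
      have cx: "cls ?P i = L.ext ?own i" if "c < i" "i \<le> k" for i
        using that unfolding cls_def taken_def L.ext_def uset_def L.U_def by auto
      have core: "conn (cls ?P i) \<and> W \<le> w (cls ?P i) \<and> w (cls ?P i) < 3 * W" if i: "c < i" "i \<le> k" for i
      proof -
        have i': "i \<in> {c<..k}" using i by simp
        have nf: "arr s' ''lab'' i \<noteq> n + 5" using F i by auto
        have wl: "w (cls ?P i) = arr s' ''load'' i" unfolding cx[OF i] by (rule L.w_ext[OF LR i'])
        have "conn (cls P i)"
        proof (cases "kd i = 1")
          case True then show ?thesis using po(7)[OF i] conn_sing by auto
        next
          case False then show ?thesis using po(8)[OF i] by blast
        qed
        moreover have "{u \<in> L.U. ?own u = i} \<subseteq> {u \<in> L.U. L.nb i u}"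
        proof
          fix u assume u: "u \<in> {u \<in> L.U. ?own u = i}"
          then show "u \<in> {u \<in> L.U. L.nb i u}" using L.LR_own[OF LR, of u] i by auto
        qed
        ultimately have "conn (L.ext ?own i)" unfolding L.ext_def by (rule L.conn_ext[OF LR i' _ uo])
        moreover have "W \<le> arr s' ''load'' i \<and> arr s' ''load'' i < 3 * W"
        proof (cases "kd i = 1")
          case True
          then have h: "L.hd i" unfolding L.hd_def .
          obtain x where x: "cls P i = {x}" using po(7)[OF i True] by blast
          then have "x < n" "P x = i" unfolding cls_def by auto
          then have "wt x < W" using po(3)[of x] i by auto
          then have "L.base i < W" unfolding L.base_cls x by simp
          then have "arr s' ''load'' i < W + W" using L.LR_ub[OF LR i'] h by simp
          then show ?thesis using L.LR_head[OF LR i' h nf] by simp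
        next
          case False
          then have h: "\<not> L.hd i" unfolding L.hd_def .
          have "W \<le> L.base i" unfolding L.base_cls using po(8)[OF i False] by blast
          then show ?thesis using L.LR_light[OF LR i' h] L.LR_load[OF LR i'] by simp
        qed
        ultimately show ?thesis using wl cx[OF i] by simp
      qed
      show ?thesis
        unfolding parts_ok_def
      proof (intro conjI allI impI)
        fix v assume v: "v < n"
        show "?P v \<le> k" using own[OF v] po(2)[OF v] unfolding taken_def by auto
        show "(W \<le> wt v) = (1 \<le> ?P v \<and> ?P v \<le> c)" using own[OF v] po(3)[OF v] unfolding taken_def by auto
      next
        fix i assume "1 \<le> i \<and> i \<le> c"
        then show "\<exists>v. cls ?P i = {v}" using cl[of i] po(4)[of i] by auto
      next
        fix i assume i: "c < i \<and> i \<le> k"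
        then have "kd' i = 0" using kd' by simp
        then show "if kd' i = 1 then \<exists>h. cls ?P i = {h} else conn (cls ?P i) \<and> W \<le> w (cls ?P i) \<and> w (cls ?P i) < 3 * W"
          using core i by simp
      qed (use po kd' in auto)
    qed
    have "t \<le> 9000 * D" using 1(3) label_time[OF d] by linarith
    then show ?case using label_frame(1)[OF 1(1) st1] A E unfolding Let_def by blast
  qed
  show ?thesis
    unfolding label_W_def using st D_bounds(3)
    by (simp add: state_def gctx_def, intro wp_eq[OF main]) (simp_all add: s1_def state_def gctx_def)
qed

lemma single_units:
  assumes g: "gctx s" and P: "arr s ''part'' = P" "\<And>v. v < n ==> P v = 0 ==> wt v < W"
  shows "wp single_units (\<lambda>t s'. units_ok P (arr s' ''unit'') \<and> wu_ok P (arr s' ''unit'') (arr s' ''wU'') \<and> t \<le> 100 * D) s"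
  unfolding single_units_def wp_Seq
proof (rule wp_For_map[where a = "''unit''" and l = 0 and h = n and vl = id and K = 6], goal_cases)
  case (5 t1)
  show ?case
  proof (rule wp_For_map[where a = "''wU''" and l = 0 and h = n and vl = wt and K = 6], goal_cases)
    case (5 t2)
    define U where "U = (\<lambda>v. if 0 \<le> v \<and> v < n then id v else arr s ''unit'' v)"
    have U: "\<And>v. v < n ==> U v = v" unfolding U_def by simp
    have "wu_ok P U x" if "\<And>v. v < n ==> x v = wt v" for x
      using single_units_ok(2)[of P U _ x] P(2) U that unfolding wu_ok_def by blast
    then show ?case using single_units_ok(1)[of P U] P(2) U 5 \<open>t1 \<le> _\<close> D_bounds unfolding U_def[symmetric] by simp
  qed (use g in \<open>simp_all add: gctx_def\<close>)
qed (use g in \<open>simp_all add: gctx_def\<close>)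

lemma take_parts:
  assumes g: "state s P Ut kd wU k" and k: "k \<le> n + 1"
  shows "wp take_parts (\<lambda>t s'. arr s' ''part'' = taken P Ut (arr s ''own'') \<and>
    arr s' ''kind'' = (\<lambda>i. if i \<le> k then 0 else kd i) \<and> t \<le> 200 * D) s"
  unfolding take_parts_def wp_Seq
proof (rule wp_For_map[where a = "''part''" and l = 0 and h = n and vl = "\<lambda>v. if P v = 0 then arr s ''own'' (Ut v) else P v" and K = 20], goal_cases)
  case (5 t1)
  show ?case
  proof (rule wp_For_map[where a = "''kind''" and l = 0 and h = "Suc k" and vl = "\<lambda>_. 0" and K = 6], goal_cases)
    case (5 t2)
    have "(\<lambda>v. if 0 \<le> v \<and> v < n then if P v = 0 then arr s ''own'' (Ut v) else P v else P v) = taken P Ut (arr s ''own'')"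
      by (auto simp: taken_def)
    then show ?case using 5 \<open>t1 \<le> _\<close> g D_bounds k by (simp add: state_def less_Suc_eq_le cong: if_cong)
  qed (use g in \<open>simp_all add: state_def\<close>)
qed (use g in \<open>simp_all add: state_def gctx_def fun_upd_idem\<close>)

end

section \<open>Independence of array contents outside the vertex range\<close>

context inst
begin

lemma cls_cong: "(\<And>v. v < n ==> P v = P' v) ==> cls P = cls P'"
  unfolding cls_def by (intro ext) auto

lemma uset_cong: "(\<And>v. v < n ==> P v = P' v) ==> (\<And>v. v < n ==> U v = U' v) ==> uset P U = uset P' U'"
  unfolding uset_def by (intro ext) auto

lemma NB_cong: "(\<And>v. v < n ==> P v = P' v) ==> (\<And>v. v < n ==> U v = U' v) ==> NB P U = NB P' U'"
  unfolding NB_def nbu_def by (intro ext Collect_cong bex_cong refl) (metis adj_less)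

lemma parts_ok_cong:
  assumes "parts_ok c k P kd" and P: "\<And>v. v < n ==> P v = P' v"
  shows "parts_ok c k P' kd"
proof -
  have "(\<forall>v < n. P' v \<le> k) = (\<forall>v < n. P v \<le> k)" "(\<forall>v < n. (W \<le> wt v) = (1 \<le> P' v \<and> P' v \<le> c)) = (\<forall>v < n. (W \<le> wt v) = (1 \<le> P v \<and> P v \<le> c))"
    using P by auto
  moreover have e: "cls P = cls P'" by (rule cls_cong) (use P in simp)
  ultimately show ?thesis using assms(1) unfolding parts_ok_def e by simp
qed

lemma units_ok_cong:
  assumes u: "units_ok P U" and P: "\<And>v. v < n ==> P v = P' v" and U: "\<And>v. v < n ==> U v = U' v"
  shows "units_ok P' U'"
  unfolding units_ok_def
proof (intro allI impI)
  fix v assume v: "v < n" "P' v = 0"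
  then have "P v = 0" using P by simp
  note o = units_okD[OF u v(1) this]
  have "uset P' U' = uset P U" using uset_cong[of P P' U U'] P U by simp
  then show "U' v < n \<and> P' (U' v) = 0 \<and> U' (U' v) = U' v \<and> conn (uset P' U' (U' v)) \<and> w (uset P' U' (U' v)) < W"
    using o U[OF v(1)] U[OF o(1)] P[OF o(1)] by simp
qed

lemma hall_cong:
  assumes "hall c k P U kd" and P: "\<And>v. v < n ==> P v = P' v" and U: "\<And>v. v < n ==> U v = U' v"
  shows "hall c k P' U' kd"
proof -
  have "acc P U = acc P' U'"
    using cls_cong[of P P'] uset_cong[of P P' U U'] NB_cong[of P P' U U'] P U unfolding acc_def by simp
  then show ?thesis using assms(1) unfolding hall_def by simp
qed

end

section \<open>Invariant of the main loop\<close>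

context packing
begin

text \<open>In the presence of heads the parts need not form a packing, so \<open>k <= kst\<close>
  and \<open>k - c <= M\<close> are carried along. They stem from the last moment without heads;
  creating a head does not change \<open>k\<close>. The number of heads is exposed for the
  potential.\<close>

definition inv :: "store \<Rightarrow> nat \<Rightarrow> nat \<Rightarrow> bool" where
  "inv s k h \<longleftrightarrow> (\<exists>P Ut kd wU. state s P Ut kd wU k \<and> parts_ok c k P kd \<and> units_ok P Ut \<and> wu_ok P Ut wU \<and>
     hall c k P Ut kd \<and> k \<le> kst \<and> k - c \<le> M \<and> h = card (heads c k kd))"

lemma invI:
  "state s P Ut kd wU k ==> parts_ok c k P kd ==> units_ok P Ut ==> wu_ok P Ut wU ==> hall c k P Ut kd ==>
    k \<le> kst ==> k - c \<le> M ==> h = card (heads c k kd) ==> inv s k h"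
  unfolding inv_def by blast

lemma hall_no_heads: "(\<And>i. c < i ==> i \<le> k ==> kd i = 0) ==> hall c k P Ut kd \<and> heads c k kd = {}"
proof -
  assume "\<And>i. c < i ==> i \<le> k ==> kd i = 0"
  then have "heads c k kd = {}" unfolding heads_def by auto
  then show ?thesis unfolding hall_def by auto
qed

lemma light_parts:
  assumes P: "parts_ok c k P kd" and v: "v < n" "P v = 0"
  shows "wt v < W"
  using parts_okD(3)[OF P v(1)] v by auto

text \<open>The assignment is carried out and no head remains, so the \<open>k\<close> parts form a
  packing. This yields \<open>k <= kst\<close> and, by the arcs inside the cores,
  \<open>k - c <= M\<close>, and it makes the Hall condition trivial.\<close>

lemma finish:
  assumes st: "state s P Ut kd wU k" and k: "k \<le> n + 1" and kd: "\<And>i. kd i \<le> 1"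
    and ok: "\<And>kd'. (\<forall>i \<le> k. kd' i = 0) ==> (\<forall>i. kd' i \<le> 1) ==> parts_ok c k (taken P Ut (arr s ''own'')) kd'"
  shows "wp (take_parts ;; single_units) (\<lambda>t s'. inv s' k 0 \<and>
     (\<exists>kd'. parts_ok c k (arr s' ''part'') kd' \<and> (\<forall>i \<le> k. kd' i = 0)) \<and> t \<le> 300 * D) s"
  unfolding wp_Seq
proof (rule wp_frame[OF take_parts[OF st k]], elim conjE, goal_cases)
  case (1 t1 s1)
  let ?kd = "\<lambda>i. if i \<le> k then 0 else kd i" and ?P = "taken P Ut (arr s ''own'')"
  have m: "rmods take_parts = {''v'', ''i''}" "amods take_parts = {''part'', ''kind''}" unfolding take_parts_def by auto
  have p: "parts_ok c k ?P ?kd" by (rule ok) (use kd in auto)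
  have g: "gctx s1" by (rule gctx_frame[OF 1(1)]) (use st in \<open>auto simp: m state_def\<close>)
  have sz: "reg s1 ''size'' = k" using frame_reg[OF 1(1), of "''size''"] st by (simp add: m state_def)
  show ?case
  proof (rule wp_frame[OF single_units[OF g 1(2)]], goal_cases)
    case (1 v) then show ?case using light_parts[OF p] by blast
  next
    case (2 t2 s2)
    have m2: "rmods single_units = {''v''}" "amods single_units = {''unit'', ''wU''}" unfolding single_units_def by auto
    have g2: "gctx s2" by (rule gctx_frame[OF 2(2) g]) (auto simp: m2)
    have s2: "state s2 ?P (arr s2 ''unit'') ?kd (arr s2 ''wU'') k"
      using g2 frame_reg[OF 2(2), of "''size''"] frame_arr[OF 2(2), of "''part''"] frame_arr[OF 2(2), of "''kind''"] sz 1
      unfolding state_def by (simp add: m2)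
    have k1: "k \<le> kst" using kst[OF parts_ok_ipack(1)[OF p]] parts_ok_ipack(2)[OF p] by simp
    have k2: "k - c \<le> M" by (rule parts_ok_arcs[OF p]) simp
    have hh: "hall c k ?P (arr s2 ''unit'') ?kd \<and> heads c k ?kd = {}" by (rule hall_no_heads) simp
    have u2: "units_ok ?P (arr s2 ''unit'')" "wu_ok ?P (arr s2 ''unit'') (arr s2 ''wU'')" using 2(1) by auto
    have "inv s2 k 0"
      by (rule invI[OF s2 p u2 conjunct1[OF hh] k1 k2]) (simp only: conjunct2[OF hh] card.empty)
    moreover have "arr s2 ''part'' = ?P" using frame_arr[OF 2(2), of "''part''"] 1 by (simp add: m2)
    moreover have "\<exists>kd'. parts_ok c k ?P kd' \<and> (\<forall>i \<le> k. kd' i = 0)" using p by (intro exI[of _ ?kd]) simp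
    ultimately show ?case using 1(4) 2(1) by simp
  qed
qed

lemma sum_units:
  assumes g: "gctx s" and a: "arr s ''part'' = P" "arr s ''unit'' = Ut" and U: "\<And>v. v < n ==> P v = 0 ==> Ut v < n"
  shows "wp sum_units (\<lambda>t s'. wu_ok P Ut (arr s' ''wU'') \<and> t \<le> 200 * D) s"
  unfolding sum_units_def wp_Seq
proof (rule wp_For_map[where a = "''wU''" and l = 0 and h = n and vl = "\<lambda>_. 0" and K = 6], goal_cases)
  case (5 t1)
  show ?case
  proof (rule wp_For_add[where h = n and cn = "\<lambda>v. P v = 0" and ix = Ut and vl = wt], goal_cases)
    case (6 t2)
    have "wu_ok P Ut (\<lambda>y. (if y < n then 0 else arr s ''wU'' y) + (\<Sum>v | v < n \<and> P v = 0 \<and> Ut v = y. wt v))"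
      unfolding wu_ok_def uset_def using U by simp
    then show ?case using 5 6 D_bounds by simp
  qed (use g a in \<open>simp_all add: gctx_def\<close>)
qed (use g a in \<open>simp_all add: gctx_def\<close>)

end

section \<open>The programs for the split and for the new head\<close>

context event
begin

lemma split_core:
  assumes st: "state s P Ut kd wU k" and r: "reg s ''jl'' = j" "reg s ''Y'' = Y" "arr s ''own'' = own" "arr s ''att'' = att"
      "arr s ''seen'' = pos" "\<forall>l < m. arr s ''ins'' l = (if anc par i l then 1 else 0)"
  shows "wp split_core (\<lambda>t s'. state s' P1 Ut (kd(Suc k := 0)) wU (Suc k) \<and> t \<le> 300 * D) s"
proof -
  define ins where "ins = arr s ''ins''"
  define A where "A = (\<lambda>v. if 0 \<le> v \<and> v < n then if P v = j \<and> ins (pos v - 1) = 1 then Suc k else P v else P v)"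
  define A2 where "A2 = (\<lambda>v. if 0 \<le> v \<and> v < n then
     if A v = 0 \<and> (own (Ut v) = j \<or> Ut v = Y) then if ins (pos (att (Ut v)) - 1) = 1 then Suc k else j else A v else A v)"
  have A2: "A2 = P1"
  proof
    fix v
    show "A2 v = P1 v"
    proof (cases "v < n")
      case False
      then show ?thesis using hull_S[of v] unfolding A2_def A_def P1_def by simp
    next
      case v: True
      show ?thesis
      proof (cases "P v = j \<or> atd v")
        case False
        then have "v \<notin> hl S1" "v \<notin> hl S2" using hull_S[of v] by auto
        then show ?thesis using v False unfolding A2_def A_def P1_def attd_def by auto
      next
        case True
        note h = home_pos[OF v True]
        have "ins (pos (home v) - 1) = (if anc par i (pos (home v) - 1) then 1 else 0)" using r h unfolding ins_def by auto
        moreover have "home v = (if P v = j then v else att (Ut v))" unfolding home_def by simp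
        ultimately show ?thesis using v True hull_S[of v] j0 unfolding A2_def A_def P1_def attd_def by auto
      qed
    qed
  qed
  have g: "gctx s" and a: "arr s ''part'' = P" "arr s ''unit'' = Ut" "arr s ''kind'' = kd" "arr s ''wU'' = wU" "reg s ''size'' = k"
    using st unfolding state_def by auto
  define s1 where "s1 = s\<lparr>reg := (reg s)(''size'' := Suc k)\<rparr>"
  have g1: "gctx s1" and a1: "arr s1 ''part'' = P" "arr s1 ''unit'' = Ut" "arr s1 ''kind'' = kd" "arr s1 ''wU'' = wU" "reg s1 ''size'' = Suc k"
    "reg s1 ''jl'' = j" "reg s1 ''Y'' = Y" "arr s1 ''own'' = own" "arr s1 ''att'' = att" "arr s1 ''seen'' = pos" "arr s1 ''ins'' = ins"
    using g a r unfolding s1_def gctx_def ins_def by simp_all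
  define s2 where "s2 = s1\<lparr>reg := (reg s1)(''v'' := n), arr := (arr s1)(''part'' := A)\<rparr>"
  have g2: "gctx s2" and a2: "arr s2 ''part'' = A" "arr s2 ''unit'' = Ut" "arr s2 ''kind'' = kd" "arr s2 ''wU'' = wU" "reg s2 ''size'' = Suc k"
    "reg s2 ''jl'' = j" "reg s2 ''Y'' = Y" "arr s2 ''own'' = own" "arr s2 ''att'' = att" "arr s2 ''seen'' = pos" "arr s2 ''ins'' = ins"
    using g1 a1 unfolding s2_def gctx_def by simp_all
  have l1: "wp (For ''v'' (N 0) (R ''n'')
    (Cond (Conj (Equal (C ''part'' (R ''v'')) (R ''jl'')) (Equal (C ''ins'' (posn (R ''v''))) (N 1)))
      (Store ''part'' (R ''v'') (R ''size'')) Skip)) (\<lambda>t s'. s' = s2 \<and> t \<le> 40 * n + 20) s1"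
  proof (rule wp_For_map[where a = "''part''" and l = 0 and h = n and vl = "\<lambda>v. if P v = j \<and> ins (pos v - 1) = 1 then Suc k else P v" and K = 20], goal_cases)
    case (5 t)
    then show ?case unfolding a1(1) A_def[symmetric] s2_def by simp
  qed (use g1 a1 in \<open>simp_all add: gctx_def fun_upd_idem\<close>)
  have l2: "wp (For ''v'' (N 0) (R ''n'')
    (Cond attached
      (Cond (Equal (C ''ins'' (posn anchor)) (N 1)) (Store ''part'' (R ''v'') (R ''size''))
        (Store ''part'' (R ''v'') (R ''jl''))) Skip))
     (\<lambda>t s'. s' = s2\<lparr>reg := (reg s2)(''v'' := n), arr := (arr s2)(''part'' := A2)\<rparr> \<and> t \<le> 60 * n + 20) s2"
    unfolding attached_def
  proof (rule wp_For_map[where a = "''part''" and l = 0 and h = n and vl = "\<lambda>v. if A v = 0 \<and> (own (Ut v) = j \<or> Ut v = Y) then if ins (pos (att (Ut v)) - 1) = 1 then Suc k else j else A v" and K = 45], goal_cases)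
    case (5 t)
    then show ?case unfolding a2(1) A2_def[symmetric] by simp
  qed (use g2 a2 in \<open>simp_all add: gctx_def fun_upd_idem\<close>)
  have l3: "wp (Store ''kind'' (R ''size'') (N 0)) (\<lambda>t s'. state s' P1 Ut (kd(Suc k := 0)) wU (Suc k) \<and> t \<le> 3)
     (s2\<lparr>reg := (reg s2)(''v'' := n), arr := (arr s2)(''part'' := A2)\<rparr>)"
    using g2 a2 A2 by (simp add: state_def gctx_def)
  have fin: "wp (For ''v'' (N 0) (R ''n'')
    (Cond (Conj (Equal (C ''part'' (R ''v'')) (R ''jl'')) (Equal (C ''ins'' (posn (R ''v''))) (N 1)))
      (Store ''part'' (R ''v'') (R ''size'')) Skip) ;;
    For ''v'' (N 0) (R ''n'')
    (Cond attached
      (Cond (Equal (C ''ins'' (posn anchor)) (N 1)) (Store ''part'' (R ''v'') (R ''size''))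
        (Store ''part'' (R ''v'') (R ''jl''))) Skip) ;; Store ''kind'' (R ''size'') (N 0))
    (\<lambda>t s'. state s' P1 Ut (kd(Suc k := 0)) wU (Suc k) \<and> t \<le> 100 * n + 43) s1"
    unfolding wp_Seq
  proof (rule wp_mono[OF l1], elim conjE, hypsubst, goal_cases)
    case (1 t)
    show ?case
    proof (rule wp_mono[OF l2], elim conjE, hypsubst, goal_cases)
      case (1 t2)
      show ?case by (rule wp_mono[OF l3]) (use 1 \<open>t \<le> _\<close> in simp)
    qed
  qed
  show ?thesis
    unfolding split_core_def
    by (subst wp_Seq, subst wp_Assign, rule wp_eq[OF fin])
      (use a D_bounds in \<open>simp_all add: s1_def\<close>)
qed

lemma make_head:
  assumes st: "state s P Ut kd wU k" and r: "reg s ''jl'' = j" "reg s ''Y'' = Y" "arr s ''own'' = own" "arr s ''att'' = att"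
      "arr s ''seen'' = pos" "arr s ''q'' = q" "arr s ''par'' = par" "reg s ''i'' = i" "reg s ''qt'' = m"
    and small: "(\<Sum>l < m. f l) - sub par m f i < W" and H: "hall c k P Ut kd" and k: "k \<le> kst" "k - c \<le> M"
  shows "wp make_head (\<lambda>t s'. inv s' k (Suc (card (heads c k kd))) \<and> t \<le> 1000 * D) s"
proof -
  define br where "br = (\<lambda>l. if 0 \<le> l \<and> l < m then rt par i l else arr s ''br'' l)"
  define A where "A = (\<lambda>v. if 0 \<le> v \<and> v < n then if P v = 0 \<and> (own (Ut v) = j \<or> Ut v = Y) \<and> att (Ut v) \<noteq> z then
     q (br (pos (att (Ut v)) - 1)) else Ut v else Ut v)"
  define A2 where "A2 = (\<lambda>v. if 0 \<le> v \<and> v < n then if P v = j \<and> v \<noteq> z then q (br (pos v - 1)) else A v else A v)"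
  define PP where "PP = (\<lambda>v. if 0 \<le> v \<and> v < n then if P v = j \<and> v \<noteq> z then 0 else P v else P v)"
  \<comment> \<open>Beyond the vertices the arrays keep their old contents, so they agree with
    \<open>P2\<close> and \<open>U2\<close> only below \<open>n\<close>.\<close>
  have PP: "P2 v = PP v" if "v < n" for v using that unfolding PP_def P2_def by simp
  have A2: "U2 v = A2 v" if v: "v < n" for v
  proof (cases "P v = j \<or> atd v")
    case False
    then show ?thesis using v unfolding A2_def A_def U2_def moved_def attd_def by auto
  next
    case True
    note h = home_pos[OF v True]
    have b: "br (pos (home v) - 1) = rt par i (pos (home v) - 1)" using h unfolding br_def by simp
    have "home v = (if P v = j then v else att (Ut v))" unfolding home_def by simp
    then show ?thesis using b v True j0 unfolding A2_def A_def U2_def moved_def attd_def by auto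
  qed
  have g: "gctx s" and a: "arr s ''part'' = P" "arr s ''unit'' = Ut" "arr s ''kind'' = kd" "arr s ''wU'' = wU" "reg s ''size'' = k"
    using st unfolding state_def by auto
  have ok: "parts_ok c k PP (kd(j := 1))" "units_ok PP A2" "hall c k PP A2 (kd(j := 1))"
    using parts_ok_cong[OF head_parts PP] units_ok_cong[OF head_units[OF small] PP A2] hall_cong[OF head_hall[OF H] PP A2] by auto
  have ch: "card (heads c k (kd(j := 1))) = Suc (card (heads c k kd))"
    unfolding head_heads(1) by (rule card_insert_disjoint) (use head_heads(2) in \<open>auto simp: heads_def\<close>)
  define s1 where "s1 = s\<lparr>reg := (reg s)(''l'' := m, ''z'' := z), arr := (arr s)(''br'' := br)\<rparr>"
  have z: "q i = z" unfolding z_def by simp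
  define s2 where "s2 = s1\<lparr>reg := (reg s1)(''v'' := n), arr := (arr s1)(''unit'' := A)\<rparr>"
  define s3 where "s3 = s2\<lparr>reg := (reg s2)(''v'' := n), arr := (arr s2)(''unit'' := A2)\<rparr>"
  define s4 where "s4 = s3\<lparr>reg := (reg s3)(''v'' := n), arr := (arr s3)(''part'' := PP)\<rparr>"
  define s5 where "s5 = s4\<lparr>arr := (arr s4)(''kind'' := kd(j := 1))\<rparr>"
  note sd = s1_def s2_def s3_def s4_def s5_def
  have g1: "gctx s1" "gctx s2" "gctx s3" "gctx s4" "gctx s5"
    using g unfolding sd gctx_def by simp_all
  have a1: "arr s1 ''part'' = P" "arr s1 ''unit'' = Ut" "reg s1 ''z'' = z" "arr s1 ''br'' = br" "arr s1 ''q'' = q"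
    "reg s1 ''jl'' = j" "reg s1 ''Y'' = Y" "arr s1 ''own'' = own" "arr s1 ''att'' = att" "arr s1 ''seen'' = pos"
    and a2: "arr s2 ''part'' = P" "arr s2 ''unit'' = A" "reg s2 ''z'' = z" "arr s2 ''br'' = br" "arr s2 ''q'' = q"
    "reg s2 ''jl'' = j" "arr s2 ''seen'' = pos"
    and a3: "arr s3 ''part'' = P" "reg s3 ''z'' = z" "reg s3 ''jl'' = j"
    and a4: "reg s4 ''jl'' = j" "arr s4 ''kind'' = kd"
    and a5: "arr s5 ''part'' = PP" "arr s5 ''unit'' = A2" "arr s5 ''kind'' = kd(j := 1)" "reg s5 ''size'' = k"
    using a r unfolding sd by simp_all
  have l1: "wp (For ''l'' (N 0) (R ''qt'')
    (Cond (either (Equal (R ''l'') (N 0)) (Equal (C ''par'' (R ''l'')) (R ''i'')))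
      (Store ''br'' (R ''l'') (R ''l''))
      (Store ''br'' (R ''l'') (C ''br'' (C ''par'' (R ''l''))))))
    (\<lambda>t s'. s' = s\<lparr>reg := (reg s)(''l'' := m), arr := (arr s)(''br'' := br)\<rparr> \<and> t \<le> 40 * m + 20) s"
  proof (rule wp_For_map[where a = "''br''" and l = 0 and h = m and vl = "rt par i" and K = 25], goal_cases)
    case (4 l g)
    show ?case
    proof (cases "l = 0 \<or> par l = i")
      case True
      then show ?thesis using r rt_root[of l par i] by auto
    next
      case False
      then have p: "par l < l" using par[of l] 4 by simp
      then have "rt par i l = g (par l)" using 4(4)[of "par l"] rt_step[of l par i] False by simp
      then show ?thesis using r False by simp
    qed
  next
    case (5 t)
    then show ?case unfolding br_def[symmetric] by simp
  qed (use r in simp_all)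
  have l2: "wp (For ''v'' (N 0) (R ''n'')
    (Cond (Conj attached (neq anchor (R ''z'')))
      (Store ''unit'' (R ''v'') (C ''q'' (C ''br'' (posn anchor)))) Skip)) (\<lambda>t s'. s' = s2 \<and> t \<le> 70 * n + 20) s1"
    unfolding attached_def
  proof (rule wp_For_map[where a = "''unit''" and l = 0 and h = n and vl = "\<lambda>v. if P v = 0 \<and> (own (Ut v) = j \<or> Ut v = Y) \<and> att (Ut v) \<noteq> z then
     q (br (pos (att (Ut v)) - 1)) else Ut v" and K = 55], goal_cases)
    case (5 t)
    then show ?case unfolding a1(2) A_def[symmetric] s2_def by simp
  qed (use g1 a1 in \<open>simp_all add: gctx_def fun_upd_idem\<close>)
  have l3: "wp (For ''v'' (N 0) (R ''n'')
    (Cond (Conj (Equal (C ''part'' (R ''v'')) (R ''jl'')) (neq (R ''v'') (R ''z'')))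
      (Store ''unit'' (R ''v'') (C ''q'' (C ''br'' (posn (R ''v''))))) Skip)) (\<lambda>t s'. s' = s3 \<and> t \<le> 40 * n + 20) s2"
  proof (rule wp_For_map[where a = "''unit''" and l = 0 and h = n and vl = "\<lambda>v. if P v = j \<and> v \<noteq> z then q (br (pos v - 1)) else A v" and K = 25], goal_cases)
    case (5 t)
    then show ?case unfolding a2(2) A2_def[symmetric] s3_def by simp
  qed (use g1 a2 in \<open>simp_all add: gctx_def fun_upd_idem\<close>)
  have l4: "wp (For ''v'' (N 0) (R ''n'')
    (Cond (Conj (Equal (C ''part'' (R ''v'')) (R ''jl'')) (neq (R ''v'') (R ''z'')))
      (Store ''part'' (R ''v'') (N 0)) Skip)) (\<lambda>t s'. s' = s4 \<and> t \<le> 40 * n + 20) s3"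
  proof (rule wp_For_map[where a = "''part''" and l = 0 and h = n and vl = "\<lambda>v. if P v = j \<and> v \<noteq> z then 0 else P v" and K = 25], goal_cases)
    case (5 t)
    then show ?case unfolding a3(1) PP_def[symmetric] s4_def by simp
  qed (use g1 a3 in \<open>simp_all add: gctx_def fun_upd_idem\<close>)
  have l5: "wp (Store ''kind'' (R ''jl'') (N 1)) (\<lambda>t s'. s' = s5 \<and> t \<le> 3) s4"
    using a4 by (simp add: s5_def)
  have l6: "wp sum_units (\<lambda>t s'. inv s' k (Suc (card (heads c k kd))) \<and> t \<le> 200 * D) s5"
  proof (rule wp_frame[OF sum_units[OF g1(5) a5(1,2)]], goal_cases)
    case (1 v) then show ?case using units_okD(1)[OF ok(2)] by blast
  next
    case (2 t s')
    have m: "rmods sum_units = {''v''}" "amods sum_units = {''wU''}" unfolding sum_units_def by auto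
    have "gctx s'" by (rule gctx_frame[OF 2(2) g1(5)]) (auto simp: m)
    then have "state s' PP A2 (kd(j := 1)) (arr s' ''wU'') k"
      using frame_reg[OF 2(2), of "''size''"] frame_arr[OF 2(2), of "''part''"] frame_arr[OF 2(2), of "''unit''"] frame_arr[OF 2(2), of "''kind''"] a5
      unfolding state_def by (simp add: m)
    then have "inv s' k (Suc (card (heads c k kd)))"
      using 2(1) by (intro invI[OF _ ok(1,2) _ ok(3) k ch[symmetric]]) auto
    then show ?case using 2(1) by simp
  qed
  have mD: "m \<le> D" using tree_size(2)[OF T] D_bounds by simp
  show ?thesis
    unfolding make_head_def wp_Seq
  proof (rule wp_mono[OF l1], elim conjE, hypsubst, goal_cases)
    case (1 t1)
    show ?case
      unfolding wp_Assign
    proof (rule wp_eq[OF l2], goal_cases)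
      case 1
      show ?case using r z by (simp add: s1_def)
    next
      case (2 t2 s')
      then have s': "s' = s2" "t2 \<le> 70 * n + 20" by auto
      show ?case
        unfolding s'(1)
      proof (rule wp_mono[OF l3], elim conjE, hypsubst, goal_cases)
        case (1 t3)
        show ?case
        proof (rule wp_mono[OF l4], elim conjE, hypsubst, goal_cases)
          case (1 t4)
          show ?case
          proof (rule wp_mono[OF l5], elim conjE, hypsubst, goal_cases)
            case (1 t5)
            show ?case
              by (rule wp_mono[OF l6]) (use 1 \<open>t1 \<le> _\<close> s'(2) \<open>t3 \<le> _\<close> \<open>t4 \<le> _\<close> mD D_bounds in simp)
          qed
        qed
      qed
    qed
  qed
qed

end

lemma sub_cong: "(\<And>l. l < m ==> f l = g l) ==> sub p m f i = sub p m g i"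
  unfolding sub_def by (intro sum.cong) auto

context packing
begin

lemma bfs_mods: "rmods bfs = {''qh'', ''qt'', ''ptr'', ''ac'', ''y''}" "amods bfs = {''q'', ''seen'', ''par''}"
  unfolding bfs_def by auto

lemma event_mods:
  "rmods core_tree = {''v'', ''r'', ''cl'', ''qh'', ''qt'', ''ptr'', ''ac'', ''y''}" "amods core_tree = {''q'', ''seen'', ''par''}"
  "rmods attach = {''a'', ''v''}" "amods attach = {''att'', ''aug''}"
  "rmods find_subtree = {''fnd'', ''ii'', ''i'', ''l'', ''s'', ''tot''}" "amods find_subtree = {''ins''}"
  unfolding core_tree_def attach_def find_subtree_def mark_subtree_def by (auto simp: bfs_mods)

text \<open>Either outcome is progress in the order by \<open>k\<close> and then by the number of
  heads: one more head, or one more set and a fresh start without heads.\<close>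

lemma light_event:
  assumes st: "state s P Ut kd wU k" and ok: "parts_ok c k P kd" "units_ok P Ut" "wu_ok P Ut wU" "hall c k P Ut kd"
    and k: "k \<le> kst" "k - c \<le> M"
    and ev: "arr s ''own'' = own" "reg s ''jl'' = j" "reg s ''ev'' - 1 = Y"
    and j: "c < j" "j \<le> k" "kd j = 0" and Y: "Y \<in> units P Ut" "own Y \<noteq> j"
    and nb: "\<And>v. v < n ==> attd P Ut own j Y v ==> nbu P Ut j (Ut v)"
    and tot: "3 * W \<le> w {v. v < n \<and> (P v = j \<or> attd P Ut own j Y v)}"
    and load: "w {v. v < n \<and> (P v = j \<or> P v = 0 \<and> own (Ut v) = j)} < 3 * W"
    and region: "\<And>Z. Z \<subseteq> heads c k kd ==>
      2 * W * card Z \<le> (\<Sum>i \<in> Z. w (cls P i)) + (\<Sum>u \<in> {u \<in> NB P Ut Z. own u \<noteq> j}. w (uset P Ut u))"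
  shows "wp light_event (\<lambda>t s'. (inv s' k (Suc (card (heads c k kd))) \<or> inv s' (Suc k) 0) \<and> t \<le> 12000 * D) s"
proof -
  define s1 where "s1 = s\<lparr>reg := (reg s)(''Y'' := Y)\<rparr>"
  have st1: "state s1 P Ut kd wU k" "reg s1 ''jl'' = j" "reg s1 ''Y'' = Y" "arr s1 ''own'' = own"
    using st ev unfolding state_def gctx_def s1_def by simp_all
  have cj: "conn (cls P j)" using parts_okD(8)[OF ok(1) j(1,2)] j(3) by simp
  have j0: "j \<noteq> 0" using j by simp
  have main: "wp (core_tree ;; attach ;; find_subtree ;; Cond (Less (Minus (R ''tot'') (R ''s'')) (R ''W'')) make_head
      (split_core ;; label_W ;; take_parts ;; single_units))
    (\<lambda>t s'. (inv s' k (Suc (card (heads c k kd))) \<or> inv s' (Suc k) 0) \<and> t \<le> 11990 * D) s1"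
    unfolding wp_Seq
  proof (rule wp_frame[OF core_tree[of s1 P j]], goal_cases)
    case (5 t2 s2)
    define q par pos m where "q = arr s2 ''q''" and "par = arr s2 ''par''" and "pos = arr s2 ''seen''" and "m = reg s2 ''qt''"
    have T: "tree P j q par pos m" and t2: "t2 \<le> 500 * D" and g2: "gctx s2" using 5(1) unfolding q_def par_def pos_def m_def by auto
    have r2: "x \<notin> rmods core_tree ==> reg s2 x = reg s1 x" "x \<notin> amods core_tree ==> arr s2 x = arr s1 x" for x
      using 5(2) unfolding frame_def by auto
    have st2: "state s2 P Ut kd wU k" "reg s2 ''jl'' = j" "reg s2 ''Y'' = Y" "arr s2 ''own'' = own"
      using st1 g2 unfolding state_def by (simp_all add: r2 event_mods)
    show ?case
    proof (rule wp_frame[OF attach[of s2 P Ut own j Y]], goal_cases)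
      case (8 t3 s3)
      define att where "att = arr s3 ''att''"
      have g3: "gctx s3" and t3: "t3 \<le> 500 * D" and an: "\<And>u. nbu P Ut j u ==> anch P Ut j u (att u)"
        and au: "\<And>x. x < n ==> P x = j ==> arr s3 ''aug'' x = w (bag P Ut own j Y att x)"
        using 8(1) unfolding att_def by auto
      have r3: "x \<notin> rmods attach ==> reg s3 x = reg s2 x" "x \<notin> amods attach ==> arr s3 x = arr s2 x" for x
        using 8(2) unfolding frame_def by auto
      have st3: "state s3 P Ut kd wU k" "reg s3 ''jl'' = j" "reg s3 ''Y'' = Y" "arr s3 ''own'' = own"
        "arr s3 ''q'' = q" "arr s3 ''par'' = par" "arr s3 ''seen'' = pos" "reg s3 ''qt'' = m"
        using st2 g3 unfolding state_def q_def par_def pos_def m_def by (simp_all add: r3 event_mods)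
      let ?f = "\<lambda>l. w (bag P Ut own j Y att (q l))" and ?g = "\<lambda>l. arr s3 ''aug'' (q l)"
      have fg: "?g l = ?f l" if "l < m" for l using au treeD(2)[OF T that] by simp
      interpret E0: event0 n M sr tg wt W c kst vfi vnx k P Ut kd wU own j Y q par pos m att
        by unfold_locales (use ok j T an nb tot load Y region in auto)
      have sg: "(\<Sum>l < m. ?g l) = (\<Sum>l < m. ?f l)" using fg by (intro sum.cong) auto
      show ?case
      proof (rule wp_frame[OF find_subtree[of s3 m q par "arr s3 ''aug''"]], goal_cases)
        case (10 t4 s4)
        define i where "i = reg s4 ''i''"
        have g4: "gctx s4" and t4: "t4 \<le> 500 * D" using 10(1) by auto
        have sub: "sub par m ?g i' = sub par m ?f i'" for i' by (rule sub_cong) (rule fg)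
        have F: "i < m" "W \<le> sub par m ?f i" "\<And>i'. i < i' ==> i' < m ==> sub par m ?f i' < W"
          "\<forall>l < m. arr s4 ''ins'' l = (if anc par i l then 1 else 0)" "reg s4 ''s'' = sub par m ?f i" "reg s4 ''tot'' = (\<Sum>l < m. ?f l)"
          using 10(1) unfolding found_def sub sg i_def by auto
        have r4: "x \<notin> rmods find_subtree ==> reg s4 x = reg s3 x" "x \<notin> amods find_subtree ==> arr s4 x = arr s3 x" for x
          using 10(2) unfolding frame_def by auto
        have st4: "state s4 P Ut kd wU k" "reg s4 ''jl'' = j" "reg s4 ''Y'' = Y" "arr s4 ''own'' = own"
          "arr s4 ''q'' = q" "arr s4 ''par'' = par" "arr s4 ''seen'' = pos" "reg s4 ''qt'' = m" "arr s4 ''att'' = att"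
          using st3 g4 unfolding state_def att_def by (simp_all add: r4 event_mods)
        have W4: "reg s4 ''W'' = W" using g4 unfolding gctx_def by simp
        interpret E: event n M sr tg wt W c kst vfi vnx k P Ut kd wU own j Y q par pos m att i
          by unfold_locales (use F in auto)
        show ?case
        proof (cases "(\<Sum>l < m. ?f l) - sub par m ?f i < W")
          case True
          have "wp make_head (\<lambda>t s'. inv s' k (Suc (card (heads c k kd))) \<and> t \<le> 1000 * D) s4"
            by (rule E.make_head) (use st4 True ok k in \<open>simp_all add: i_def\<close>)
          then show ?thesis
            unfolding wp_Cond using True F W4 t2 t3 t4 D_bounds by (simp, elim wp_mono) simp
        next
          case False
          note sp = E.split_parts[of, OF not_less[THEN iffD1, OF False]]
          have rd: "ready E.P1 Ut (kd(Suc k := 0)) wU (Suc k)"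
            unfolding ready_def
          proof (intro conjI)
            show "wu_ok E.P1 Ut wU" unfolding wu_ok_def using sp(3,4) ok(3) unfolding wu_ok_def by simp
          qed (use sp k kst_n in auto)
          have hd: "heads c (Suc k) (kd(Suc k := 0)) = heads c k kd" unfolding heads_def by (auto simp: le_Suc_eq)
          have kd1: "(kd(Suc k := 0)) i \<le> 1" for i using parts_okD(5)[OF ok(1)] by simp
          have "wp (split_core ;; label_W ;; take_parts ;; single_units) (\<lambda>t s'. inv s' (Suc k) 0 \<and> t \<le> 9610 * D) s4"
          proof (subst wp_Seq, rule wp_mono[OF E.split_core], goal_cases)
            case (8 t5 s5)
            show ?case
            proof (subst wp_Seq, rule wp_mono[OF label_W[OF conjunct1[OF 8] rd]], goal_cases)
              case (1 t6 s6)
              let ?Z = "{i \<in> {c<..Suc k}. arr s6 ''lab'' i = n + 5}"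
              \<comment> \<open>A blocked set would have a Hall deficit above \<open>W\<close>, but
                the split has cost the heads at most the unit \<open>Y\<close>.\<close>
              have "?Z = {}"
              proof (rule ccontr)
                assume "?Z \<noteq> {}"
                then have "?Z \<subseteq> heads c k kd" "acc E.P1 Ut ?Z + W < 2 * W * card ?Z" using 1 unfolding Let_def hd by auto
                then show False using E.split_hall[of ?Z] E0.wY by linarith
              qed
              then have "\<And>kd'. (\<forall>i \<le> Suc k. kd' i = 0) ==> (\<forall>i. kd' i \<le> 1) ==> parts_ok c (Suc k) (taken E.P1 Ut (arr s6 ''own'')) kd'"
                using 1 unfolding Let_def by blast
              then have "wp (take_parts ;; single_units) (\<lambda>t s'. inv s' (Suc k) 0 \<and>
                 (\<exists>kd'. parts_ok c (Suc k) (arr s' ''part'') kd' \<and> (\<forall>i \<le> Suc k. kd' i = 0)) \<and> t \<le> 300 * D) s6"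
                using 1 k kst_n kd1 by (intro finish[of _ E.P1 Ut "kd(Suc k := 0)" wU]) auto
              then show ?case by (rule wp_mono) (use 8 1 in simp)
            qed
          qed (use st4 F in simp_all)
          then show ?thesis
            unfolding wp_Cond using False F W4 t2 t3 t4 D_bounds by (simp, elim wp_mono) simp
        qed
      qed (use st3 g3 treeD(3)[OF T] tree_size[OF T] sg E0.total(1) in \<open>simp_all\<close>)
    qed (use st2 g2 j0 in \<open>simp_all add: state_def\<close>)
  qed (use st1 cj in \<open>simp_all add: state_def\<close>)
  show ?thesis
    unfolding light_event_def
    by (subst wp_Seq, subst wp_Assign, rule wp_eq[OF main]) (use ev D_bounds in \<open>simp_all add: s1_def\<close>)
qed

section \<open>Arcs that violate the certificate\<close>

definition conflict_free :: "(nat \<Rightarrow> nat) \<Rightarrow> (nat \<Rightarrow> nat) \<Rightarrow> nat set \<Rightarrow> bool" where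
  "conflict_free P Ut F \<longleftrightarrow> (\<forall>x y. adj x y \<and> P x = 0 \<and> P y = 0 \<and> Ut x \<noteq> Ut y --> Ut x \<in> NB P Ut F \<and> Ut y \<in> NB P Ut F)"

lemma find_conflict:
  assumes g: "gctx s" and a: "arr s ''part'' = P" "arr s ''unit'' = Ut" "arr s ''fl'' = fl"
    and P: "\<And>v. v < n ==> P v \<le> k" and U: "\<And>v. v < n ==> P v = 0 ==> Ut v < n"
    and F: "F = {i \<in> {c<..k}. fl i = 1}"
  shows "wp find_conflict (\<lambda>t s'. (reg s' ''fnd'' = 0 --> conflict_free P Ut F) \<and>
    (\<forall>a. reg s' ''fnd'' = a \<and> a \<noteq> 0 --> a \<le> M \<and> P (sr a) = 0 \<and> P (tg a) = 0 \<and> Ut (sr a) \<noteq> Ut (tg a) \<and>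
       \<not> (Ut (sr a) \<in> NB P Ut F \<and> Ut (tg a) \<in> NB P Ut F)) \<and> t \<le> 500 * D) s"
proof -
  define I where "I i s' \<longleftrightarrow> gctx s' \<and> arr s' ''part'' = P \<and> arr s' ''unit'' = Ut \<and> arr s' ''fl'' = fl \<and>
    (\<forall>u < n. arr s' ''nf'' u = (if \<exists>a. 1 \<le> a \<and> a < i \<and> c < P (sr a) \<and> P (tg a) = 0 \<and> fl (P (sr a)) = 1 \<and> Ut (tg a) = u then 1 else 0))"
    for i and s' :: store
  have rest: "wp (''fnd'' ::= N 0 ;;
  For ''a'' (N 1) (Plus (R ''M'') (N 1))
    (Cond (Conj (Conj (Equal (C ''part'' (C ''src'' (R ''a''))) (N 0)) (Equal (C ''part'' (C ''tgt'' (R ''a''))) (N 0)))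
       (Conj (neq (C ''unit'' (C ''src'' (R ''a''))) (C ''unit'' (C ''tgt'' (R ''a''))))
         (Neg (Conj (Equal (C ''nf'' (C ''unit'' (C ''src'' (R ''a'')))) (N 1)) (Equal (C ''nf'' (C ''unit'' (C ''tgt'' (R ''a'')))) (N 1))))))
      (''fnd'' ::= R ''a'') Skip))
   (\<lambda>t s'. (reg s' ''fnd'' = 0 --> conflict_free P Ut F) \<and>
    (\<forall>a. reg s' ''fnd'' = a \<and> a \<noteq> 0 --> a \<le> M \<and> P (sr a) = 0 \<and> P (tg a) = 0 \<and> Ut (sr a) \<noteq> Ut (tg a) \<and>
       \<not> (Ut (sr a) \<in> NB P Ut F \<and> Ut (tg a) \<in> NB P Ut F)) \<and> t \<le> 60 * M + 30) s1"
    if I1: "I (Suc M) s1" for s1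
  proof -
    define nf where "nf = arr s1 ''nf''"
    have g1: "gctx s1" "arr s1 ''part'' = P" "arr s1 ''unit'' = Ut" using I1 unfolding I_def by auto
    have nf: "(nf u = 1) = (u \<in> NB P Ut F)" if u: "u < n" for u
    proof -
      have "(\<exists>a. 1 \<le> a \<and> a < Suc M \<and> c < P (sr a) \<and> P (tg a) = 0 \<and> fl (P (sr a)) = 1 \<and> Ut (tg a) = u) = (u \<in> NB P Ut F)"
      proof
        assume "\<exists>a. 1 \<le> a \<and> a < Suc M \<and> c < P (sr a) \<and> P (tg a) = 0 \<and> fl (P (sr a)) = 1 \<and> Ut (tg a) = u"
        then obtain a where x: "1 \<le> a" "a \<le> M" "c < P (sr a)" "P (tg a) = 0" "fl (P (sr a)) = 1" "Ut (tg a) = u" by auto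
        then have "P (sr a) \<in> F" "adj (sr a) (tg a)" using P sr unfolding F adj_def by auto
        then show "u \<in> NB P Ut F" using x unfolding NB_def nbu_def by blast
      next
        assume "u \<in> NB P Ut F"
        then obtain x y where "adj x y" "P x \<in> F" "P y = 0" "Ut y = u" unfolding NB_def nbu_def by blast
        then obtain a where "1 \<le> a" "a \<le> M" "P (sr a) \<in> F" "P (tg a) = 0" "Ut (tg a) = u" unfolding adj_def by blast
        then show "\<exists>a. 1 \<le> a \<and> a < Suc M \<and> c < P (sr a) \<and> P (tg a) = 0 \<and> fl (P (sr a)) = 1 \<and> Ut (tg a) = u" unfolding F by auto
      qed
      then show ?thesis using I1 u unfolding I_def nf_def by simp
    qed
    define cn where "cn a \<longleftrightarrow> P (sr a) = 0 \<and> P (tg a) = 0 \<and> Ut (sr a) \<noteq> Ut (tg a) \<and> \<not> (nf (Ut (sr a)) = 1 \<and> nf (Ut (tg a)) = 1)" for a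
    have cn: "cn a \<longleftrightarrow> P (sr a) = 0 \<and> P (tg a) = 0 \<and> Ut (sr a) \<noteq> Ut (tg a) \<and> \<not> (Ut (sr a) \<in> NB P Ut F \<and> Ut (tg a) \<in> NB P Ut F)"
      if a: "1 \<le> a" "a \<le> M" for a
      using nf U sr[OF a] tg[OF a] unfolding cn_def by auto
    have cf: "conflict_free P Ut F" if "\<forall>a. 1 \<le> a \<and> a < Suc M --> \<not> cn a"
      using that cn unfolding conflict_free_def adj_def by (metis less_Suc_eq_le)
    show ?thesis
      unfolding wp_Seq wp_Assign
    proof (rule wp_For_find[where l = 1 and h = "Suc M" and cn = cn and vl = id], goal_cases)
      case (7 t z)
      then consider "z = 0" "\<forall>a. 1 \<le> a \<and> a < Suc M --> \<not> cn a" | "1 \<le> z" "z < Suc M" "cn z" by auto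
      then show ?case
      proof cases
        case 1 then show ?thesis using 7(1) cf by auto
      next
        case 2 then show ?thesis using 7(1) cn[of z] by simp
      qed
    qed (use g1 in \<open>simp_all add: gctx_def cn_def nf_def\<close>)
  qed
  show ?thesis
    unfolding find_conflict_def
  proof (subst wp_Seq, rule wp_For_map[where a = "''nf''" and l = 0 and h = n and vl = "\<lambda>_. 0" and K = 6], goal_cases)
    case (5 t0)
    show ?case
    proof (subst wp_Seq, rule wp_For[where I = I and l = 1 and h = "Suc M" and K = 40], goal_cases)
      case 3 then show ?case using g a by (simp add: I_def gctx_def)
    next
      case (4 i s') then show ?case by (simp add: I_def gctx_def)
    next
      case (5 i s')
      have J: "gctx s'" "arr s' ''part'' = P" "arr s' ''unit'' = Ut" "arr s' ''fl'' = fl" using 5(1) unfolding I_def by auto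
      let ?c = "\<lambda>a u. c < P (sr a) \<and> P (tg a) = 0 \<and> fl (P (sr a)) = 1 \<and> Ut (tg a) = u"
      have A: "arr s' ''nf'' u = (if \<exists>a. 1 \<le> a \<and> a < i \<and> ?c a u then 1 else 0)" if "u < n" for u using 5(1) that unfolding I_def by blast
      have ex: "(\<exists>a. 1 \<le> a \<and> a < Suc i \<and> ?c a u) \<longleftrightarrow> (\<exists>a. 1 \<le> a \<and> a < i \<and> ?c a u) \<or> ?c i u" for u
        using 5(3) less_Suc_eq by auto
      show ?case
      proof (cases "c < P (sr i) \<and> P (tg i) = 0 \<and> fl (P (sr i)) = 1")
        case True
        have "((arr s' ''nf'')(Ut (tg i) := 1)) u = (if \<exists>a. 1 \<le> a \<and> a < Suc i \<and> ?c a u then 1 else 0)" if "u < n" for u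
          unfolding ex using A[OF that] True by auto
        then show ?thesis using J True 5(2) by (simp add: I_def gctx_def)
      next
        case False
        have "arr s' ''nf'' u = (if \<exists>a. 1 \<le> a \<and> a < Suc i \<and> ?c a u then 1 else 0)" if "u < n" for u
          unfolding ex using A[OF that] False by auto
        then have "I (Suc i) (s'\<lparr>reg := (reg s')(''a'' := Suc i)\<rparr>)" using J by (simp add: I_def gctx_def)
        moreover have "\<not> ((c < P (sr i) \<and> P (tg i) = 0) \<and> fl (P (sr i)) = Suc 0)" using False by simp
        ultimately show ?thesis using J 5(2) by (simp add: gctx_def, intro impI, elim conjE, simp)
      qed
    next
      case (6 s' t)
      show ?case by (rule wp_mono[OF rest[OF 6(1)]]) (use 5 6(3) D_bounds in simp)
    qed simp_all
  qed (use g in \<open>simp_all add: gctx_def\<close>)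
qed

end

section \<open>A tentative core made of two units\<close>

context packing
begin

definition joined :: "(nat \<Rightarrow> nat) \<Rightarrow> (nat \<Rightarrow> nat) \<Rightarrow> nat \<Rightarrow> nat \<Rightarrow> nat \<Rightarrow> nat \<Rightarrow> nat" where
  "joined P Ut k p q v = (if v < n \<and> P v = 0 \<and> (Ut v = p \<or> Ut v = q) then Suc k else P v)"

context
  fixes k x y :: nat and P Ut kd wU :: "nat \<Rightarrow> nat"
  assumes p: "parts_ok c k P kd" and u: "units_ok P Ut" and wu: "wu_ok P Ut wU" and sep: "separated P Ut"
    and xy: "adj x y" "P x = 0" "P y = 0" "Ut x \<noteq> Ut y"
begin

abbreviation "P3 \<equiv> joined P Ut k (Ut x) (Ut y)"

lemma joined_eq: "v < n ==> i \<noteq> Suc k ==> (P3 v = i) = (P v = i \<and> \<not> (P v = 0 \<and> (Ut v = Ut x \<or> Ut v = Ut y)))"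
  unfolding joined_def by auto

lemma joined_uset: "v \<noteq> Ut x ==> v \<noteq> Ut y ==> uset P3 Ut v = uset P Ut v"
  unfolding uset_def using joined_eq[of _ 0] by auto

text \<open>Adjacent units together weigh at least \<open>W\<close> by \<open>separated\<close>, and
  less than \<open>2 * W\<close> as each is light.\<close>

lemma joined_parts: "parts_ok c (Suc k) P3 (kd(Suc k := 0))"
proof -
  note po = parts_okD[OF p]
  have n: "x < n" "y < n" using adj_less xy by auto
  have new: "cls P3 (Suc k) = uset P Ut (Ut x) \<union> uset P Ut (Ut y)"
    using po(2) unfolding cls_def uset_def joined_def by (auto; fastforce)
  have dis: "uset P Ut (Ut x) \<inter> uset P Ut (Ut y) = {}" using disjoint_uset xy by simp
  have wx: "w (cls P3 (Suc k)) = w (uset P Ut (Ut x)) + w (uset P Ut (Ut y))"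
    unfolding new by (rule sum.union_disjoint) (use dis in auto)
  have mem: "x \<in> uset P Ut (Ut x)" "y \<in> uset P Ut (Ut y)" using n xy unfolding uset_def by auto
  have cx: "conn (cls P3 (Suc k))"
    unfolding new by (rule conn_Un[OF units_okD(4)[OF u] units_okD(4)[OF u] mem xy(1)]) (use n xy in auto)
  have wb: "W \<le> w (cls P3 (Suc k))" "w (cls P3 (Suc k)) < 3 * W"
    using sep xy units_okD(5)[OF u n(1) xy(2)] units_okD(5)[OF u n(2) xy(3)] unfolding wx separated_def by auto
  have co: "cls P3 i = cls P i" if "i \<noteq> 0" "i \<noteq> Suc k" for i
    using that joined_eq unfolding cls_def by auto
  show ?thesis
    unfolding parts_ok_def
  proof (intro conjI allI impI)
    fix v assume v: "v < n"
    show "P3 v \<le> Suc k" using po(2)[OF v] unfolding joined_def by auto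
    show "(W \<le> wt v) = (1 \<le> P3 v \<and> P3 v \<le> c)" using po(1) po(3)[OF v] unfolding joined_def by auto
  next
    fix i assume "1 \<le> i \<and> i \<le> c"
    then show "\<exists>v. cls P3 i = {v}" using co[of i] po(1) po(4)[of i] by auto
  next
    fix i assume i: "c < i \<and> i \<le> Suc k"
    show "if (kd(Suc k := 0)) i = 1 then \<exists>h. cls P3 i = {h} else conn (cls P3 i) \<and> W \<le> w (cls P3 i) \<and> w (cls P3 i) < 3 * W"
      using i cx wb co[of i] po(7,8)[of i] by (cases "i = Suc k") auto
  qed (use po in auto)
qed

lemma joined_units: "units_ok P3 Ut" "wu_ok P3 Ut wU"
proof -
  have a: "P v = 0 \<and> Ut v \<noteq> Ut x \<and> Ut v \<noteq> Ut y" if "v < n" "P3 v = 0" for v using joined_eq[of v 0] that by auto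
  show "units_ok P3 Ut"
    unfolding units_ok_def
  proof (intro allI impI)
    fix v assume v: "v < n" "P3 v = 0"
    note av = a[OF v]
    note uo = units_okD[OF u v(1) conjunct1[OF av]]
    have "P3 (Ut v) = 0" using joined_eq[of "Ut v" 0] uo av by auto
    then show "Ut v < n \<and> P3 (Ut v) = 0 \<and> Ut (Ut v) = Ut v \<and> conn (uset P3 Ut (Ut v)) \<and> w (uset P3 Ut (Ut v)) < W"
      using uo av joined_uset by simp
  qed
  show "wu_ok P3 Ut wU"
    unfolding wu_ok_def
  proof (intro allI impI)
    fix v assume v: "v < n" "P3 v = 0"
    then show "wU (Ut v) = w (uset P3 Ut (Ut v))" using a[OF v] joined_uset wu unfolding wu_ok_def by simp
  qed
qed

lemma joined_heads: "heads c (Suc k) (kd(Suc k := 0)) = heads c k kd"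
  unfolding heads_def by (auto simp: le_Suc_eq)

text \<open>The two joined units are the only ones that the heads can lose.\<close>

lemma joined_acc:
  assumes Z: "Z \<subseteq> heads c k kd"
  shows "acc P Ut Z \<le> acc P3 Ut Z + (\<Sum>u \<in> {Ut x, Ut y} \<inter> NB P Ut Z. w (uset P Ut u))"
proof -
  have Zi: "i \<noteq> 0 \<and> i \<noteq> Suc k" if "i \<in> Z" for i using that Z unfolding heads_def by auto
  have cl: "cls P3 i = cls P i" if "i \<in> Z" for i using Zi[OF that] joined_eq unfolding cls_def by auto
  let ?N = "NB P Ut Z" and ?u = "\<lambda>u. w (uset P Ut u)"
  have sub: "?N - {Ut x, Ut y} \<subseteq> NB P3 Ut Z"
  proof
    fix v assume v: "v \<in> ?N - {Ut x, Ut y}"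
    then have "v \<in> NB P Ut Z" and vn: "v \<noteq> Ut x" "v \<noteq> Ut y" by blast+
    then obtain a b where ab: "adj a b" "P a \<in> Z" "P b = 0" "Ut b = v" unfolding NB_def nbu_def by blast
    have "P3 a = P a" using Zi[OF ab(2)] unfolding joined_def by simp
    moreover have "P3 b = 0" using ab(3,4) vn unfolding joined_def by simp
    ultimately show "v \<in> NB P3 Ut Z" using ab unfolding NB_def nbu_def by blast
  qed
  let ?X = "{Ut x, Ut y}"
  have 1: "sum ?u ?N = sum ?u (?N \<inter> ?X) + sum ?u (?N - ?X)" by (rule sum.Int_Diff[OF fin_NB])
  have 2: "?N \<inter> ?X = ?X \<inter> ?N" by (rule Int_commute)
  have 3: "sum ?u (?N - ?X) = (\<Sum>v \<in> ?N - ?X. w (uset P3 Ut v))"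
    by (rule sum.cong[OF refl], subst joined_uset) auto
  have 4: "(\<Sum>v \<in> ?N - ?X. w (uset P3 Ut v)) \<le> (\<Sum>v \<in> NB P3 Ut Z. w (uset P3 Ut v))"
    by (rule sum_mono2[OF fin_NB sub]) (rule le0)
  have "sum ?u ?N \<le> sum ?u (?X \<inter> ?N) + (\<Sum>v \<in> NB P3 Ut Z. w (uset P3 Ut v))"
    using 1 3 4 unfolding 2 by linarith
  moreover have "(\<Sum>i \<in> Z. w (cls P3 i)) = (\<Sum>i \<in> Z. w (cls P i))" by (rule sum.cong[OF refl], subst cl) auto
  ultimately show ?thesis unfolding acc_def by linarith
qed

text \<open>Blocked heads \<open>Z\<close> lack more than \<open>W\<close> after the joining. Giving
  back two units lighter than \<open>W\<close> proves the first claim. If \<open>Z\<close> were part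
  of \<open>F\<close>, at most one of the two units could be adjacent to \<open>Z\<close>, since
  they are in conflict for \<open>F\<close>; giving back one cannot close the deficit, against the
  Hall condition.\<close>

lemma joined_frozen:
  assumes H: "hall c k P Ut kd" and Z: "Z \<subseteq> heads c k kd" and s: "acc P3 Ut Z + W < 2 * W * card Z"
    and F: "\<not> (Ut x \<in> NB P Ut F \<and> Ut y \<in> NB P Ut F)"
  shows "acc P Ut Z < 2 * W * card Z + W" and "\<not> Z \<subseteq> F"
proof -
  have n: "x < n" "y < n" using adj_less xy by auto
  have sm: "w (uset P Ut (Ut x)) < W" "w (uset P Ut (Ut y)) < W" using units_okD(5)[OF u] n xy by auto
  have "(\<Sum>v \<in> {Ut x, Ut y} \<inter> NB P Ut Z. w (uset P Ut v)) \<le> (\<Sum>v \<in> {Ut x, Ut y}. w (uset P Ut v))" by (rule sum_mono2) auto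
  also have "\<dots> = w (uset P Ut (Ut x)) + w (uset P Ut (Ut y))" using xy(4) by simp
  finally show "acc P Ut Z < 2 * W * card Z + W" using joined_acc[OF Z] s sm by linarith
  show "\<not> Z \<subseteq> F"
  proof
    assume "Z \<subseteq> F"
    then have "NB P Ut Z \<subseteq> NB P Ut F" unfolding NB_def by blast
    then have "{Ut x, Ut y} \<inter> NB P Ut Z \<subseteq> {Ut x} \<or> {Ut x, Ut y} \<inter> NB P Ut Z \<subseteq> {Ut y}" using F by blast
    then have "(\<Sum>v \<in> {Ut x, Ut y} \<inter> NB P Ut Z. w (uset P Ut v)) < W"
    proof (elim disjE)
      assume "{Ut x, Ut y} \<inter> NB P Ut Z \<subseteq> {Ut x}"
      then have "(\<Sum>v \<in> {Ut x, Ut y} \<inter> NB P Ut Z. w (uset P Ut v)) \<le> (\<Sum>v \<in> {Ut x}. w (uset P Ut v))" by (intro sum_mono2) auto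
      then show ?thesis using sm by simp
    next
      assume "{Ut x, Ut y} \<inter> NB P Ut Z \<subseteq> {Ut y}"
      then have "(\<Sum>v \<in> {Ut x, Ut y} \<inter> NB P Ut Z. w (uset P Ut v)) \<le> (\<Sum>v \<in> {Ut y}. w (uset P Ut v))" by (intro sum_mono2) auto
      then show ?thesis using sm by simp
    qed
    moreover have "2 * W * card Z \<le> acc P Ut Z" using H Z unfolding hall_def by blast
    ultimately show False using joined_acc[OF Z] s by linarith
  qed
qed

end

definition balanced :: "store \<Rightarrow> (nat \<Rightarrow> nat) \<Rightarrow> (nat \<Rightarrow> nat) \<Rightarrow> (nat \<Rightarrow> nat) \<Rightarrow> nat \<Rightarrow> bool" where
  "balanced s P Ut kd k \<longleftrightarrow> (let Z = {i \<in> {c<..k}. arr s ''lab'' i = n + 5} in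
     (Z \<noteq> {} --> Z \<subseteq> heads c k kd \<and> acc P Ut Z + W < 2 * W * card Z) \<and>
     (Z = {} --> (\<forall>kd'. (\<forall>i \<le> k. kd' i = 0) \<and> (\<forall>i. kd' i \<le> 1) --> parts_ok c k (taken P Ut (arr s ''own'')) kd')))"

lemma label_W_mods: "rmods label_W = {''th''} \<union> rmods label" "amods label_W = amods label"
  unfolding label_W_def by (auto simp: label_mods)

lemma probe:
  assumes st: "state s P Ut kd wU k" and p: "parts_ok c k P kd" and u: "units_ok P Ut" and wu: "wu_ok P Ut wU" and sep: "separated P Ut"
    and k: "k \<le> kst" "k - c \<le> M"
    and a: "reg s ''fnd'' = a" "1 \<le> a" "a \<le> M" "P (sr a) = 0" "P (tg a) = 0" "Ut (sr a) \<noteq> Ut (tg a)"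
  shows "wp probe (\<lambda>t s'. state s' (joined P Ut k (Ut (sr a)) (Ut (tg a))) Ut (kd(Suc k := 0)) wU (Suc k) \<and>
     balanced s' (joined P Ut k (Ut (sr a)) (Ut (tg a))) Ut (kd(Suc k := 0)) (Suc k) \<and>
     (reg s' ''bad'' = 0 \<longleftrightarrow> {i \<in> {c<..Suc k}. arr s' ''lab'' i = n + 5} = {}) \<and> t \<le> 9300 * D) s"
proof -
  define x y where "x = sr a" and "y = tg a"
  have xy: "adj x y" "P x = 0" "P y = 0" "Ut x \<noteq> Ut y" using a unfolding adj_def x_def y_def by auto
  note J = joined_parts[OF p u wu sep xy] joined_units[OF p u wu sep xy] joined_heads[OF p u wu sep xy]
  let ?P = "joined P Ut k (Ut x) (Ut y)" and ?kd = "kd(Suc k := 0)"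
  have g: "gctx s" and sa: "arr s ''part'' = P" "arr s ''unit'' = Ut" "arr s ''kind'' = kd" "arr s ''wU'' = wU" "reg s ''size'' = k"
    using st unfolding state_def by auto
  define s1 where "s1 = s\<lparr>reg := (reg s)(''p'' := Ut x, ''q'' := Ut y, ''size'' := Suc k), arr := (arr s)(''kind'' := ?kd)\<rparr>"
  define s2 where "s2 = s1\<lparr>reg := (reg s1)(''v'' := n), arr := (arr s1)(''part'' := ?P)\<rparr>"
  have st2: "state s2 ?P Ut ?kd wU (Suc k)" using st unfolding state_def gctx_def s1_def s2_def by simp
  have rd: "ready ?P Ut ?kd wU (Suc k)" unfolding ready_def using J k kst_n by auto
  have m: "wp (For ''i'' (Plus (R ''c'') (N 1)) (Plus (R ''size'') (N 1))
    (Cond (Equal (C ''lab'' (R ''i'')) (R ''big'')) (''bad'' ::= N 1) Skip)) (\<lambda>t s'. state s' ?P Ut ?kd wU (Suc k) \<and> balanced s' ?P Ut ?kd (Suc k) \<and>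
     (reg s' ''bad'' = 0 \<longleftrightarrow> {i \<in> {c<..Suc k}. arr s' ''lab'' i = n + 5} = {}) \<and> t \<le> 50 * D) s4"
    if s4: "state s4 ?P Ut ?kd wU (Suc k)" "balanced s4 ?P Ut ?kd (Suc k)" "reg s4 ''bad'' = 0" for s4
  proof (rule wp_For_find[where l = "Suc c" and h = "Suc (Suc k)" and cn = "\<lambda>i. arr s4 ''lab'' i = n + 5" and vl = "\<lambda>_. 1"], goal_cases)
    case 2 show ?case using parts_okD(1)[OF p] by simp
  next
    case (7 t z)
    have "Suc k - c \<le> M + 1" using k by simp
    then have "t \<le> 50 * D" using 7(1) D_bounds by simp
    moreover have "z = 0 \<longleftrightarrow> {i \<in> {c<..Suc k}. arr s4 ''lab'' i = n + 5} = {}"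
      using 7(2) s4(3) by (auto simp: less_Suc_eq_le Suc_le_eq)
    ultimately show ?case using s4 by (simp add: state_def gctx_def balanced_def)
  qed (use s4 in \<open>simp_all add: state_def gctx_def\<close>)
  have main: "wp (For ''v'' (N 0) (R ''n'')
    (Cond (Conj (Equal (C ''part'' (R ''v'')) (N 0)) (either (Equal (C ''unit'' (R ''v'')) (R ''p'')) (Equal (C ''unit'' (R ''v'')) (R ''q''))))
      (Store ''part'' (R ''v'') (R ''size'')) Skip) ;;
    label_W ;; ''bad'' ::= N 0 ;;
    For ''i'' (Plus (R ''c'') (N 1)) (Plus (R ''size'') (N 1))
      (Cond (Equal (C ''lab'' (R ''i'')) (R ''big'')) (''bad'' ::= N 1) Skip))
   (\<lambda>t s'. state s' ?P Ut ?kd wU (Suc k) \<and> balanced s' ?P Ut ?kd (Suc k) \<and>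
     (reg s' ''bad'' = 0 \<longleftrightarrow> {i \<in> {c<..Suc k}. arr s' ''lab'' i = n + 5} = {}) \<and> t \<le> 9200 * D) s1"
    unfolding wp_Seq
  proof (rule wp_For_map[where a = "''part''" and l = 0 and h = n and vl = ?P and K = 25], goal_cases)
    case (5 t1)
    have "(\<lambda>v. if 0 \<le> v \<and> v < n then ?P v else arr s1 ''part'' v) = ?P"
      using sa by (auto simp: s1_def joined_def)
    then have e: "s1\<lparr>reg := (reg s1)(''v'' := n), arr := (arr s1)(''part'' := \<lambda>v. if 0 \<le> v \<and> v < n then ?P v else arr s1 ''part'' v)\<rparr> = s2"
      unfolding s2_def by simp
    show ?case
      unfolding e
    proof (rule wp_mono[OF label_W[OF st2 rd]], goal_cases)
      case (1 t3 s3)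
      define s4 where "s4 = s3\<lparr>reg := (reg s3)(''bad'' := 0)\<rparr>"
      have "state s4 ?P Ut ?kd wU (Suc k)" "balanced s4 ?P Ut ?kd (Suc k)" "reg s4 ''bad'' = 0"
        using 1 unfolding s4_def balanced_def state_def gctx_def by simp_all
      note M4 = m[OF this]
      have e4: "s3\<lparr>reg := (reg s3)(''bad'' := aval (N 0) s3)\<rparr> = s4" unfolding s4_def by simp
      show ?case
        unfolding wp_Assign e4
        by (rule wp_mono[OF M4]) (use 1 5 D_bounds in simp)
    qed
  qed (use g sa in \<open>simp_all add: s1_def gctx_def joined_def fun_upd_idem\<close>)
  show ?thesis
    unfolding probe_def x_def[symmetric] y_def[symmetric]
    by (simp only: wp_Seq[of "Assign _ _"] wp_Seq[of "Store _ _ _"] wp_Assign wp_Store, rule wp_eq[OF main])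
      (use g sa a D_bounds in \<open>simp_all add: s1_def gctx_def x_def y_def\<close>)
qed

text \<open>\<open>P\<close> takes no value above \<open>k\<close>, so the vertices of class
  \<open>Suc k\<close> are exactly those that the probe took from class 0.\<close>

lemma undo_probe:
  assumes st: "state s (joined P Ut k p q) Ut kd wU (Suc k)" and P: "\<And>v. v < n ==> P v \<le> k" and k: "k - c \<le> M" and ck: "c \<le> k"
  shows "wp undo_probe (\<lambda>t s'. state s' P Ut kd wU k \<and>
     (\<forall>i. c < i \<and> i \<le> k --> arr s' ''fl'' i = (if arr s ''lab'' i = n + 5 then 1 else arr s ''fl'' i)) \<and> t \<le> 200 * D) s"
  unfolding undo_probe_def
proof (subst wp_Seq, rule wp_For_map[where a = "''part''" and l = 0 and h = n and vl = P and K = 20], goal_cases)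
  case (5 t1)
  have "(\<lambda>v. if 0 \<le> v \<and> v < n then P v else joined P Ut k p q v) = P" by (auto simp: joined_def)
  then have e: "(\<lambda>v. if 0 \<le> v \<and> v < n then P v else arr s ''part'' v) = P" using st unfolding state_def by (simp cong: if_cong)
  show ?case
    unfolding e wp_Seq wp_Assign
  proof (rule wp_For_map[where a = "''fl''" and l = "Suc c" and h = "Suc k" and vl = "\<lambda>i. if arr s ''lab'' i = n + 5 then 1 else arr s ''fl'' i" and K = 20], goal_cases)
    case (5 t2)
    then show ?case using st \<open>t1 \<le> _\<close> k D_bounds by (simp add: state_def gctx_def)
  qed (use st ck in \<open>simp_all add: state_def gctx_def fun_upd_idem\<close>)
next
  case (4 i g)
  then show ?case using st P[of i] by (simp add: state_def gctx_def joined_def fun_upd_idem)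
qed (use st in \<open>simp_all add: state_def gctx_def\<close>)

end

context packing
begin

definition frozen :: "nat \<Rightarrow> store \<Rightarrow> nat set" where "frozen k s = {i \<in> {c<..k}. arr s ''fl'' i = 1}"

text \<open>\<open>H\<close> is the fixed set of heads. The kinds are quantified because a probe
  overwrites the entry at \<open>Suc k\<close>, which does not change the heads up to
  \<open>k\<close>.\<close>

definition conf_inv :: "(nat \<Rightarrow> nat) \<Rightarrow> (nat \<Rightarrow> nat) \<Rightarrow> (nat \<Rightarrow> nat) \<Rightarrow> nat \<Rightarrow> nat set \<Rightarrow> store \<Rightarrow> bool" where
  "conf_inv P Ut wU k H s \<longleftrightarrow> (\<exists>kd. state s P Ut kd wU k \<and> parts_ok c k P kd \<and> hall c k P Ut kd \<and> heads c k kd = H) \<and>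
     {c<..k} - H \<subseteq> frozen k s \<and> acc P Ut (frozen k s) \<le> 3 * W * card (frozen k s)"

text \<open>The tentative core has been accepted, but the assignment of units has not been carried
  out yet.\<close>

definition grown :: "(nat \<Rightarrow> nat) \<Rightarrow> (nat \<Rightarrow> nat) \<Rightarrow> nat \<Rightarrow> store \<Rightarrow> bool" where
  "grown Ut wU k s \<longleftrightarrow> (\<exists>P kd. state s P Ut kd wU (Suc k) \<and> (\<forall>i. kd i \<le> 1) \<and>
     (\<forall>kd'. (\<forall>i \<le> Suc k. kd' i = 0) \<and> (\<forall>i. kd' i \<le> 1) --> parts_ok c (Suc k) (taken P Ut (arr s ''own'')) kd'))"

lemma parts_ok_kd: "parts_ok c k P kd ==> parts_ok c k P (kd(Suc k := 0))"
  unfolding parts_ok_def by auto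

lemma heads_kd: "heads c k (kd(Suc k := 0)) = heads c k kd"
  unfolding heads_def by auto

lemma loop_mods:
  "rmods find_conflict = {''v'', ''a'', ''fnd''}" "amods find_conflict = {''nf''}"
  "rmods probe = {''p'', ''q'', ''size'', ''v'', ''bad'', ''i'', ''th''} \<union> rmods label" "amods probe = {''kind'', ''part''} \<union> amods label"
  "rmods undo_probe = {''v'', ''size'', ''i''}" "amods undo_probe = {''part'', ''fl''}"
  unfolding find_conflict_def probe_def undo_probe_def by (auto simp: label_W_mods label_mods)

lemma conf_inv_step:
  assumes I: "conf_inv P Ut wU k H s" and u: "units_ok P Ut" and wu: "wu_ok P Ut wU" and sep: "separated P Ut"
    and k: "k \<le> kst" "k - c \<le> M" and a: "reg s ''fnd'' = a" "a \<noteq> 0" "a \<le> M" "P (sr a) = 0" "P (tg a) = 0" "Ut (sr a) \<noteq> Ut (tg a)"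
      "\<not> (Ut (sr a) \<in> NB P Ut (frozen k s) \<and> Ut (tg a) \<in> NB P Ut (frozen k s))"
    and lp: "reg s ''lp'' = 1"
  shows "wp (probe ;; Cond (Equal (R ''bad'') (N 0)) (''lp'' ::= N 0) undo_probe)
    (\<lambda>t s'. (reg s' ''lp'' = 1 \<and> conf_inv P Ut wU k H s' \<and> card (H - frozen k s') < card (H - frozen k s) \<or>
       reg s' ''lp'' = 0 \<and> reg s' ''fnd'' = a \<and> grown Ut wU k s') \<and> t \<le> 9600 * D) s"
proof -
  obtain kd where st: "state s P Ut kd wU k" and p: "parts_ok c k P kd" and H: "hall c k P Ut kd" and hd: "heads c k kd = H"
    and L: "{c<..k} - H \<subseteq> frozen k s" and A: "acc P Ut (frozen k s) \<le> 3 * W * card (frozen k s)"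
    using I unfolding conf_inv_def by blast
  have a1: "1 \<le> a" using a(2) by simp
  have adj: "adj (sr a) (tg a)" using a1 a(3) unfolding adj_def by blast
  note po = parts_okD[OF p]
  let ?P = "joined P Ut k (Ut (sr a)) (Ut (tg a))" and ?kd = "kd(Suc k := 0)"
  show ?thesis
  proof (subst wp_Seq, rule wp_frame[OF probe[OF st p u wu sep k a(1) a1 a(3-6)]], elim conjE, goal_cases)
    case (1 t1 s1)
    let ?Z = "{i \<in> {c<..Suc k}. arr s1 ''lab'' i = n + 5}"
    have r1: "reg s1 ''lp'' = 1" "reg s1 ''fnd'' = a" "arr s1 ''fl'' = arr s ''fl''"
      using frame_reg[OF 1(1), of "''lp''"] frame_reg[OF 1(1), of "''fnd''"] frame_arr[OF 1(1), of "''fl''"] lp a(1)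
      by (simp_all add: loop_mods label_mods)
    have f1: "frozen k s1 = frozen k s" unfolding frozen_def r1 ..
    show ?case
    proof (cases "reg s1 ''bad'' = 0")
      case True
      then have "?Z = {}" using 1(4) by blast
      then have G: "\<forall>kd'. (\<forall>i \<le> Suc k. kd' i = 0) \<and> (\<forall>i. kd' i \<le> 1) --> parts_ok c (Suc k) (taken ?P Ut (arr s1 ''own'')) kd'"
        using 1(3) unfolding balanced_def Let_def by blast
      define s2 where "s2 = s1\<lparr>reg := (reg s1)(''lp'' := 0)\<rparr>"
      have gs: "state s2 ?P Ut ?kd wU (Suc k)" using 1(2) unfolding s2_def state_def gctx_def by simp
      have gk: "\<forall>i. ?kd i \<le> 1" using po(5) by simp
      have ow: "arr s2 ''own'' = arr s1 ''own''" unfolding s2_def by simp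
      have "grown Ut wU k s2"
        unfolding grown_def ow by (rule exI[of _ ?P], rule exI[of _ ?kd], intro conjI gs gk G)
      moreover have "reg s2 ''lp'' = 0" "reg s2 ''fnd'' = a" using r1 by (simp_all add: s2_def)
      moreover have "t1 + (bcost (Equal (R ''bad'') (N 0)) + 1 + (acost (N 0) + 1)) \<le> 9600 * D" using 1(5) D_bounds(3) by simp
      ultimately show ?thesis
        by (subst wp_Cond, simp only: True bval.simps aval.simps if_True refl wp_Assign s2_def[symmetric]) blast
    next
      case False
      then have nz: "?Z \<noteq> {}" using 1(4) by argo
      note bal = 1(3)[unfolded balanced_def Let_def]
      have Z: "?Z \<subseteq> heads c (Suc k) ?kd" "acc ?P Ut ?Z + W < 2 * W * card ?Z"
        using mp[OF conjunct1[OF bal] nz] by (rule conjunct1, rule conjunct2)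
      have ZH: "?Z \<subseteq> heads c k kd" using Z(1) unfolding joined_heads[OF p u wu sep adj a(4-6)] .
      note fz = joined_frozen[OF p u wu sep adj a(4-6) H ZH Z(2) a(7)]
      have fin: "finite (frozen k s)" unfolding frozen_def by simp
      note ext = frozen_extend[OF fin A H ZH fz]
      have ck: "c \<le> k" using po(1) .
      show ?thesis
      proof (subst wp_Cond, simp only: False bval.simps aval.simps if_False,
          rule wp_frame[OF undo_probe[OF 1(2) po(2) k(2) ck]], assumption, elim conjE, goal_cases)
        case (1 t2 s2)
        have lp2: "reg s2 ''lp'' = 1" using frame_reg[OF 1(1), of "''lp''"] r1 by (simp add: loop_mods)
        have "frozen k s2 = frozen k s \<union> ?Z"
        proof (intro set_eqI iffI)
          fix i assume "i \<in> frozen k s2"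
          then have i: "c < i" "i \<le> k" "arr s2 ''fl'' i = 1" unfolding frozen_def by auto
          then have "arr s1 ''lab'' i = n + 5 \<or> arr s1 ''fl'' i = 1" using 1(3) by (auto split: if_splits)
          then show "i \<in> frozen k s \<union> ?Z" using i r1 unfolding frozen_def by auto
        next
          fix i assume "i \<in> frozen k s \<union> ?Z"
          moreover have "i \<le> k" if "i \<in> ?Z" using that ZH unfolding heads_def by blast
          ultimately have i: "c < i" "i \<le> k" "arr s1 ''fl'' i = 1 \<or> arr s1 ''lab'' i = n + 5" using r1 unfolding frozen_def by auto
          then show "i \<in> frozen k s2" using 1(3) unfolding frozen_def by auto
        qed
        then have f2: "frozen k s2 = frozen k s \<union> ?Z" .
        have "H - (frozen k s \<union> ?Z) \<subset> H - frozen k s" using ZH fz(2) hd by blast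
        moreover have "finite (H - frozen k s)" using hd unfolding heads_def by (auto intro: finite_subset[of _ "{..k}"])
        ultimately have "card (H - frozen k s2) < card (H - frozen k s)" unfolding f2 by (rule psubset_card_mono[rotated])
        moreover have "hall c k P Ut ?kd" using H unfolding hall_def heads_kd .
        then have "\<exists>kd. state s2 P Ut kd wU k \<and> parts_ok c k P kd \<and> hall c k P Ut kd \<and> heads c k kd = H"
          using 1(2) parts_ok_kd[OF p] heads_kd[of k kd] hd by blast
        then have "conf_inv P Ut wU k H s2" using L ext unfolding conf_inv_def f2 by blast
        moreover have "t1 + (bcost (Equal (R ''bad'') (N 0)) + 1 + t2) \<le> 9600 * D"
        proof -
          have "t1 + t2 \<le> 9500 * D" using \<open>t1 \<le> _\<close> 1(4) by linarith
          then show ?thesis using D_bounds(3) by simp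
        qed
        ultimately show ?case using lp2 by blast
      qed
    qed
  qed
qed

text \<open>Each failing probe freezes a further head, so there are at most \<open>card H\<close> of
  them besides the last round; \<open>card (H - frozen k s)\<close> is the measure.\<close>

lemma probe_loop:
  assumes I: "conf_inv P Ut wU k H s" and u: "units_ok P Ut" and wu: "wu_ok P Ut wU" and sep: "separated P Ut"
    and k: "k \<le> kst" "k - c \<le> M" and H: "finite H"
  shows "wp probe_loop (\<lambda>t s'. (reg s' ''fnd'' = 0 \<and> conf_inv P Ut wU k H s' \<and> conflict_free P Ut (frozen k s') \<or>
      reg s' ''fnd'' \<noteq> 0 \<and> grown Ut wU k s') \<and> t \<le> 11000 * D * (card H + 2)) s"
proof -
  define J where "J s \<longleftrightarrow> reg s ''lp'' = 1 \<and> conf_inv P Ut wU k H s \<or>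
    reg s ''lp'' = 0 \<and> reg s ''fnd'' = 0 \<and> conf_inv P Ut wU k H s \<and> conflict_free P Ut (frozen k s) \<or>
    reg s ''lp'' = 0 \<and> reg s ''fnd'' \<noteq> 0 \<and> grown Ut wU k s" for s
  define po where "po s = (if reg s ''lp'' = 0 then 0 else 11000 * D * (card (H - frozen k s) + 1))" for s
  define s0 where "s0 = s\<lparr>reg := (reg s)(''lp'' := 1)\<rparr>"
  have f0: "frozen k s0 = frozen k s" unfolding s0_def frozen_def by simp
  have "state s0 P Ut kd wU k = state s P Ut kd wU k" for kd unfolding s0_def state_def gctx_def by simp
  then have I0: "conf_inv P Ut wU k H s0" using I unfolding conf_inv_def f0 by simp
  have "card (H - frozen k s0) \<le> card H" by (rule card_mono[OF H]) blast
  then have "11000 * D * (card (H - frozen k s0) + 1) \<le> 11000 * D * (card H + 1)" by (intro mult_le_mono2) simp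
  moreover have "po s0 = 11000 * D * (card (H - frozen k s0) + 1)" unfolding po_def by (simp add: s0_def)
  moreover have "11000 * D * (card H + 2) = 11000 * D * (card H + 1) + 11000 * D" by simp
  ultimately have p0: "po s0 + 20 \<le> 11000 * D * (card H + 2)" using D_bounds(3) by linarith
  have main: "wp (While (Less (N 0) (R ''lp''))
    (find_conflict ;;
     Cond (Equal (R ''fnd'') (N 0)) (''lp'' ::= N 0)
       (probe ;; Cond (Equal (R ''bad'') (N 0)) (''lp'' ::= N 0) undo_probe)))
    (\<lambda>t s'. (reg s' ''fnd'' = 0 \<and> conf_inv P Ut wU k H s' \<and> conflict_free P Ut (frozen k s') \<or>
      reg s' ''fnd'' \<noteq> 0 \<and> grown Ut wU k s') \<and> t + 10 \<le> 11000 * D * (card H + 2)) s0"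
  proof (rule wp_while[where I = J and p = po], goal_cases)
    case 1
    show ?case using I0 unfolding J_def by (simp add: s0_def)
  next
    case (2 s1)
    then have lp: "reg s1 ''lp'' = 1" and I1: "conf_inv P Ut wU k H s1" unfolding J_def by auto
    obtain kd where st: "state s1 P Ut kd wU k" and pk: "parts_ok c k P kd" and r1: "hall c k P Ut kd" "heads c k kd = H"
      using I1 unfolding conf_inv_def by blast
    have g1: "gctx s1" "arr s1 ''part'' = P" "arr s1 ''unit'' = Ut" using st unfolding state_def by auto
    note fc = find_conflict[OF g1 refl parts_okD(2)[OF pk] units_okD(1)[OF u] frozen_def[of k s1]]
    show ?case
    proof (subst wp_Seq, rule wp_frame[OF fc], assumption+, goal_cases)
      case (1 t2 s2)
      have fr: "x \<notin> rmods find_conflict ==> reg s2 x = reg s1 x" "x \<notin> amods find_conflict ==> arr s2 x = arr s1 x" for x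
        using 1(2) unfolding frame_def by auto
      have f2: "frozen k s2 = frozen k s1" unfolding frozen_def by (simp add: fr loop_mods)
      have "gctx s2" by (rule gctx_frame[OF 1(2) g1(1)]) (auto simp: loop_mods)
      then have st2: "state s2 P Ut kd wU k" using st unfolding state_def by (simp add: fr loop_mods)
      then have I2: "conf_inv P Ut wU k H s2" using I1 pk r1 unfolding conf_inv_def f2 by blast
      have lp2: "reg s2 ''lp'' = 1" using lp by (simp add: fr loop_mods)
      have po1: "po s1 = 11000 * D * (card (H - frozen k s1) + 1)" unfolding po_def using lp by simp
      have t2: "t2 \<le> 500 * D" using 1(1) by blast
      show ?case
      proof (cases "reg s2 ''fnd'' = 0")
        case True
        define s3 where "s3 = s2\<lparr>reg := (reg s2)(''lp'' := 0)\<rparr>"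
        have f3: "frozen k s3 = frozen k s2" unfolding frozen_def s3_def by simp
        have "state s3 P Ut kd wU k" using st2 unfolding state_def gctx_def s3_def by simp
        then have "conf_inv P Ut wU k H s3" using I2 pk r1 unfolding conf_inv_def f3 by blast
        moreover have "conflict_free P Ut (frozen k s3)" using 1(1) True unfolding f3 f2 by blast
        ultimately have "J s3" unfolding J_def using True by (simp add: s3_def)
        then show ?thesis using True t2 D_bounds(3) po1 by (simp add: s3_def po_def)
      next
        case False
        define a where "a = reg s2 ''fnd''"
        have a: "a \<noteq> 0" "a \<le> M" "P (sr a) = 0" "P (tg a) = 0" "Ut (sr a) \<noteq> Ut (tg a)"
          "\<not> (Ut (sr a) \<in> NB P Ut (frozen k s2) \<and> Ut (tg a) \<in> NB P Ut (frozen k s2))"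
          using 1(1) False unfolding a_def f2 by auto
        note cs = conf_inv_step[OF I2 u wu sep k a_def[symmetric] a lp2]
        show ?thesis
        proof (subst wp_Cond, simp only: False bval.simps aval.simps if_False, rule wp_mono[OF cs], elim conjE disjE, goal_cases)
          case (1 t3 s3)
          have "11000 * D * (card (H - frozen k s3) + 1) + 11000 * D \<le> po s1"
          proof -
            have "card (H - frozen k s3) + 1 + 1 \<le> card (H - frozen k s1) + 1" using 1 f2 by simp
            then have "11000 * D * (card (H - frozen k s3) + 1 + 1) \<le> po s1" unfolding po1 by (rule mult_le_mono2)
            then show ?thesis by simp
          qed
          then have "t2 + (bcost (Equal (R ''fnd'') (N 0)) + 1 + t3) + bcost (Less (N 0) (R ''lp'')) + 1 + po s3 \<le> po s1"
            using 1(1,2) t2 D_bounds(3) unfolding po_def by simp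
          then show ?case using 1 unfolding J_def by blast
        next
          case (2 t3 s3)
          have "t2 + (bcost (Equal (R ''fnd'') (N 0)) + 1 + t3) + bcost (Less (N 0) (R ''lp'')) + 1 + po s3 \<le> po s1"
            using 2(1,2) t2 D_bounds(3) unfolding po1 by (simp add: po_def)
          then show ?case using 2 a(1) unfolding J_def by blast
        qed
      qed
    qed
  next
    case (3 s' t)
    then have "reg s' ''lp'' = 0" by simp
    then show ?case using 3 p0 unfolding J_def by simp
  qed
  show ?thesis
    unfolding probe_loop_def
    by (subst wp_Seq, subst wp_Assign, rule wp_eq[OF main]) (simp_all add: s0_def)
qed

definition completed :: "store \<Rightarrow> nat \<Rightarrow> bool" where
  "completed s k \<longleftrightarrow> reg s ''size'' = k \<and> (\<exists>kd. parts_ok c k (arr s ''part'') kd \<and> (\<forall>i \<le> k. kd i = 0)) \<and> (\<forall>G. ipack G --> card G \<le> 3 * k)"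

text \<open>The initial frozen set consists of the blocked cores, which here include all light
  cores; this is what \<open>certificate\<close> demands of \<open>F\<close>. The price of up to
  \<open>kst + 3\<close> multiples of \<open>D\<close> is acceptable because the round either ends
  the loop or gains a set.\<close>

lemma no_event:
  assumes st: "state s P Ut kd wU k" and p: "parts_ok c k P kd" and u: "units_ok P Ut" and wu: "wu_ok P Ut wU" and H: "hall c k P Ut kd"
    and sep: "separated P Ut" and k: "k \<le> kst" "k - c \<le> M" and fin: "reg s ''fin'' = 0"
    and F: "F = {i \<in> {c<..k}. arr s ''lab'' i = n + 5}" "\<And>i. c < i ==> i \<le> k ==> kd i \<noteq> 1 ==> i \<in> F" "acc P Ut F \<le> 3 * W * card F"
  shows "wp no_event (\<lambda>t s'. (reg s' ''fin'' = 1 \<and> completed s' k \<or> reg s' ''fin'' = 0 \<and> inv s' (Suc k) 0) \<and>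
     t \<le> 11000 * D * (kst + 3)) s"
proof -
  note po = parts_okD[OF p]
  let ?H = "heads c k kd"
  define FI where "FI = For ''i'' (Plus (R ''c'') (N 1)) (Plus (R ''size'') (N 1))
    (Cond (Equal (C ''lab'' (R ''i'')) (R ''big'')) (Store ''fl'' (R ''i'') (N 1)) (Store ''fl'' (R ''i'') (N 0)))"
  have HK: "?H \<subseteq> {c<..k}" unfolding heads_def by auto
  then have Hf: "finite ?H" using finite_subset by blast
  have "card ?H \<le> k - c" using card_mono[OF _ HK] by simp
  then have cH: "card ?H \<le> kst" using k(1) by simp
  then have cD: "11000 * D * (card ?H + 2) \<le> 11000 * D * (kst + 2)" by (intro mult_le_mono2) simp
  have l1: "wp FI (\<lambda>t s'. state s' P Ut kd wU k \<and> frozen k s' = F \<and> t \<le> 50 * D) s"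
    unfolding FI_def
  proof (rule wp_For_map[where a = "''fl''" and l = "Suc c" and h = "Suc k" and vl = "\<lambda>i. if arr s ''lab'' i = n + 5 then 1 else 0" and K = 15], goal_cases)
    case (5 t)
    have "t \<le> 50 * D" using 5 k(2) D_bounds by simp
    then show ?case using st F(1) by (auto simp: state_def gctx_def frozen_def)
  qed (use st po(1) in \<open>simp_all add: state_def gctx_def\<close>)
  have mfi: "rmods FI = {''i''}" "amods FI = {''fl''}" unfolding FI_def by auto
  have mpl: "''fin'' \<notin> rmods probe_loop" unfolding probe_loop_def by (simp add: loop_mods label_mods)
  have mts: "''fin'' \<notin> rmods (take_parts ;; single_units)" unfolding take_parts_def single_units_def by simp
  have kn: "k \<le> n + 1" "Suc k \<le> n + 1" using k(1) kst_n by auto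
  show ?thesis
    unfolding no_event_def FI_def[symmetric]
  proof (subst wp_Seq, rule wp_frame[OF l1], elim conjE, goal_cases)
    case (1 t1 s1)
    have fin1: "reg s1 ''fin'' = 0" using frame_reg[OF 1(1), of "''fin''"] fin by (simp add: mfi)
    have sub: "{c<..k} - ?H \<subseteq> F"
    proof
      fix i assume "i \<in> {c<..k} - ?H"
      then have "c < i" "i \<le> k" "kd i \<noteq> 1" unfolding heads_def by auto
      then show "i \<in> F" by (rule F(2))
    qed
    have I: "conf_inv P Ut wU k ?H s1"
      unfolding conf_inv_def 1(3)
      by (intro conjI exI[of _ kd] sub F(3) 1(2) p H refl)
    show ?case
    proof (subst wp_Seq, rule wp_frame[OF probe_loop[OF I u wu sep k Hf]], elim conjE, goal_cases)
      case (1 t2 s2)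
      have fin2: "reg s2 ''fin'' = 0" using frame_reg[OF 1(1) mpl] fin1 by simp
      have t12: "t1 + t2 \<le> 11000 * D * (kst + 2) + 50 * D" using \<open>t1 \<le> _\<close> 1(3) cD by linarith
      show ?case
      proof (cases "reg s2 ''fnd'' = 0")
        case False
        then have "grown Ut wU k s2" using 1(2) by argo
        then obtain P' kd' where G0: "state s2 P' Ut kd' wU (Suc k) \<and> (\<forall>i. kd' i \<le> 1) \<and>
           (\<forall>kd''. (\<forall>i \<le> Suc k. kd'' i = 0) \<and> (\<forall>i. kd'' i \<le> 1) --> parts_ok c (Suc k) (taken P' Ut (arr s2 ''own'')) kd'')"
          unfolding grown_def by (elim exE) (rule that)
        have G1: "state s2 P' Ut kd' wU (Suc k)" using G0 by (rule conjunct1)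
        have G2: "kd' i \<le> 1" for i using G0 by simp
        have G3: "parts_ok c (Suc k) (taken P' Ut (arr s2 ''own'')) kd''" if "\<forall>i \<le> Suc k. kd'' i = 0" "\<forall>i. kd'' i \<le> 1" for kd''
          using conjunct2[OF conjunct2[OF G0]] that by simp
        show ?thesis
        proof (subst wp_Seq, subst wp_Cond, simp only: False bval.simps aval.simps if_False wp_Skip,
            rule wp_frame[OF finish[OF G1 kn(2) G2 G3]], assumption+, elim conjE, goal_cases)
          case (1 t3 s3)
          have "reg s3 ''fin'' = 0" using frame_reg[OF 1(1) mts] fin2 by simp
          moreover have "t1 + (t2 + (bcost (Equal (R ''fnd'') (N 0)) + 1 + 1 + t3)) \<le> 11000 * D * (kst + 3)"
            using t12 1(4) D_bounds(3) by (simp add: algebra_simps)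
          ultimately show ?case using 1 by blast
        qed
      next
        case True
        then obtain kd' where G: "state s2 P Ut kd' wU k" "parts_ok c k P kd'" "hall c k P Ut kd'" "heads c k kd' = ?H"
          and L: "{c<..k} - ?H \<subseteq> frozen k s2" "acc P Ut (frozen k s2) \<le> 3 * W * card (frozen k s2)" and cf: "conflict_free P Ut (frozen k s2)"
          using 1(2) unfolding conf_inv_def by blast
        have cert: "\<forall>G. ipack G --> card G \<le> 3 * k"
        proof (intro allI impI)
          fix X assume X: "ipack X"
          show "card X \<le> 3 * k"
          proof (rule certificate[OF G(2) u W0 _ _ L(2) _ X])
            show "frozen k s2 \<subseteq> {c<..k}" unfolding frozen_def by auto
            show "i \<in> frozen k s2" if "c < i" "i \<le> k" "kd' i \<noteq> 1" for i
            proof -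
              have "i \<notin> heads c k kd'" using that unfolding heads_def by auto
              then show ?thesis using L(1) that G(4) by auto
            qed
            show "Ut x \<in> NB P Ut (frozen k s2) \<and> Ut y \<in> NB P Ut (frozen k s2)"
              if "adj x y" "P x = 0" "P y = 0" "Ut x \<noteq> Ut y" for x y using cf that unfolding conflict_free_def by blast
          qed
        qed
        have rd: "ready P Ut kd' wU k" unfolding ready_def using G u wu k kn by simp
        show ?thesis
        proof (subst wp_Seq, subst wp_Cond, simp only: True bval.simps aval.simps if_True refl, subst wp_Seq,
            rule wp_mono[OF label_W[OF G(1) rd]], goal_cases)
          case (1 t3 s3)
          let ?Z = "{i \<in> {c<..k}. arr s3 ''lab'' i = n + 5}"
          \<comment> \<open>Nothing has been taken from the heads, so the Hall condition itself
            excludes a deficit.\<close>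
          have "?Z = {}"
          proof (rule ccontr)
            assume "?Z \<noteq> {}"
            then have "?Z \<subseteq> heads c k kd'" "acc P Ut ?Z + W < 2 * W * card ?Z" using 1 unfolding Let_def by auto
            moreover have "2 * W * card ?Z \<le> acc P Ut ?Z" using G(3) calculation(1) unfolding hall_def by blast
            ultimately show False by linarith
          qed
          then have T: "\<And>kd''. (\<forall>i \<le> k. kd'' i = 0) ==> (\<forall>i. kd'' i \<le> 1) ==> parts_ok c k (taken P Ut (arr s3 ''own'')) kd''"
            using 1 unfolding Let_def by blast
          define s4 where "s4 = s3\<lparr>reg := (reg s3)(''fin'' := 1)\<rparr>"
          have st4: "state s4 P Ut kd' wU k" using 1 unfolding s4_def state_def gctx_def by simp
          have T4: "\<And>kd''. (\<forall>i \<le> k. kd'' i = 0) ==> (\<forall>i. kd'' i \<le> 1) ==> parts_ok c k (taken P Ut (arr s4 ''own'')) kd''"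
            using T unfolding s4_def by simp
          have e4: "s3\<lparr>reg := (reg s3)(''fin'' := aval (N 1) s3)\<rparr> = s4" unfolding s4_def by simp
          have t3: "t3 \<le> 9010 * D" using 1 by blast
          show ?case
          proof (subst wp_Assign, subst e4, rule wp_frame[OF finish[OF st4 kn(1) parts_okD(5)[OF G(2)] T4]], assumption+, elim conjE, goal_cases)
            case (1 t5 s5)
            have "reg s5 ''fin'' = 1" using frame_reg[OF 1(1) mts] by (simp add: s4_def)
            moreover have "reg s5 ''size'' = k" using 1(2) unfolding inv_def state_def by blast
            then have "completed s5 k" using 1(3) cert unfolding completed_def by blast
            moreover have "t1 + (t2 + (bcost (Equal (R ''fnd'') (N 0)) + 1 + (t3 + (acost (N 1) + 1)) + t5)) \<le> 11000 * D * (kst + 3)"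
              using t12 t3 1(4) D_bounds(3) by (simp add: algebra_simps)
            ultimately show ?case by blast
          qed
        qed
      qed
    qed
  qed
qed

end

section \<open>The test of components and the main loop\<close>

context packing
begin

definition closed_small :: "(nat \<Rightarrow> nat) \<Rightarrow> nat set \<Rightarrow> bool" where
  "closed_small P S \<longleftrightarrow> finite S \<and> (\<forall>x \<in> S. \<forall>y. adj x y \<and> P y = 0 --> y \<in> S) \<and> w S < W"

text \<open>While \<open>any\<close> is 0, every marked vertex lies in a closed set of free vertices
  lighter than \<open>W\<close>, so a connected set without heavy vertices is too light. A component
  that reaches \<open>W\<close> is a packing of size 1, and it has an arc because a single free
  vertex is lighter than \<open>W\<close>.\<close>

lemma screen:
  assumes g: "gctx s" and P: "arr s ''part'' = P" "parts_ok c c P kd" and z: "arr s ''seen'' = (\<lambda>_. 0)" "reg s ''qt'' = 0" "reg s ''cl'' = 0"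
  shows "wp screen (\<lambda>t s'. (reg s' ''any'' = 0 --> (\<forall>G. ipack G --> card G \<le> c)) \<and>
     (reg s' ''any'' \<noteq> 0 --> 1 \<le> kst \<and> 1 \<le> M) \<and> t \<le> 400 * (n + M + 1)) s"
proof -
  define I where "I i s' \<longleftrightarrow> gctx s' \<and> arr s' ''part'' = P \<and> reg s' ''cl'' = 0 \<and>
    (\<forall>x. arr s' ''seen'' x \<noteq> 0 --> P x = 0 \<and> (\<forall>y. adj x y \<and> P y = 0 --> arr s' ''seen'' y \<noteq> 0)) \<and>
    (\<forall>v < i. P v = 0 --> arr s' ''seen'' v \<noteq> 0) \<and>
    (reg s' ''any'' = 0 --> (\<forall>v. arr s' ''seen'' v \<noteq> 0 --> (\<exists>S. v \<in> S \<and> closed_small P S))) \<and>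
    (reg s' ''any'' \<noteq> 0 --> 1 \<le> kst \<and> 1 \<le> M)" for i :: nat and s' :: store
  define po where "po s = bpot (arr s ''seen'')" for s :: store
  note pp = parts_okD[OF P(2)]
  have step: "wp (''r'' ::= R ''v'' ;; bfs ;; Cond (Less (R ''ac'') (R ''W'')) Skip (''any'' ::= N 1))
      (\<lambda>t s'. reg s' ''v'' = i \<and> I (Suc i) (s'\<lparr>reg := (reg s')(''v'' := Suc i)\<rparr>) \<and> t + po s' \<le> po s1 + 70) s1"
    if J: "I i s1" "reg s1 ''v'' = i" "i < n" "P i = 0" "arr s1 ''seen'' i = 0" for i s1
  proof -
    let ?old = "arr s1 ''seen''"
    define s2 where "s2 = s1\<lparr>reg := (reg s1)(''r'' := i)\<rparr>"
    have g2: "gctx s2" "arr s2 ''part'' = P" "reg s2 ''cl'' = 0" using J unfolding I_def s2_def gctx_def by simp_all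
    have sc: "\<And>x. ?old x \<noteq> 0 ==> P x = 0 \<and> (\<forall>y. adj x y \<and> P y = 0 --> ?old y \<noteq> 0)" and sv: "\<And>v. v < i ==> P v = 0 ==> ?old v \<noteq> 0"
      and sa: "\<And>v. reg s1 ''any'' = 0 ==> ?old v \<noteq> 0 ==> \<exists>S. v \<in> S \<and> closed_small P S"
      and ka: "reg s1 ''any'' \<noteq> 0 ==> 1 \<le> kst \<and> 1 \<le> M" using J(1) unfolding I_def by (elim conjE, metis)+
    have b: "wp bfs (\<lambda>t s'. BI P 0 i (reg s2 ''qt'') ?old (reg s' ''qt'') (reg s' ''qt'') 0 (arr s' ''q'') (arr s' ''par'') (arr s' ''seen'') (reg s' ''ac'') \<and>
     gctx s' \<and> t + bpot (arr s' ''seen'') \<le> bpot ?old + 50) s2"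
      by (rule bfs) (use g2 J in \<open>simp_all add: s2_def\<close>)
    have main: "wp (bfs ;; Cond (Less (R ''ac'') (R ''W'')) Skip (''any'' ::= N 1))
      (\<lambda>t s'. reg s' ''v'' = i \<and> I (Suc i) (s'\<lparr>reg := (reg s')(''v'' := Suc i)\<rparr>) \<and> t + po s' \<le> po s1 + 60) s2"
    proof (subst wp_Seq, rule wp_frame[OF b], elim conjE, goal_cases)
      case (1 t s3)
      have fr: "x \<notin> rmods bfs ==> reg s3 x = reg s2 x" "x \<notin> amods bfs ==> arr s3 x = arr s2 x" for x
        using 1(1) unfolding frame_def by auto
      have P3: "arr s3 ''part'' = P" "reg s3 ''cl'' = 0" "reg s3 ''v'' = i" "reg s3 ''any'' = reg s1 ''any''"
        using g2 J by (simp_all add: fr bfs_mods s2_def)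
      have W3: "reg s3 ''W'' = W" using 1(3) unfolding gctx_def by simp
      define t0 qt q par where "t0 = reg s2 ''qt''" and "qt = reg s3 ''qt''" and "q = arr s3 ''q''" and "par = arr s3 ''par''"
      let ?s = "arr s3 ''seen''"
      define S where "S = q ` {t0..<qt}"
      have B: "BI P 0 i t0 ?old qt qt 0 q par ?s (reg s3 ''ac'')" using 1(2) unfolding t0_def qt_def q_def par_def .
      have B1: "t0 < qt" "q t0 = i" and B2: "\<And>l. t0 \<le> l ==> l < qt ==> q l < n \<and> P (q l) = 0 \<and> ?s (q l) = Suc l \<and> ?old (q l) = 0"
        and B3: "\<And>l. t0 < l ==> l < qt ==> t0 \<le> par l \<and> par l < l \<and> adj (q (par l)) (q l)"
        and B4: "\<And>v. v \<notin> S ==> ?s v = ?old v"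
        and B5: "\<And>a. 1 \<le> a ==> a \<le> M ==> P (tg a) = 0 ==> sr a \<in> S ==> ?s (tg a) \<noteq> 0"
        and B6: "reg s3 ''ac'' = (\<Sum>l = t0..<qt. wt (q l))"
        using B unfolding BI_def S_def by (elim conjE, blast)+
      have Sx: "x < n \<and> P x = 0 \<and> ?s x \<noteq> 0 \<and> ?old x = 0" if "x \<in> S" for x using B2 that unfolding S_def by auto
      have inj: "inj_on q {t0..<qt}" by (rule inj_onI) (metis B2 atLeastLessThan_iff nat.inject)
      have wS: "w S = reg s3 ''ac''" unfolding B6 S_def using inj by (simp add: sum.reindex)
      have Scl: "y \<in> S" if x: "x \<in> S" and y: "adj x y" "P y = 0" for x y
      proof (rule ccontr)
        assume n: "y \<notin> S"
        have "?s y \<noteq> 0" using B5 x y unfolding adj_def by blast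
        then have "?old y \<noteq> 0" using B4[OF n] by simp
        then have "?old x \<noteq> 0" using sc[of y] adj_sym[OF y(1)] Sx[OF x] by blast
        then show False using Sx[OF x] by simp
      qed
      have iS: "i \<in> S" unfolding S_def using B1 by auto
      have c1: "P x = 0 \<and> (\<forall>y. adj x y \<and> P y = 0 --> ?s y \<noteq> 0)" if "?s x \<noteq> 0" for x
      proof (cases "x \<in> S")
        case True then show ?thesis using Scl Sx by blast
      next
        case False
        then have "?old x \<noteq> 0" using B4 that by simp
        then show ?thesis using sc[of x] B4 Sx by metis
      qed
      have c2: "?s v \<noteq> 0" if "v < Suc i" "P v = 0" for v
        using that sv[of v] B4[of v] Sx iS by (metis less_SucE)
      have sm: "\<exists>S. v \<in> S \<and> closed_small P S" if "reg s1 ''any'' = 0" "reg s3 ''ac'' < W" "?s v \<noteq> 0" for v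
      proof (cases "v \<in> S")
        case True
        have "closed_small P S" unfolding closed_small_def using Scl that(2) wS unfolding S_def by auto
        then show ?thesis using True by blast
      next
        case False
        then show ?thesis using sa[OF that(1)] B4 that(3) by simp
      qed
      have bg: "1 \<le> kst \<and> 1 \<le> M" if "W \<le> reg s3 ''ac''"
      proof -
        have cS: "conn S" unfolding S_def
        proof (rule conn_tree)
          show "t0 \<in> {t0..<qt}" using B1 by simp
          show "par l \<in> {t0..<qt} \<and> par l < l \<and> adj (q (par l)) (q l)" if "l \<in> {t0..<qt}" "l \<noteq> t0" for l
            using B3[of l] that by auto
        qed
        have "ipack {S}" unfolding ipack_def using cS that wS Sx by auto
        from kst[OF this] have "1 \<le> kst" by simp
        moreover have "Suc t0 < qt"
        proof (rule ccontr)
          assume "\<not> Suc t0 < qt"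
          then have "{t0..<qt} = {t0}" using B1 by auto
          then have "w S = wt i" unfolding S_def using B1 by simp
          moreover have "wt i < W" by (rule light_parts[OF P(2) J(3,4)])
          ultimately show False using that wS by simp
        qed
        then have "adj (q (par (Suc t0))) (q (Suc t0))" using B3[of "Suc t0"] by simp
        then have "1 \<le> M" unfolding adj_def by auto
        ultimately show ?thesis by simp
      qed
      have I3: "I (Suc i) (s3\<lparr>reg := (reg s3)(''v'' := Suc i, ''any'' := a)\<rparr>)"
        if "a = 0 ==> reg s1 ''any'' = 0 \<and> reg s3 ''ac'' < W" "a \<noteq> 0 ==> 1 \<le> kst \<and> 1 \<le> M" for a
      proof -
        define s4 where "s4 = s3\<lparr>reg := (reg s3)(''v'' := Suc i, ''any'' := a)\<rparr>"
        have g4: "gctx s4" "reg s4 ''cl'' = 0" "arr s4 = arr s3" "reg s4 ''any'' = a"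
          using 1(3) P3(2) unfolding s4_def gctx_def by simp_all
        have C1: "\<forall>x. ?s x \<noteq> 0 --> P x = 0 \<and> (\<forall>y. adj x y \<and> P y = 0 --> ?s y \<noteq> 0)" using c1 by (intro allI impI)
        have C2: "\<forall>v < Suc i. P v = 0 --> ?s v \<noteq> 0" using c2 by (intro allI impI)
        have C3: "a = 0 --> (\<forall>v. ?s v \<noteq> 0 --> (\<exists>S. v \<in> S \<and> closed_small P S))"
        proof (intro allI impI)
          fix v assume "a = 0" "?s v \<noteq> 0"
          then show "\<exists>S. v \<in> S \<and> closed_small P S" using sm[of v] that(1) by blast
        qed
        have C4: "a \<noteq> 0 --> 1 \<le> kst \<and> 1 \<le> M" using that(2) by (intro impI)
        show ?thesis
          unfolding s4_def[symmetric] I_def g4(2-4) by (intro conjI g4(1) P3(1) refl C1 C2 C3 C4)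
      qed
      show ?case
      proof (cases "reg s3 ''ac'' < W")
        case True
        have "s3\<lparr>reg := (reg s3)(''v'' := Suc i)\<rparr> = s3\<lparr>reg := (reg s3)(''v'' := Suc i, ''any'' := reg s1 ''any'')\<rparr>"
          using P3(4) by (simp add: fun_upd_idem)
        then have "I (Suc i) (s3\<lparr>reg := (reg s3)(''v'' := Suc i)\<rparr>)" using I3[of "reg s1 ''any''"] True ka by simp
        then show ?thesis using True W3 P3 1(4) by (simp add: po_def)
      next
        case False
        have "s3\<lparr>reg := (reg s3)(''any'' := 1, ''v'' := Suc i)\<rparr> = s3\<lparr>reg := (reg s3)(''v'' := Suc i, ''any'' := 1)\<rparr>"
          by (simp add: fun_upd_twist)
        moreover have "I (Suc i) (s3\<lparr>reg := (reg s3)(''v'' := Suc i, ''any'' := 1)\<rparr>)" using I3[of 1] False bg by simp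
        ultimately have "I (Suc i) (s3\<lparr>reg := (reg s3)(''any'' := 1, ''v'' := Suc i)\<rparr>)" by (simp only:)
        then show ?thesis using False W3 P3 1(4) by (simp add: po_def)
      qed
    qed
    show ?thesis
      by (subst wp_Seq, subst wp_Assign, rule wp_eq[OF main]) (use J(2) in \<open>simp_all add: s2_def\<close>)
  qed
  have fin: "card G \<le> c" if J: "I n s'" "reg s' ''any'' = 0" and G: "ipack G" for s' G
  proof -
    let ?X = "\<Union>i \<in> {1..c}. cls P i"
    have "card ?X \<le> (\<Sum>i \<in> {1..c}. card (cls P i))" by (rule card_UN_le) simp
    also have "\<dots> \<le> (\<Sum>i \<in> {1..c}. 1)"
    proof (rule sum_mono)
      fix i assume "i \<in> {1..c}"
      then obtain v where "cls P i = {v}" using pp(4)[of i] by auto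
      then show "card (cls P i) \<le> 1" by simp
    qed
    finally have cX: "card ?X \<le> c" by simp
    have "card G \<le> card ?X"
    proof (rule ipack_card_hit[OF G])
      show "finite ?X" by simp
      fix T assume T: "T \<in> G"
      show "T \<inter> ?X \<noteq> {}"
      proof
        assume e: "T \<inter> ?X = {}"
        have t: "conn T" "T \<subseteq> {..<n}" "W \<le> w T" using G T unfolding ipack_def by auto
        have P0: "P x = 0" if "x \<in> T" for x
        proof (rule ccontr)
          assume "P x \<noteq> 0"
          moreover have "x < n" using t that by auto
          ultimately have "x \<in> ?X" using pp(2)[of x] unfolding cls_def by auto
          then show False using e that by blast
        qed
        obtain x where x: "x \<in> T" using t unfolding conn_def by blast
        then have "x < n" using t by auto
        then have "arr s' ''seen'' x \<noteq> 0" using J(1) P0[OF x] unfolding I_def by metis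
        then obtain S where S: "x \<in> S" "closed_small P S" using J unfolding I_def by metis
        have "T \<subseteq> S"
          by (rule conn_subset[OF t(1) x S(1)]) (use S(2) P0 in \<open>auto simp: closed_small_def\<close>)
        then have "w T \<le> w S" using S(2) by (intro sum_mono2) (auto simp: closed_small_def)
        then show False using t S(2) unfolding closed_small_def by simp
      qed
    qed
    then show ?thesis using cX by simp
  qed
  define s1 where "s1 = s\<lparr>reg := (reg s)(''any'' := 0)\<rparr>"
  have I0: "I 0 (s1\<lparr>reg := (reg s1)(''v'' := 0)\<rparr>)" using g P z unfolding I_def s1_def gctx_def by simp
  have bp: "po s1 \<le> 100 * (n + M)"
  proof -
    have "card {a. 1 \<le> a \<and> a \<le> M \<and> arr s1 ''seen'' (sr a) = 0} \<le> card {1..M}" by (rule card_mono) auto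
    moreover have "card {v. v < n \<and> arr s1 ''seen'' v = 0} \<le> card {..<n}" by (rule card_mono) auto
    ultimately show ?thesis unfolding po_def bpot_def unseen_def by simp
  qed
  show ?thesis
    unfolding screen_def
  proof (subst wp_Seq, subst wp_Assign, rule wp_For_pot[where I = I and p = po and l = 0 and h = n and K = 90], goal_cases)
    case 3 then show ?case using I0 unfolding s1_def by simp
  next
    case (4 i s') then show ?case unfolding I_def gctx_def by simp
  next
    case (5 s' i) then show ?case unfolding po_def by simp
  next
    case (6 i s')
    have J: "arr s' ''part'' = P" using 6 unfolding I_def by simp
    show ?case
    proof (cases "P i = 0 \<and> arr s' ''seen'' i = 0")
      case True
      show ?thesis
        by (subst wp_Cond, simp only: bval.simps aval.simps J 6(2) True simp_thms if_True, rule wp_mono[OF step[OF 6(1,2,4)]])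
          (use True in auto)
    next
      case False
      have C2: "\<forall>v < Suc i. P v = 0 --> arr s' ''seen'' v \<noteq> 0"
      proof (intro allI impI)
        fix v assume v: "v < Suc i" "P v = 0"
        show "arr s' ''seen'' v \<noteq> 0"
        proof (cases "v = i")
          case True then show ?thesis using False v by simp
        next
          case False
          then have "v < i" using v by simp
          then show ?thesis using 6(1) v(2) unfolding I_def by metis
        qed
      qed
      define s4 where "s4 = s'\<lparr>reg := (reg s')(''v'' := Suc i)\<rparr>"
      have "gctx s'" using 6(1) unfolding I_def by (rule conjunct1)
      then have g4: "gctx s4" "reg s4 ''cl'' = reg s' ''cl''" "arr s4 = arr s'" "reg s4 ''any'' = reg s' ''any''"
        unfolding s4_def gctx_def by simp_all
      have "I (Suc i) s4"
        using 6(1) C2 g4(1) unfolding I_def g4(2-4) by (elim conjE, intro conjI) assumption+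
      then have "I (Suc i) (s'\<lparr>reg := (reg s')(''v'' := Suc i)\<rparr>)" unfolding s4_def .
      moreover have "\<not> (P i = 0 \<and> arr s' ''seen'' i = 0)" by (rule False)
      ultimately show ?thesis using J 6(2) by (simp, intro impI, elim conjE disjE; simp)
    qed
  next
    case (7 s' t)
    have "po s1 = po (s\<lparr>reg := (reg s)(''any'' := aval (N 0) s)\<rparr>)" unfolding po_def s1_def by simp
    then show ?case using 7 bp fin[OF 7(1)] unfolding I_def by simp
  qed simp_all
qed

text \<open>Lexicographic progress as one number. A new head is worth one \<open>E\<close>. A new
  set is worth \<open>2 * K + 4\<close>, of which at most \<open>K\<close> restores the allowance
  for heads; what is left covers the \<open>K + 1\<close> spent on the round.\<close>

lemma grow_arith:
  fixes E K h k :: nat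
  shows "Suc h \<le> K ==> E * (a + (K - Suc h) + b) + E = E * (a + (K - h) + b)"
    and "Suc k \<le> K ==> E * ((K - Suc k) * (2 * K + 4) + (K - 0) + (K + 2)) + E * (K + 1) \<le> E * ((K - k) * (2 * K + 4) + (K - h) + (K + 2))"
    and "E * (K + 1) \<le> E * (a + b + (K + 2))"
proof -
  show "Suc h \<le> K ==> E * (a + (K - Suc h) + b) + E = E * (a + (K - h) + b)"
  proof -
    assume "Suc h \<le> K"
    then have "a + (K - h) + b = Suc (a + (K - Suc h) + b)" by simp
    then show ?thesis by simp
  qed
  show "Suc k \<le> K ==> E * ((K - Suc k) * (2 * K + 4) + (K - 0) + (K + 2)) + E * (K + 1) \<le> E * ((K - k) * (2 * K + 4) + (K - h) + (K + 2))"
  proof -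
    assume "Suc k \<le> K"
    then have "K - k = Suc (K - Suc k)" by simp
    then have "(K - k) * (2 * K + 4) = (K - Suc k) * (2 * K + 4) + (2 * K + 4)" by simp
    then have "((K - Suc k) * (2 * K + 4) + (K - 0) + (K + 2)) + (K + 1) \<le> (K - k) * (2 * K + 4) + (K - h) + (K + 2)" by linarith
    then have "E * (((K - Suc k) * (2 * K + 4) + (K - 0) + (K + 2)) + (K + 1)) \<le> E * ((K - k) * (2 * K + 4) + (K - h) + (K + 2))"
      by (rule mult_le_mono2)
    then show ?thesis unfolding distrib_left[of E "_ + (K + 2)" "K + 1"] .
  qed
  show "E * (K + 1) \<le> E * (a + b + (K + 2))" by (rule mult_le_mono2) simp
qed

lemma invD: "inv s k h ==> reg s ''size'' = k \<and> h = card (heads c k (arr s ''kind'')) \<and> k \<le> kst \<and> h \<le> kst"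
proof -
  assume "inv s k h"
  then obtain kd where k: "reg s ''size'' = k" "arr s ''kind'' = kd" "h = card (heads c k kd)" "k \<le> kst" unfolding inv_def state_def by blast
  have "card (heads c k kd) \<le> card {c<..k}" by (rule card_mono) (auto simp: heads_def)
  then show ?thesis using k by simp
qed

text \<open>A round that creates a head costs a constant multiple of \<open>D\<close>; a round with
  probes costs about \<open>kst\<close> multiples but ends the loop or raises \<open>k\<close>.
  There are at most \<open>kst\<close> heads for each \<open>k\<close> and at most
  \<open>kst\<close> values of \<open>k\<close>, hence a number of multiples quadratic in
  \<open>kst\<close>.\<close>

lemma grow:
  assumes g: "gctx s" and P: "arr s ''part'' = P" "parts_ok c c P kd" and z: "arr s ''kind'' = kd" "reg s ''size'' = c"
  shows "wp grow (\<lambda>t s'. (\<exists>k. completed s' k) \<and> t \<le> 45000 * D * (kst * (2 * kst + 4) + 2 * kst + 3)) s"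
proof -
  define E where "E = 45000 * D"
  define J where "J s \<longleftrightarrow> reg s ''fin'' = 0 \<and> (\<exists>k h. inv s k h) \<or> reg s ''fin'' = 1 \<and> (\<exists>k. completed s k)" for s :: store
  \<comment> \<open>The reserve \<open>kst + 2\<close> pays for the last round, which certifies the
    packing instead of enlarging it.\<close>
  define po where "po s = (if reg s ''fin'' = 0 then E * ((kst - reg s ''size'') * (2 * kst + 4) +
    (kst - card (heads c (reg s ''size'') (arr s ''kind''))) + (kst + 2)) else 0)" for s :: store
  have pinv: "po s = E * ((kst - k) * (2 * kst + 4) + (kst - h) + (kst + 2))" if "inv s k h" "reg s ''fin'' = 0" for s k h
    unfolding po_def using invD[OF that(1)] that(2) by simp
  have E: "45000 \<le> E" "45000 * D = E" unfolding E_def using D_bounds(3) by auto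
  define s1 where "s1 = s"
  have mm: "rmods merge_units = {''a'', ''p'', ''q'', ''v''}" "amods merge_units = {''wU'', ''unit''}" unfolding merge_units_def by auto
  have ml: "''fin'' \<notin> rmods label" by (simp add: label_mods)
  have me: "''fin'' \<notin> rmods light_event"
    unfolding light_event_def make_head_def sum_units_def split_core_def take_parts_def single_units_def by (simp add: event_mods label_W_mods label_mods)
  have body: "wp (merge_units ;; ''th'' ::= Plus (R ''W'') (R ''W'') ;; ''jl'' ::= Plus (R ''c'') (N 1) ;; label ;;
      Cond (Equal (R ''ev'') (N 0)) no_event light_event)
     (\<lambda>t s'. J s' \<and> t + po s' + 10 \<le> po s1) s1" if I: "inv s1 k h" and f: "reg s1 ''fin'' = 0" for s1 k h
  proof -
    obtain P Ut kd wU where st: "state s1 P Ut kd wU k" and p: "parts_ok c k P kd" and u: "units_ok P Ut" and wu: "wu_ok P Ut wU"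
      and H: "hall c k P Ut kd" and k: "k \<le> kst" "k - c \<le> M" and h: "h = card (heads c k kd)"
      using I unfolding inv_def by blast
    have p1: "po s1 = E * ((kst - k) * (2 * kst + 4) + (kst - h) + (kst + 2))" by (rule pinv[OF I f])
    have a1: "gctx s1" "arr s1 ''part'' = P" "arr s1 ''unit'' = Ut" "arr s1 ''wU'' = wU" using st unfolding state_def by auto
    show ?thesis
    proof (subst wp_Seq, rule wp_frame[OF merge_units[OF a1(1,2) u[folded a1(3)] wu[folded a1(3,4)]]], elim conjE, goal_cases)
      case (1 t2 s2)
      let ?U = "arr s2 ''unit''" and ?w = "arr s2 ''wU''"
      have fr: "x \<notin> rmods merge_units ==> reg s2 x = reg s1 x" "x \<notin> amods merge_units ==> arr s2 x = arr s1 x" for x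
        using 1(1) unfolding frame_def by auto
      have H2: "hall c k P ?U kd" by (rule hall_coarser[OF H]) (use 1(6) a1(3) in simp)
      have st2: "state s2 P ?U kd ?w k" using st 1(2) unfolding state_def by (simp add: fr mm)
      have rd: "ready P ?U kd ?w k" unfolding ready_def using p 1(4,5) k kst_n by simp
      define s3 where "s3 = s2\<lparr>reg := (reg s2)(''th'' := W + W, ''jl'' := Suc c)\<rparr>"
      have st3: "state s3 P ?U kd ?w k" using st2 unfolding s3_def state_def gctx_def by simp
      have r3: "reg s3 ''th'' = 2 * W" "reg s3 ''jl'' = Suc c" "reg s3 ''fin'' = 0"
        using f unfolding s3_def by (simp_all add: fr mm)
      have t2: "t2 \<le> 200 * D" using 1 by blast
      have sep: "separated P ?U" and u2: "units_ok P ?U" "wu_ok P ?U ?w" using 1 by blast+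
      have main: "wp (label ;; Cond (Equal (R ''ev'') (N 0)) no_event light_event)
        (\<lambda>t s'. J s' \<and> t + po s' + 200 * D + 30 \<le> po s1) s3"
      proof (subst wp_Seq, rule wp_frame[OF label_2W[OF st3 rd H2 r3(1,2)]], elim conjE, goal_cases)
        case (1 t4 s4)
        have f4: "reg s4 ''fin'' = 0" using frame_reg[OF 1(1) ml] r3 by simp
        have t4: "t4 \<le> 9000 * D" by fact
        show ?case
        proof (cases "reg s4 ''ev'' = 0")
          case True
          have F: "\<And>i. c < i ==> i \<le> k ==> kd i \<noteq> 1 ==> i \<in> {i \<in> {c<..k}. arr s4 ''lab'' i = n + 5}"
            "acc P ?U {i \<in> {c<..k}. arr s4 ''lab'' i = n + 5} \<le> 3 * W * card {i \<in> {c<..k}. arr s4 ''lab'' i = n + 5}"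
            using 1(4) True unfolding Let_def by blast+
          show ?thesis
          proof (subst wp_Cond, simp only: True bval.simps aval.simps if_True refl,
              rule wp_mono[OF no_event[OF 1(2) p u2 H2 sep k f4 refl F]], assumption+, elim conjE disjE, goal_cases)
            case (1 t5 s5)
            have "po s5 = 0" unfolding po_def using 1 by simp
            moreover have "E * (kst + 1) \<le> po s1" unfolding p1 by (rule grow_arith(3))
            moreover have "t4 + t5 + 240 * D \<le> E * (kst + 1)" using t4 1(1) unfolding E_def by (simp add: algebra_simps)
            ultimately have "t4 + (bcost (Equal (R ''ev'') (N 0)) + 1 + t5) + po s5 + 200 * D + 30 \<le> po s1" using D_bounds(3) by simp
            then show ?case using 1 unfolding J_def by blast
          next
            case (2 t5 s5)
            have "Suc k \<le> kst" using invD 2 by blast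
            then have "po s5 + E * (kst + 1) \<le> po s1"
              unfolding p1 pinv[OF 2(3,2)] by (rule grow_arith(2))
            moreover have "t4 + t5 + 240 * D \<le> E * (kst + 1)" using t4 2(1) unfolding E_def by (simp add: algebra_simps)
            ultimately have "t4 + (bcost (Equal (R ''ev'') (N 0)) + 1 + t5) + po s5 + 200 * D + 30 \<le> po s1" using D_bounds(3) by simp
            then show ?case using 2 unfolding J_def by blast
          qed
        next
          case False
          let ?j = "reg s4 ''jl''" and ?Y = "reg s4 ''ev'' - 1" and ?own = "arr s4 ''own''"
          have V: "c < ?j" "?j \<le> k" "kd ?j = 0" "?Y \<in> units P ?U" "?own ?Y \<noteq> ?j"
            "\<forall>v < n. attd P ?U ?own ?j ?Y v --> nbu P ?U ?j (?U v)"
            "3 * W \<le> w {v. v < n \<and> (P v = ?j \<or> attd P ?U ?own ?j ?Y v)}"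
            "w {v. v < n \<and> (P v = ?j \<or> P v = 0 \<and> ?own (?U v) = ?j)} < 3 * W"
            "\<forall>Z \<subseteq> heads c k kd. 2 * W * card Z \<le> (\<Sum>i \<in> Z. w (cls P i)) + (\<Sum>u \<in> {u \<in> NB P ?U Z. ?own u \<noteq> ?j}. w (uset P ?U u))"
            using 1(4) False unfolding Let_def by blast+
          have le: "wp light_event (\<lambda>t s'. (inv s' k (Suc (card (heads c k kd))) \<or> inv s' (Suc k) 0) \<and> t \<le> 12000 * D) s4"
            by (rule light_event[OF 1(2) p u2 H2 k refl refl refl V(1-5) _ V(7,8)]) (use V(6,9) in blast)+
          show ?thesis
          proof (subst wp_Cond, simp only: False bval.simps aval.simps if_False, rule wp_frame[OF le], elim conjE disjE, goal_cases)
            case (1 t5 s5)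
            have f5: "reg s5 ''fin'' = 0" using frame_reg[OF 1(1) me] f4 by simp
            have I5: "inv s5 k (Suc h)" using 1(3) h by simp
            have "Suc h \<le> kst" using invD[OF I5] by blast
            then have "po s5 + E = po s1" unfolding p1 pinv[OF I5 f5] by (rule grow_arith(1))
            moreover have "t4 + t5 + 240 * D \<le> E" using t4 1(2) unfolding E_def by simp
            ultimately have "t4 + (bcost (Equal (R ''ev'') (N 0)) + 1 + t5) + po s5 + 200 * D + 30 \<le> po s1" using D_bounds(3) by simp
            then show ?case using I5 f5 unfolding J_def by blast
          next
            case (2 t5 s5)
            have f5: "reg s5 ''fin'' = 0" using frame_reg[OF 2(1) me] f4 by simp
            have "Suc k \<le> kst" using invD[OF 2(3)] by blast
            then have "po s5 + E * (kst + 1) \<le> po s1"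
              unfolding p1 pinv[OF 2(3) f5] by (rule grow_arith(2))
            moreover have "t4 + t5 + 240 * D \<le> E * (kst + 1)" using t4 2(2) unfolding E_def by (simp add: algebra_simps)
            ultimately have "t4 + (bcost (Equal (R ''ev'') (N 0)) + 1 + t5) + po s5 + 200 * D + 30 \<le> po s1" using D_bounds(3) by simp
            then show ?case using 2(3) f5 unfolding J_def by blast
          qed
        qed
      qed
      have g2: "reg s2 ''W'' = W" "reg s2 ''c'' = c" using st2 unfolding state_def gctx_def by auto
      show ?case
        by (subst wp_Seq, subst wp_Assign, subst wp_Seq, subst wp_Assign, rule wp_eq[OF main]) (use g2 t2 in \<open>simp_all add: s3_def\<close>)
    qed
  qed
  note pp = parts_okD[OF P(2)]
  have su: "wp single_units (\<lambda>t s'. units_ok P (arr s' ''unit'') \<and> wu_ok P (arr s' ''unit'') (arr s' ''wU'') \<and> t \<le> 100 * D) s"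
    by (rule single_units[OF g P(1) light_parts[OF P(2)]])
  show ?thesis
    unfolding grow_def
  proof (subst wp_Seq, rule wp_frame[OF su], elim conjE, goal_cases)
    case (1 t1 s1)
    have m2: "rmods single_units = {''v''}" "amods single_units = {''unit'', ''wU''}" unfolding single_units_def by auto
    have fr: "x \<notin> rmods single_units ==> reg s1 x = reg s x" "x \<notin> amods single_units ==> arr s1 x = arr s x" for x
      using 1(1) unfolding frame_def by auto
    define s2 where "s2 = s1\<lparr>reg := (reg s1)(''fin'' := 0)\<rparr>"
    have "gctx s1" by (rule gctx_frame[OF 1(1) g]) (auto simp: m2)
    then have st: "state s2 P (arr s1 ''unit'') kd (arr s1 ''wU'') c" using P z unfolding s2_def state_def gctx_def by (simp add: fr m2)
    have k1: "c \<le> kst" using kst[OF parts_ok_ipack(1)[OF P(2)]] parts_ok_ipack(2)[OF P(2)] by simp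
    have hh: "hall c c P (arr s1 ''unit'') kd \<and> heads c c kd = {}" by (rule hall_no_heads) simp
    have I2: "inv s2 c 0"
      by (rule invI[OF st P(2) 1(2,3) conjunct1[OF hh] k1]) (simp_all only: conjunct2[OF hh] card.empty diff_self_eq_0 le0)
    have f2: "reg s2 ''fin'' = 0" unfolding s2_def by simp
    have p2: "po s2 \<le> E * (kst * (2 * kst + 4) + kst + (kst + 2))" unfolding pinv[OF I2 f2]
      by (intro mult_le_mono2 add_mono mult_le_mono1) simp_all
    have main: "wp (While (Equal (R ''fin'') (N 0))
      (merge_units ;; ''th'' ::= Plus (R ''W'') (R ''W'') ;; ''jl'' ::= Plus (R ''c'') (N 1) ;; label ;;
       Cond (Equal (R ''ev'') (N 0)) no_event light_event))
      (\<lambda>t s'. (\<exists>k. completed s' k) \<and> t \<le> po s2 + 4) s2"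
    proof (rule wp_while[where I = J and p = po], goal_cases)
      case 1 show ?case unfolding J_def using I2 f2 by blast
    next
      case (2 s3)
      then have f3: "reg s3 ''fin'' = 0" by simp
      then obtain k h where I3: "inv s3 k h" using 2(1) unfolding J_def by auto
      show ?case by (rule wp_mono[OF body[OF I3 f3]]) simp
    next
      case (3 s' t)
      then show ?case unfolding J_def by simp
    qed
    have "E * (kst * (2 * kst + 4) + 2 * kst + 3) = E * (kst * (2 * kst + 4) + kst + (kst + 2)) + E" by (simp add: algebra_simps)
    then have fin: "po s2 + 100 * D + 10 \<le> 45000 * D * (kst * (2 * kst + 4) + 2 * kst + 3)"
      using p2 E D_bounds(3) unfolding E(2) by (simp add: E_def)
    show ?case
      by (subst wp_Seq, subst wp_Assign, rule wp_eq[OF main]) (use fin 1(4) in \<open>simp_all add: s2_def\<close>)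
  qed
qed

end

section \<open>Reading the input and numbering the heavy vertices\<close>

definition heavy :: "(nat \<Rightarrow> nat) \<Rightarrow> nat \<Rightarrow> nat \<Rightarrow> nat" where "heavy wt W i = card {u. u < i \<and> W \<le> wt u}"

lemma heavy_0: "heavy wt W 0 = 0" unfolding heavy_def by simp

lemma heavy_Suc: "heavy wt W (Suc i) = (if W \<le> wt i then Suc (heavy wt W i) else heavy wt W i)"
proof -
  have "{u. u < Suc i \<and> W \<le> wt u} = (if W \<le> wt i then insert i {u. u < i \<and> W \<le> wt u} else {u. u < i \<and> W \<le> wt u})"
    by (auto simp: less_Suc_eq)
  then show ?thesis unfolding heavy_def by simp
qed

lemma heavy_mono: "i \<le> j ==> heavy wt W i \<le> heavy wt W j"
  unfolding heavy_def by (rule card_mono) auto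

text \<open>The counter grows in steps of one and so passes through every value.\<close>

lemma heavy_hit: "1 \<le> i ==> i \<le> heavy wt W m ==> \<exists>v < m. W \<le> wt v \<and> heavy wt W (Suc v) = i"
proof (induction m)
  case (Suc m)
  show ?case
  proof (cases "i \<le> heavy wt W m")
    case True then show ?thesis using Suc less_SucI by blast
  next
    case False
    then have "W \<le> wt m" "heavy wt W (Suc m) = i" using Suc.prems unfolding heavy_Suc by (auto split: if_splits)
    then show ?thesis by blast
  qed
qed (simp add: heavy_0)

text \<open>The analogue of \<open>lists\<close> with chains for single vertices in place of
  cores.\<close>

definition bucket :: "(nat \<Rightarrow> nat) \<Rightarrow> (nat \<Rightarrow> nat) \<Rightarrow> (nat \<Rightarrow> nat) \<Rightarrow> nat \<Rightarrow> bool" where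
  "bucket sr nx fi i \<longleftrightarrow>
    (\<forall>a. 1 \<le> a \<and> a < i --> nx a < a \<and> (nx a \<noteq> 0 --> sr (nx a) = sr a) \<and> (\<forall>b. nx a < b \<and> b < a --> sr b \<noteq> sr a)) \<and>
    (\<forall>v. fi v < i \<and> (fi v \<noteq> 0 --> sr (fi v) = v) \<and> (\<forall>b. fi v < b \<and> b < i --> sr b \<noteq> v))"

lemma bucket_step:
  assumes B: "bucket sr nx fi i" and i: "1 \<le> i"
  shows "bucket sr (nx(i := fi (sr i))) (fi(sr i := i)) (Suc i)"
proof -
  have B1: "\<And>a. 1 \<le> a ==> a < i ==> nx a < a \<and> (nx a \<noteq> 0 --> sr (nx a) = sr a) \<and> (\<forall>b. nx a < b \<and> b < a --> sr b \<noteq> sr a)"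
    and B2: "\<And>v. fi v < i \<and> (fi v \<noteq> 0 --> sr (fi v) = v) \<and> (\<forall>b. fi v < b \<and> b < i --> sr b \<noteq> v)"
    using B unfolding bucket_def by blast+
  let ?n = "nx(i := fi (sr i))" and ?f = "fi(sr i := i)"
  have 1: "?n a < a \<and> (?n a \<noteq> 0 --> sr (?n a) = sr a) \<and> (\<forall>b. ?n a < b \<and> b < a --> sr b \<noteq> sr a)" if "1 \<le> a" "a < Suc i" for a
    using B1[of a] B2[of "sr i"] that by (cases "a = i") simp_all
  have 2: "?f v < Suc i \<and> (?f v \<noteq> 0 --> sr (?f v) = v) \<and> (\<forall>b. ?f v < b \<and> b < Suc i --> sr b \<noteq> v)" for v
  proof (cases "v = sr i")
    case True then show ?thesis by auto
  next
    case False
    then have "sr b \<noteq> v" if "fi v < b" "b < Suc i" for b using B2[of v] that by (cases "b = i") auto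
    then show ?thesis using B2[of v] False by auto
  qed
  show ?thesis unfolding bucket_def using 1 2 by blast
qed

text \<open>The edge at list position \<open>e\<close> becomes the opposite arcs
  \<open>e + 1\<close> and \<open>me + e + 1\<close>; number 0 remains the end mark of
  chains.\<close>

lemma read_input:
  assumes r: "reg s ''n'' = nv" "reg s ''m'' = me" "reg s ''W'' = W" "reg s ''size'' = 0"
    and a: "arr s ''weight'' = wt" "arr s ''fst'' = f" "arr s ''snd'' = g" "arr s ''vfi'' = (\<lambda>_. 0)" "arr s ''part'' = (\<lambda>_. 0)"
  shows "wp read_input (\<lambda>t s'. reg s' ''n'' = nv \<and> reg s' ''M'' = 2 * me \<and> reg s' ''c'' = heavy wt W nv \<and> reg s' ''size'' = heavy wt W nv \<and>
     reg s' ''W'' = W \<and> reg s' ''W3'' = 3 * W \<and> reg s' ''big'' = nv + 5 \<and> arr s' ''weight'' = wt \<and>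
     (\<forall>a. 1 \<le> a \<and> a \<le> me --> arr s' ''src'' a = f (a - 1) \<and> arr s' ''tgt'' a = g (a - 1)) \<and>
     (\<forall>a. me < a \<and> a \<le> 2 * me --> arr s' ''src'' a = g (a - (me + 1)) \<and> arr s' ''tgt'' a = f (a - (me + 1))) \<and>
     bucket (arr s' ''src'') (arr s' ''vnx'') (arr s' ''vfi'') (Suc (2 * me)) \<and>
     arr s' ''part'' = (\<lambda>v. if v < nv \<and> W \<le> wt v then heavy wt W (Suc v) else 0) \<and> t \<le> 500 * (nv + me + 1)) s"
proof -
  define M where "M = me + me"
  define s1 where "s1 = s\<lparr>reg := (reg s)(''M'' := M, ''W3'' := W + W + W, ''big'' := nv + 5)\<rparr>"
  define A1 where "A1 = (\<lambda>a. if 1 \<le> a \<and> a < Suc me then f (a - 1) else arr s ''src'' a)"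
  define A2 where "A2 = (\<lambda>a. if Suc me \<le> a \<and> a < Suc M then g (a - (me + 1)) else A1 a)"
  define B1 where "B1 = (\<lambda>a. if 1 \<le> a \<and> a < Suc me then g (a - 1) else arr s ''tgt'' a)"
  define B2 where "B2 = (\<lambda>a. if Suc me \<le> a \<and> a < Suc M then f (a - (me + 1)) else B1 a)"
  define s2 where "s2 = s1\<lparr>reg := (reg s1)(''a'' := Suc me), arr := (arr s1)(''src'' := A1)\<rparr>"
  define s3 where "s3 = s2\<lparr>reg := (reg s2)(''a'' := Suc M), arr := (arr s2)(''src'' := A2)\<rparr>"
  define s4 where "s4 = s3\<lparr>reg := (reg s3)(''a'' := Suc me), arr := (arr s3)(''tgt'' := B1)\<rparr>"
  define s5 where "s5 = s4\<lparr>reg := (reg s4)(''a'' := Suc M), arr := (arr s4)(''tgt'' := B2)\<rparr>"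
  note sd = s1_def s2_def s3_def s4_def s5_def
  have b1: "reg s1 ''n'' = nv" "reg s1 ''m'' = me" "reg s1 ''M'' = M" "arr s1 ''fst'' = f" "arr s1 ''snd'' = g" "arr s1 ''src'' = arr s ''src''"
    and b2: "reg s2 ''m'' = me" "reg s2 ''M'' = M" "arr s2 ''snd'' = g" "arr s2 ''src'' = A1"
    and b3: "reg s3 ''m'' = me" "reg s3 ''M'' = M" "arr s3 ''snd'' = g" "arr s3 ''fst'' = f" "arr s3 ''tgt'' = arr s ''tgt''"
    and b4: "reg s4 ''m'' = me" "reg s4 ''M'' = M" "arr s4 ''fst'' = f" "arr s4 ''tgt'' = B1"
    and b5: "reg s5 ''n'' = nv" "reg s5 ''m'' = me" "reg s5 ''M'' = M" "reg s5 ''W'' = W" "reg s5 ''W3'' = 3 * W" "reg s5 ''big'' = nv + 5"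
      "reg s5 ''size'' = 0" "arr s5 ''weight'' = wt" "arr s5 ''src'' = A2" "arr s5 ''tgt'' = B2" "arr s5 ''vfi'' = (\<lambda>_. 0)" "arr s5 ''part'' = (\<lambda>_. 0)"
    unfolding sd using r a by simp_all
  have l1: "wp (For ''a'' (N 1) (Plus (R ''m'') (N 1)) (Store ''src'' (R ''a'') (C ''fst'' (Minus (R ''a'') (N 1)))))
    (\<lambda>t s'. s' = s2 \<and> t \<le> 50 * me + 20) s1"
  proof (rule wp_For_map[where a = "''src''" and l = 1 and h = "Suc me" and vl = "\<lambda>a. f (a - 1)" and K = 10], goal_cases)
    case (5 t) then show ?case unfolding b1(6) A1_def[symmetric] s2_def by simp
  qed (use b1 in simp_all)
  have l2: "wp (For ''a'' (Plus (R ''m'') (N 1)) (Plus (R ''M'') (N 1)) (Store ''src'' (R ''a'') (C ''snd'' (Minus (R ''a'') (Plus (R ''m'') (N 1))))))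
    (\<lambda>t s'. s' = s3 \<and> t \<le> 50 * me + 20) s2"
  proof (rule wp_For_map[where a = "''src''" and l = "Suc me" and h = "Suc M" and vl = "\<lambda>a. g (a - (me + 1))" and K = 15], goal_cases)
    case (5 t)
    then have "t \<le> 50 * me + 20" by (simp add: M_def)
    then show ?case unfolding b2(4) A2_def[symmetric] s3_def by simp
  qed (use b2 in \<open>simp_all add: M_def\<close>)
  have l3: "wp (For ''a'' (N 1) (Plus (R ''m'') (N 1)) (Store ''tgt'' (R ''a'') (C ''snd'' (Minus (R ''a'') (N 1)))))
    (\<lambda>t s'. s' = s4 \<and> t \<le> 50 * me + 20) s3"
  proof (rule wp_For_map[where a = "''tgt''" and l = 1 and h = "Suc me" and vl = "\<lambda>a. g (a - 1)" and K = 10], goal_cases)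
    case (5 t) then show ?case unfolding b3(5) B1_def[symmetric] s4_def by simp
  qed (use b3 in simp_all)
  have l4: "wp (For ''a'' (Plus (R ''m'') (N 1)) (Plus (R ''M'') (N 1)) (Store ''tgt'' (R ''a'') (C ''fst'' (Minus (R ''a'') (Plus (R ''m'') (N 1))))))
    (\<lambda>t s'. s' = s5 \<and> t \<le> 50 * me + 20) s4"
  proof (rule wp_For_map[where a = "''tgt''" and l = "Suc me" and h = "Suc M" and vl = "\<lambda>a. f (a - (me + 1))" and K = 15], goal_cases)
    case (5 t)
    then have "t \<le> 50 * me + 20" by (simp add: M_def)
    then show ?case unfolding b4(4) B2_def[symmetric] s5_def by simp
  qed (use b4 in \<open>simp_all add: M_def\<close>)
  define base where "base s' \<longleftrightarrow> reg s' ''n'' = nv \<and> reg s' ''m'' = me \<and> reg s' ''M'' = M \<and> reg s' ''W'' = W \<and> reg s' ''W3'' = 3 * W \<and>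
    reg s' ''big'' = nv + 5 \<and> arr s' ''weight'' = wt \<and> arr s' ''src'' = A2 \<and> arr s' ''tgt'' = B2" for s' :: store
  have l5: "wp (For ''a'' (N 1) (Plus (R ''M'') (N 1))
    (Store ''vnx'' (R ''a'') (C ''vfi'' (C ''src'' (R ''a''))) ;; Store ''vfi'' (C ''src'' (R ''a'')) (R ''a'')))
    (\<lambda>t s'. base s' \<and> bucket A2 (arr s' ''vnx'') (arr s' ''vfi'') (Suc M) \<and> reg s' ''size'' = 0 \<and> arr s' ''part'' = (\<lambda>_. 0) \<and> t \<le> 100 * me + 20) s5"
  proof (rule wp_For[where I = "\<lambda>i s'. base s' \<and> bucket A2 (arr s' ''vnx'') (arr s' ''vfi'') i \<and> reg s' ''size'' = 0 \<and> arr s' ''part'' = (\<lambda>_. 0)"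
      and l = 1 and h = "Suc M" and K = 20], goal_cases)
    case 3 show ?case using b5 by (simp add: base_def bucket_def) auto
  next
    case (4 i s') then show ?case by (simp add: base_def)
  next
    case (5 i s')
    then have "bucket A2 ((arr s' ''vnx'')(i := arr s' ''vfi'' (A2 i))) ((arr s' ''vfi'')(A2 i := i)) (Suc i)" by (intro bucket_step) auto
    then show ?case using 5 by (simp add: base_def)
  next
    case (6 s' t) then show ?case by (simp add: M_def)
  qed simp_all
  let ?h = "heavy wt W"
  have l6: "wp (For ''v'' (N 0) (R ''n'')
    (Cond (Less (C ''weight'' (R ''v'')) (R ''W'')) Skip (inc ''size'' ;; Store ''part'' (R ''v'') (R ''size''))))
    (\<lambda>t s'. base s' \<and> bucket A2 (arr s' ''vnx'') (arr s' ''vfi'') (Suc M) \<and> reg s' ''size'' = ?h nv \<and>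
      arr s' ''part'' = (\<lambda>v. if v < nv \<and> W \<le> wt v then ?h (Suc v) else 0) \<and> t \<le> 50 * nv + 20) s6"
    if s6: "base s6" "bucket A2 (arr s6 ''vnx'') (arr s6 ''vfi'') (Suc M)" "reg s6 ''size'' = 0" "arr s6 ''part'' = (\<lambda>_. 0)" for s6
  proof (rule wp_For[where I = "\<lambda>i s'. base s' \<and> bucket A2 (arr s' ''vnx'') (arr s' ''vfi'') (Suc M) \<and> reg s' ''size'' = ?h i \<and>
      arr s' ''part'' = (\<lambda>v. if v < i \<and> W \<le> wt v then ?h (Suc v) else 0)" and l = 0 and h = nv and K = 20], goal_cases)
    case 3 show ?case using s6 by (simp add: base_def heavy_0)
  next
    case (4 i s') then show ?case by (simp add: base_def)
  next
    case (5 i s')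
    show ?case
    proof (cases "W \<le> wt i")
      case True
      have "(\<lambda>v. if v < i \<and> W \<le> wt v then ?h (Suc v) else 0)(i := Suc (?h i)) = (\<lambda>v. if v < Suc i \<and> W \<le> wt v then ?h (Suc v) else 0)"
        using True by (auto simp: less_Suc_eq heavy_Suc)
      then show ?thesis using 5 True by (simp add: base_def heavy_Suc[of _ _ i])
    next
      case False
      have "(\<lambda>v. if v < i \<and> W \<le> wt v then ?h (Suc v) else 0) = (\<lambda>v. if v < Suc i \<and> W \<le> wt v then ?h (Suc v) else 0)"
        using False by (auto simp: less_Suc_eq)
      then show ?thesis using 5 False by (simp add: base_def heavy_Suc[of _ _ i])
    qed
  next
    case (6 s' t) then show ?case by simp
  qed simp_all
  have A: "\<forall>a. 1 \<le> a \<and> a \<le> me --> A2 a = f (a - 1) \<and> B2 a = g (a - 1)"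
    "\<forall>a. me < a \<and> a \<le> 2 * me --> A2 a = g (a - (me + 1)) \<and> B2 a = f (a - (me + 1))"
    unfolding A2_def A1_def B2_def B1_def M_def by auto
  have main: "wp (For ''a'' (N 1) (Plus (R ''m'') (N 1)) (Store ''src'' (R ''a'') (C ''fst'' (Minus (R ''a'') (N 1)))) ;;
  For ''a'' (Plus (R ''m'') (N 1)) (Plus (R ''M'') (N 1)) (Store ''src'' (R ''a'') (C ''snd'' (Minus (R ''a'') (Plus (R ''m'') (N 1))))) ;;
  For ''a'' (N 1) (Plus (R ''m'') (N 1)) (Store ''tgt'' (R ''a'') (C ''snd'' (Minus (R ''a'') (N 1)))) ;;
  For ''a'' (Plus (R ''m'') (N 1)) (Plus (R ''M'') (N 1)) (Store ''tgt'' (R ''a'') (C ''fst'' (Minus (R ''a'') (Plus (R ''m'') (N 1))))) ;;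
  For ''a'' (N 1) (Plus (R ''M'') (N 1))
    (Store ''vnx'' (R ''a'') (C ''vfi'' (C ''src'' (R ''a''))) ;; Store ''vfi'' (C ''src'' (R ''a'')) (R ''a'')) ;;
  For ''v'' (N 0) (R ''n'')
    (Cond (Less (C ''weight'' (R ''v'')) (R ''W'')) Skip (inc ''size'' ;; Store ''part'' (R ''v'') (R ''size''))) ;;
  ''c'' ::= R ''size'')
   (\<lambda>t s'. base s' \<and> bucket A2 (arr s' ''vnx'') (arr s' ''vfi'') (Suc M) \<and> reg s' ''size'' = ?h nv \<and> reg s' ''c'' = ?h nv \<and>
      arr s' ''part'' = (\<lambda>v. if v < nv \<and> W \<le> wt v then ?h (Suc v) else 0) \<and> t \<le> 300 * me + 50 * nv + 130) s1"
  proof (subst wp_Seq, rule wp_mono[OF l1], elim conjE, hypsubst, goal_cases)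
    case (1 t1)
    show ?case
    proof (subst wp_Seq, rule wp_mono[OF l2], elim conjE, hypsubst, goal_cases)
      case (1 t2)
      show ?case
      proof (subst wp_Seq, rule wp_mono[OF l3], elim conjE, hypsubst, goal_cases)
        case (1 t3)
        show ?case
        proof (subst wp_Seq, rule wp_mono[OF l4], elim conjE, hypsubst, goal_cases)
          case (1 t4)
          show ?case
          proof (subst wp_Seq, rule wp_mono[OF l5], elim conjE, goal_cases)
            case (1 t5 s6)
            show ?case
            proof (subst wp_Seq, rule wp_mono[OF l6[OF 1(1-4)]], elim conjE, goal_cases)
              case (1 t6 s7)
              then show ?case using \<open>t1 \<le> _\<close> \<open>t2 \<le> _\<close> \<open>t3 \<le> _\<close> \<open>t4 \<le> _\<close> \<open>t5 \<le> _\<close> by (simp add: base_def)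
            qed
          qed
        qed
      qed
    qed
  qed
  show ?thesis
    unfolding read_input_def
    by (subst wp_Seq, subst wp_Assign, subst wp_Seq, subst wp_Assign, subst wp_Seq, subst wp_Assign, rule wp_eq[OF main])
      (use r A in \<open>simp_all add: s1_def base_def M_def mult_2\<close>)
qed

section \<open>Vertex numbers and vertices\<close>

text \<open>Connectivity is defined through the symmetric closure. On a symmetric arc set the
  closure adds nothing, so only reachability inside \<open>X\<close> remains.\<close>

lemma connected_induced:
  fixes G :: "'a pair_pre_digraph"
  assumes sym: "\<And>u v. (u, v) \<in> parcs G ==> (v, u) \<in> parcs G"
  shows "Digraph_Component.connected (with_proj G \<restriction> X) \<longleftrightarrow>
    X \<noteq> {} \<and> (\<forall>u \<in> X. \<forall>v \<in> X. (u, v) \<in> rtrancl_on X {(u, v). (u, v) \<in> parcs G \<and> u \<in> X \<and> v \<in> X})"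
proof -
  let ?S = "mk_symmetric (with_proj G \<restriction> X)"
  let ?r = "{(u, v). (u, v) \<in> parcs G \<and> u \<in> X \<and> v \<in> X}"
  have v: "verts (with_proj ?S) = X" by (simp add: mk_symmetric_def induce_subgraph_def)
  have "parcs ?S = ?r"
    using sym by (auto simp: mk_symmetric_def induce_subgraph_def)
  then have a: "arcs_ends (with_proj ?S) = ?r" unfolding arcs_ends_conv by (auto simp: image_iff)
  show ?thesis unfolding Digraph_Component.connected_def strongly_connected_def reachable_def v a ..
qed

locale numbered =
  fixes G :: "'a pair_pre_digraph" and w :: "'a \<Rightarrow> nat" and W :: nat and vs :: "'a list" and es :: "(nat \<times> nat) list"
    and sr tg :: "nat \<Rightarrow> nat"
  assumes G: "pair_graph G" and rep: "represents vs es G"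
    and lo: "\<And>a. 1 \<le> a ==> a \<le> length es ==> sr a = fst (es ! (a - 1)) \<and> tg a = snd (es ! (a - 1))"
    and up: "\<And>a. length es < a ==> a \<le> 2 * length es ==>
      sr a = snd (es ! (a - (length es + 1))) \<and> tg a = fst (es ! (a - (length es + 1)))"
begin

definition wt :: "nat \<Rightarrow> nat" where "wt i = (if i < length vs then w (vs ! i) else 0)"

lemma vs: "distinct vs" "set vs = pverts G" and es: "\<And>i j. (i, j) \<in> set es ==> i < length vs \<and> j < length vs"
  and es_d: "distinct (map (\<lambda>(i, j). {vs ! i, vs ! j}) es)" and es_s: "set (map (\<lambda>(i, j). {vs ! i, vs ! j}) es) = edges G"
  using rep unfolding represents_def by auto

lemma card_verts: "card (pverts G) = length vs"
  using distinct_card[OF vs(1)] vs(2) by simp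

lemma fin_verts: "finite (pverts G)"
  unfolding vs(2)[symmetric] by simp

lemma parcs_sym: "(u, v) \<in> parcs G ==> (v, u) \<in> parcs G"
proof -
  assume a: "(u, v) \<in> parcs G"
  interpret pair_graph G by (rule G)
  show ?thesis using arcs_ends_symmetric[OF pair_sym_arcs, of u v] a by simp
qed

lemma arc_cases:
  assumes "1 \<le> a" "a \<le> 2 * length es"
  shows "(sr a, tg a) \<in> set es \<or> (tg a, sr a) \<in> set es"
proof (cases "a \<le> length es")
  case True
  then have "es ! (a - 1) \<in> set es" using assms by simp
  then show ?thesis using lo[OF assms(1) True] by simp
next
  case False
  then have "es ! (a - (length es + 1)) \<in> set es" using assms by simp
  then show ?thesis using up[of a] False assms(2) by simp
qed

lemma arc_exists:
  assumes "(i, j) \<in> set es"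
  shows "\<exists>a. 1 \<le> a \<and> a \<le> 2 * length es \<and> sr a = i \<and> tg a = j" and "\<exists>a. 1 \<le> a \<and> a \<le> 2 * length es \<and> sr a = j \<and> tg a = i"
proof -
  obtain k where k: "k < length es" "es ! k = (i, j)" using assms by (auto simp: in_set_conv_nth)
  have "1 \<le> Suc k \<and> Suc k \<le> 2 * length es \<and> sr (Suc k) = i \<and> tg (Suc k) = j" using lo[of "Suc k"] k by simp
  then show "\<exists>a. 1 \<le> a \<and> a \<le> 2 * length es \<and> sr a = i \<and> tg a = j" by blast
  have "1 \<le> length es + Suc k \<and> length es + Suc k \<le> 2 * length es \<and> sr (length es + Suc k) = j \<and> tg (length es + Suc k) = i"
    using up[of "length es + Suc k"] k by simp
  then show "\<exists>a. 1 \<le> a \<and> a \<le> 2 * length es \<and> sr a = j \<and> tg a = i" by blast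
qed

sublocale inst "length vs" "2 * length es" sr tg wt W
proof
  fix a assume a: "1 \<le> a" "a \<le> 2 * length es"
  show "sr a < length vs" "tg a < length vs" using arc_cases[OF a] es by blast+
  show "\<exists>b. 1 \<le> b \<and> b \<le> 2 * length es \<and> sr b = tg a \<and> tg b = sr a"
    using arc_cases[OF a] arc_exists by blast
qed

lemma nth_inj: "inj_on ((!) vs) {..<length vs}"
  using vs(1) by (auto simp: inj_on_def nth_eq_iff_index_eq)

lemma adj_parcs:
  assumes "x < length vs" "y < length vs"
  shows "adj x y \<longleftrightarrow> (vs ! x, vs ! y) \<in> parcs G"
proof
  assume "adj x y"
  then obtain a where a: "1 \<le> a" "a \<le> 2 * length es" "sr a = x" "tg a = y" unfolding adj_def by blast
  have "{vs ! x, vs ! y} \<in> set (map (\<lambda>(i, j). {vs ! i, vs ! j}) es)"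
    using arc_cases[OF a(1,2)] a(3,4) by (force simp: image_iff)
  then obtain u v where "(u, v) \<in> parcs G" "{vs ! x, vs ! y} = {u, v}" unfolding es_s edges_def by auto
  then show "(vs ! x, vs ! y) \<in> parcs G" using parcs_sym by (auto simp: doubleton_eq_iff)
next
  assume "(vs ! x, vs ! y) \<in> parcs G"
  then have "{vs ! x, vs ! y} \<in> edges G" unfolding edges_def by force
  then obtain i j where ij: "(i, j) \<in> set es" "{vs ! x, vs ! y} = {vs ! i, vs ! j}" unfolding es_s[symmetric] by auto
  then have "(x = i \<and> y = j) \<or> (x = j \<and> y = i)"
    using es[OF ij(1)] assms vs(1) by (auto simp: doubleton_eq_iff nth_eq_iff_index_eq)
  then show "adj x y" unfolding adj_def using arc_exists[OF ij(1)] by blast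
qed

text \<open>A walk that starts inside a part and ends outside must leave it by an arc; conversely,
  the set of vertices reachable from one vertex has no leaving arc and hence is everything.\<close>

lemma conn_connected:
  assumes T: "T \<subseteq> {..<length vs}"
  shows "Digraph_Component.connected (with_proj G \<restriction> ((!) vs ` T)) \<longleftrightarrow> conn T"
proof -
  let ?X = "(!) vs ` T"
  let ?r = "{(u, v). (u, v) \<in> parcs G \<and> u \<in> ?X \<and> v \<in> ?X}"
  have nth: "vs ! x = vs ! y \<longleftrightarrow> x = y" if "x \<in> T" "y \<in> T" for x y using T that vs(1) by (auto simp: nth_eq_iff_index_eq subset_eq)
  have ad: "adj x y \<longleftrightarrow> (vs ! x, vs ! y) \<in> parcs G" if "x \<in> T" "y \<in> T" for x y using adj_parcs T that by auto
  have eq: "(?X \<noteq> {} \<and> (\<forall>u \<in> ?X. \<forall>v \<in> ?X. (u, v) \<in> rtrancl_on ?X ?r)) = conn T"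
  proof
    assume R: "?X \<noteq> {} \<and> (\<forall>u \<in> ?X. \<forall>v \<in> ?X. (u, v) \<in> rtrancl_on ?X ?r)"
    show "conn T"
      unfolding conn_def
    proof (intro conjI allI impI)
      show "T \<noteq> {}" using R by blast
      fix A assume A: "A \<subset> T \<and> A \<noteq> {}"
      then obtain a b where ab: "a \<in> A" "b \<in> T" "b \<notin> A" by blast
      show "\<exists>x \<in> A. \<exists>y \<in> T - A. adj x y"
      proof (rule ccontr)
        assume no: "\<not> (\<exists>x \<in> A. \<exists>y \<in> T - A. adj x y)"
        have "(vs ! a, vs ! b) \<in> rtrancl_on ?X ?r" using R ab A by blast
        then have "vs ! b \<in> (!) vs ` A"
        proof (induction rule: rtrancl_on_induct)
          case base then show ?case using ab by blast
        next
          case (step y z)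
          then obtain x x' where x: "x \<in> A" "y = vs ! x" "x' \<in> T" "z = vs ! x'" by blast
          have "(vs ! x, vs ! x') \<in> parcs G" using step(2) unfolding x(2,4) by simp
          moreover have xT: "x \<in> T" using x(1) A by blast
          ultimately have "adj x x'" using ad[OF xT x(3)] by simp
          then have "x' \<in> A" using no x(1,3) by blast
          then show ?case unfolding x(4) by (rule imageI)
        qed
        then obtain x where x: "x \<in> A" "vs ! b = vs ! x" by blast
        then have "b = x" using nth[of b x] ab(2) A by blast
        then show False using x(1) ab(3) by simp
      qed
    qed
  next
    assume c: "conn T"
    show "?X \<noteq> {} \<and> (\<forall>u \<in> ?X. \<forall>v \<in> ?X. (u, v) \<in> rtrancl_on ?X ?r)"
    proof (intro conjI ballI)
      show "?X \<noteq> {}" using c unfolding conn_def by blast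
      fix u v assume "u \<in> ?X" "v \<in> ?X"
      then obtain a b where ab: "a \<in> T" "u = vs ! a" "b \<in> T" "v = vs ! b" by blast
      define A where "A = {t \<in> T. (u, vs ! t) \<in> rtrancl_on ?X ?r}"
      have "T \<subseteq> A"
      proof (rule conn_subset[OF c ab(1)])
        show "a \<in> A" unfolding A_def ab(2) using ab(1) by simp
        fix x y assume xy: "x \<in> T" "y \<in> T" "x \<in> A" "y \<notin> A"
        show "\<not> adj x y"
        proof
          assume "adj x y"
          then have e1: "(vs ! x, vs ! y) \<in> ?r" using ad[OF xy(1,2)] xy(1,2) by simp
          have e2: "(u, vs ! x) \<in> rtrancl_on ?X ?r" using xy(3) unfolding A_def by simp
          have e3: "vs ! y \<in> ?X" using xy(2) by simp
          have "(u, vs ! y) \<in> rtrancl_on ?X ?r" by (rule rtrancl_on_into_rtrancl_on[OF e2 e1 e3])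
          then show False using xy(2,4) unfolding A_def by simp
        qed
      qed
      then have "b \<in> A" using ab(3) by blast
      then show "(u, v) \<in> rtrancl_on ?X ?r" unfolding A_def ab(4) by simp
    qed
  qed
  have "Digraph_Component.connected (with_proj G \<restriction> ?X) \<longleftrightarrow> (?X \<noteq> {} \<and> (\<forall>u \<in> ?X. \<forall>v \<in> ?X. (u, v) \<in> rtrancl_on ?X ?r))"
    by (rule connected_induced) (rule parcs_sym)
  then show ?thesis using eq by (rule trans)
qed

lemma w_nth: "T \<subseteq> {..<length vs} ==> sum w ((!) vs ` T) = sum wt T"
  using inj_on_subset[OF nth_inj] by (subst sum.reindex) (auto simp: wt_def intro!: sum.cong)

lemma ipack_packing:
  assumes X: "ipack (set Ls)" and d: "distinct Ls"
  shows "is_packing G w W (map (\<lambda>T. (!) vs ` T) Ls)"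
  unfolding is_packing_def
proof (intro conjI ballI allI impI)
  fix T assume "T \<in> set (map (\<lambda>T. (!) vs ` T) Ls)"
  then obtain S where S: "S \<in> set Ls" "T = (!) vs ` S" by auto
  then have s: "S \<subseteq> {..<length vs}" "conn S" "W \<le> sum wt S" using X unfolding ipack_def by auto
  show "T \<subseteq> pverts G" unfolding S(2) vs(2)[symmetric] using s(1) by (auto simp: subset_iff)
  show "Digraph_Component.connected (with_proj G \<restriction> T)" using conn_connected[OF s(1)] s(2) S(2) by simp
  show "sum w T \<ge> W" using w_nth[OF s(1)] s(3) S(2) by simp
next
  fix i j assume ij: "i < length (map (\<lambda>T. (!) vs ` T) Ls)" "j < length (map (\<lambda>T. (!) vs ` T) Ls)" "i \<noteq> j"
  then have m: "Ls ! i \<in> set Ls" "Ls ! j \<in> set Ls" "Ls ! i \<noteq> Ls ! j" using d by (auto simp: nth_eq_iff_index_eq)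
  have "\<forall>S \<in> set Ls. \<forall>T \<in> set Ls. S \<noteq> T --> S \<inter> T = {}" using X unfolding ipack_def by simp
  then have "Ls ! i \<inter> Ls ! j = {}" using m by blast
  moreover have "Ls ! i \<subseteq> {..<length vs}" "Ls ! j \<subseteq> {..<length vs}" using X m unfolding ipack_def by blast+
  ultimately have "(!) vs ` (Ls ! i) \<inter> (!) vs ` (Ls ! j) = {}"
    using inj_on_image_Int[OF nth_inj, of "Ls ! i" "Ls ! j"] by simp
  then show "map (\<lambda>T. (!) vs ` T) Ls ! i \<inter> map (\<lambda>T. (!) vs ` T) Ls ! j = {}" using ij by simp
qed

lemma ipack_le_opt:
  assumes X: "ipack X"
  shows "card X \<le> opt_packing G w W"
proof -
  have "finite X" using X unfolding ipack_def by blast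
  then obtain Ls where L: "set Ls = X" "distinct Ls" using finite_distinct_list by blast
  then have "is_packing G w W (map (\<lambda>T. (!) vs ` T) Ls)" using ipack_packing X by blast
  then have "length (map (\<lambda>T. (!) vs ` T) Ls) \<le> opt_packing G w W" using opt_packing_attained(2)[OF fin_verts] by blast
  then show ?thesis using distinct_card[OF L(2)] L(1) by simp
qed

text \<open>Members of a packing are nonempty and disjoint, hence pairwise different, so passing
  from a list to a set of sets does not lose any.\<close>

lemma opt_ipack: "\<exists>X. ipack X \<and> card X = opt_packing G w W"
proof -
  obtain Ts where Ts: "is_packing G w W Ts" "length Ts = opt_packing G w W"
    using opt_packing_attained(1)[OF fin_verts] by blast
  define ix where "ix T = {i. i < length vs \<and> vs ! i \<in> T}" for T
  have im: "(!) vs ` ix T = T" if "T \<in> set Ts" for T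
  proof -
    have "T \<subseteq> set vs" using Ts(1) that vs(2) unfolding is_packing_def by blast
    then show ?thesis unfolding ix_def by (auto simp: in_set_conv_nth image_iff) (metis in_set_conv_nth subsetD)
  qed
  have ixn: "ix T \<subseteq> {..<length vs}" for T unfolding ix_def by auto
  have dj: "ix (Ts ! i) \<inter> ix (Ts ! j) = {}" if "i < length Ts" "j < length Ts" "i \<noteq> j" for i j
    using Ts(1) that unfolding is_packing_def ix_def by blast
  have pr: "conn (ix T) \<and> W \<le> sum wt (ix T)" if T: "T \<in> set Ts" for T
    using Ts(1) T conn_connected[OF ixn, of T] w_nth[OF ixn, of T] im[OF T] unfolding is_packing_def by auto
  have "inj_on (\<lambda>i. ix (Ts ! i)) {..<length Ts}"
  proof (rule inj_onI, rule ccontr)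
    fix i j assume ij: "i \<in> {..<length Ts}" "j \<in> {..<length Ts}" "ix (Ts ! i) = ix (Ts ! j)" "i \<noteq> j"
    then have "ix (Ts ! i) = {}" using dj[of i j] by auto
    then show False using pr[of "Ts ! i"] ij unfolding conn_def by auto
  qed
  then have "card ((\<lambda>i. ix (Ts ! i)) ` {..<length Ts}) = length Ts" by (simp add: card_image)
  moreover have "ipack ((\<lambda>i. ix (Ts ! i)) ` {..<length Ts})"
    unfolding ipack_def
  proof (intro conjI ballI impI)
    fix S T assume "S \<in> (\<lambda>i. ix (Ts ! i)) ` {..<length Ts}" "T \<in> (\<lambda>i. ix (Ts ! i)) ` {..<length Ts}" "S \<noteq> T"
    then show "S \<inter> T = {}" using dj by fastforce
  qed (use pr ixn in auto)
  ultimately show ?thesis using Ts(2) by metis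
qed

lemma output_packing:
  assumes P: "parts_ok c k (arr s ''part'') kd" and kd: "\<And>i. c < i ==> i \<le> k ==> kd i = 0" and k: "reg s ''size'' = k"
  shows "is_packing G w W (output_sets vs s)" and "length (output_sets vs s) = k"
proof -
  let ?Ls = "map (cls (arr s ''part'')) [1..<Suc k]"
  have st: "set ?Ls = cls (arr s ''part'') ` {1..k}" by auto
  have "card (set ?Ls) = length ?Ls" unfolding st using parts_ok_ipack(2)[OF P kd] by simp
  then have d: "distinct ?Ls" by (rule card_distinct)
  have "ipack (set ?Ls)" unfolding st by (rule parts_ok_ipack(1)[OF P kd])
  from ipack_packing[OF this d] have "is_packing G w W (map (\<lambda>T. (!) vs ` T) ?Ls)" .
  moreover have "map (\<lambda>T. (!) vs ` T) ?Ls = output_sets vs s"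
    unfolding output_sets_def k cls_def by (auto intro!: map_cong)
  ultimately show "is_packing G w W (output_sets vs s)" by simp
  show "length (output_sets vs s) = k" unfolding output_sets_def k by simp
qed

lemma heavy_parts:
  defines "P \<equiv> \<lambda>v. if v < length vs \<and> W \<le> wt v then heavy wt W (Suc v) else 0" and "c \<equiv> heavy wt W (length vs)"
  shows "parts_ok c c P (\<lambda>_. 0)"
proof -
  have le: "heavy wt W (Suc v) \<le> c" if "v < length vs" for v unfolding c_def by (rule heavy_mono) (use that in simp)
  have pos: "1 \<le> heavy wt W (Suc v)" if "W \<le> wt v" for v using that unfolding heavy_Suc by simp
  have inj: "u = v" if "W \<le> wt u" "W \<le> wt v" "heavy wt W (Suc u) = heavy wt W (Suc v)" for u v
  proof (rule ccontr)
    have *: False if "x < y" "W \<le> wt x" "W \<le> wt y" "heavy wt W (Suc x) = heavy wt W (Suc y)" for x y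
      using heavy_mono[of "Suc x" y wt W] heavy_Suc[of wt W y] that by simp
    assume "u \<noteq> v"
    then have "u < v \<or> v < u" by linarith
    then show False using *[of u v] *[of v u] that by auto
  qed
  show ?thesis
    unfolding parts_ok_def
  proof (intro conjI allI impI)
    fix i assume i: "1 \<le> i \<and> i \<le> c"
    then obtain v where v: "v < length vs" "W \<le> wt v" "heavy wt W (Suc v) = i" using heavy_hit[of i wt W "length vs"] unfolding c_def by blast
    have "cls P i = {v}"
      using v i inj unfolding cls_def P_def by auto
    then show "\<exists>v. cls P i = {v}" by blast
  qed (use le pos in \<open>auto simp: P_def\<close>)
qed

end

text \<open>For the case \<open>W = 0\<close>: all vertices are heavy, so no search is
  started.\<close>

lemma screen_trivial:
  assumes r: "reg s ''n'' = n" and P: "\<And>v. v < n ==> arr s ''part'' v \<noteq> 0"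
  shows "wp screen (\<lambda>t s'. reg s' ''any'' = 0 \<and> t \<le> 100 * (n + 1)) s"
  unfolding screen_def
proof (subst wp_Seq, subst wp_Assign, rule wp_For[where I = "\<lambda>i s'. reg s' ''n'' = n \<and> arr s' ''part'' = arr s ''part'' \<and> reg s' ''any'' = 0"
    and l = 0 and h = n and K = 20], goal_cases)
  case (5 i s')
  then show ?case using P[of i] by simp
next
  case (6 s' t)
  then show ?case by simp
qed (use r in simp_all)

lemma screen_mods: "rmods screen = {''any'', ''v'', ''r'', ''qh'', ''qt'', ''ptr'', ''ac'', ''y''}" "amods screen = {''q'', ''seen'', ''par''}"
  unfolding screen_def bfs_def by auto

lemma read_input_mods: "rmods read_input = {''M'', ''W3'', ''big'', ''a'', ''v'', ''size'', ''c''}"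
  "amods read_input = {''src'', ''tgt'', ''vnx'', ''vfi'', ''part''}"
  unfolding read_input_def by auto

text \<open>With \<open>n\<close>, \<open>me\<close> and \<open>K\<close> positive, the constants
  added to the factors are absorbed: \<open>(n + 1) * (2 * me + 1)\<close> is at most 6 times
  \<open>n * me\<close>, and the polynomial in \<open>K\<close> at most 11 times the square. The
  constant comes from 45000 * 6 * 11 = 2970000 and the linear parts.\<close>

lemma time_bound:
  fixes n me K t1 t2 t3 :: nat
  assumes "t1 \<le> 500 * (n + me + 1)" "t2 \<le> 400 * (n + 2 * me + 1)"
    and t3: "t3 \<le> 45000 * ((n + 1) * (2 * me + 1)) * (K * (2 * K + 4) + 2 * K + 3)" and K: "1 \<le> K" and n: "1 \<le> n" and me: "1 \<le> me"
  shows "t1 + (t2 + (t3 + 10)) \<le> 3000000 * (K\<^sup>2 * n * me + n + me + 1)"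
proof -
  have A: "(n + 1) * (2 * me + 1) \<le> (2 * n) * (3 * me)" using n me by (intro mult_le_mono) auto
  have B: "K * (2 * K + 4) + 2 * K + 3 \<le> 11 * K\<^sup>2"
  proof -
    have "1 * K \<le> K * K" using K by (intro mult_le_mono1) auto
    then have "K \<le> K * K" by (simp only: mult_1)
    moreover have "K * (2 * K + 4) + 2 * K + 3 = 2 * (K * K) + 6 * K + 3" by (simp add: algebra_simps)
    moreover have "11 * K\<^sup>2 = 11 * (K * K)" by (simp add: power2_eq_square)
    ultimately show ?thesis using K by linarith
  qed
  have "45000 * ((n + 1) * (2 * me + 1)) * (K * (2 * K + 4) + 2 * K + 3) \<le> 45000 * ((2 * n) * (3 * me)) * (11 * K\<^sup>2)"
    by (rule mult_le_mono[OF mult_le_mono[OF order_refl A] B])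
  also have "\<dots> = 2970000 * (K\<^sup>2 * n * me)" by simp
  finally have "t3 \<le> 2970000 * (K\<^sup>2 * n * me)" using t3 by linarith
  then show ?thesis using assms(1,2) unfolding distrib_left by linarith
qed

lemma time_bound_0:
  fixes n me t1 t2 x :: nat
  assumes "t1 \<le> 500 * (n + me + 1)" "t2 \<le> 400 * (n + 2 * me + 1)"
  shows "t1 + (t2 + 10) \<le> 3000000 * (x + n + me + 1)"
  using assms unfolding distrib_left by linarith

theorem theorem10:
  shows "\<exists>(P :: com) (C :: nat).
    \<forall>(G :: nat pair_pre_digraph) (w :: nat \<Rightarrow> nat) (W :: nat) vs es.
      pair_graph G \<longrightarrow> represents vs es G \<longrightarrow>
      (\<exists>t s. exec P (input_store vs es w W) t s \<and>
         t \<le> C * ((opt_packing G w W)\<^sup>2 * card (pverts G) * card (edges G)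
                   + card (pverts G) + card (edges G) + 1) \<and>
         is_packing G w W (output_sets vs s) \<and>
         int (length (output_sets vs s)) \<ge> \<lceil>real (opt_packing G w W) / 3\<rceil>)"
proof (rule exI[of _ pack], rule exI[of _ 3000000], intro allI impI)
  fix G :: "nat pair_pre_digraph" and w :: "nat \<Rightarrow> nat" and W :: nat and vs es
  assume G: "pair_graph G" and rep: "represents vs es G"
  define n me K where "n = length vs" and "me = length es" and "K = opt_packing G w W"
  let ?s0 = "input_store vs es w W"
  define wt where "wt = (\<lambda>i. if i < length vs then w (vs ! i) else 0)"
  define f g where "f = (\<lambda>i. if i < length es then fst (es ! i) else 0)" and "g = (\<lambda>i. if i < length es then snd (es ! i) else 0)"
  define P where "P = (\<lambda>v. if v < n \<and> W \<le> wt v then heavy wt W (Suc v) else 0)"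
  define c where "c = heavy wt W n"
  have i0: "reg ?s0 ''n'' = n" "reg ?s0 ''m'' = me" "reg ?s0 ''W'' = W" "reg ?s0 ''size'' = 0"
    "arr ?s0 ''weight'' = wt" "arr ?s0 ''fst'' = f" "arr ?s0 ''snd'' = g" "arr ?s0 ''vfi'' = (\<lambda>_. 0)" "arr ?s0 ''part'' = (\<lambda>_. 0)"
    "arr ?s0 ''seen'' = (\<lambda>_. 0)" "arr ?s0 ''kind'' = (\<lambda>_. 0)" "reg ?s0 ''qt'' = 0" "reg ?s0 ''cl'' = 0"
    unfolding input_store_def n_def me_def wt_def f_def g_def by simp_all
  have ceil: "\<lceil>real K / 3\<rceil> \<le> int l" if "K \<le> 3 * l" for l
  proof -
    have "real K / 3 \<le> real_of_int (int l)" using that by simp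
    then show ?thesis by (simp only: ceiling_le_iff)
  qed
  have "wp pack (\<lambda>t s. t \<le> 3000000 * (K\<^sup>2 * n * me + n + me + 1) \<and> is_packing G w W (output_sets vs s) \<and>
      K \<le> 3 * length (output_sets vs s)) ?s0"
    unfolding pack_def
  proof (subst wp_Seq, rule wp_frame[OF read_input[OF i0(1-9)]], elim conjE, goal_cases)
    case (1 t1 s1)
    define sr tg where "sr = arr s1 ''src''" and "tg = arr s1 ''tgt''"
    interpret N: numbered G w W vs es sr tg
    proof (rule numbered.intro)
      show "pair_graph G" "represents vs es G" by (rule G, rule rep)
      fix a
      show "sr a = fst (es ! (a - 1)) \<and> tg a = snd (es ! (a - 1))" if "1 \<le> a" "a \<le> length es"
      proof -
        have "sr a = f (a - 1) \<and> tg a = g (a - 1)" using 1(10) that unfolding sr_def tg_def me_def by blast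
        moreover have "a - 1 < length es" using that by simp
        ultimately show ?thesis unfolding f_def g_def by simp
      qed
      show "sr a = snd (es ! (a - (length es + 1))) \<and> tg a = fst (es ! (a - (length es + 1)))" if "length es < a" "a \<le> 2 * length es"
      proof -
        have "sr a = g (a - (me + 1)) \<and> tg a = f (a - (me + 1))" using 1(11) that unfolding sr_def tg_def me_def by blast
        moreover have "a - (me + 1) < length es" using that unfolding me_def by simp
        ultimately show ?thesis unfolding f_def g_def me_def by simp
      qed
    qed
    have wt: "N.wt = wt" unfolding N.wt_def wt_def ..
    have pk: "N.parts_ok c c P (\<lambda>_. 0)" using N.heavy_parts unfolding wt P_def c_def n_def .
    have P1: "arr s1 ''part'' = P" "reg s1 ''size'' = c" "reg s1 ''n'' = n" using 1 unfolding P_def c_def by auto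
    have fr1: "x \<notin> rmods read_input \<Longrightarrow> reg s1 x = reg ?s0 x" "x \<notin> amods read_input \<Longrightarrow> arr s1 x = arr ?s0 x" for x
      using 1(1) unfolding frame_def by auto
    have z1: "arr s1 ''seen'' = (\<lambda>_. 0)" "arr s1 ''kind'' = (\<lambda>_. 0)" "reg s1 ''qt'' = 0" "reg s1 ''cl'' = 0"
      using i0 by (simp_all add: fr1 read_input_mods)
    obtain X where X: "N.ipack X" "card X = K" using N.opt_ipack unfolding K_def by blast
    have Kn: "K \<le> n"
    proof -
      obtain Ts where "is_packing G w W Ts" "length Ts = K" using opt_packing_attained(1)[OF N.fin_verts] unfolding K_def by blast
      then show ?thesis using is_packing_length[OF N.fin_verts] N.card_verts unfolding n_def by metis
    qed
    have outP: "is_packing G w W (output_sets vs s) \<and> length (output_sets vs s) = c" if "arr s ''part'' = P" "reg s ''size'' = c" for s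
      using N.output_packing[of c c s "\<lambda>_. 0"] pk that by simp
    show ?case
    \<comment> \<open>For \<open>W = 0\<close> every vertex is a set of its own, and no packing is
      larger because members are nonempty. The other case meets the assumption of
      \<open>packing\<close> that \<open>W\<close> is positive.\<close>
    proof (cases "W = 0")
      case True
      have cn: "c = n" unfolding c_def heavy_def True by simp
      have "P v \<noteq> 0" if "v < n" for v using that unfolding P_def True heavy_Suc by simp
      then have sc: "wp screen (\<lambda>t s'. reg s' ''any'' = 0 \<and> t \<le> 100 * (n + 1)) s1" by (intro screen_trivial) (use P1 in auto)
      show ?thesis
      proof (subst wp_Seq, rule wp_frame[OF sc], elim conjE, goal_cases)
        case (1 t2 s2)
        have "arr s2 ''part'' = P" "reg s2 ''size'' = c"
          using frame_arr[OF 1(1), of "''part''"] frame_reg[OF 1(1), of "''size''"] P1 by (simp_all add: screen_mods)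
        then have o: "is_packing G w W (output_sets vs s2) \<and> length (output_sets vs s2) = c" by (rule outP)
        have "t2 \<le> 400 * (n + 2 * me + 1)" using 1(3) by simp
        note tb = time_bound_0[OF \<open>t1 \<le> 500 * (n + me + 1)\<close> this, of "K\<^sup>2 * n * me"]
        then show ?case using 1(2) o Kn cn by simp
      qed
    next
      case False
      interpret Q: packing n "2 * me" sr tg wt W c K "arr s1 ''vfi''" "arr s1 ''vnx''"
      proof
        fix a v :: nat
        show "1 \<le> a \<Longrightarrow> a \<le> 2 * me \<Longrightarrow> sr a < n" "1 \<le> a \<Longrightarrow> a \<le> 2 * me \<Longrightarrow> tg a < n"
          "1 \<le> a \<Longrightarrow> a \<le> 2 * me \<Longrightarrow> \<exists>b. 1 \<le> b \<and> b \<le> 2 * me \<and> sr b = tg a \<and> tg b = sr a"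
          using N.sr N.tg N.rev unfolding n_def me_def by blast+
        show "card Y \<le> K" if "inst.ipack n (2 * me) sr tg wt W Y" for Y
          using N.ipack_le_opt[of Y] that unfolding n_def me_def wt K_def by blast
        have b: "bucket sr (arr s1 ''vnx'') (arr s1 ''vfi'') (Suc (2 * me))" using 1(12) unfolding sr_def .
        show "arr s1 ''vnx'' a < a \<and> (arr s1 ''vnx'' a \<noteq> 0 \<longrightarrow> sr (arr s1 ''vnx'' a) = sr a) \<and>
          (\<forall>b. arr s1 ''vnx'' a < b \<and> b < a \<longrightarrow> sr b \<noteq> sr a)" if "1 \<le> a" "a \<le> 2 * me"
          using b that unfolding bucket_def by (simp add: less_Suc_eq_le)
        show "arr s1 ''vfi'' v \<le> 2 * me \<and> (arr s1 ''vfi'' v \<noteq> 0 \<longrightarrow> sr (arr s1 ''vfi'' v) = v) \<and>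
          (\<forall>b. arr s1 ''vfi'' v < b \<and> b \<le> 2 * me \<longrightarrow> sr b \<noteq> v)" if "v < n"
          using b unfolding bucket_def by (simp add: less_Suc_eq_le)
      qed (use False Kn in auto)
      have g1: "Q.gctx s1" unfolding Q.gctx_def using 1(2-9) by (simp add: sr_def tg_def c_def)
      have pk': "Q.parts_ok c c P (\<lambda>_. 0)" using pk unfolding wt n_def me_def .
      have ipk: "N.ipack = Q.ipack" unfolding wt n_def me_def ..
      show ?thesis
      proof (subst wp_Seq, rule wp_frame[OF Q.screen[OF g1 P1(1) pk' z1(1,3,4)]], elim conjE, goal_cases)
        case (1 t2 s2)
        have fr2: "x \<notin> rmods screen \<Longrightarrow> reg s2 x = reg s1 x" "x \<notin> amods screen \<Longrightarrow> arr s2 x = arr s1 x" for x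
          using 1(1) unfolding frame_def by auto
        have P2: "arr s2 ''part'' = P" "reg s2 ''size'' = c" "arr s2 ''kind'' = (\<lambda>_. 0)"
          using P1 z1 by (simp_all add: fr2 screen_mods)
        note t1 = \<open>t1 \<le> 500 * (n + me + 1)\<close>
        show ?case
        proof (cases "reg s2 ''any'' = 0")
          case True
          \<comment> \<open>No component of light vertices reaches \<open>W\<close>, so the heavy
            vertices alone are an optimal packing.\<close>
          then have "K \<le> c" using 1(2) X unfolding ipk by blast
          then show ?thesis using True outP[OF P2(1,2)] time_bound_0[OF t1 1(4), of "K\<^sup>2 * n * me"] by simp
        next
          case False
          then have K1: "1 \<le> K" "1 \<le> 2 * me" using 1(3) by auto
          have g2: "Q.gctx s2" by (rule Q.gctx_frame[OF 1(1) g1]) (auto simp: screen_mods)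
          show ?thesis
          proof (subst wp_Cond, simp only: False bval.simps aval.simps if_False, rule wp_mono[OF Q.grow[OF g2 P2(1) pk' P2(3,2)]], elim conjE exE, goal_cases)
            case (1 t3 s3 k)
            obtain kd where pc: "Q.parts_ok c k (arr s3 ''part'') kd" "\<forall>i \<le> k. kd i = 0" and sz: "reg s3 ''size'' = k"
              and opt: "\<forall>G. Q.ipack G \<longrightarrow> card G \<le> 3 * k" using 1(2) unfolding Q.completed_def by blast
            have "N.parts_ok c k (arr s3 ''part'') kd" using pc(1) unfolding wt n_def me_def .
            then have o: "is_packing G w W (output_sets vs s3)" "length (output_sets vs s3) = k"
              using N.output_packing[of c k s3 kd] pc(2) sz by auto
            have "K \<le> 3 * k" using opt X unfolding ipk by blast
            moreover have "t1 + (t2 + (t3 + 10)) \<le> 3000000 * (K\<^sup>2 * n * me + n + me + 1)"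
              by (rule time_bound[OF t1 \<open>t2 \<le> _\<close> 1(1)[unfolded Q.D_def] K1(1)]) (use K1 Kn in auto)
            ultimately show ?case using o by simp
          qed
        qed
      qed
    qed
  qed
  then obtain t s where "exec pack ?s0 t s" "t \<le> 3000000 * (K\<^sup>2 * n * me + n + me + 1)" "is_packing G w W (output_sets vs s)"
      "K \<le> 3 * length (output_sets vs s)" unfolding wp_def by blast
  moreover have "card (pverts G) = n" "card (edges G) = me"
  proof -
    have d: "distinct vs" "set vs = pverts G" "distinct (map (\<lambda>(i, j). {vs ! i, vs ! j}) es)" "set (map (\<lambda>(i, j). {vs ! i, vs ! j}) es) = edges G"
      using rep unfolding represents_def by auto
    show "card (pverts G) = n" using distinct_card[OF d(1)] d(2) unfolding n_def by simp
    show "card (edges G) = me" using distinct_card[OF d(3)] d(4) unfolding me_def by simp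
  qed
  ultimately show "\<exists>t s. exec pack (input_store vs es w W) t s \<and>
         t \<le> 3000000 * ((opt_packing G w W)\<^sup>2 * card (pverts G) * card (edges G) + card (pverts G) + card (edges G) + 1) \<and>
         is_packing G w W (output_sets vs s) \<and>
         int (length (output_sets vs s)) \<ge> \<lceil>real (opt_packing G w W) / 3\<rceil>"
    using ceil unfolding K_def by metis
qed

end
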